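(* Let $n\ge2$ and equip $\mathbb R^{2n}$ with coordinates $(p_1,q_1,\dots,p_n,q_n)$ and the symplectic form $\sum_{i=1}^n dp_i\wedge dq_i$. If $n\ge3$ (respectively $n=2$), any (germ at $0$ of a) subset of $\mathbb R^{2n}$ diffeomorphic to $U_8$ is symplectically equivalent to one and only one of the normal forms listed below (respectively one and only one of $U_8^0,U_8^1,U_8^2,U_8{}^{3,0}_5,U_8{}^{3,0}_\infty$). The real parameters $c,c_1,c_2$ are moduli. - $U_8^0$: $p_1^2+p_2q_1=0,\ p_1p_2+p_1q_1^2=0,\ q_2=c_1q_1-c_2p_1,\ p_{\ge3}=q_{\ge3}=0$; - $U_8^1$: $p_1^2\pm p_2q_2=0,\ p_1p_2+p_1q_2^2=0,\ q_1=c_1p_2+\frac{c_2}{2}q_2^2,\ p_{\ge3}=q_{\ge3}=0$; - $U_8^2$: $p_1^2+q_1q_2=0,\ p_1q_1+p_1q_2^2=0,\ p_2=c_1p_1q_2+\frac{c_2}{2}p_1^2,\ p_{\ge3}=q_{\ge3}=0$, with $c_1\ne2$ and $c_1\ne-\frac13$; - $U_8{}^{3,0}_5$: $p_1^2+q_1q_2=0,\ p_1q_1+p_1q_2^2=0,\ p_2=-\frac13p_1q_2+\frac{c_1}{2}p_1^2+c_2p_1q_2^2,\ p_{\ge3}=q_{\ge3}=0$; - $U_8{}^{3,0}_\infty$: $p_1^2+q_1q_2=0,\ p_1q_1+p_1q_2^2=0,\ p_2=2p_1q_2+\frac{c_1}{2}p_1^2+\frac{c_2}{2}p_1^2q_2,\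 p_{\ge3}=q_{\ge3}=0$; - $U_8^{3,1}$: $p_1^2+p_2p_3=0,\ p_1p_2+p_1p_3^2=0,\ q_1=q_2=0,\ q_3=-p_1p_3-\frac c2p_1^2,\ p_{>3}=q_{>3}=0$; - $U_8^4$: $p_1^2+p_2p_3=0,\ p_1p_2+p_1p_3^2=0,\ q_1=q_2=0,\ q_3=\mp\frac12p_1^2-cp_1p_3^2,\ p_{>3}=q_{>3}=0$; - $U_8^5$: $p_1^2+p_2p_3=0,\ p_1p_2+p_1p_3^2=0,\ q_1=q_2=0,\ q_3=-p_1p_3^2-\frac c2p_1^2p_3,\ p_{>3}=q_{>3}=0$; - $U_8^6$: $p_1^2+p_2p_3=0,\ p_1p_2+p_1p_3^2=0,\ q_1=q_2=0,\ q_3=\mp\frac12p_1^2p_3+cp_1p_3^3,\ p_{>3}=q_{>3}=0$; - $U_8^7$: $p_1^2+p_2p_3=0,\ p_1p_2+p_1p_3^2=0,\ q_1=q_2=0,\ q_3=-p_1p_3^3,\ p_{>3}=q_{>3}=0$; - $U_8^8$: $p_1^2+p_2p_3=0,\ p_1p_2+p_1p_3^2=0,\ q_{\ge1}=p_{\ge4}=0$.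
   Context: $U_8=\{x\in\mathbb R^{2n}: x_1^2+x_2x_3=x_1x_2+x_1x_3^2=x_{\ge4}=0\}$, $2n\ge4$, where $x_{\ge k}=0$ means $x_j=0$ for all $j\ge k$ (similarly for $p,q$). All sets are germs at $0$. A germ is diffeomorphic to $U_8$ if it is the image of $U_8$ under a germ of a diffeomorphism of $\mathbb R^{2n}$. Two germs $N_1,N_2$ of subsets of a symplectic space $(\mathbb R^{2n},\omega)$ are symplectically equivalent if there is a germ of a symplectomorphism $\Phi$ with $\Phi(N_1)=N_2$. Each normal form denotes the family obtained by varying parameters and sign; "one and only one" refers to the listed families. Parameters are moduli in the usual sense of singularity theory: they are independent continuous invariants, i.e. no nonconstant smooth path of parameter values (within one normal form) consists of mutually equivalent members. *)

theory Defs
  imports "HOL-Analysis.Analysis"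
begin

section \<open>Smooth maps and germs of subsets at the origin\<close>

text \<open>Differentiability is taken in the full space, so these notions are meant for open sets.\<close>

primrec Ck_on :: "nat \<Rightarrow> 'a::real_normed_vector set \<Rightarrow> ('a \<Rightarrow> 'b::real_normed_vector) \<Rightarrow> bool" where
  "Ck_on 0 S f \<longleftrightarrow> continuous_on S f"
| "Ck_on (Suc k) S f \<longleftrightarrow>
     (\<forall>x\<in>S. f differentiable (at x)) \<and> (\<forall>v. Ck_on k S (\<lambda>x. frechet_derivative f (at x) v))"

definition smooth_on :: "'a::real_normed_vector set \<Rightarrow> ('a \<Rightarrow> 'b::real_normed_vector) \<Rightarrow> bool" where
  "smooth_on S f \<longleftrightarrow> (\<forall>k. Ck_on k S f)"

definition germ_eq :: "'a::real_normed_vector set \<Rightarrow> 'a set \<Rightarrow> bool" where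
  "germ_eq A B \<longleftrightarrow> (\<forall>\<^sub>F x in nhds 0. x \<in> A \<longleftrightarrow> x \<in> B)"

text \<open>\<open>f\<close>, restricted to \<open>U\<close>, represents a germ at \<open>0\<close> of a diffeomorphism fixing \<open>0\<close>.\<close>

definition diffeo_near_0 :: "'a::real_normed_vector set \<Rightarrow> ('a \<Rightarrow> 'a) \<Rightarrow> bool" where
  "diffeo_near_0 U f \<longleftrightarrow>
     open U \<and> 0 \<in> U \<and> f 0 = 0 \<and> smooth_on U f \<and> inj_on f U \<and>
     open (f ` U) \<and> smooth_on (f ` U) (inv_into U f)"

definition germ_diffeomorphic :: "'a::real_normed_vector set \<Rightarrow> 'a set \<Rightarrow> bool" where
  "germ_diffeomorphic N M \<longleftrightarrow> (\<exists>U f. diffeo_near_0 U f \<and> germ_eq (f ` (N \<inter> U)) M)"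


section \<open>The standard symplectic space\<close>

text \<open>
  The space of dimension \<open>2n\<close> is \<open>real ^ 'm\<close>, where an enumeration \<open>e\<close> maps \<open>{1..2n}\<close>
  bijectively onto the index type. The coordinates \<open>x\<^sub>1, \<dots>, x\<^sub>2\<^sub>n\<close> are, in this order,
  \<open>p\<^sub>1, q\<^sub>1, \<dots>, p\<^sub>n, q\<^sub>n\<close>.
\<close>

definition xc :: "(nat \<Rightarrow> 'm::finite) \<Rightarrow> nat \<Rightarrow> real ^ 'm \<Rightarrow> real" where
  "xc e j z = z $ e j"

definition pc :: "(nat \<Rightarrow> 'm::finite) \<Rightarrow> nat \<Rightarrow> real ^ 'm \<Rightarrow> real" where
  "pc e i z = xc e (2 * i - 1) z"

definition qc :: "(nat \<Rightarrow> 'm::finite) \<Rightarrow> nat \<Rightarrow> real ^ 'm \<Rightarrow> real" where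
  "qc e i z = xc e (2 * i) z"

definition symp_form :: "(nat \<Rightarrow> 'm::finite) \<Rightarrow> nat \<Rightarrow> real ^ 'm \<Rightarrow> real ^ 'm \<Rightarrow> real" where
  "symp_form e n v w = (\<Sum>i=1..n. pc e i v * qc e i w - qc e i v * pc e i w)"

definition symplectomorphism_near_0 ::
    "(nat \<Rightarrow> 'm::finite) \<Rightarrow> nat \<Rightarrow> (real ^ 'm) set \<Rightarrow> (real ^ 'm \<Rightarrow> real ^ 'm) \<Rightarrow> bool" where
  "symplectomorphism_near_0 e n U f \<longleftrightarrow>
     diffeo_near_0 U f \<and>
     (\<forall>x\<in>U. \<forall>v w. symp_form e n (frechet_derivative f (at x) v) (frechet_derivative f (at x) w)
                   = symp_form e n v w)"

definition symp_equiv ::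
    "(nat \<Rightarrow> 'm::finite) \<Rightarrow> nat \<Rightarrow> (real ^ 'm) set \<Rightarrow> (real ^ 'm) set \<Rightarrow> bool" where
  "symp_equiv e n N M \<longleftrightarrow>
     (\<exists>U f. symplectomorphism_near_0 e n U f \<and> germ_eq (f ` (N \<inter> U)) M)"


section \<open>The singularity and its symplectic normal forms\<close>

definition U8 :: "(nat \<Rightarrow> 'm::finite) \<Rightarrow> nat \<Rightarrow> (real ^ 'm) set" where
  "U8 e n = {z. xc e 1 z ^ 2 + xc e 2 z * xc e 3 z = 0 \<and>
                xc e 1 z * xc e 2 z + xc e 1 z * xc e 3 z ^ 2 = 0 \<and>
                (\<forall>j\<in>{4..2*n}. xc e j z = 0)}"

definition pq_zero_from :: "(nat \<Rightarrow> 'm::finite) \<Rightarrow> nat \<Rightarrow> nat \<Rightarrow> real ^ 'm \<Rightarrow> bool" where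
  "pq_zero_from e n k z \<longleftrightarrow> (\<forall>i\<in>{k..n}. pc e i z = 0 \<and> qc e i z = 0)"

text \<open>
  The argument \<open>s\<close> is the sign, \<open>1\<close> or \<open>-1\<close>: the upper sign of \<open>\<plusminus>\<close> and of \<open>\<mp>\<close>
  corresponds to \<open>s = 1\<close>.
\<close>

definition U8_0 :: "(nat \<Rightarrow> 'm::finite) \<Rightarrow> nat \<Rightarrow> real \<Rightarrow> real \<Rightarrow> (real ^ 'm) set" where
  "U8_0 e n c1 c2 = {z.
     pc e 1 z ^ 2 + pc e 2 z * qc e 1 z = 0 \<and>
     pc e 1 z * pc e 2 z + pc e 1 z * qc e 1 z ^ 2 = 0 \<and>
     qc e 2 z = c1 * qc e 1 z - c2 * pc e 1 z \<and>
     pq_zero_from e n 3 z}"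

definition U8_1 :: "(nat \<Rightarrow> 'm::finite) \<Rightarrow> nat \<Rightarrow> real \<Rightarrow> real \<Rightarrow> real \<Rightarrow> (real ^ 'm) set" where
  "U8_1 e n s c1 c2 = {z.
     pc e 1 z ^ 2 + s * (pc e 2 z * qc e 2 z) = 0 \<and>
     pc e 1 z * pc e 2 z + pc e 1 z * qc e 2 z ^ 2 = 0 \<and>
     qc e 1 z = c1 * pc e 2 z + c2 / 2 * qc e 2 z ^ 2 \<and>
     pq_zero_from e n 3 z}"

definition U8_2 :: "(nat \<Rightarrow> 'm::finite) \<Rightarrow> nat \<Rightarrow> real \<Rightarrow> real \<Rightarrow> (real ^ 'm) set" where
  "U8_2 e n c1 c2 = {z.
     pc e 1 z ^ 2 + qc e 1 z * qc e 2 z = 0 \<and>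
     pc e 1 z * qc e 1 z + pc e 1 z * qc e 2 z ^ 2 = 0 \<and>
     pc e 2 z = c1 * pc e 1 z * qc e 2 z + c2 / 2 * pc e 1 z ^ 2 \<and>
     pq_zero_from e n 3 z}"

definition U8_2_params :: "(real \<times> real) set" where
  "U8_2_params = {(c1, c2). c1 \<noteq> 2 \<and> c1 \<noteq> - (1/3)}"

definition U8_30_5 :: "(nat \<Rightarrow> 'm::finite) \<Rightarrow> nat \<Rightarrow> real \<Rightarrow> real \<Rightarrow> (real ^ 'm) set" where
  "U8_30_5 e n c1 c2 = {z.
     pc e 1 z ^ 2 + qc e 1 z * qc e 2 z = 0 \<and>
     pc e 1 z * qc e 1 z + pc e 1 z * qc e 2 z ^ 2 = 0 \<and>
     pc e 2 z = - (1/3) * pc e 1 z * qc e 2 z + c1 / 2 * pc e 1 z ^ 2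
                  + c2 * pc e 1 z * qc e 2 z ^ 2 \<and>
     pq_zero_from e n 3 z}"

definition U8_30_inf :: "(nat \<Rightarrow> 'm::finite) \<Rightarrow> nat \<Rightarrow> real \<Rightarrow> real \<Rightarrow> (real ^ 'm) set" where
  "U8_30_inf e n c1 c2 = {z.
     pc e 1 z ^ 2 + qc e 1 z * qc e 2 z = 0 \<and>
     pc e 1 z * qc e 1 z + pc e 1 z * qc e 2 z ^ 2 = 0 \<and>
     pc e 2 z = 2 * pc e 1 z * qc e 2 z + c1 / 2 * pc e 1 z ^ 2
                  + c2 / 2 * pc e 1 z ^ 2 * qc e 2 z \<and>
     pq_zero_from e n 3 z}"

definition U8_31 :: "(nat \<Rightarrow> 'm::finite) \<Rightarrow> nat \<Rightarrow> real \<Rightarrow> (real ^ 'm) set" where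
  "U8_31 e n c = {z.
     pc e 1 z ^ 2 + pc e 2 z * pc e 3 z = 0 \<and>
     pc e 1 z * pc e 2 z + pc e 1 z * pc e 3 z ^ 2 = 0 \<and>
     qc e 1 z = 0 \<and> qc e 2 z = 0 \<and>
     qc e 3 z = - (pc e 1 z * pc e 3 z) - c / 2 * pc e 1 z ^ 2 \<and>
     pq_zero_from e n 4 z}"

definition U8_4 :: "(nat \<Rightarrow> 'm::finite) \<Rightarrow> nat \<Rightarrow> real \<Rightarrow> real \<Rightarrow> (real ^ 'm) set" where
  "U8_4 e n s c = {z.
     pc e 1 z ^ 2 + pc e 2 z * pc e 3 z = 0 \<and>
     pc e 1 z * pc e 2 z + pc e 1 z * pc e 3 z ^ 2 = 0 \<and>
     qc e 1 z = 0 \<and> qc e 2 z = 0 \<and>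
     qc e 3 z = - s * (1/2) * pc e 1 z ^ 2 - c * pc e 1 z * pc e 3 z ^ 2 \<and>
     pq_zero_from e n 4 z}"

definition U8_5 :: "(nat \<Rightarrow> 'm::finite) \<Rightarrow> nat \<Rightarrow> real \<Rightarrow> (real ^ 'm) set" where
  "U8_5 e n c = {z.
     pc e 1 z ^ 2 + pc e 2 z * pc e 3 z = 0 \<and>
     pc e 1 z * pc e 2 z + pc e 1 z * pc e 3 z ^ 2 = 0 \<and>
     qc e 1 z = 0 \<and> qc e 2 z = 0 \<and>
     qc e 3 z = - (pc e 1 z * pc e 3 z ^ 2) - c / 2 * pc e 1 z ^ 2 * pc e 3 z \<and>
     pq_zero_from e n 4 z}"

definition U8_6 :: "(nat \<Rightarrow> 'm::finite) \<Rightarrow> nat \<Rightarrow> real \<Rightarrow> real \<Rightarrow> (real ^ 'm) set" where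
  "U8_6 e n s c = {z.
     pc e 1 z ^ 2 + pc e 2 z * pc e 3 z = 0 \<and>
     pc e 1 z * pc e 2 z + pc e 1 z * pc e 3 z ^ 2 = 0 \<and>
     qc e 1 z = 0 \<and> qc e 2 z = 0 \<and>
     qc e 3 z = - s * (1/2) * pc e 1 z ^ 2 * pc e 3 z + c * pc e 1 z * pc e 3 z ^ 3 \<and>
     pq_zero_from e n 4 z}"

definition U8_7 :: "(nat \<Rightarrow> 'm::finite) \<Rightarrow> nat \<Rightarrow> (real ^ 'm) set" where
  "U8_7 e n = {z.
     pc e 1 z ^ 2 + pc e 2 z * pc e 3 z = 0 \<and>
     pc e 1 z * pc e 2 z + pc e 1 z * pc e 3 z ^ 2 = 0 \<and>
     qc e 1 z = 0 \<and> qc e 2 z = 0 \<and>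
     qc e 3 z = - (pc e 1 z * pc e 3 z ^ 3) \<and>
     pq_zero_from e n 4 z}"

definition U8_8 :: "(nat \<Rightarrow> 'm::finite) \<Rightarrow> nat \<Rightarrow> (real ^ 'm) set" where
  "U8_8 e n = {z.
     pc e 1 z ^ 2 + pc e 2 z * pc e 3 z = 0 \<and>
     pc e 1 z * pc e 2 z + pc e 1 z * pc e 3 z ^ 2 = 0 \<and>
     (\<forall>i\<in>{1..n}. qc e i z = 0) \<and> (\<forall>i\<in>{4..n}. pc e i z = 0)}"

datatype normal_form = F0 | F1 | F2 | F30_5 | F30_inf | F31 | F4 | F5 | F6 | F7 | F8

definition normal_forms :: "nat \<Rightarrow> normal_form set" where
  "normal_forms n = (if n = 2 then {F0, F1, F2, F30_5, F30_inf} else UNIV)"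

fun members :: "(nat \<Rightarrow> 'm::finite) \<Rightarrow> nat \<Rightarrow> normal_form \<Rightarrow> (real ^ 'm) set set" where
  "members e n F0 = {U8_0 e n c1 c2 | c1 c2. True}"
| "members e n F1 = {U8_1 e n s c1 c2 | s c1 c2. s \<in> {1, -1}}"
| "members e n F2 = {U8_2 e n c1 c2 | c1 c2. (c1, c2) \<in> U8_2_params}"
| "members e n F30_5 = {U8_30_5 e n c1 c2 | c1 c2. True}"
| "members e n F30_inf = {U8_30_inf e n c1 c2 | c1 c2. True}"
| "members e n F31 = {U8_31 e n c | c. True}"
| "members e n F4 = {U8_4 e n s c | s c. s \<in> {1, -1}}"
| "members e n F5 = {U8_5 e n c | c. True}"
| "members e n F6 = {U8_6 e n s c | s c. s \<in> {1, -1}}"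
| "members e n F7 = {U8_7 e n}"
| "members e n F8 = {U8_8 e n}"


section \<open>Moduli\<close>

text \<open>
  No nonconstant smooth path in the parameter domain \<open>P\<close> consists of parameters of mutually
  equivalent members of the family \<open>N\<close>. Smoothness on the closed unit interval means
  smoothness on an open neighbourhood of it.
\<close>

definition moduli_on ::
    "(nat \<Rightarrow> 'm::finite) \<Rightarrow> nat \<Rightarrow> 'c::real_normed_vector set \<Rightarrow> ('c \<Rightarrow> (real ^ 'm) set) \<Rightarrow> bool" where
  "moduli_on e n P N \<longleftrightarrow>
     (\<forall>\<gamma> :: real \<Rightarrow> 'c.
        (\<exists>I. open I \<and> {0..1} \<subseteq> I \<and> smooth_on I \<gamma>) \<and> \<gamma> ` {0..1} \<subseteq> P \<and>
        (\<forall>t\<in>{0..1}. \<forall>u\<in>{0..1}. symp_equiv e n (N (\<gamma> t)) (N (\<gamma> u)))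
        \<longrightarrow> (\<forall>t\<in>{0..1}. \<gamma> t = \<gamma> 0))"

text \<open>A path of parameters within a normal form has a constant sign, by continuity.\<close>

fun parameters_are_moduli :: "(nat \<Rightarrow> 'm::finite) \<Rightarrow> nat \<Rightarrow> normal_form \<Rightarrow> bool" where
  "parameters_are_moduli e n F0 = moduli_on e n UNIV (\<lambda>(c1, c2). U8_0 e n c1 c2)"
| "parameters_are_moduli e n F1 =
     (\<forall>s\<in>{1, -1}. moduli_on e n UNIV (\<lambda>(c1, c2). U8_1 e n s c1 c2))"
| "parameters_are_moduli e n F2 = moduli_on e n U8_2_params (\<lambda>(c1, c2). U8_2 e n c1 c2)"
| "parameters_are_moduli e n F30_5 = moduli_on e n UNIV (\<lambda>(c1, c2). U8_30_5 e n c1 c2)"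
| "parameters_are_moduli e n F30_inf = moduli_on e n UNIV (\<lambda>(c1, c2). U8_30_inf e n c1 c2)"
| "parameters_are_moduli e n F31 = moduli_on e n UNIV (\<lambda>c. U8_31 e n c)"
| "parameters_are_moduli e n F4 = (\<forall>s\<in>{1, -1}. moduli_on e n UNIV (\<lambda>c. U8_4 e n s c))"
| "parameters_are_moduli e n F5 = moduli_on e n UNIV (\<lambda>c. U8_5 e n c)"
| "parameters_are_moduli e n F6 = (\<forall>s\<in>{1, -1}. moduli_on e n UNIV (\<lambda>c. U8_6 e n s c))"
| "parameters_are_moduli e n F7 = True"
| "parameters_are_moduli e n F8 = True"

end

theory Submission
  imports Defs
begin

text \<open>
  Let \<open>C\<close> be the curve \<open>U8\<close>, a union of two lines and a cusp, and let \<open>f\<close> be a local diffeomorphism with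
  \<open>f(C) = N\<close>. The symplectic class of \<open>N\<close> is determined by the class of the one-form
  \<open>theta f = \<omega>(f, df) / 2\<close>, restricted to points of \<open>C\<close>, modulo exact forms: no homotopy argument is needed, since a
  symplectomorphism with \<open>\<Phi> \<circ> f0 = f1\<close> on \<open>C\<close> is obtained from the midpoint generating function,
  a primitive of \<open>theta f1 - theta f0\<close> transported by \<open>(f0 + f1) / 2\<close>.

  For the weights 3, 4, 2 of \<open>x1, x2, x3\<close>, one-forms modulo exact forms have an eight-dimensional quotient with a
  quasihomogeneous basis \<open>B\<close> of weights 5, 6, 7, 7, 8, 9, 10, 11. A diffeomorphism preserving \<open>C\<close> is, up to
  terms of higher order, \<open>x_i \<mapsto> a^w_i x_i + w_i a^(w_i - 1) x_i \<mu>\<close> with \<open>\<mu> = b x3 + d x1\<close>, so the group acts on the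
  coordinates by triangular formulas. Normalising the leading coordinate by scaling and killing those of
  higher weight by \<open>x_i \<mapsto> (1 + \<mu>)^w_i x_i\<close> with monomials \<open>\<mu>\<close> gives the list of normal forms; the resonances of these
  formulas at leading part \<open>B 3 + c B 4\<close> occur for \<open>c = -1/3\<close> and \<open>c = 2\<close>. If \<open>n = 2\<close>, the tangent space of \<open>N\<close>
  is three-dimensional and cannot be isotropic, so that one of the first three coordinates does not vanish.
\<close>

section \<open>Smooth maps\<close>

text \<open>Pulled back to the tangents of a single branch every one-form is exact; this is why
  values in all ambient directions are compared at the points of the curve. Negligible are then
  differentials and forms that vanish at these points, so that \<open>F dG\<close> depends on the
  restrictions of \<open>F\<close> and \<open>G\<close> only. The weights are chosen to make the two
  equations of the curve quasihomogeneous, of degrees 6 and 7. The obstacle is that germs are merely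
  smooth: an expansion stops at a finite weight, and its remainder, possibly flat, still needs a
  primitive. On the cusp such a primitive comes from inverting \<open>N + E\<close> with the
  weighted Euler field \<open>E\<close>, on the lines from integration in one variable; together
  they make every form of weight at least 12 exact. First-order formulas suffice for the group
  action: a substitution that changes coordinates by relative weight \<kappa> is known up to
  relative weight \<open>2 * \<kappa>\<close>, and the least possible \<kappa> is 2. A form whose
  leading weight is higher is thereby controlled further, which is why the invariants of high weight
  are only claimed when the low coordinates vanish.\<close>

abbreviation near_zero :: "('a::real_normed_vector \<Rightarrow> bool) \<Rightarrow> bool" (binder "near " 10) where
  "near_zero P \<equiv> eventually P (nhds 0)"

abbreviation fder :: "('a::real_normed_vector \<Rightarrow> 'b::real_normed_vector) \<Rightarrow> 'a \<Rightarrow> 'a \<Rightarrow> 'b" where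
  "fder f x \<equiv> frechet_derivative f (at x)"

section \<open>Calculus of derivatives and of the classes \<open>Ck_on\<close>\<close>

lemma fder_eqI: "(f has_derivative f') (at x) \<Longrightarrow> fder f x v = f' v"
  using frechet_derivative_at by metis

lemma has_fder: "f differentiable (at x) \<Longrightarrow> (f has_derivative fder f x) (at x)"
  by (simp add: frechet_derivative_works)

lemma has_derivative_cong_nhds:
  assumes "(f has_derivative f') (at x)" "\<forall>\<^sub>F y in nhds x. f y = g y"
  shows "(g has_derivative f') (at x)"
proof -
  obtain S where "open S" "x \<in> S" "\<And>y. y \<in> S \<Longrightarrow> f y = g y"
    using assms(2) by (auto simp: eventually_nhds)
  then show ?thesis using has_derivative_transform_within_open[OF assms(1)] by metis
qed

lemma fder_cong_nhds:
  assumes "\<forall>\<^sub>F y in nhds x. f y = g y"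
  shows "fder f x = fder g x"
proof -
  have "\<forall>\<^sub>F y in nhds x. g y = f y" using assms by (auto elim: eventually_mono)
  then have "(f has_derivative f') (at x) \<longleftrightarrow> (g has_derivative f') (at x)" for f'
    using has_derivative_cong_nhds assms by metis
  then show ?thesis unfolding frechet_derivative_def by simp
qed

lemma Ck_on_cong:
  assumes "open S" "\<And>x. x \<in> S \<Longrightarrow> f x = g x" "Ck_on k S f"
  shows "Ck_on k S g"
  using assms(2,3)
proof (induction k arbitrary: f g)
  case 0
  then show ?case using continuous_on_cong[of S S f g] by simp
next
  case (Suc k)
  have ev: "\<forall>\<^sub>F y in nhds x. f y = g y" if "x \<in> S" for x
    using Suc.prems(1) assms(1) that eventually_nhds by blast
  have d: "g differentiable (at x)" if "x \<in> S" for x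
    using Suc.prems(2) ev[OF that] that has_derivative_cong_nhds unfolding differentiable_def
    by (metis Ck_on.simps(2) differentiable_def)
  have "Ck_on k S (\<lambda>x. fder g x v)" for v
    by (rule Suc.IH[of "\<lambda>x. fder f x v"]) (use Suc.prems fder_cong_nhds[OF ev] in auto)
  then show ?case using d by simp
qed

lemma Ck_on_subset: "Ck_on k S f \<Longrightarrow> T \<subseteq> S \<Longrightarrow> Ck_on k T f"
  by (induction k arbitrary: f) (auto intro: continuous_on_subset)

lemma Ck_on_continuous: "Ck_on k S f \<Longrightarrow> continuous_on S f"
  by (cases k) (auto intro!: continuous_at_imp_continuous_on differentiable_imp_continuous_within)

lemma Ck_on_SucD: "Ck_on (Suc k) S f \<Longrightarrow> Ck_on k S f"
proof (induction k arbitrary: f)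
  case 0
  then show ?case using Ck_on_continuous by (metis Ck_on.simps(1))
next
  case (Suc k)
  then show ?case by (metis Ck_on.simps(2))
qed

lemma Ck_on_const: "Ck_on k S (\<lambda>x. c)"
  by (induction k arbitrary: c) auto

lemma Ck_on_linear: "bounded_linear f \<Longrightarrow> Ck_on k S f"
proof (cases k)
  case (Suc j)
  assume f: "bounded_linear f"
  have "(f has_derivative f) (at x)" for x by (rule bounded_linear_imp_has_derivative[OF f])
  then have "f differentiable (at x)" "fder f x = f" for x
    using differentiable_def frechet_derivative_at by metis+
  then show ?thesis using Suc by (simp add: Ck_on_const)
qed (simp add: linear_continuous_on)

lemma Ck_on_add:
  assumes "open S" "Ck_on k S f" "Ck_on k S g"
  shows "Ck_on k S (\<lambda>x. f x + g x)"
  using assms(2,3)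
proof (induction k arbitrary: f g)
  case 0
  then show ?case by (auto intro: continuous_intros)
next
  case (Suc k)
  have d: "((\<lambda>x. f x + g x) has_derivative (\<lambda>v. fder f x v + fder g x v)) (at x)" if "x \<in> S" for x
    using Suc.prems that by (auto intro!: has_derivative_add has_fder)
  have "Ck_on k S (\<lambda>x. fder (\<lambda>x. f x + g x) x v)" for v
    by (rule Ck_on_cong[OF assms(1) _ Suc.IH[of "\<lambda>x. fder f x v" "\<lambda>x. fder g x v"]])
       (use Suc.prems fder_eqI[OF d] in auto)
  then show ?case using d by (auto simp: differentiable_def)
qed

lemma Ck_on_bilinear:
  assumes b: "bounded_bilinear prd" and S: "open S" "Ck_on k S f" "Ck_on k S g"
  shows "Ck_on k S (\<lambda>x. prd (f x) (g x))"
  using S(2,3)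
proof (induction k arbitrary: f g)
  case 0
  then show ?case by (auto intro: bounded_bilinear.continuous_on[OF b])
next
  case (Suc k)
  have d: "((\<lambda>x. prd (f x) (g x)) has_derivative (\<lambda>v. prd (f x) (fder g x v) + prd (fder f x v) (g x))) (at x)"
    if "x \<in> S" for x
    using Suc.prems that by (auto intro!: bounded_bilinear.FDERIV[OF b] has_fder)
  have "Ck_on k S (\<lambda>x. prd (f x) (fder g x v) + prd (fder f x v) (g x))" for v
    by (intro Ck_on_add S(1) Suc.IH) (use Suc.prems Ck_on_SucD in auto)
  then have "Ck_on k S (\<lambda>x. fder (\<lambda>x. prd (f x) (g x)) x v)" for v
    by (rule Ck_on_cong[OF S(1), rotated]) (simp add: fder_eqI[OF d])
  then show ?case using d by (auto simp: differentiable_def)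
qed

lemma Ck_on_sum:
  assumes "open S" "\<And>i. i \<in> I \<Longrightarrow> Ck_on k S (f i)"
  shows "Ck_on k S (\<lambda>x. \<Sum>i\<in>I. f i x)"
  using assms(2)
proof (induction I rule: infinite_finite_induct)
  case (insert i I)
  then show ?case using Ck_on_add[OF assms(1), of k "f i" "\<lambda>x. \<Sum>i\<in>I. f i x"] by simp
qed (auto simp: Ck_on_const)

text \<open>Only the derivative in each fixed direction is known to be of class
  \<open>Ck_on\<close>, so the inner derivative is expanded in a basis of the middle space. This is
  what forces that space to be Euclidean.\<close>

lemma Ck_on_compose:
  fixes f :: "'a::real_normed_vector \<Rightarrow> 'b::euclidean_space" and g :: "'b \<Rightarrow> 'c::real_normed_vector"
  assumes S: "open S" and fg: "Ck_on k S f" "Ck_on k T g" "f ` S \<subseteq> T"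
  shows "Ck_on k S (\<lambda>x. g (f x))"
  using fg
proof (induction k arbitrary: f g)
  case 0
  then show ?case by (auto intro: continuous_on_compose2)
next
  case (Suc k)
  have d: "((\<lambda>x. g (f x)) has_derivative (\<lambda>v. fder g (f x) (fder f x v))) (at x)" if "x \<in> S" for x
    using diff_chain_at[OF has_fder has_fder, of f x g] Suc.prems that by (auto simp: o_def)
  have eq: "fder (\<lambda>x. g (f x)) x v = (\<Sum>b\<in>Basis. (fder f x v \<bullet> b) *\<^sub>R fder g (f x) b)" if "x \<in> S" for x v
  proof -
    have l: "linear (fder g (f x))"
      using Suc.prems that by (auto intro!: linear_frechet_derivative)
    have "fder (\<lambda>x. g (f x)) x v = fder g (f x) (\<Sum>b\<in>Basis. (fder f x v \<bullet> b) *\<^sub>R b)"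
      using fder_eqI[OF d[OF that]] by (simp add: euclidean_representation)
    also have "\<dots> = (\<Sum>b\<in>Basis. (fder f x v \<bullet> b) *\<^sub>R fder g (f x) b)"
      by (simp add: linear_sum[OF l] linear_scale[OF l])
    finally show ?thesis .
  qed
  have "Ck_on k S (\<lambda>x. (fder f x v \<bullet> b) *\<^sub>R fder g (f x) b)" for v b
  proof (rule Ck_on_bilinear[OF bounded_bilinear_scaleR S])
    show "Ck_on k S (\<lambda>x. fder f x v \<bullet> b)"
      by (rule Ck_on_bilinear[OF bounded_bilinear_inner S _ Ck_on_const]) (use Suc.prems in auto)
    show "Ck_on k S (\<lambda>x. fder g (f x) b)"
      using Suc.IH[of f "\<lambda>y. fder g y b"] Suc.prems Ck_on_SucD[OF Suc.prems(1)] by auto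
  qed
  then have "Ck_on k S (\<lambda>x. \<Sum>b\<in>Basis. (fder f x v \<bullet> b) *\<^sub>R fder g (f x) b)" for v
    by (intro Ck_on_sum S)
  then have "Ck_on k S (\<lambda>x. fder (\<lambda>x. g (f x)) x v)" for v
    by (rule Ck_on_cong[OF S, rotated]) (simp add: eq)
  then show ?case using d by (auto simp: differentiable_def)
qed

text \<open>The derivative is \<open>- v\<close> times the square of \<open>inverse\<close>, so the
  induction feeds on itself.\<close>

lemma Ck_on_inverse: "Ck_on k (- {0}) (inverse :: real \<Rightarrow> real)"
proof (induction k)
  case 0
  then show ?case by (auto intro: continuous_intros)
next
  case (Suc k)
  have o: "open (- {0::real})" by (simp add: open_Compl)
  have d: "(inverse has_derivative (\<lambda>v. - v * (inverse x * inverse x))) (at x)" if "x \<noteq> 0" for x :: real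
    using has_derivative_inverse'[OF that] by (simp add: algebra_simps)
  have "Ck_on k (- {0}) (\<lambda>x. fder inverse x v)" for v :: real
    by (rule Ck_on_cong[OF o _ Ck_on_bilinear[OF bounded_bilinear_mult o Ck_on_const[of k _ "- v"]
          Ck_on_bilinear[OF bounded_bilinear_mult o Suc Suc]]])
       (use fder_eqI[OF d] in auto)
  then show ?case using d by (auto simp: differentiable_def)
qed

text \<open>The integrand is smooth on an open set around \<open>U \<times> {0..1}\<close> in the
  product space; its derivative in a direction \<open>(v, 0)\<close> is again such an integrand, and
  the induction on \<open>k\<close> closes.\<close>

lemma Ck_on_integral:
  fixes G :: "'a::euclidean_space \<times> real \<Rightarrow> real"
  assumes "open W" "open U" "U \<times> {0..1} \<subseteq> W" "Ck_on k W G"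
  shows "Ck_on k U (\<lambda>x. integral {0..1} (\<lambda>s. G (x, s)))"
    and "k > 0 \<Longrightarrow> x \<in> U \<Longrightarrow> ((\<lambda>x. integral {0..1} (\<lambda>s. G (x, s))) has_derivative
            (\<lambda>v. integral {0..1} (\<lambda>s. fder G (x, s) (v, 0)))) (at x)"
proof -
  have der: "((\<lambda>x. integral {0..1} (\<lambda>s. G (x, s))) has_derivative
            (\<lambda>v. integral {0..1} (\<lambda>s. fder G (x, s) (v, 0)))) (at x)"
    if G: "Ck_on (Suc 0) W G" and x: "x \<in> U" for x and G :: "'a \<times> real \<Rightarrow> real"
  proof -
    obtain e where e: "e > 0" "ball x e \<subseteq> U" using assms(2) x openE by blast
    have W: "(y, s) \<in> W" if "y \<in> ball x e" "s \<in> {0..1}" for y s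
      using e(2) assms(3) that by blast
    have cG: "continuous_on W G" using Ck_on_continuous[OF G] .
    have hd: "((\<lambda>y. G (y, s)) has_derivative (\<lambda>v. fder G (y, s) (v, 0))) (at y)"
      if "(y, s) \<in> W" for y s
    proof -
      have "((\<lambda>y. (y, s)) has_derivative (\<lambda>v. (v, 0))) (at y)"
        by (auto intro!: derivative_eq_intros)
      moreover have "(G has_derivative fder G (y, s)) (at (y, s))"
        using G that by (auto intro: has_fder)
      ultimately show ?thesis
        using diff_chain_at[of "\<lambda>y. (y, s)" "\<lambda>v. (v, 0)" y G "fder G (y, s)"] by (simp add: o_def)
    qed
    \<comment> \<open>Differentiation under the integral needs a derivative that is continuous in
      operator norm; in finite dimension this can be checked on each vector.\<close>
    define B where "B y s = Blinfun (\<lambda>v. fder G (y, s) (v, 0))" for y s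
    have Bap: "blinfun_apply (B y s) = (\<lambda>v. fder G (y, s) (v, 0))" if "(y, s) \<in> W" for y s
      unfolding B_def by (rule bounded_linear_Blinfun_apply) (use hd[OF that] has_derivative_bounded_linear in blast)
    have "continuous_on W (\<lambda>p. fder G p v)" for v
      using G by (cases v) auto
    then have "continuous_on (ball x e \<times> cbox 0 1) (\<lambda>p. fder G p (v, 0))" for v
      by (rule continuous_on_subset) (use W in auto)
    then have cB: "continuous_on (ball x e \<times> cbox 0 1) (\<lambda>(y, s). B y s)"
      by (intro continuous_on_blinfun_componentwise)
         (rule continuous_on_eq, assumption, use Bap W in \<open>auto simp: split_beta\<close>)
    have int: "(\<lambda>s. G (y, s)) integrable_on cbox 0 1" if "y \<in> ball x e" for y
      by (rule integrable_continuous, rule continuous_on_compose2[OF cG])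
         (use W that in \<open>auto intro!: continuous_intros\<close>)
    have "((\<lambda>y. integral (cbox 0 1) (\<lambda>s. G (y, s))) has_derivative blinfun_apply (integral (cbox 0 1) (B x))) (at x within ball x e)"
      by (rule leibniz_rule[where fx = B])
         (use hd Bap W int cB e in \<open>auto intro: has_derivative_at_withinI\<close>)
    then have 1: "((\<lambda>y. integral {0..1} (\<lambda>s. G (y, s))) has_derivative blinfun_apply (integral {0..1} (B x))) (at x)"
      using e(1) by (simp add: at_within_open[of x "ball x e"] cbox_interval)
    have cP: "continuous_on {0..1::real} (\<lambda>s. (x, s))"
      by (rule continuous_on_Pair[OF continuous_on_const continuous_on_id])
    have "(\<lambda>s. (x, s)) ` {0..1::real} \<subseteq> ball x e \<times> cbox 0 1"
      using e(1) by (auto simp: cbox_interval)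
    then have cBx: "continuous_on {0..1} (B x)"
      using continuous_on_compose2[OF cB cP] by simp
    have "blinfun_apply (integral {0..1} (B x)) v = integral {0..1} (\<lambda>s. blinfun_apply (B x s) v)" for v
      by (rule blinfun_apply_integral) (use cBx in \<open>auto intro: integrable_continuous_interval\<close>)
    also have "\<dots> v = integral {0..1} (\<lambda>s. fder G (x, s) (v, 0))" for v
      by (rule integral_cong) (use Bap W e(1) in auto)
    finally have "blinfun_apply (integral {0..1} (B x)) = (\<lambda>v. integral {0..1} (\<lambda>s. fder G (x, s) (v, 0)))"
      by auto
    then show ?thesis using 1 by simp
  qed
  show "Ck_on k U (\<lambda>x. integral {0..1} (\<lambda>s. G (x, s)))"
    using assms(4)
  proof (induction k arbitrary: G)
    case 0
    then have "continuous_on (U \<times> cbox 0 1) (\<lambda>(x, s). G (x, s))"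
      using assms(3) by (auto intro: continuous_on_subset simp: cbox_interval)
    then show ?case using integral_continuous_on_param[of U 0 1 "\<lambda>x s. G (x, s)"] by (simp add: cbox_interval)
  next
    case (Suc k)
    have G1: "Ck_on (Suc 0) W G" using Suc.prems by (auto intro: Ck_on_continuous)
    have "Ck_on k U (\<lambda>x. integral {0..1} (\<lambda>s. fder G (x, s) (v, 0)))" for v
      using Suc.IH[of "\<lambda>p. fder G p (v, 0)"] Suc.prems by simp
    then have "Ck_on k U (\<lambda>x. fder (\<lambda>x. integral {0..1} (\<lambda>s. G (x, s))) x v)" for v
      by (rule Ck_on_cong[OF assms(2), rotated]) (use fder_eqI[OF der[OF G1]] in auto)
    then show ?case using der[OF G1] by (auto simp: differentiable_def)
  qed
  assume "k > 0" "x \<in> U"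
  then obtain j where "k = Suc j" by (cases k) auto
  then have "Ck_on (Suc 0) W G" using assms(4) by (auto intro: Ck_on_continuous)
  then show "((\<lambda>x. integral {0..1} (\<lambda>s. G (x, s))) has_derivative
            (\<lambda>v. integral {0..1} (\<lambda>s. fder G (x, s) (v, 0)))) (at x)"
    using der \<open>x \<in> U\<close> by blast
qed

lemma smooth_on_const: "smooth_on S (\<lambda>x. c)"
  by (simp add: smooth_on_def Ck_on_const)

lemma smooth_on_linear: "bounded_linear f \<Longrightarrow> smooth_on S f"
  by (simp add: smooth_on_def Ck_on_linear)

lemma smooth_on_add: "open S \<Longrightarrow> smooth_on S f \<Longrightarrow> smooth_on S g \<Longrightarrow> smooth_on S (\<lambda>x. f x + g x)"
  by (simp add: smooth_on_def Ck_on_add)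

lemma smooth_on_bilinear:
  "bounded_bilinear prd \<Longrightarrow> open S \<Longrightarrow> smooth_on S f \<Longrightarrow> smooth_on S g \<Longrightarrow> smooth_on S (\<lambda>x. prd (f x) (g x))"
  by (simp add: smooth_on_def Ck_on_bilinear)

lemma smooth_on_compose:
  fixes f :: "'a::real_normed_vector \<Rightarrow> 'b::euclidean_space"
  shows "open S \<Longrightarrow> smooth_on S f \<Longrightarrow> smooth_on T g \<Longrightarrow> f ` S \<subseteq> T \<Longrightarrow> smooth_on S (\<lambda>x. g (f x))"
  unfolding smooth_on_def by (blast intro: Ck_on_compose)

lemma smooth_on_subset: "smooth_on S f \<Longrightarrow> T \<subseteq> S \<Longrightarrow> smooth_on T f"
  using Ck_on_subset by (metis smooth_on_def)

lemma smooth_on_cong: "open S \<Longrightarrow> (\<And>x. x \<in> S \<Longrightarrow> f x = g x) \<Longrightarrow> smooth_on S f \<Longrightarrow> smooth_on S g"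
  using Ck_on_cong by (metis smooth_on_def)

lemma smooth_on_fder: "smooth_on S f \<Longrightarrow> smooth_on S (\<lambda>x. fder f x v)"
  unfolding smooth_on_def by (metis Ck_on.simps(2))

lemma smooth_on_differentiable: "smooth_on S f \<Longrightarrow> x \<in> S \<Longrightarrow> f differentiable (at x)"
  unfolding smooth_on_def by (metis Ck_on.simps(2))

lemma smooth_on_continuous: "smooth_on S f \<Longrightarrow> continuous_on S f"
  unfolding smooth_on_def by (metis Ck_on.simps(1))

lemma smooth_on_sum:
  "open S \<Longrightarrow> (\<And>i. i \<in> I \<Longrightarrow> smooth_on S (f i)) \<Longrightarrow> smooth_on S (\<lambda>x. \<Sum>i\<in>I. f i x)"
  by (simp add: smooth_on_def Ck_on_sum)

lemma smooth_on_integral: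
  fixes G :: "'a::euclidean_space \<times> real \<Rightarrow> real"
  assumes "open W" "open U" "U \<times> {0..1} \<subseteq> W" "smooth_on W G"
  shows "smooth_on U (\<lambda>x. integral {0..1} (\<lambda>s. G (x, s)))"
    and "x \<in> U \<Longrightarrow> ((\<lambda>x. integral {0..1} (\<lambda>s. G (x, s))) has_derivative
            (\<lambda>v. integral {0..1} (\<lambda>s. fder G (x, s) (v, 0)))) (at x)"
  using Ck_on_integral(1)[OF assms(1-3)] Ck_on_integral(2)[OF assms(1-3), of "Suc 0" G] assms(4)
  unfolding smooth_on_def by blast+

section \<open>Germs of smooth maps at the origin\<close>

definition sm :: "('a::real_normed_vector \<Rightarrow> 'b::real_normed_vector) \<Rightarrow> bool" where
  "sm f \<longleftrightarrow> (\<exists>U. open U \<and> 0 \<in> U \<and> smooth_on U f)"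

lemma smI: "open U \<Longrightarrow> 0 \<in> U \<Longrightarrow> smooth_on U f \<Longrightarrow> sm f"
  by (auto simp: sm_def)

lemma sm_obtain2:
  assumes "sm f" "sm g"
  obtains U where "open U" "0 \<in> U" "smooth_on U f" "smooth_on U g"
proof -
  obtain U V where "open U" "0 \<in> U" "smooth_on U f" "open V" "0 \<in> V" "smooth_on V g"
    using assms by (auto simp: sm_def)
  then show ?thesis
    by (intro that[of "U \<inter> V"]) (auto intro: smooth_on_subset)
qed

lemma sm_const [simp, intro]: "sm (\<lambda>x. c)"
  by (auto simp: sm_def intro: smooth_on_const)

lemma sm_linear: "bounded_linear f \<Longrightarrow> sm f"
  by (auto simp: sm_def intro: smooth_on_linear)

lemma sm_ident [simp, intro]: "sm (\<lambda>x. x)"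
  by (rule sm_linear) (rule bounded_linear_ident)

lemma sm_add [intro]: assumes "sm f" "sm g" shows "sm (\<lambda>x. f x + g x)"
  by (rule sm_obtain2[OF assms]) (auto intro!: smI smooth_on_add)

lemma sm_bilinear: assumes "bounded_bilinear prd" "sm f" "sm g" shows "sm (\<lambda>x. prd (f x) (g x))"
  by (rule sm_obtain2[OF assms(2,3)]) (rule smI, assumption, assumption, rule smooth_on_bilinear[OF assms(1)])

lemma sm_scaleR [intro]: "sm f \<Longrightarrow> sm g \<Longrightarrow> sm (\<lambda>x. f x *\<^sub>R g x)"
  by (rule sm_bilinear[OF bounded_bilinear_scaleR])

lemma sm_mult [intro]:
  fixes f g :: "'a::real_normed_vector \<Rightarrow> real"
  shows "sm f \<Longrightarrow> sm g \<Longrightarrow> sm (\<lambda>x. f x * g x)"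
  by (rule sm_bilinear[OF bounded_bilinear_mult])

lemma sm_minus [intro]: "sm f \<Longrightarrow> sm (\<lambda>x. - f x)"
  using sm_scaleR[OF sm_const[of "-1"], of f] by simp

lemma sm_diff [intro]: "sm f \<Longrightarrow> sm g \<Longrightarrow> sm (\<lambda>x. f x - g x)"
  using sm_add[OF _ sm_minus, of f g] by simp

lemma sm_divide_const [intro]:
  fixes f :: "'a::real_normed_vector \<Rightarrow> real"
  shows "sm f \<Longrightarrow> sm (\<lambda>x. f x / c)"
  using sm_mult[OF _ sm_const[of "1/c"], of f] by simp

lemma sm_power [intro]:
  fixes f :: "'a::real_normed_vector \<Rightarrow> real"
  shows "sm f \<Longrightarrow> sm (\<lambda>x. f x ^ k)"
  by (induction k) auto

lemma sm_sum [intro]: "(\<And>i. i \<in> I \<Longrightarrow> sm (f i)) \<Longrightarrow> sm (\<lambda>x. \<Sum>i\<in>I. f i x)"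
  by (induction I rule: infinite_finite_induct) auto

lemma sm_fder [intro]: "sm f \<Longrightarrow> sm (\<lambda>x. fder f x v)"
  unfolding sm_def using smooth_on_fder by blast

lemma sm_cong:
  assumes "sm f" "near x. f x = g x"
  shows "sm g"
proof -
  obtain U V where "open U" "0 \<in> U" "smooth_on U f" "open V" "0 \<in> V" "\<And>x. x \<in> V \<Longrightarrow> f x = g x"
    using assms by (auto simp: sm_def eventually_nhds)
  then show ?thesis
    by (intro smI[of "U \<inter> V"] smooth_on_cong[of "U \<inter> V" f g]) (auto intro: smooth_on_subset)
qed

lemma sm_compose:
  fixes f :: "'a::real_normed_vector \<Rightarrow> 'b::euclidean_space"
  assumes "sm g" "sm f" "f 0 = 0"
  shows "sm (\<lambda>x. g (f x))"
proof -
  obtain U V where UV: "open U" "0 \<in> U" "smooth_on U f" "open V" "0 \<in> V" "smooth_on V g"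
    using assms by (auto simp: sm_def)
  have o: "open (U \<inter> f -` V)"
    using continuous_on_open_vimage[OF UV(1)] smooth_on_continuous[OF UV(3)] UV by (auto simp: Int_commute)
  show ?thesis
    by (rule smI[OF o])
       (use UV assms(3) o in \<open>auto intro!: smooth_on_compose[of "U \<inter> f -` V" f V g] intro: smooth_on_subset\<close>)
qed

lemma sm_vec:
  assumes "\<And>i. sm (\<lambda>x. f x $ i)"
  shows "sm (f :: 'a::real_normed_vector \<Rightarrow> real ^ 'm)"
proof -
  have "sm (\<lambda>x. \<Sum>i\<in>UNIV. f x $ i *\<^sub>R (axis i 1 :: real ^ 'm))"
    by (intro sm_sum sm_scaleR sm_const assms)
  moreover have "f x = (\<Sum>i\<in>UNIV. f x $ i *\<^sub>R (axis i 1 :: real ^ 'm))" for x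
    by (simp add: vec_eq_iff axis_def if_distrib cong: if_cong)
  ultimately show ?thesis by simp
qed

lemma sm_nth [intro]: "sm f \<Longrightarrow> sm (\<lambda>x. (f x :: real ^ 'm) $ i)"
  unfolding sm_def
  using smooth_on_compose[OF _ _ smooth_on_linear[OF bounded_linear_vec_nth], of _ f UNIV i] by auto

lemma sm_differentiable: "sm f \<Longrightarrow> near x. f differentiable (at x)"
  unfolding sm_def eventually_nhds using smooth_on_differentiable by metis

lemma sm_has_fder: "sm f \<Longrightarrow> near x. (f has_derivative fder f x) (at x)"
  by (drule sm_differentiable) (auto elim!: eventually_mono intro: has_fder)

lemma sm_has_fder_0: "sm f \<Longrightarrow> (f has_derivative fder f 0) (at 0)"
  using sm_has_fder eventually_nhds_x_imp_x by blast

lemma sm_differentiable_0: "sm f \<Longrightarrow> f differentiable (at 0)"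
  using sm_has_fder_0 differentiable_def by blast

lemma sm_isCont: "sm f \<Longrightarrow> isCont f 0"
  using sm_has_fder_0 has_derivative_continuous by blast

lemma sm_tendsto: "sm f \<Longrightarrow> f 0 = 0 \<Longrightarrow> filterlim f (nhds 0) (nhds 0)"
  using sm_isCont by (metis continuous_at_imp_continuous_at_within filterlim_iff isCont_def tendsto_at_iff_tendsto_nhds)

text \<open>Pulls any statement valid near \<open>0\<close> back along a germ that fixes
  \<open>0\<close>; nearly all changes of parametrisation below go through it.\<close>

lemma eventually_compose_germ:
  assumes "near y. P y" "sm f" "f 0 = 0"
  shows "near x. P (f x)"
  using filterlim_iff[THEN iffD1, OF sm_tendsto[OF assms(2,3)]] assms(1) by blast

lemma linear_fder: "f differentiable (at x) \<Longrightarrow> linear (fder f x)"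
  by (rule linear_frechet_derivative)

lemma fder_compose:
  assumes "g differentiable (at (f x))" "f differentiable (at x)"
  shows "fder (\<lambda>x. g (f x)) x v = fder g (f x) (fder f x v)"
  using fder_eqI[OF diff_chain_at[OF has_fder has_fder, unfolded o_def]] assms by blast

lemma fder_linear: "bounded_linear f \<Longrightarrow> fder f x v = f v"
  by (rule fder_eqI) (rule bounded_linear_imp_has_derivative)

lemma fder_add: "f differentiable (at x) \<Longrightarrow> g differentiable (at x) \<Longrightarrow>
    fder (\<lambda>x. f x + g x) x v = fder f x v + fder g x v"
  by (rule fder_eqI) (auto intro!: has_derivative_add has_fder)

lemma fder_diff: "f differentiable (at x) \<Longrightarrow> g differentiable (at x) \<Longrightarrow>
    fder (\<lambda>x. f x - g x) x v = fder f x v - fder g x v"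
  by (rule fder_eqI) (auto intro!: has_derivative_diff has_fder)

lemma fder_mult:
  fixes f g :: "'a::real_normed_vector \<Rightarrow> real"
  shows "f differentiable (at x) \<Longrightarrow> g differentiable (at x) \<Longrightarrow>
    fder (\<lambda>x. f x * g x) x v = f x * fder g x v + fder f x v * g x"
  by (rule fder_eqI) (auto intro!: has_derivative_mult has_fder)

lemma fder_cmult:
  fixes f :: "'a::real_normed_vector \<Rightarrow> real"
  shows "f differentiable (at x) \<Longrightarrow> fder (\<lambda>x. c * f x) x v = c * fder f x v"
  by (rule fder_eqI) (auto intro!: has_derivative_mult_right has_fder)

lemma fder_sum:
  "(\<And>i. i \<in> I \<Longrightarrow> f i differentiable (at x)) \<Longrightarrow>
    fder (\<lambda>x. \<Sum>i\<in>I. f i x) x v = (\<Sum>i\<in>I. fder (f i) x v)"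
  by (rule fder_eqI) (auto intro!: has_derivative_sum has_fder)

lemma fder_nth: "f differentiable (at x) \<Longrightarrow> fder (\<lambda>x. (f x :: real ^ 'm) $ i) x v = fder f x v $ i"
  by (rule fder_eqI) (rule bounded_linear.has_derivative[OF bounded_linear_vec_nth has_fder])

subsection \<open>Local diffeomorphisms\<close>

text \<open>By the inverse function theorem these are exactly the germs of diffeomorphisms fixing
  \<open>0\<close>; in finite dimension injectivity of the derivative is enough.\<close>

definition ld :: "(real ^ 'm \<Rightarrow> real ^ 'm) \<Rightarrow> bool" where
  "ld f \<longleftrightarrow> sm f \<and> f 0 = 0 \<and> inj (fder f 0)"

lemma ldD: "ld f \<Longrightarrow> sm f" "ld f \<Longrightarrow> f 0 = 0" "ld f \<Longrightarrow> inj (fder f 0)"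
  by (auto simp: ld_def)

lemma ld_compose:
  assumes "ld f" "ld g"
  shows "ld (\<lambda>x. g (f x))"
proof -
  have "fder (\<lambda>x. g (f x)) 0 v = fder g 0 (fder f 0 v)" for v
    using fder_compose[of g f 0 v] sm_differentiable_0[OF ldD(1)[OF assms(1)]]
      sm_differentiable_0[OF ldD(1)[OF assms(2)]] ldD(2)[OF assms(1)]
    by simp
  then have "fder (\<lambda>x. g (f x)) 0 = fder g 0 \<circ> fder f 0" by auto
  then show ?thesis
    using assms sm_compose[of g f] by (auto simp: ld_def intro: inj_compose)
qed

lemma Ck_on_prod:
  fixes f :: "'i \<Rightarrow> 'a::real_normed_vector \<Rightarrow> real"
  assumes "open S" "\<And>i. i \<in> I \<Longrightarrow> Ck_on k S (f i)"
  shows "Ck_on k S (\<lambda>x. \<Prod>i\<in>I. f i x)"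
  using assms(2)
proof (induction I rule: infinite_finite_induct)
  case (insert i I)
  then show ?case using Ck_on_bilinear[OF bounded_bilinear_mult assms(1), of k "f i" "\<lambda>x. \<Prod>i\<in>I. f i x"] by simp
qed (auto simp: Ck_on_const)

lemma Ck_on_det:
  assumes S: "open S" and "\<And>i j. Ck_on k S (\<lambda>x. A x $ i $ j)"
  shows "Ck_on k S (\<lambda>x. det (A x :: real ^ 'm ^ 'm))"
  unfolding det_def
  by (intro Ck_on_sum Ck_on_bilinear[OF bounded_bilinear_mult S] Ck_on_const Ck_on_prod S assms(2))

text \<open>Cramer's rule: the solution is a quotient of determinants, which are polynomials in the
  entries.\<close>

lemma Ck_on_matrix_solve:
  fixes A :: "'a::real_normed_vector \<Rightarrow> real ^ 'm ^ 'm"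
  assumes S: "open S" and A: "\<And>i j. Ck_on k S (\<lambda>x. A x $ i $ j)" "\<And>x. x \<in> S \<Longrightarrow> det (A x) \<noteq> 0"
    and B: "\<And>x. x \<in> S \<Longrightarrow> A x *v B x = v"
  shows "Ck_on k S B"
proof -
  have n: "Ck_on k S (\<lambda>x. det (\<chi> i j. if j = l then v $ i else A x $ i $ j))" for l
  proof (rule Ck_on_det[OF S])
    fix i j
    show "Ck_on k S (\<lambda>x. (\<chi> i j. if j = l then v $ i else A x $ i $ j) $ i $ j)"
      using A(1) by (cases "j = l") (simp_all add: Ck_on_const)
  qed
  have "Ck_on k S (\<lambda>x. inverse (det (A x)))"
    by (rule Ck_on_compose[OF S Ck_on_det[OF S A(1)] Ck_on_inverse]) (use A(2) in auto)
  then have "Ck_on k S (\<lambda>x. det (\<chi> i j. if j = l then v $ i else A x $ i $ j) * inverse (det (A x)))" for l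
    by (rule Ck_on_bilinear[OF bounded_bilinear_mult S n])
  then have *: "Ck_on k S (\<lambda>x. \<Sum>l\<in>UNIV. (det (\<chi> i j. if j = l then v $ i else A x $ i $ j) * inverse (det (A x))) *\<^sub>R (axis l 1 :: real ^ 'm))"
    by (intro Ck_on_sum S Ck_on_bilinear[OF bounded_bilinear_scaleR S _ Ck_on_const])
  have "(\<Sum>l\<in>UNIV. (det (\<chi> i j. if j = l then v $ i else A x $ i $ j) * inverse (det (A x))) *\<^sub>R (axis l 1 :: real ^ 'm)) = B x"
    if "x \<in> S" for x
    using cramer[OF A(2)[OF that], of "B x" v] B[OF that]
    by (simp add: vec_eq_iff axis_def if_distrib divide_inverse cong: if_cong)
  then show ?thesis by (rule Ck_on_cong[OF S _ *])
qed

text \<open>The inverse function theorem provides a differentiable inverse; its higher smoothness is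
  bootstrapped. The set \<open>V\<close> allows the domain to be shrunk to where a further
  condition, such as being symplectic, holds.\<close>

lemma ld_imp_diffeo_near_0:
  assumes f: "ld f" and V: "open V" "0 \<in> V"
  obtains U where "U \<subseteq> V" "diffeo_near_0 U f"
proof -
  obtain U0 where U0: "open U0" "0 \<in> U0" "smooth_on U0 f" using ldD(1)[OF f] by (auto simp: sm_def)
  define W where "W = U0 \<inter> V"
  have W: "open W" "0 \<in> W" "smooth_on W f" using U0 V by (auto simp: W_def intro: smooth_on_subset)
  have df: "(f has_derivative fder f x) (at x)" if "x \<in> W" for x
    using smooth_on_differentiable[OF W(3) that] by (rule has_fder)
  have bl: "bounded_linear (fder f x)" if "x \<in> W" for x
    using df[OF that] by (rule has_derivative_bounded_linear)
  define f' where "f' x = Blinfun (fder f x)" for x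
  have f': "blinfun_apply (f' x) = fder f x" if "x \<in> W" for x
    unfolding f'_def by (rule bounded_linear_Blinfun_apply[OF bl[OF that]])
  have cf': "continuous_on W f'"
    by (intro continuous_on_blinfun_componentwise)
       (rule continuous_on_eq, rule smooth_on_continuous[OF smooth_on_fder[OF W(3)]], simp add: f')
  have l0: "linear (fder f 0)" using bl[OF W(2)] by (rule bounded_linear.linear)
  obtain h where h: "linear h" "h \<circ> fder f 0 = id"
    using linear_injective_left_inverse[OF l0 ldD(3)[OF f]] by auto
  have blh: "bounded_linear h" using h(1) by (simp add: linear_conv_bounded_linear)
  have "Blinfun h o\<^sub>L f' 0 = id_blinfun"
    by (rule blinfun_eqI) (use h(2) in \<open>auto simp: f' W(2) bounded_linear_Blinfun_apply[OF blh] o_def fun_eq_iff\<close>)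
  then obtain U' V' g g' where g: "open U'" "U' \<subseteq> W" "0 \<in> U'" "open V'" "f 0 \<in> V'" "homeomorphism U' V' f g"
    "\<And>y. y \<in> V' \<Longrightarrow> (g has_derivative (g' y)) (at y)"
    "\<And>y. y \<in> V' \<Longrightarrow> g' y = inv (blinfun_apply (f'(g y)))"
    "\<And>y. y \<in> V' \<Longrightarrow> bij (blinfun_apply (f'(g y)))"
    using inverse_function_theorem[OF W(1) _ cf' W(2), of f "Blinfun h"] df f' by (metis (no_types, lifting))
  have gU: "g y \<in> U'" "g y \<in> W" "f (g y) = y" if "y \<in> V'" for y
    using g(2,6) that by (auto simp: homeomorphism_def)
  have bij: "bij (fder f (g y))" if "y \<in> V'" for y using g(9)[OF that] f' gU that by simp
  have dg: "fder f (g y) (fder g y v) = v" if "y \<in> V'" for y v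
    using fder_eqI[OF g(7)[OF that], of v] g(8)[OF that] f' gU that bij[OF that]
    by (simp add: bij_is_surj surj_f_inv_f)
  \<comment> \<open>If \<open>g\<close> is of class \<open>k\<close>, so are the entries of the
    matrix of \<open>f\<close> at \<open>g y\<close>; the derivative of \<open>g\<close> solves a
    linear system with this matrix and is of class \<open>k\<close> too.\<close>
  have sg: "Ck_on k V' g" for k
  proof (induction k)
    case 0
    then show ?case using g(6) by (simp add: homeomorphism_def)
  next
    case (Suc k)
    have "Ck_on k V' (\<lambda>y. fder g y v)" for v
    proof (rule Ck_on_matrix_solve[OF g(4), where A = "\<lambda>y. matrix (fder f (g y))" and v = v])
      fix i j
      have "Ck_on k W (\<lambda>x. fder f x (axis j 1))" using smooth_on_fder[OF W(3)] by (simp add: smooth_on_def)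
      then have "Ck_on k V' (\<lambda>y. fder f (g y) (axis j 1))"
        by (rule Ck_on_compose[OF g(4) Suc]) (use gU in auto)
      then have "Ck_on k V' (\<lambda>y. fder f (g y) (axis j 1) $ i)"
        using Ck_on_compose[OF g(4) _ Ck_on_linear[OF bounded_linear_vec_nth], of k _ UNIV i] by auto
      then show "Ck_on k V' (\<lambda>y. matrix (fder f (g y)) $ i $ j)" by (simp add: matrix_def)
    next
      fix y assume y: "y \<in> V'"
      have l: "linear (fder f (g y))" using bl gU y by (auto intro: bounded_linear.linear)
      show "det (matrix (fder f (g y))) \<noteq> 0" using bij[OF y] det_nz_iff_inj[OF l] by (simp add: bij_def)
      show "matrix (fder f (g y)) *v fder g y v = v" using dg[OF y] fun_cong[OF matrix_vector_mul(2)[OF l]] by simp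
    qed
    then show ?case using g(7) by (auto simp: differentiable_def)
  qed
  have inj: "inj_on f U'" and img: "f ` U' = V'"
    using g(6) by (auto simp: homeomorphism_def intro: inj_on_inverseI)
  have "inv_into U' f y = g y" if "y \<in> V'" for y
    using inv_into_f_eq[OF inj gU(1)[OF that] gU(3)[OF that]] .
  then have "smooth_on V' (inv_into U' f)"
    using smooth_on_cong[OF g(4), of g "inv_into U' f"] sg by (auto simp: smooth_on_def)
  then have "diffeo_near_0 U' f"
    using g inj img W(3) ldD(2)[OF f] by (auto simp: diffeo_near_0_def intro: smooth_on_subset)
  then show ?thesis using g(2) that by (auto simp: W_def)
qed

lemma diffeo_near_0_imp_ld:
  fixes f :: "real ^ 'm \<Rightarrow> real ^ 'm"
  assumes "diffeo_near_0 U f"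
  shows "ld f"
proof -
  define g where "g = inv_into U f"
  have U: "open U" "0 \<in> U" "f 0 = 0" "smooth_on U f" "inj_on f U" "open (f ` U)" "smooth_on (f ` U) g"
    using assms by (auto simp: diffeo_near_0_def g_def)
  have d: "f differentiable (at 0)" "g differentiable (at (f 0))"
    using smooth_on_differentiable U by blast+
  have "near x. g (f x) = x"
    unfolding eventually_nhds using U by (intro exI[of _ U]) (auto simp: g_def)
  from fder_cong_nhds[OF this] have "fder g (f 0) (fder f 0 v) = v" for v
    using fder_compose[OF d(2,1), of v] by simp
  then have "inj (fder f 0)" by (rule inj_on_inverseI)
  then show ?thesis using U by (auto simp: ld_def intro: smI)
qed

lemma ld_inverse:
  assumes "ld f"
  obtains g where "ld g" "near x. g (f x) = x" "near y. f (g y) = y"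
proof -
  obtain U where U: "diffeo_near_0 U f" using ld_imp_diffeo_near_0[OF assms open_UNIV UNIV_I] by blast
  define g where "g = inv_into U f"
  have U: "open U" "0 \<in> U" "f 0 = 0" "smooth_on U f" "inj_on f U" "open (f ` U)" "smooth_on (f ` U) g"
    using U by (auto simp: diffeo_near_0_def g_def)
  have f0: "0 \<in> f ` U" using U by (metis imageI)
  have gf: "near x. g (f x) = x"
    unfolding eventually_nhds using U by (intro exI[of _ U]) (auto simp: g_def)
  have fg: "near x. f (g x) = x"
    unfolding eventually_nhds using U f0 by (intro exI[of _ "f ` U"]) (auto simp: g_def f_inv_into_f)
  have g0: "g 0 = 0" using eventually_nhds_x_imp_x[OF gf] U(3) by simp
  have sg: "sm g" using smI U f0 by blast
  have "fder f 0 (fder g 0 v) = v" for v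
    using fder_cong_nhds[OF fg] fder_compose[of f g 0 v] sm_differentiable_0[OF sg]
      sm_differentiable_0[OF ldD(1)[OF assms]] g0
    by simp
  then have "inj (fder g 0)" by (rule inj_on_inverseI)
  then show ?thesis using that gf fg sg g0 by (auto simp: ld_def)
qed

text \<open>Injectivity on \<open>U\<close> turns membership in the image into membership in
  \<open>A\<close>, and images of neighbourhoods of \<open>0\<close> are neighbourhoods of
  \<open>0\<close>. From here on equivalences are statements about points near \<open>0\<close>,
  free of domains and images.\<close>

lemma germ_eq_diffeo_image:
  fixes f :: "real ^ 'm \<Rightarrow> real ^ 'm"
  assumes "diffeo_near_0 U f"
  shows "germ_eq (f ` (A \<inter> U)) B \<longleftrightarrow> (near x. x \<in> A \<longleftrightarrow> f x \<in> B)"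
proof -
  have U: "open U" "0 \<in> U" "f 0 = 0" "smooth_on U f" "inj_on f U" "open (f ` U)" "smooth_on (f ` U) (inv_into U f)"
    using assms by (auto simp: diffeo_near_0_def)
  have mem: "f x \<in> f ` (A \<inter> U) \<longleftrightarrow> x \<in> A" if "x \<in> U" for x
    using U(5) that by (auto dest: inj_onD)
  show ?thesis
  proof
    assume "germ_eq (f ` (A \<inter> U)) B"
    then have "near x. f x \<in> f ` (A \<inter> U) \<longleftrightarrow> f x \<in> B"
      unfolding germ_eq_def
      by (rule eventually_compose_germ) (use U in \<open>auto intro: smI\<close>)
    moreover have "near x. x \<in> U" using U by (auto simp: eventually_nhds)
    ultimately show "near x. x \<in> A \<longleftrightarrow> f x \<in> B"
      by eventually_elim (use mem in auto)
  next
    assume "near x. x \<in> A \<longleftrightarrow> f x \<in> B"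
    then obtain S where S: "open S" "0 \<in> S" "\<And>x. x \<in> S \<Longrightarrow> x \<in> A \<longleftrightarrow> f x \<in> B"
      by (auto simp: eventually_nhds)
    have eq: "f ` (S \<inter> U) = inv_into U f -` S \<inter> f ` U"
      using U(5) by (auto simp: f_inv_into_f)
    have "open (f ` (S \<inter> U))"
      unfolding eq using continuous_on_open_vimage[OF U(6)] smooth_on_continuous[OF U(7)] S(1) by blast
    moreover have "0 \<in> f ` (S \<inter> U)" using U S by (metis IntI image_eqI)
    moreover have "y \<in> f ` (A \<inter> U) \<longleftrightarrow> y \<in> B" if "y \<in> f ` (S \<inter> U)" for y
      using that mem S(3) by auto
    ultimately show "germ_eq (f ` (A \<inter> U)) B"
      unfolding germ_eq_def eventually_nhds by blast
  qed
qed

lemma germ_diffeomorphic_iff: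
  fixes N M :: "(real ^ 'm) set"
  shows "germ_diffeomorphic N M \<longleftrightarrow> (\<exists>f. ld f \<and> (near x. x \<in> N \<longleftrightarrow> f x \<in> M))"
proof
  assume "germ_diffeomorphic N M"
  then obtain U f where f: "diffeo_near_0 U f" "germ_eq (f ` (N \<inter> U)) M"
    by (auto simp: germ_diffeomorphic_def)
  then show "\<exists>f. ld f \<and> (near x. x \<in> N \<longleftrightarrow> f x \<in> M)"
    using germ_eq_diffeo_image[OF f(1)] diffeo_near_0_imp_ld[OF f(1)] by blast
next
  assume "\<exists>f. ld f \<and> (near x. x \<in> N \<longleftrightarrow> f x \<in> M)"
  then obtain f where f: "ld f" "near x. x \<in> N \<longleftrightarrow> f x \<in> M" by blast
  obtain U where "diffeo_near_0 U f" using ld_imp_diffeo_near_0[OF f(1) open_UNIV UNIV_I] by blast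
  then show "germ_diffeomorphic N M"
    unfolding germ_diffeomorphic_def using germ_eq_diffeo_image f(2) by blast
qed

definition sympl :: "(nat \<Rightarrow> 'm::finite) \<Rightarrow> nat \<Rightarrow> (real ^ 'm \<Rightarrow> real ^ 'm) \<Rightarrow> bool" where
  "sympl e n f \<longleftrightarrow> ld f \<and>
     (near x. \<forall>v w. symp_form e n (fder f x v) (fder f x w) = symp_form e n v w)"

lemma symp_equiv_iff:
  "symp_equiv e n N M \<longleftrightarrow> (\<exists>f. sympl e n f \<and> (near x. x \<in> N \<longleftrightarrow> f x \<in> M))"
proof
  assume "symp_equiv e n N M"
  then obtain U f where U: "symplectomorphism_near_0 e n U f" "germ_eq (f ` (N \<inter> U)) M"
    by (auto simp: symp_equiv_def)
  then have d: "diffeo_near_0 U f" by (simp add: symplectomorphism_near_0_def)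
  have "near x. x \<in> U" using d by (auto simp: eventually_nhds diffeo_near_0_def)
  then have "near x. \<forall>v w. symp_form e n (fder f x v) (fder f x w) = symp_form e n v w"
    by eventually_elim (use U in \<open>auto simp: symplectomorphism_near_0_def\<close>)
  then show "\<exists>f. sympl e n f \<and> (near x. x \<in> N \<longleftrightarrow> f x \<in> M)"
    using U(2) germ_eq_diffeo_image[OF d] diffeo_near_0_imp_ld[OF d] by (auto simp: sympl_def)
next
  assume "\<exists>f. sympl e n f \<and> (near x. x \<in> N \<longleftrightarrow> f x \<in> M)"
  then obtain f where f: "ld f" "near x. x \<in> N \<longleftrightarrow> f x \<in> M"
    "near x. \<forall>v w. symp_form e n (fder f x v) (fder f x w) = symp_form e n v w"
    unfolding sympl_def by blast
  obtain V where V: "open V" "0 \<in> V"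
    "\<And>x. x \<in> V \<Longrightarrow> \<forall>v w. symp_form e n (fder f x v) (fder f x w) = symp_form e n v w"
    using f(3) unfolding eventually_nhds by blast
  obtain U where U: "U \<subseteq> V" "diffeo_near_0 U f" using ld_imp_diffeo_near_0[OF f(1) V(1,2)] by blast
  then have "symplectomorphism_near_0 e n U f" using V by (auto simp: symplectomorphism_near_0_def)
  then show "symp_equiv e n N M"
    using germ_eq_diffeo_image[OF U(2)] f(2) by (auto simp: symp_equiv_def)
qed

subsection \<open>Parameter integrals\<close>

lemma smooth_on_mult:
  fixes f g :: "'a::real_normed_vector \<Rightarrow> real"
  shows "open S \<Longrightarrow> smooth_on S f \<Longrightarrow> smooth_on S g \<Longrightarrow> smooth_on S (\<lambda>x. f x * g x)"
  by (rule smooth_on_bilinear[OF bounded_bilinear_mult])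

lemma smooth_on_scaleR:
  "open S \<Longrightarrow> smooth_on S f \<Longrightarrow> smooth_on S g \<Longrightarrow> smooth_on S (\<lambda>x. f x *\<^sub>R g x)"
  by (rule smooth_on_bilinear[OF bounded_bilinear_scaleR])

lemma smooth_on_power:
  fixes f :: "'a::real_normed_vector \<Rightarrow> real"
  shows "open S \<Longrightarrow> smooth_on S f \<Longrightarrow> smooth_on S (\<lambda>x. f x ^ k)"
  by (induction k) (auto intro: smooth_on_const smooth_on_mult)

text \<open>Common source of \<open>schwarz_0\<close>, \<open>hadamard\<close>,
  \<open>poincare\<close> and \<open>euler_solve\<close>. The paths \<open>c s x\<close> are linear
  in \<open>x\<close>, so by the tube lemma they stay in the domain of \<open>F\<close> for all
  \<open>s\<close> at once.\<close>

lemma param_integral: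
  fixes F :: "'a::euclidean_space \<Rightarrow> real" and c :: "real \<Rightarrow> 'b::euclidean_space \<Rightarrow> 'a"
  assumes F: "sm F" and c: "smooth_on UNIV (\<lambda>p. c (snd p) (fst p))"
    and lin: "\<And>s. bounded_linear (c s)" and k: "smooth_on UNIV k"
    and I: "\<And>x. I x = integral {0..1} (\<lambda>s. k s * F (c s x))"
  shows "\<exists>V U. open V \<and> smooth_on V F \<and> open U \<and> 0 \<in> U \<and> (\<forall>x\<in>U. \<forall>s\<in>{0..1}. c s x \<in> V) \<and> smooth_on U I \<and>
    (\<forall>x\<in>U. \<forall>v. fder I x v = integral {0..1} (\<lambda>s. k s * fder F (c s x) (c s v)))"
proof -
  obtain V where V: "open V" "0 \<in> V" "smooth_on V F" using F by (auto simp: sm_def)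
  define C where "C p = c (snd p) (fst p)" for p
  have sC: "smooth_on UNIV C" using c by (simp add: C_def[abs_def])
  define W where "W = C -` V"
  have oW: "open W"
    unfolding W_def using continuous_on_open_vimage[OF open_UNIV] smooth_on_continuous[OF sC] V(1) by auto
  have "{0} \<times> {0..1} \<subseteq> W"
    using V(2) linear_0[OF bounded_linear.linear[OF lin]] by (auto simp: W_def C_def)
  then obtain U where U: "0 \<in> U" "open U" "U \<times> {0..1} \<subseteq> W"
    using Elementary_Topology.tube_lemma[OF compact_Icc oW, of 0 0 1] by auto
  define G where "G p = k (snd p) * F (C p)" for p
  have sk: "smooth_on W (\<lambda>p. k (snd p))"
    by (rule smooth_on_compose[OF oW _ k]) (auto intro: smooth_on_linear bounded_linear_snd)
  have sF: "smooth_on W (\<lambda>p. F (C p))"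
    by (rule smooth_on_compose[OF oW _ V(3)]) (auto intro: smooth_on_subset[OF sC] simp: W_def)
  have sG: "smooth_on W G"
    unfolding G_def by (rule smooth_on_mult[OF oW sk sF])
  have Gd: "fder G (x, s) (v, 0) = k s * fder F (c s x) (c s v)" if "(x, s) \<in> W" for x s v
  proof -
    have "((\<lambda>y. G (y, s)) has_derivative (\<lambda>v. fder G (x, s) (v, 0))) (at x)"
    proof -
      have "((\<lambda>y. (y, s)) has_derivative (\<lambda>v. (v, 0))) (at x)"
        by (auto intro!: derivative_eq_intros)
      moreover have "(G has_derivative fder G (x, s)) (at (x, s))"
        by (rule has_fder) (rule smooth_on_differentiable[OF sG that])
      ultimately show ?thesis
        using diff_chain_at[of "\<lambda>y. (y, s)" "\<lambda>v. (v, 0)" x G "fder G (x, s)"] by (simp add: o_def)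
    qed
    moreover have "((\<lambda>y. G (y, s)) has_derivative (\<lambda>v. k s * fder F (c s x) (c s v))) (at x)"
    proof -
      have "((\<lambda>y. F (c s y)) has_derivative (\<lambda>v. fder F (c s x) (c s v))) (at x)"
        using diff_chain_at[OF bounded_linear_imp_has_derivative[OF lin] has_fder, of F s x]
          smooth_on_differentiable[OF V(3)] that by (auto simp: o_def W_def C_def)
      then show ?thesis by (auto simp: G_def C_def intro!: has_derivative_mult_right)
    qed
    ultimately show ?thesis by (metis has_derivative_unique)
  qed
  have I': "I = (\<lambda>x. integral {0..1} (\<lambda>s. G (x, s)))" by (auto simp: I G_def C_def)
  have "c s x \<in> V" if "x \<in> U" "s \<in> {0..1}" for x s
  proof -
    have "(x, s) \<in> W" using that U(3) by blast
    then show ?thesis by (simp add: W_def C_def)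
  qed
  moreover have "smooth_on U I"
    unfolding I' by (rule smooth_on_integral(1)[OF oW U(2,3) sG])
  moreover have "fder I x v = integral {0..1} (\<lambda>s. k s * fder F (c s x) (c s v))" if x: "x \<in> U" for x v
  proof -
    have "fder I x v = integral {0..1} (\<lambda>s. fder G (x, s) (v, 0))"
      unfolding I' by (rule fder_eqI[OF smooth_on_integral(2)[OF oW U(2,3) sG x]])
    also have "\<dots> = integral {0..1} (\<lambda>s. k s * fder F (c s x) (c s v))"
      by (rule integral_cong) (use Gd U(3) x in blast)
    finally show ?thesis .
  qed
  ultimately show ?thesis using V(1,3) U(1,2) by blast
qed

lemma ftc01:
  fixes f :: "real \<Rightarrow> real"
  assumes "\<And>s. s \<in> {0..1} \<Longrightarrow> (f has_real_derivative f' s) (at s)"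
  shows "integral {0..1} f' = f 1 - f 0"
  by (rule integral_unique, rule fundamental_theorem_of_calculus)
     (use assms in \<open>auto simp: has_real_derivative_iff_has_vector_derivative[symmetric] intro: has_field_derivative_at_within\<close>)

lemma has_real_derivative_along:
  assumes "(F has_derivative F') (at (c s))" "(c has_vector_derivative c') (at s)"
  shows "((\<lambda>s. F (c s)) has_real_derivative F' c') (at s)"
proof -
  have "((\<lambda>s. F (c s)) has_derivative (\<lambda>t. F' (t *\<^sub>R c'))) (at s)"
    using diff_chain_at[OF assms(2)[unfolded has_vector_derivative_def] assms(1)] by (simp add: o_def)
  moreover have "F' (t *\<^sub>R c') = F' c' * t" for t
    using linear_scale[OF has_derivative_linear[OF assms(1)]] by simp
  ultimately show ?thesis by (simp add: has_field_derivative_def)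
qed

lemma continuous_on_along:
  fixes F :: "'a::euclidean_space \<Rightarrow> real"
  assumes "smooth_on V F" "\<And>s. s \<in> {0..1} \<Longrightarrow> c s \<in> V" "continuous_on {0..1} c"
  shows "continuous_on {0..1} (\<lambda>s. F (c s))"
  by (rule continuous_on_compose2[OF smooth_on_continuous[OF assms(1)] assms(3)]) (use assms(2) in auto)

text \<open>Write \<open>f (y + e w) - f y\<close> as \<open>e * I (y, e)\<close> with
  \<open>I\<close> smooth. Differentiating in \<open>y\<close> along \<open>v\<close> and dividing
  by \<open>e\<close>, the left side tends to one mixed derivative as \<open>e\<close> tends to
  \<open>0\<close>; the right side tends to the derivative of \<open>I\<close> at
  \<open>e = 0\<close>, an integral with constant integrand equal to the other mixed
  derivative.\<close>

lemma schwarz_0: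
  fixes f :: "'a::euclidean_space \<Rightarrow> real"
  assumes f: "sm f"
  shows "fder (\<lambda>x. fder f x v) 0 w = fder (\<lambda>x. fder f x w) 0 v"
proof -
  define F where "F x = fder f x w" for x
  have F: "sm F" unfolding F_def[abs_def] by (rule sm_fder[OF f])
  define c where "c s p = fst p + (s * snd p) *\<^sub>R w" for s :: real and p :: "'a \<times> real"
  have c1: "smooth_on UNIV (\<lambda>p. c (snd p) (fst p))"
    unfolding c_def
    by (intro smooth_on_add smooth_on_scaleR smooth_on_mult smooth_on_const open_UNIV smooth_on_linear
        bounded_linear_fst bounded_linear_snd bounded_linear_compose[OF bounded_linear_fst bounded_linear_fst]
        bounded_linear_compose[OF bounded_linear_snd bounded_linear_fst])
  have c2: "bounded_linear (c s)" for s
    unfolding c_def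
    by (intro bounded_linear_add bounded_linear_fst bounded_linear_scaleR_left
      bounded_linear_compose[OF bounded_linear_scaleR_left] bounded_linear_compose[OF bounded_linear_mult_right bounded_linear_snd])
  define I where "I p = integral {0..1} (\<lambda>s. 1 * F (c s p))" for p
  obtain V U where U: "open V" "smooth_on V F" "open U" "0 \<in> U" "\<And>x s. x \<in> U \<Longrightarrow> s \<in> {0..1} \<Longrightarrow> c s x \<in> V"
    "smooth_on U I" "\<And>x v. x \<in> U \<Longrightarrow> fder I x v = integral {0..1} (\<lambda>s. 1 * fder F (c s x) (c s v))"
    using param_integral[OF F c1 c2 smooth_on_const I_def] by blast
  obtain V1 where V1: "open V1" "0 \<in> V1" "smooth_on V1 f" using f by (auto simp: sm_def)
  have sI: "sm I" using U by (auto intro: smI)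
  have "{0} \<times> {0..1} \<subseteq> (\<lambda>p. c (snd p) (fst p)) -` V1" using V1(2) by (auto simp: c_def)
  moreover have "open ((\<lambda>p. c (snd p) (fst p)) -` V1)"
    using continuous_on_open_vimage[OF open_UNIV] smooth_on_continuous[OF c1] V1(1) by auto
  ultimately obtain U1 where U1: "0 \<in> U1" "open U1" "U1 \<times> {0..1} \<subseteq> (\<lambda>p. c (snd p) (fst p)) -` V1"
    using Elementary_Topology.tube_lemma[OF compact_Icc, of "(\<lambda>p. c (snd p) (fst p)) -` V1" 0 0 1] by auto
  have eq: "f (y + e *\<^sub>R w) - f y = e * I (y, e)" if "(y, e) \<in> U \<inter> U1" for y e
  proof -
    have "((\<lambda>s. f (c s (y, e))) has_real_derivative fder f (c s (y, e)) (e *\<^sub>R w)) (at s)" if "s \<in> {0..1}" for s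
    proof (rule has_real_derivative_along[of f "fder f (c s (y, e))" "\<lambda>s. c s (y, e)" s "e *\<^sub>R w"])
      show "(f has_derivative fder f (c s (y, e))) (at (c s (y, e)))"
      proof -
        have "((y, e), s) \<in> (\<lambda>p. c (snd p) (fst p)) -` V1" using U1(3) \<open>(y, e) \<in> U \<inter> U1\<close> that by blast
        then show ?thesis using has_fder smooth_on_differentiable[OF V1(3)] by auto
      qed
      show "((\<lambda>s. c s (y, e)) has_vector_derivative e *\<^sub>R w) (at s)"
        unfolding c_def by (auto intro!: derivative_eq_intros)
    qed
    from ftc01[OF this] have "integral {0..1} (\<lambda>s. fder f (c s (y, e)) (e *\<^sub>R w)) = f (y + e *\<^sub>R w) - f y"
      by (simp add: c_def)
    moreover have "integral {0..1} (\<lambda>s. fder f (c s (y, e)) (e *\<^sub>R w)) = integral {0..1} (\<lambda>s. e * F (c s (y, e)))"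
    proof (rule integral_cong)
      fix s :: real assume s: "s \<in> {0..1}"
      have "linear (fder f (c s (y, e)))"
      proof -
        have "((y, e), s) \<in> (\<lambda>p. c (snd p) (fst p)) -` V1" using U1(3) that s by blast
        then show ?thesis using linear_fder smooth_on_differentiable[OF V1(3)] by auto
      qed
      then show "fder f (c s (y, e)) (e *\<^sub>R w) = e * F (c s (y, e))" by (simp add: F_def linear_scale)
    qed
    ultimately show ?thesis by (simp add: I_def)
  qed
  define K where "K e = fder I (0, e) (v, 0)" for e :: real
  have sK: "sm K"
    unfolding K_def
    by (rule sm_compose[OF sm_fder[OF sI, of "(v, 0)"]])
       (auto simp: zero_prod_def intro!: sm_linear bounded_linear_Pair bounded_linear_zero bounded_linear_ident)
  have evU: "near e. (0, e) \<in> U \<inter> U1"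
  proof -
    have "continuous (at 0) (\<lambda>e::real. (0::'a, e))" by (auto intro!: continuous_intros)
    then have "filterlim (\<lambda>e::real. (0::'a, e)) (nhds (0, 0)) (nhds 0)"
      by (subst tendsto_at_iff_tendsto_nhds[symmetric]) (simp add: continuous_at)
    moreover have "\<forall>\<^sub>F p in nhds (0, 0). p \<in> U \<inter> U1"
      using U U1 eventually_nhds_in_open[of "U \<inter> U1" "(0, 0)"] by (auto simp: zero_prod_def)
    ultimately show ?thesis unfolding filterlim_iff by blast
  qed
  have diff: "fder f (e *\<^sub>R w) v - fder f 0 v = e * K e" if e: "(0, e) \<in> U \<inter> U1" for e
  proof -
    have fd: "f differentiable at (e *\<^sub>R w)" "f differentiable at 0"
    proof -
      have "((0, e), 1) \<in> (\<lambda>p. c (snd p) (fst p)) -` V1" "((0, e), 0) \<in> (\<lambda>p. c (snd p) (fst p)) -` V1"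
        by (rule subsetD[OF U1(3)], use e in simp)+
      then have "c 1 (0, e) \<in> V1" "c 0 (0, e) \<in> V1" by auto
      then show "f differentiable at (e *\<^sub>R w)" "f differentiable at 0"
        using smooth_on_differentiable[OF V1(3)] by (auto simp: c_def)
    qed
    have "((\<lambda>y. y + e *\<^sub>R w) has_derivative (\<lambda>y. y)) (at 0)" by (auto intro!: derivative_eq_intros)
    then have "((\<lambda>y. f (y + e *\<^sub>R w)) has_derivative fder f (e *\<^sub>R w)) (at 0)"
      using diff_chain_at[of "\<lambda>y. y + e *\<^sub>R w" "\<lambda>y. y" 0 f "fder f (e *\<^sub>R w)"] has_fder[OF fd(1)]
      by (simp add: o_def)
    then have d1: "((\<lambda>y. f (y + e *\<^sub>R w) - f y) has_derivative (\<lambda>v. fder f (e *\<^sub>R w) v - fder f 0 v)) (at 0)"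
      by (intro has_derivative_diff has_fder[OF fd(2)])
    have Id: "(I has_derivative fder I (0, e)) (at (0, e))"
      by (rule has_fder) (use smooth_on_differentiable[OF U(6)] e in auto)
    have "((\<lambda>y::'a. (y, e)) has_derivative (\<lambda>v. (v, 0))) (at 0)" by (auto intro!: derivative_eq_intros)
    then have "((\<lambda>y. I (y, e)) has_derivative (\<lambda>v. fder I (0, e) (v, 0))) (at 0)"
      using diff_chain_at[of "\<lambda>y. (y, e)" "\<lambda>v. (v, 0)" 0 I "fder I (0, e)"] Id
      by (simp add: o_def)
    then have d2: "((\<lambda>y. e * I (y, e)) has_derivative (\<lambda>v. e * fder I (0, e) (v, 0))) (at 0)"
      by (rule has_derivative_mult_right)
    have "near y. (y, e) \<in> U \<inter> U1"
    proof -
      have "continuous (at 0) (\<lambda>y::'a. (y, e))" by (auto intro!: continuous_intros)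
      then have "filterlim (\<lambda>y::'a. (y, e)) (nhds (0, e)) (nhds 0)"
        by (subst tendsto_at_iff_tendsto_nhds[symmetric]) (simp add: continuous_at)
      moreover have "\<forall>\<^sub>F p in nhds (0, e). p \<in> U \<inter> U1"
        using U U1 e eventually_nhds_in_open[of "U \<inter> U1" "(0, e)"] by auto
      ultimately show ?thesis unfolding filterlim_iff by blast
    qed
    then have "near y. f (y + e *\<^sub>R w) - f y = e * I (y, e)"
      by eventually_elim (rule eq)
    from has_derivative_unique[OF has_derivative_cong_nhds[OF d1 this] d2] show ?thesis
      unfolding K_def by metis
  qed
  have "((\<lambda>e. e *\<^sub>R w) has_vector_derivative w) (at 0)" by (auto intro!: derivative_eq_intros)
  then have "((\<lambda>e. fder f (e *\<^sub>R w) v) has_real_derivative fder (\<lambda>x. fder f x v) 0 w) (at 0)"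
    using has_real_derivative_along[of "\<lambda>x. fder f x v" "fder (\<lambda>x. fder f x v) 0" "\<lambda>e. e *\<^sub>R w" 0 w]
      sm_has_fder_0[OF sm_fder[OF f]] by simp
  then have "((\<lambda>e. (fder f (e *\<^sub>R w) v - fder f 0 v) / e) \<longlongrightarrow> fder (\<lambda>x. fder f x v) 0 w) (at 0)"
    by (simp add: has_field_derivative_iff)
  moreover have "\<forall>\<^sub>F e in at 0. (fder f (e *\<^sub>R w) v - fder f 0 v) / e = K e"
    using evU unfolding eventually_at_filter
  proof eventually_elim
    case (elim e)
    show ?case unfolding diff[OF elim] by simp
  qed
  ultimately have "(K \<longlongrightarrow> fder (\<lambda>x. fder f x v) 0 w) (at 0)"
    by (rule Lim_transform_eventually)
  moreover have "(K \<longlongrightarrow> K 0) (at 0)" using sm_isCont[OF sK] by (simp add: isCont_def)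
  ultimately have "fder (\<lambda>x. fder f x v) 0 w = K 0" using LIM_unique by blast
  also have "K 0 = integral {0..1::real} (\<lambda>s. fder F 0 v)"
    using U(7)[of "(0, 0)" "(v, 0)"] U(4) by (simp add: K_def c_def zero_prod_def)
  finally show ?thesis by (simp add: F_def[abs_def])
qed

lemma schwarz:
  fixes f :: "'a::euclidean_space \<Rightarrow> real"
  assumes "smooth_on U f" "open U" "p \<in> U"
  shows "fder (\<lambda>x. fder f x v) p w = fder (\<lambda>x. fder f x w) p v"
proof -
  have shift: "fder (\<lambda>x. g (p + x)) y v = fder g (p + y) v" if "g differentiable (at (p + y))"
    for g :: "'a \<Rightarrow> real" and y v
  proof -
    have d: "((\<lambda>x. p + x) has_derivative (\<lambda>v. v)) (at y)" by (auto intro!: derivative_eq_intros)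
    show ?thesis
      using fder_compose[of g "\<lambda>x. p + x" y v] that fder_eqI[OF d] d by (auto simp: differentiable_def)
  qed
  have o: "open ((+) p -` U)" by (rule open_vimage[OF assms(2)]) (intro continuous_intros)
  have sg: "sm (\<lambda>x. f (p + x))"
  proof (rule smI[OF o])
    show "smooth_on ((+) p -` U) (\<lambda>x. f (p + x))"
      by (rule smooth_on_compose[OF o smooth_on_add[OF o smooth_on_const smooth_on_linear[OF bounded_linear_ident]] assms(1)]) auto
  qed (use assms in auto)
  have "fder (\<lambda>x. fder (\<lambda>x. f (p + x)) x v) 0 w = fder (\<lambda>x. fder f x v) p w" for v w
  proof -
    have "near x. p + x \<in> U"
      using o assms(3) unfolding eventually_nhds by (intro exI[of _ "(+) p -` U"]) auto
    then have "near x. fder (\<lambda>x. f (p + x)) x v = fder f (p + x) v"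
      by eventually_elim (rule shift, rule smooth_on_differentiable[OF assms(1)])
    from fder_cong_nhds[OF this] show ?thesis
      using shift[of "\<lambda>x. fder f x v" 0] smooth_on_differentiable[OF smooth_on_fder[OF assms(1)] assms(3)] by simp
  qed
  then show ?thesis using schwarz_0[OF sg] by metis
qed

lemma sm_schwarz:
  fixes f :: "'a::euclidean_space \<Rightarrow> real"
  assumes "sm f"
  shows "near p. \<forall>v w. fder (\<lambda>x. fder f x v) p w = fder (\<lambda>x. fder f x w) p v"
  using assms schwarz unfolding sm_def eventually_nhds by metis

text \<open>Integrate the derivative along the segment from \<open>P x\<close> to \<open>x\<close>.
  With \<open>P = 0\<close> this is the usual lemma; with the projection to an axis it separates the
  values on a line of the curve from terms divisible by the other coordinates.\<close>

lemma hadamard: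
  fixes F :: "real ^ 'm \<Rightarrow> real"
  assumes F: "sm F" and P: "bounded_linear P"
  obtains H where "\<And>j. sm (H j)" "near x. F x = F (P x) + (\<Sum>j\<in>UNIV. (x - P x) $ j * H j x)"
proof -
  define c where "c s x = P x + s *\<^sub>R (x - P x)" for s x
  have P2: "bounded_linear (\<lambda>p::(real ^ 'm) \<times> real. P (fst p))"
    by (rule bounded_linear_compose[OF P bounded_linear_fst])
  have c1: "smooth_on UNIV (\<lambda>p. c (snd p) (fst p))"
    unfolding c_def
    by (intro smooth_on_add smooth_on_scaleR open_UNIV smooth_on_linear bounded_linear_sub P2
        bounded_linear_fst bounded_linear_snd)
  have c2: "bounded_linear (c s)" for s
    unfolding c_def
    by (intro bounded_linear_add bounded_linear_sub bounded_linear_ident P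
      bounded_linear_compose[OF bounded_linear_scaleR_right])
  define H where "H j x = integral {0..1} (\<lambda>s. 1 * fder F (c s x) (axis j 1))" for j x
  have sH: "sm (H j)" for j
    using param_integral[where I = "H j", OF sm_fder[OF F, of "axis j 1"] c1 c2 smooth_on_const[of UNIV 1] H_def[of j]] smI by blast
  obtain V U where U: "open V" "smooth_on V F" "open U" "0 \<in> U" "\<And>x s. x \<in> U \<Longrightarrow> s \<in> {0..1} \<Longrightarrow> c s x \<in> V"
    using param_integral[where I = "\<lambda>x. integral {0..1} (\<lambda>s. 1 * F (c s x))", OF F c1 c2 smooth_on_const[of UNIV 1] refl]
    by blast
  have eq: "F x = F (P x) + (\<Sum>j\<in>UNIV. (x - P x) $ j * H j x)" if x: "x \<in> U" for x
  proof -
    have cd: "((\<lambda>s. c s x) has_vector_derivative (x - P x)) (at s)" for s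
      unfolding c_def by (auto intro!: derivative_eq_intros)
    have cc: "continuous_on {0..1} (\<lambda>s. c s x)" unfolding c_def by (auto intro!: continuous_intros)
    have "((\<lambda>s. F (c s x)) has_real_derivative fder F (c s x) (x - P x)) (at s)" if "s \<in> {0..1}" for s
      using has_real_derivative_along[OF has_fder cd] smooth_on_differentiable[OF U(2)] U(5)[OF x that] by blast
    from ftc01[OF this] have 1: "integral {0..1} (\<lambda>s. fder F (c s x) (x - P x)) = F x - F (P x)"
      by (simp add: c_def)
    have "integral {0..1} (\<lambda>s. fder F (c s x) (x - P x)) =
        integral {0..1} (\<lambda>s. \<Sum>j\<in>UNIV. (x - P x) $ j * fder F (c s x) (axis j 1))"
    proof (rule integral_cong)
      fix s :: real assume s: "s \<in> {0..1}"
      have l: "linear (fder F (c s x))"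
        by (rule linear_fder, rule smooth_on_differentiable[OF U(2)], rule U(5)[OF x s])
      have "fder F (c s x) (x - P x) = fder F (c s x) (\<Sum>j\<in>UNIV. (x - P x) $ j *\<^sub>R axis j 1)"
        by (subst basis_expansion[of "x - P x", symmetric]) (simp only: scalar_mult_eq_scaleR)
      also have "\<dots> = (\<Sum>j\<in>UNIV. (x - P x) $ j * fder F (c s x) (axis j 1))"
        by (simp add: linear_sum[OF l] linear_scale[OF l])
      finally show "fder F (c s x) (x - P x) = (\<Sum>j\<in>UNIV. (x - P x) $ j * fder F (c s x) (axis j 1))" .
    qed
    also have "\<dots> = (\<Sum>j\<in>UNIV. integral {0..1} (\<lambda>s. (x - P x) $ j * fder F (c s x) (axis j 1)))"
      by (rule integral_sum)
         (auto intro!: integrable_continuous_interval continuous_on_mult continuous_on_const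
           continuous_on_along[OF smooth_on_fder[OF U(2)] _ cc] U(5)[OF x])
    also have "\<dots> = (\<Sum>j\<in>UNIV. (x - P x) $ j * H j x)"
      by (simp add: H_def)
    finally show ?thesis using 1 by simp
  qed
  have "near x. F x = F (P x) + (\<Sum>j\<in>UNIV. (x - P x) $ j * H j x)"
    unfolding eventually_nhds using U(3,4) eq by blast
  then show ?thesis using that sH by blast
qed

text \<open>The radial primitive: \<open>S x\<close> is the integral of \<open>b (s x) x\<close>.
  Closedness turns the integrand of its derivative along \<open>v\<close> into the derivative of
  \<open>s * b (s x) v\<close> in \<open>s\<close>.\<close>

lemma poincare:
  fixes b :: "real ^ 'm \<Rightarrow> real ^ 'm \<Rightarrow> real"
  assumes b: "\<And>v. sm (\<lambda>x. b x v)" and lin: "near x. linear (b x)"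
    and cl: "near x. \<forall>v w. fder (\<lambda>x. b x v) x w = fder (\<lambda>x. b x w) x v"
  obtains S where "sm S" "near x. \<forall>v. fder S x v = b x v"
proof -
  define c where "c s x = s *\<^sub>R x" for s and x :: "real ^ 'm"
  have c1: "smooth_on UNIV (\<lambda>p. c (snd p) (fst p))"
    unfolding c_def
    by (intro smooth_on_scaleR open_UNIV smooth_on_linear bounded_linear_fst bounded_linear_snd)
  have c2: "bounded_linear (c s)" for s
    unfolding c_def by (rule bounded_linear_scaleR_right)
  define I where "I j x = integral {0..1} (\<lambda>s. 1 * b (c s x) (axis j 1))" for j x
  define Q where "Q j V U \<longleftrightarrow> open V \<and> smooth_on V (\<lambda>x. b x (axis j 1)) \<and> open U \<and> 0 \<in> U \<and>
      (\<forall>x\<in>U. \<forall>s\<in>{0..1}. c s x \<in> V) \<and> smooth_on U (I j) \<and>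
      (\<forall>x\<in>U. \<forall>v. fder (I j) x v = integral {0..1} (\<lambda>s. 1 * fder (\<lambda>x. b x (axis j 1)) (c s x) (c s v)))" for j V U
  have "\<exists>V U. Q j V U" for j
    unfolding Q_def
    by (rule param_integral[where I = "I j", OF b[of "axis j 1"] c1 c2 smooth_on_const[of UNIV 1] I_def[of j]])
  then obtain V U where Q: "\<And>j. Q j (V j) (U j)" by metis
  have U: "\<And>j. open (V j)" "\<And>j. smooth_on (V j) (\<lambda>x. b x (axis j 1))" "\<And>j. open (U j)"
    "\<And>j. 0 \<in> U j" "\<And>j x s. x \<in> U j \<Longrightarrow> s \<in> {0..1} \<Longrightarrow> c s x \<in> V j" "\<And>j. smooth_on (U j) (I j)"
    "\<And>j x v. x \<in> U j \<Longrightarrow> fder (I j) x v = integral {0..1} (\<lambda>s. 1 * fder (\<lambda>x. b x (axis j 1)) (c s x) (c s v))"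
    using Q unfolding Q_def by blast+
  obtain W where W: "open W" "0 \<in> W" "\<And>x. x \<in> W \<Longrightarrow> linear (b x)"
    "\<And>x v w. x \<in> W \<Longrightarrow> fder (\<lambda>x. b x v) x w = fder (\<lambda>x. b x w) x v"
    using eventually_conj[OF lin cl] unfolding eventually_nhds by blast
  have "open (\<Inter>j. U j)" "open (\<Inter>j. V j)" using U(1,3) by (auto intro!: open_INT)
  then have "open (W \<inter> (\<Inter>j. U j) \<inter> (\<Inter>j. V j))" "0 \<in> W \<inter> (\<Inter>j. U j) \<inter> (\<Inter>j. V j)"
    using W(1,2) U(4) U(5)[OF U(4), of 0] by (auto simp: c_def)
  then obtain r where r: "r > 0" "ball 0 r \<subseteq> W \<inter> (\<Inter>j. U j) \<inter> (\<Inter>j. V j)"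
    by (meson openE)
  define S where "S x = (\<Sum>j\<in>UNIV. x $ j * I j x)" for x
  have sI: "sm (I j)" for j by (rule smI[OF U(3,4,6)])
  have bsum: "b x y = (\<Sum>j\<in>UNIV. y $ j * b x (axis j 1))" if "x \<in> W" for x y
  proof -
    have "b x y = b x (\<Sum>j\<in>UNIV. y $ j *\<^sub>R axis j 1)"
      by (simp add: basis_expansion scalar_mult_eq_scaleR[symmetric])
    then show ?thesis by (simp add: linear_sum[OF W(3)[OF that]] linear_scale[OF W(3)[OF that]])
  qed
  have bj: "(\<lambda>x. b x (axis j 1)) differentiable (at x)" if "x \<in> ball 0 r" for x j
    using smooth_on_differentiable[OF U(2)] r(2) that by blast
  have hd: "((\<lambda>x. b x y) has_derivative (\<lambda>w. \<Sum>j\<in>UNIV. y $ j * fder (\<lambda>x. b x (axis j 1)) x w)) (at x)"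
    if "x \<in> ball 0 r" for x y
  proof (rule has_derivative_cong_nhds)
    show "((\<lambda>x. \<Sum>j\<in>UNIV. y $ j * b x (axis j 1)) has_derivative
        (\<lambda>w. \<Sum>j\<in>UNIV. y $ j * fder (\<lambda>x. b x (axis j 1)) x w)) (at x)"
      by (intro has_derivative_sum has_derivative_mult_right has_fder bj that)
    have "\<forall>\<^sub>F x in nhds x. x \<in> W" using eventually_nhds_in_open[OF W(1)] r(2) that by blast
    then show "\<forall>\<^sub>F x in nhds x. (\<Sum>j\<in>UNIV. y $ j * b x (axis j 1)) = b x y"
      by eventually_elim (simp add: bsum[symmetric])
  qed
  have "fder S x v = b x v" if x: "x \<in> ball 0 r" for x v
  proof -
    have sx: "s *\<^sub>R x \<in> ball 0 r" if "s \<in> {0..1}" for s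
      using x that mult_left_le_one_le[of "norm x" s] by auto
    have xU: "x \<in> U j" for j using r(2) x by auto
    have Id: "I j differentiable (at x)" for j using smooth_on_differentiable[OF U(6) xU] .
    have cont: "continuous_on {0..1} (\<lambda>s. fder (\<lambda>x. b x (axis j 1)) (s *\<^sub>R x) v)"
      "continuous_on {0..1} (\<lambda>s. b (s *\<^sub>R x) (axis j 1))" for j v
      by (rule continuous_on_along[OF smooth_on_fder[OF U(2)]] continuous_on_along[OF U(2)],
          use U(5)[OF xU] in \<open>auto simp: c_def intro!: continuous_intros\<close>)+
    have lf: "linear (fder (\<lambda>x. b x y) (s *\<^sub>R x))" if "s \<in> {0..1}" for s y
      by (rule has_derivative_linear[OF has_fder]) (use hd[OF sx[OF that]] differentiable_def in blast)
    have "(S has_derivative (\<lambda>v. \<Sum>j\<in>UNIV. x $ j * fder (I j) x v + v $ j * I j x)) (at x)"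
      unfolding S_def
      by (intro has_derivative_sum has_derivative_mult has_fder Id bounded_linear_imp_has_derivative bounded_linear_vec_nth)
    then have "fder S x v = (\<Sum>j\<in>UNIV. x $ j * fder (I j) x v + v $ j * I j x)"
      by (rule fder_eqI)
    also have "\<dots> = (\<Sum>j\<in>UNIV. integral {0..1} (\<lambda>s. x $ j * fder (\<lambda>x. b x (axis j 1)) (s *\<^sub>R x) (s *\<^sub>R v) + v $ j * b (s *\<^sub>R x) (axis j 1)))"
    proof (rule sum.cong[OF refl])
      fix j
      have e: "integral {0..1} (\<lambda>s. fder (\<lambda>x. b x (axis j 1)) (s *\<^sub>R x) (s *\<^sub>R v))
         = integral {0..1} (\<lambda>s. s * fder (\<lambda>x. b x (axis j 1)) (s *\<^sub>R x) v)"
        by (rule integral_cong) (simp add: linear_scale[OF lf])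
      have i1: "(\<lambda>s. fder (\<lambda>x. b x (axis j 1)) (s *\<^sub>R x) (s *\<^sub>R v)) integrable_on {0..1}"
      proof (rule integrable_eq)
        show "(\<lambda>s. s * fder (\<lambda>x. b x (axis j 1)) (s *\<^sub>R x) v) integrable_on {0..1}"
          by (intro integrable_continuous_interval continuous_on_mult continuous_on_id cont)
      qed (simp add: linear_scale[OF lf])
      have i2: "(\<lambda>s. b (s *\<^sub>R x) (axis j 1)) integrable_on {0..1}"
        by (intro integrable_continuous_interval cont)
      show "x $ j * fder (I j) x v + v $ j * I j x = integral {0..1} (\<lambda>s. x $ j * fder (\<lambda>x. b x (axis j 1)) (s *\<^sub>R x) (s *\<^sub>R v) + v $ j * b (s *\<^sub>R x) (axis j 1))"
        using U(7)[OF xU, of j v] integrable_on_cmult_left[OF i1, of "x $ j"] integrable_on_cmult_left[OF i2, of "v $ j"]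
        by (simp add: I_def c_def integral_add)
    qed
    also have "\<dots> = integral {0..1} (\<lambda>s. \<Sum>j\<in>UNIV. x $ j * fder (\<lambda>x. b x (axis j 1)) (s *\<^sub>R x) (s *\<^sub>R v) + v $ j * b (s *\<^sub>R x) (axis j 1))"
    proof (rule integral_sum[symmetric, OF finite])
      fix j
      show "(\<lambda>s. x $ j * fder (\<lambda>x. b x (axis j 1)) (s *\<^sub>R x) (s *\<^sub>R v) + v $ j * b (s *\<^sub>R x) (axis j 1)) integrable_on {0..1}"
      proof (rule integrable_eq)
        show "(\<lambda>s. x $ j * (s * fder (\<lambda>x. b x (axis j 1)) (s *\<^sub>R x) v) + v $ j * b (s *\<^sub>R x) (axis j 1)) integrable_on {0..1}"
          by (intro integrable_continuous_interval continuous_on_add continuous_on_mult continuous_on_const continuous_on_id cont)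
      qed (simp add: linear_scale[OF lf])
    qed
    also have "\<dots> = integral {0..1} (\<lambda>s. s * fder (\<lambda>x. b x v) (s *\<^sub>R x) x + b (s *\<^sub>R x) v)"
    proof (rule integral_cong)
      fix s :: real assume s: "s \<in> {0..1}"
      have w: "s *\<^sub>R x \<in> W" using sx[OF s] r(2) by auto
      have "(\<Sum>j\<in>UNIV. x $ j * fder (\<lambda>x. b x (axis j 1)) (s *\<^sub>R x) (s *\<^sub>R v)) = fder (\<lambda>p. b p x) (s *\<^sub>R x) (s *\<^sub>R v)"
        using fder_eqI[OF hd[OF sx[OF s], of x]] by simp
      also have "\<dots> = s * fder (\<lambda>p. b p v) (s *\<^sub>R x) x"
        using W(4)[OF w] by (simp add: linear_scale[OF lf[OF s]])
      finally show "(\<Sum>j\<in>UNIV. x $ j * fder (\<lambda>x. b x (axis j 1)) (s *\<^sub>R x) (s *\<^sub>R v) + v $ j * b (s *\<^sub>R x) (axis j 1)) =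
          s * fder (\<lambda>x. b x v) (s *\<^sub>R x) x + b (s *\<^sub>R x) v"
        using bsum[OF w, of v] by (simp add: sum.distrib)
    qed
    also have "\<dots> = 1 * b (1 *\<^sub>R x) v - 0 * b (0 *\<^sub>R x) v"
    proof (rule ftc01)
      fix s :: real assume s: "s \<in> {0..1}"
      have "((\<lambda>s. b (s *\<^sub>R x) v) has_real_derivative fder (\<lambda>x. b x v) (s *\<^sub>R x) x) (at s)"
        by (rule has_real_derivative_along[OF has_fder])
           (use hd[OF sx[OF s]] in \<open>auto simp: differentiable_def intro!: derivative_eq_intros\<close>)
      then show "((\<lambda>s. s * b (s *\<^sub>R x) v) has_real_derivative s * fder (\<lambda>x. b x v) (s *\<^sub>R x) x + b (s *\<^sub>R x) v) (at s)"
        by (auto intro!: derivative_eq_intros)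
    qed
    finally show ?thesis by simp
  qed
  then have "near x. \<forall>v. fder S x v = b x v"
    unfolding eventually_nhds using r(1) by (intro exI[of _ "ball 0 r"]) auto
  moreover have "sm S"
    unfolding S_def by (intro sm_sum sm_mult sI sm_nth sm_ident)
  ultimately show ?thesis using that by blast
qed

text \<open>The operator \<open>N + E\<close> with the Euler field \<open>E\<close> of the weights \<open>w\<close> is surjective on smooth germs.\<close>

lemma euler_solve:
  fixes F :: "real ^ 'm \<Rightarrow> real" and w :: "'m \<Rightarrow> nat"
  assumes F: "sm F" and N: "N > 0"
  obtains G where "sm G"
    "near x. of_nat N * G x + fder G x (\<chi> j. of_nat (w j) * x $ j) = F x"
proof -
  define c where "c s x = (\<Sum>j\<in>UNIV. (s ^ w j * x $ j) *\<^sub>R axis j (1::real))" for s and x :: "real ^ 'm"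
  have cn: "c s x $ j = s ^ w j * x $ j" for s x j
    by (simp add: c_def axis_def if_distrib cong: if_cong)
  have c1: "smooth_on UNIV (\<lambda>p. c (snd p) (fst p))"
    unfolding c_def
    by (intro smooth_on_sum smooth_on_scaleR smooth_on_mult smooth_on_power smooth_on_const open_UNIV smooth_on_linear
        bounded_linear_snd bounded_linear_compose[OF bounded_linear_vec_nth bounded_linear_fst])
  have c2: "bounded_linear (c s)" for s
    unfolding c_def
    by (intro bounded_linear_sum bounded_linear_compose[OF bounded_linear_scaleR_left]
        bounded_linear_compose[OF bounded_linear_mult_right] bounded_linear_vec_nth)
  \<comment> \<open>The factor \<open>s ^ (N - 1)\<close> is chosen so that \<open>N * G\<close>
    plus the Euler derivative of \<open>G\<close> is the integral of the derivative of
    \<open>s ^ N * F (c s x)\<close>; since \<open>N > 0\<close> there is no contribution from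
    \<open>s = 0\<close>.\<close>
  define G where "G x = integral {0..1} (\<lambda>s. s ^ (N - 1) * F (c s x))" for x
  obtain V U where U: "open V" "smooth_on V F" "open U" "0 \<in> U" "\<And>x s. x \<in> U \<Longrightarrow> s \<in> {0..1} \<Longrightarrow> c s x \<in> V"
    "smooth_on U G" "\<And>x v. x \<in> U \<Longrightarrow> fder G x v = integral {0..1} (\<lambda>s. s ^ (N - 1) * fder F (c s x) (c s v))"
    using param_integral[OF F c1 c2 smooth_on_power[OF open_UNIV smooth_on_linear[OF bounded_linear_ident]] G_def]
    by blast
  have "of_nat N * G x + fder G x (\<chi> j. of_nat (w j) * x $ j) = F x" if x: "x \<in> U" for x
  proof -
    define E :: "real ^ 'm" where "E = (\<chi> j. of_nat (w j) * x $ j)"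
    \<comment> \<open>For \<open>w j = 0\<close> the truncated exponent \<open>w j - 1\<close> is
      harmless, as the factor in front of it is \<open>0\<close>.\<close>
    define c' where "c' s = (\<Sum>j\<in>UNIV. (of_nat (w j) * s ^ (w j - 1) * x $ j) *\<^sub>R axis j (1::real))" for s
    have c'n: "c' s $ j = of_nat (w j) * s ^ (w j - 1) * x $ j" for s j
      by (simp add: c'_def axis_def if_distrib cong: if_cong)
    have cd: "((\<lambda>s. c s x) has_vector_derivative c' s) (at s)" for s
      unfolding c_def c'_def
      by (rule has_vector_derivative_sum) (auto intro!: derivative_eq_intros simp: has_real_derivative_iff_has_vector_derivative[symmetric])
    have cE: "s *\<^sub>R c' s = c s E" for s
      by (auto simp: vec_eq_iff cn c'n E_def power_eq_if)
    have cc: "continuous_on {0..1} (\<lambda>s. c s x)"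
      unfolding c_def by (auto intro!: continuous_intros)
    have l: "linear (fder F (c s x))" if "s \<in> {0..1}" for s
      by (rule linear_fder, rule smooth_on_differentiable[OF U(2)], rule U(5)[OF x that])
    have cF: "continuous_on {0..1} (\<lambda>s. F (c s x))"
      by (rule continuous_on_along[OF U(2) U(5)[OF x] cc])
    have cD: "continuous_on {0..1} (\<lambda>s. fder F (c s x) (c s E))"
    proof (rule continuous_on_eq)
      show "continuous_on {0..1} (\<lambda>s. \<Sum>j\<in>UNIV. (s ^ w j * E $ j) * fder F (c s x) (axis j 1))"
        by (intro continuous_intros continuous_on_along[OF smooth_on_fder[OF U(2)] U(5)[OF x] cc])
      show "(\<Sum>j\<in>UNIV. (s ^ w j * E $ j) * fder F (c s x) (axis j 1)) = fder F (c s x) (c s E)" if "s \<in> {0..1}" for s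
        unfolding c_def[of s E] by (simp add: linear_sum[OF l[OF that]] linear_scale[OF l[OF that]])
    qed
    have int: "(\<lambda>s. s ^ (N - 1) * F (c s x)) integrable_on {0..1}"
      "(\<lambda>s. s ^ (N - 1) * fder F (c s x) (c s E)) integrable_on {0..1}"
      by (intro integrable_continuous_interval continuous_on_mult continuous_on_power continuous_on_id cF cD)+
    have "of_nat N * G x + fder G x E =
        integral {0..1} (\<lambda>s. of_nat N * (s ^ (N - 1) * F (c s x)) + s ^ (N - 1) * fder F (c s x) (c s E))"
      unfolding U(7)[OF x] G_def
      using integral_add[OF integrable_on_cmult_left[OF int(1), of "of_nat N"] int(2)] by simp
    also have "\<dots> = integral {0..1} (\<lambda>s. of_nat N * s ^ (N - 1) * F (c s x) + s ^ N * fder F (c s x) (c' s))"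
    proof (rule integral_cong)
      fix s :: real assume s: "s \<in> {0..1}"
      have "s ^ N = s ^ (N - 1) * s" using N by (cases N) auto
      then show "of_nat N * (s ^ (N - 1) * F (c s x)) + s ^ (N - 1) * fder F (c s x) (c s E) =
          of_nat N * s ^ (N - 1) * F (c s x) + s ^ N * fder F (c s x) (c' s)"
        by (simp add: cE[symmetric] linear_scale[OF l[OF s]])
    qed
    also have "\<dots> = 1 ^ N * F (c 1 x) - 0 ^ N * F (c 0 x)"
    proof (rule ftc01)
      fix s :: real assume s: "s \<in> {0..1}"
      have "((\<lambda>s. F (c s x)) has_real_derivative fder F (c s x) (c' s)) (at s)"
        by (rule has_real_derivative_along[OF has_fder cd]) (rule smooth_on_differentiable[OF U(2) U(5)[OF x s]])
      then show "((\<lambda>s. s ^ N * F (c s x)) has_real_derivative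
          of_nat N * s ^ (N - 1) * F (c s x) + s ^ N * fder F (c s x) (c' s)) (at s)"
        by (auto intro!: derivative_eq_intros)
    qed
    also have "\<dots> = F x"
    proof -
      have "c 1 x = x" by (simp add: vec_eq_iff cn)
      then show ?thesis using N by simp
    qed
    finally show ?thesis by (simp add: E_def)
  qed
  then have "near x. of_nat N * G x + fder G x (\<chi> j. of_nat (w j) * x $ j) = F x"
    unfolding eventually_nhds using U(3,4) by blast
  moreover have "sm G" using U by (auto intro: smI)
  ultimately show ?thesis using that by blast
qed

section \<open>One-forms along the curve\<close>

declare One_nat_def [simp del]

lemma has_derivative_coord [derivative_intros]:
  "((\<lambda>x. x $ i) has_derivative (\<lambda>v. v $ i)) F"
  by (rule bounded_linear_imp_has_derivative) (rule bounded_linear_vec_nth)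

lemma fder_coord [simp]: "fder (\<lambda>x. x $ i) x v = v $ i"
  by (rule fder_eqI) (rule has_derivative_coord)

lemma sm_coord [simp, intro]: "sm (\<lambda>x. x $ i)"
  by (rule sm_linear) (rule bounded_linear_vec_nth)

locale symp_coords =
  fixes e :: "nat \<Rightarrow> 'm::finite" and n :: nat
  assumes n2: "n \<ge> 2" and bij: "bij_betw e {1..2*n} UNIV"
begin

abbreviation "X1 x \<equiv> (x :: real ^ 'm) $ e 1"
abbreviation "X2 x \<equiv> (x :: real ^ 'm) $ e 2"
abbreviation "X3 x \<equiv> (x :: real ^ 'm) $ e 3"
abbreviation "C \<equiv> U8 e n"

lemma C_iff: "x \<in> C \<longleftrightarrow> X1 x ^ 2 + X2 x * X3 x = 0 \<and> X1 x * X2 x + X1 x * X3 x ^ 2 = 0 \<and> (\<forall>j\<in>{4..2*n}. x $ e j = 0)"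
  by (simp add: U8_def xc_def)

lemma C_rel: "x \<in> C \<Longrightarrow> X1 x ^ 2 + X2 x * X3 x = 0" "x \<in> C \<Longrightarrow> X1 x * X2 x + X1 x * X3 x ^ 2 = 0"
  by (auto simp: C_iff)

lemma e_eq_iff: "i \<in> {1..2*n} \<Longrightarrow> j \<in> {1..2*n} \<Longrightarrow> e i = e j \<longleftrightarrow> i = j"
  using bij by (auto simp: bij_betw_def dest: inj_onD)

lemma e_neq [simp]: "e 1 \<noteq> e 2" "e 1 \<noteq> e 3" "e 2 \<noteq> e 3" "e 2 \<noteq> e 1" "e 3 \<noteq> e 1" "e 3 \<noteq> e 2"
  "e (Suc 0) \<noteq> e 2" "e (Suc 0) \<noteq> e 3" "e 2 \<noteq> e (Suc 0)" "e 3 \<noteq> e (Suc 0)"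
  using e_eq_iff n2 by auto

lemma e_obtain: obtains i where "i \<in> {1..2*n}" "j = e i"
  using bij by (metis UNIV_I bij_betw_imp_surj_on imageE)

lemma UNIV_split: "UNIV = {e 1, e 2, e 3} \<union> e ` {4..2*n}" "{e 1, e 2, e 3} \<inter> e ` {4..2*n} = {}"
proof -
  have "{1..2*n} = {1, 2, 3} \<union> {4..2*n}" using n2 by auto
  then show "UNIV = {e 1, e 2, e 3} \<union> e ` {4..2*n}"
    using bij_betw_imp_surj_on[OF bij] by auto
  have "e i \<noteq> e j" if "i \<in> {1,2,3}" "j \<in> {4..2*n}" for i j
    using that n2 by (subst e_eq_iff) auto
  then show "{e 1, e 2, e 3} \<inter> e ` {4..2*n} = {}" by auto
qed

lemma sum_UNIV_split: "(\<Sum>j\<in>UNIV. g j) = g (e 1) + g (e 2) + g (e 3) + (\<Sum>j\<in>e ` {4..2*n}. g j :: real)"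
  by (subst UNIV_split(1), subst sum.union_disjoint[OF _ _ UNIV_split(2)]) (auto simp: add.assoc)

lemma C_zero: "x \<in> C \<Longrightarrow> j \<in> e ` {4..2*n} \<Longrightarrow> x $ j = 0"
  by (auto simp: C_iff)

lemma zero_in_C [simp]: "0 \<in> C"
  by (simp add: C_iff)

definition ceq :: "(real ^ 'm \<Rightarrow> real) \<Rightarrow> (real ^ 'm \<Rightarrow> real) \<Rightarrow> bool" where
  "ceq F G \<longleftrightarrow> (near x. x \<in> C \<longrightarrow> F x = G x)"

text \<open>Exactness only concerns the values of the form at points of the curve, in all directions.\<close>

definition exact :: "(real ^ 'm \<Rightarrow> real ^ 'm \<Rightarrow> real) \<Rightarrow> bool" where
  "exact a \<longleftrightarrow> (\<exists>S. sm S \<and> (near x. x \<in> C \<longrightarrow> (\<forall>v. a x v = fder S x v)))"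

lemma ceqI: "(\<And>x. x \<in> C \<Longrightarrow> F x = G x) \<Longrightarrow> ceq F G"
  by (simp add: ceq_def)

lemma ceq_refl: "ceq F F" by (simp add: ceq_def)

lemma ceq_trans: assumes "ceq F G" "ceq G H" shows "ceq F H"
  using assms unfolding ceq_def by eventually_elim auto

lemma exactI:
  "sm S \<Longrightarrow> (near x. x \<in> C \<longrightarrow> (\<forall>v. a x v = fder S x v)) \<Longrightarrow> exact a"
  by (auto simp: exact_def)

lemma exact_fder: "sm S \<Longrightarrow> exact (fder S)"
  by (rule exactI) auto

lemma exact_cong:
  assumes "exact a" "near x. x \<in> C \<longrightarrow> (\<forall>v. b x v = a x v)"
  shows "exact b"
proof -
  obtain S where S: "sm S" "near x. x \<in> C \<longrightarrow> (\<forall>v. a x v = fder S x v)"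
    using assms(1) by (auto simp: exact_def)
  show ?thesis
    by (rule exactI[OF S(1)]) (use S(2) assms(2) in \<open>eventually_elim, simp\<close>)
qed

lemma exact_congC: "exact a \<Longrightarrow> (\<And>x v. x \<in> C \<Longrightarrow> b x v = a x v) \<Longrightarrow> exact b"
  by (rule exact_cong) auto

lemma exact_add:
  assumes "exact a" "exact b"
  shows "exact (\<lambda>x v. a x v + b x v)"
proof -
  obtain S T where S: "sm S" "near x. x \<in> C \<longrightarrow> (\<forall>v. a x v = fder S x v)"
    and T: "sm T" "near x. x \<in> C \<longrightarrow> (\<forall>v. b x v = fder T x v)"
    using assms by (auto simp: exact_def)
  show ?thesis
  proof (rule exactI[OF sm_add[OF S(1) T(1)]])
    show "near x. x \<in> C \<longrightarrow> (\<forall>v. a x v + b x v = fder (\<lambda>x. S x + T x) x v)"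
      using S(2) T(2) sm_differentiable[OF S(1)] sm_differentiable[OF T(1)]
      by eventually_elim (simp add: fder_add)
  qed
qed

lemma exact_cmult:
  assumes "exact a"
  shows "exact (\<lambda>x v. c * a x v)"
proof -
  obtain S where S: "sm S" "near x. x \<in> C \<longrightarrow> (\<forall>v. a x v = fder S x v)"
    using assms by (auto simp: exact_def)
  show ?thesis
    by (rule exactI[OF sm_mult[OF sm_const[of c] S(1)]])
       (use S(2) sm_differentiable[OF S(1)] in \<open>eventually_elim, simp add: fder_cmult\<close>)
qed

lemma exact_diff: "exact a \<Longrightarrow> exact b \<Longrightarrow> exact (\<lambda>x v. a x v - b x v)"
  using exact_add[OF _ exact_cmult[of b "-1"], of a] by simp

lemma exact_0: "exact (\<lambda>x v. 0)"
  by (rule exactI[OF sm_const[of 0]]) auto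

lemma exact_sum: "finite I \<Longrightarrow> (\<And>i. i \<in> I \<Longrightarrow> exact (a i)) \<Longrightarrow> exact (\<lambda>x v. \<Sum>i\<in>I. a i x v)"
  by (induction I rule: finite_induct) (auto intro: exact_0 exact_add)

lemma exact_vanish: "ceq F (\<lambda>x. 0) \<Longrightarrow> exact (\<lambda>x v. F x * a x v)"
  by (rule exact_cong[OF exact_0]) (auto simp: ceq_def elim: eventually_mono)

lemma exact_by_parts:
  assumes "sm F" "sm G"
  shows "exact (\<lambda>x v. F x * fder G x v + G x * fder F x v)"
  by (rule exactI[OF sm_mult[OF assms]])
     (use sm_differentiable[OF assms(1)] sm_differentiable[OF assms(2)] in
       \<open>eventually_elim, simp add: fder_mult mult.commute\<close>)

text \<open>\<open>F dG\<close> is \<open>d (F G) - G dF\<close>, and \<open>G dF\<close> vanishes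
  at the points of the curve. The form \<open>dG\<close> itself need not vanish there.\<close>

lemma exact_fder_vanish:
  assumes "sm F" "sm G" "ceq G (\<lambda>x. 0)"
  shows "exact (\<lambda>x v. F x * fder G x v)"
  by (rule exact_congC[OF exact_diff[OF exact_by_parts[OF assms(1,2)] exact_vanish[OF assms(3), of "fder F"]]]) simp

text \<open>Replace first \<open>F\<close>, then \<open>G\<close>: the first change is a form
  vanishing on the curve, the second is handled by \<open>exact_fder_vanish\<close>. Hence the class
  of \<open>F dG\<close> only sees restrictions to the curve.\<close>

lemma fd_ceq:
  assumes "sm F" "sm F'" "sm G" "sm G'" "ceq F F'" "ceq G G'"
  shows "exact (\<lambda>x v. F x * fder G x v - F' x * fder G' x v)"
proof -
  have "exact (\<lambda>x v. (F x - F' x) * fder G x v)"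
    by (rule exact_vanish) (use assms(5) in \<open>auto simp: ceq_def elim: eventually_mono\<close>)
  moreover have "exact (\<lambda>x v. F' x * fder (\<lambda>x. G x - G' x) x v)"
    by (rule exact_fder_vanish) (use assms in \<open>auto simp: ceq_def elim: eventually_mono\<close>)
  ultimately have "exact (\<lambda>x v. (F x - F' x) * fder G x v + F' x * fder (\<lambda>x. G x - G' x) x v)"
    by (rule exact_add)
  then show ?thesis
    by (rule exact_cong)
       (use sm_differentiable[OF assms(3)] sm_differentiable[OF assms(4)] in
         \<open>eventually_elim, simp add: fder_diff algebra_simps\<close>)
qed

text \<open>The first equation \<open>f\<close> of the curve, of weight 6, in the role of the
  function vanishing on it; \<open>rel_g\<close> does the same for the second equation
  \<open>g\<close>, of weight 7.\<close>

lemma rel_f: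
  assumes "sm H"
  shows "exact (\<lambda>x v. H x * (2 * X1 x * X1 v + X2 x * X3 v + X3 x * X2 v))"
proof -
  have s: "sm (\<lambda>x. X1 x ^ 2 + X2 x * X3 x)" by (intro sm_add sm_power sm_mult sm_coord)
  have "fder (\<lambda>x. X1 x ^ 2 + X2 x * X3 x) x v = 2 * X1 x * X1 v + X2 x * X3 v + X3 x * X2 v" for x v
    by (rule fder_eqI) (auto intro!: derivative_eq_intros simp: algebra_simps)
  moreover have "ceq (\<lambda>x. X1 x ^ 2 + X2 x * X3 x) (\<lambda>x. 0)" by (rule ceqI) (rule C_rel)
  ultimately show ?thesis using exact_fder_vanish[OF assms s] by simp
qed

lemma rel_g:
  assumes "sm H"
  shows "exact (\<lambda>x v. H x * ((X2 x + X3 x ^ 2) * X1 v + X1 x * X2 v + 2 * X1 x * X3 x * X3 v))"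
proof -
  have s: "sm (\<lambda>x. X1 x * X2 x + X1 x * X3 x ^ 2)" by (intro sm_add sm_power sm_mult sm_coord)
  have "fder (\<lambda>x. X1 x * X2 x + X1 x * X3 x ^ 2) x v =
      (X2 x + X3 x ^ 2) * X1 v + X1 x * X2 v + 2 * X1 x * X3 x * X3 v" for x v
    by (rule fder_eqI) (auto intro!: derivative_eq_intros simp: algebra_simps)
  moreover have "ceq (\<lambda>x. X1 x * X2 x + X1 x * X3 x ^ 2) (\<lambda>x. 0)" by (rule ceqI) (rule C_rel)
  ultimately show ?thesis using exact_fder_vanish[OF assms s] by simp
qed

text \<open>Multiples of \<open>X1\<close> live on the cusp \<open>(t\<^sup>3, -t\<^sup>4, t\<^sup>2)\<close> only; there the relations from \<open>f\<close>
  and \<open>g\<close> express \<open>dX1\<close> and \<open>dX2\<close> by \<open>dX3\<close>.\<close>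

lemma red_2e: "sm H \<Longrightarrow> exact (\<lambda>x v. X1 x ^ 2 * X3 x * H x * X2 v + 2 * (X1 x ^ 2 * X3 x ^ 2 * H x * X3 v))"
  by (rule exact_congC[OF rel_g[of "\<lambda>x. X1 x * X3 x * H x"]])
     (intro sm_mult sm_coord, assumption, frule C_rel(1), drule C_rel(2), algebra)

lemma red_2o: "sm H \<Longrightarrow> exact (\<lambda>x v. X1 x ^ 3 * H x * X2 v + 2 * (X1 x ^ 3 * X3 x * H x * X3 v))"
  by (rule exact_congC[OF rel_g[of "\<lambda>x. X1 x ^ 2 * H x"]])
     (intro sm_mult sm_power sm_coord, assumption, frule C_rel(1), drule C_rel(2), algebra)

text \<open>In these names the digit is the index of the differential, and \<open>e\<close> or
  \<open>o\<close> is the parity of the power of \<open>t\<close> by which the monomial in front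
  restricts to the cusp. The \<open>dX2\<close> part of \<open>rel_f\<close> is removed by
  \<open>red_2e\<close>.\<close>

lemma red_1o:
  assumes "sm H"
  shows "exact (\<lambda>x v. 2 * (X1 x ^ 3 * H x * X1 v) - 3 * (X1 x ^ 2 * X3 x ^ 2 * H x * X3 v))"
proof -
  have "exact (\<lambda>x v. X1 x ^ 2 * H x * (2 * X1 x * X1 v + X2 x * X3 v + X3 x * X2 v) -
     (X1 x ^ 2 * X3 x * H x * X2 v + 2 * (X1 x ^ 2 * X3 x ^ 2 * H x * X3 v)))"
    by (intro exact_diff red_2e rel_f sm_mult sm_power sm_coord assms)
  then show ?thesis
    by (rule exact_congC) (frule C_rel(1), drule C_rel(2), algebra)
qed

lemma red_1e:
  assumes "sm H"
  shows "exact (\<lambda>x v. 2 * (X1 x ^ 2 * X3 x ^ 2 * H x * X1 v) - 3 * (X1 x ^ 3 * X3 x * H x * X3 v))"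
proof -
  have "exact (\<lambda>x v. X1 x * X3 x ^ 2 * H x * (2 * X1 x * X1 v + X2 x * X3 v + X3 x * X2 v) -
     (X1 x ^ 3 * H x * X2 v + 2 * (X1 x ^ 3 * X3 x * H x * X3 v)))"
    by (intro exact_diff red_2o rel_f sm_mult sm_power sm_coord assms)
  then show ?thesis
    by (rule exact_congC) (frule C_rel(1), drule C_rel(2), algebra)
qed

definition P3 :: "real ^ 'm \<Rightarrow> real ^ 'm" where
  "P3 x = X1 x *\<^sub>R axis (e 1) 1 + X2 x *\<^sub>R axis (e 2) 1 + X3 x *\<^sub>R axis (e 3) 1"

lemma bl_P3: "bounded_linear P3"
  unfolding P3_def
  by (intro bounded_linear_add bounded_linear_compose[OF bounded_linear_scaleR_left] bounded_linear_vec_nth)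

lemma P3_nth: "P3 x $ j = (if j \<in> {e 1, e 2, e 3} then x $ j else 0)"
  by (auto simp: P3_def axis_def)

lemma P3_C: "x \<in> C \<Longrightarrow> P3 x = x"
  using C_zero UNIV_split(1) by (auto simp: vec_eq_iff P3_nth)

lemma P3_0 [simp]: "P3 0 = 0" by (simp add: vec_eq_iff P3_nth)

lemma sm_P3 [intro]: "sm F \<Longrightarrow> sm (\<lambda>x. F (P3 x))"
  by (rule sm_compose) (auto intro: sm_linear bl_P3)

lemma fder_P3:
  fixes F :: "real ^ 'm \<Rightarrow> real"
  assumes "sm F"
  shows "near x. ((\<lambda>x. F (P3 x)) has_derivative (\<lambda>v. X1 v * fder F (P3 x) (axis (e 1) 1) +
     X2 v * fder F (P3 x) (axis (e 2) 1) + X3 v * fder F (P3 x) (axis (e 3) 1))) (at x)"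
  using eventually_compose_germ[OF sm_differentiable[OF assms] sm_linear[OF bl_P3] P3_0]
proof eventually_elim
  case (elim x)
  have "((\<lambda>x. F (P3 x)) has_derivative (\<lambda>v. fder F (P3 x) (P3 v))) (at x)"
    using diff_chain_at[OF bounded_linear_imp_has_derivative[OF bl_P3] has_fder[OF elim]] by (simp add: o_def)
  moreover have "fder F (P3 x) (P3 v) = X1 v * fder F (P3 x) (axis (e 1) 1) +
     X2 v * fder F (P3 x) (axis (e 2) 1) + X3 v * fder F (P3 x) (axis (e 3) 1)" for v
    using linear_fder[OF elim] by (simp add: P3_def linear_add linear_scale)
  ultimately show ?case by simp
qed

text \<open>Composition with \<open>P3\<close> changes nothing at points of the curve but leaves
  only the three differentials \<open>dX1\<close>, \<open>dX2\<close>, \<open>dX3\<close> in the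
  derivative.\<close>

lemma euler_C:
  assumes F: "sm F" and N: "N > 0"
  obtains G G1 G2 G3 where "sm G" "sm G1" "sm G2" "sm G3"
    "near x. x \<in> C \<longrightarrow> (G has_derivative (\<lambda>v. X1 v * G1 x + X2 v * G2 x + X3 v * G3 x)) (at x) \<and>
       of_nat N * G x + 3 * X1 x * G1 x + 4 * X2 x * G2 x + 2 * X3 x * G3 x = F x"
proof -
  define w where "w j = (if j = e 1 then 3 else if j = e 2 then 4 else if j = e 3 then 2 else (0::nat))" for j
  obtain G where G: "sm G" "near x. of_nat N * G x + fder G x (\<chi> j. of_nat (w j) * x $ j) = F x"
    using euler_solve[OF F N] by blast
  show ?thesis
  proof (rule that[of "\<lambda>x. G (P3 x)" "\<lambda>x. fder G x (axis (e 1) 1)" "\<lambda>x. fder G x (axis (e 2) 1)" "\<lambda>x. fder G x (axis (e 3) 1)"])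
    show "near x. x \<in> C \<longrightarrow> ((\<lambda>x. G (P3 x)) has_derivative
        (\<lambda>v. X1 v * fder G x (axis (e 1) 1) + X2 v * fder G x (axis (e 2) 1) + X3 v * fder G x (axis (e 3) 1))) (at x) \<and>
       of_nat N * G (P3 x) + 3 * X1 x * fder G x (axis (e 1) 1) + 4 * X2 x * fder G x (axis (e 2) 1) + 2 * X3 x * fder G x (axis (e 3) 1) = F x"
      using fder_P3[OF G(1)] G(2) sm_differentiable[OF G(1)]
    proof eventually_elim
      case (elim x)
      show ?case
      proof
        assume x: "x \<in> C"
        have "(\<chi> j. of_nat (w j) * x $ j) = (3 * X1 x) *\<^sub>R axis (e 1) 1 + (4 * X2 x) *\<^sub>R axis (e 2) 1 + (2 * X3 x) *\<^sub>R axis (e 3) (1::real)"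
          by (auto simp: vec_eq_iff w_def axis_def)
        then show "((\<lambda>x. G (P3 x)) has_derivative
          (\<lambda>v. X1 v * fder G x (axis (e 1) 1) + X2 v * fder G x (axis (e 2) 1) + X3 v * fder G x (axis (e 3) 1))) (at x) \<and>
          of_nat N * G (P3 x) + 3 * X1 x * fder G x (axis (e 1) 1) + 4 * X2 x * fder G x (axis (e 2) 1) + 2 * X3 x * fder G x (axis (e 3) 1) = F x"
          using elim(1,2) linear_fder[OF elim(3)] by (simp add: P3_C[OF x] linear_add linear_scale)
      qed
    qed
  qed (use G in auto)
qed

text \<open>Here a primitive along the cusp is needed: on it, \<open>12 G + E G = 2 F\<close> says
  \<open>d (t\<^sup>1\<^sup>2 G) = 2 t\<^sup>1\<^sup>1 F dt\<close>.\<close>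

lemma exact_3e:
  assumes F: "sm F"
  shows "exact (\<lambda>x v. X1 x ^ 2 * X3 x ^ 2 * F x * X3 v)"
proof -
  obtain G G1 G2 G3 where G: "sm G" "sm G1" "sm G2" "sm G3"
    "near x. x \<in> C \<longrightarrow> (G has_derivative (\<lambda>v. X1 v * G1 x + X2 v * G2 x + X3 v * G3 x)) (at x) \<and>
       of_nat 12 * G x + 3 * X1 x * G1 x + 4 * X2 x * G2 x + 2 * X3 x * G3 x = F x"
    by (rule euler_C[OF F zero_less_numeral]) (rule that; assumption)
  \<comment> \<open>The differential of \<open>X1^2 X3^3 G\<close>, which is \<open>t^12 G\<close>
    on the cusp, with its \<open>dX1\<close> and \<open>dX2\<close> parts converted into
    \<open>dX3\<close> parts; what remains is half of \<open>X1^2 X3^2 (12 G + E G) dX3\<close>,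
    whence the outer factor 2.\<close>
  define R where "R x v = 2 * (fder (\<lambda>x. X1 x ^ 2 * X3 x ^ 3 * G x) x v
      - (2 * (X1 x ^ 3 * G x * X1 v) - 3 * (X1 x ^ 2 * X3 x ^ 2 * G x * X3 v))
      - 1/2 * (2 * (X1 x ^ 2 * X3 x ^ 2 * (X3 x * G1 x) * X1 v) - 3 * (X1 x ^ 3 * X3 x * (X3 x * G1 x) * X3 v))
      - (X1 x ^ 2 * X3 x * (X3 x ^ 2 * G2 x) * X2 v + 2 * (X1 x ^ 2 * X3 x ^ 2 * (X3 x ^ 2 * G2 x) * X3 v)))" for x v
  have "exact R"
    unfolding R_def
    by (rule exact_cmult, rule exact_diff, rule exact_diff, rule exact_diff)
       (intro exact_cmult exact_fder red_1e red_1o red_2e sm_mult sm_power sm_coord G)+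
  then show ?thesis
  proof (rule exact_cong)
    show "near x. x \<in> C \<longrightarrow> (\<forall>v. X1 x ^ 2 * X3 x ^ 2 * F x * X3 v = R x v)"
      using G(5)
    proof eventually_elim
      case (elim x)
      show ?case
      proof (intro impI allI)
        fix v assume x: "x \<in> C"
        then have dG: "(G has_derivative (\<lambda>v. X1 v * G1 x + X2 v * G2 x + X3 v * G3 x)) (at x)"
          and FG: "12 * G x + 3 * X1 x * G1 x + 4 * X2 x * G2 x + 2 * X3 x * G3 x = F x"
          using elim by auto
        have d: "fder (\<lambda>x. X1 x ^ 2 * X3 x ^ 3 * G x) x v =
          2 * X1 x * X3 x ^ 3 * G x * X1 v + 3 * X1 x ^ 2 * X3 x ^ 2 * G x * X3 v +
          X1 x ^ 2 * X3 x ^ 3 * (X1 v * G1 x + X2 v * G2 x + X3 v * G3 x)"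
          by (rule fder_eqI) (auto intro!: derivative_eq_intros dG simp: algebra_simps)
        show "X1 x ^ 2 * X3 x ^ 2 * F x * X3 v = R x v"
          unfolding R_def d FG[symmetric] using C_rel[OF x] by algebra
      qed
    qed
  qed
qed

text \<open>The argument of \<open>exact_3e\<close> with the primitive \<open>X1^3 X3^2 G\<close>,
  which restricts to \<open>t^13 G\<close> on the cusp; this is the origin of the constant
  13.\<close>

lemma exact_3o:
  assumes F: "sm F"
  shows "exact (\<lambda>x v. X1 x ^ 3 * X3 x * F x * X3 v)"
proof -
  obtain G G1 G2 G3 where G: "sm G" "sm G1" "sm G2" "sm G3"
    "near x. x \<in> C \<longrightarrow> (G has_derivative (\<lambda>v. X1 v * G1 x + X2 v * G2 x + X3 v * G3 x)) (at x) \<and>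
       of_nat 13 * G x + 3 * X1 x * G1 x + 4 * X2 x * G2 x + 2 * X3 x * G3 x = F x"
    by (rule euler_C[OF F zero_less_numeral]) (rule that; assumption)
  define R where "R x v = 2 * (fder (\<lambda>x. X1 x ^ 3 * X3 x ^ 2 * G x) x v
      - 3/2 * (2 * (X1 x ^ 2 * X3 x ^ 2 * G x * X1 v) - 3 * (X1 x ^ 3 * X3 x * G x * X3 v))
      - 1/2 * (2 * (X1 x ^ 3 * (X3 x ^ 2 * G1 x) * X1 v) - 3 * (X1 x ^ 2 * X3 x ^ 2 * (X3 x ^ 2 * G1 x) * X3 v))
      - (X1 x ^ 3 * (X3 x ^ 2 * G2 x) * X2 v + 2 * (X1 x ^ 3 * X3 x * (X3 x ^ 2 * G2 x) * X3 v)))" for x v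
  have "exact R"
    unfolding R_def
    by (intro exact_cmult exact_diff exact_fder red_1e red_1o red_2o sm_mult sm_power sm_coord G)
  then show ?thesis
  proof (rule exact_cong)
    show "near x. x \<in> C \<longrightarrow> (\<forall>v. X1 x ^ 3 * X3 x * F x * X3 v = R x v)"
      using G(5)
    proof eventually_elim
      case (elim x)
      show ?case
      proof (intro impI allI)
        fix v assume x: "x \<in> C"
        then have dG: "(G has_derivative (\<lambda>v. X1 v * G1 x + X2 v * G2 x + X3 v * G3 x)) (at x)"
          and FG: "13 * G x + 3 * X1 x * G1 x + 4 * X2 x * G2 x + 2 * X3 x * G3 x = F x"
          using elim by auto
        have d: "fder (\<lambda>x. X1 x ^ 3 * X3 x ^ 2 * G x) x v =
          3 * X1 x ^ 2 * X3 x ^ 2 * G x * X1 v + 2 * X1 x ^ 3 * X3 x * G x * X3 v +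
          X1 x ^ 3 * X3 x ^ 2 * (X1 v * G1 x + X2 v * G2 x + X3 v * G3 x)"
          by (rule fder_eqI) (auto intro!: derivative_eq_intros dG simp: algebra_simps)
        show "X1 x ^ 3 * X3 x * F x * X3 v = R x v"
          unfolding R_def d FG[symmetric] using C_rel[OF x] by algebra
      qed
    qed
  qed
qed

lemma exact_2e: "sm F \<Longrightarrow> exact (\<lambda>x v. X1 x ^ 2 * X3 x * F x * X2 v)"
  by (rule exact_congC[OF exact_diff[OF red_2e exact_cmult[OF exact_3e, of _ 2]]]) auto

lemma exact_2o: "sm F \<Longrightarrow> exact (\<lambda>x v. X1 x ^ 3 * F x * X2 v)"
  by (rule exact_congC[OF exact_diff[OF red_2o exact_cmult[OF exact_3o, of _ 2]]]) auto

lemma exact_1o: "sm F \<Longrightarrow> exact (\<lambda>x v. X1 x ^ 3 * F x * X1 v)"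
  by (rule exact_congC[OF exact_cmult[OF exact_add[OF red_1o exact_cmult[OF exact_3e, of _ 3]], of _ _ "1/2"]]) auto

lemma exact_1e: "sm F \<Longrightarrow> exact (\<lambda>x v. X1 x ^ 2 * X3 x ^ 2 * F x * X1 v)"
  by (rule exact_congC[OF exact_cmult[OF exact_add[OF red_1e exact_cmult[OF exact_3o, of _ 3]], of _ _ "1/2"]]) auto

text \<open>Functions of weight at least \<open>k\<close> on the curve, for the weights 3, 4, 2 of \<open>X1, X2, X3\<close>.\<close>

inductive J :: "nat \<Rightarrow> (real ^ 'm \<Rightarrow> real) \<Rightarrow> bool" where
  J_monomial: "sm P \<Longrightarrow> k \<le> 3 * a + 4 * b + 2 * c \<Longrightarrow> J k (\<lambda>x. X1 x ^ a * X2 x ^ b * X3 x ^ c * P x)"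
| J_add: "J k F \<Longrightarrow> J k G \<Longrightarrow> J k (\<lambda>x. F x + G x)"
| J_ceq: "J k F \<Longrightarrow> sm G \<Longrightarrow> ceq G F \<Longrightarrow> J k G"

lemma J_sm: "J k F \<Longrightarrow> sm F"
  by (induction rule: J.induct) (auto intro!: sm_mult sm_power)

lemma J_antimono: "J k F \<Longrightarrow> l \<le> k \<Longrightarrow> J l F"
  by (induction rule: J.induct) (auto intro: J.intros)

lemma J_0: "sm F \<Longrightarrow> J 0 F"
  using J_monomial[of F 0 0 0 0] by simp

lemma J_X: "J 3 (\<lambda>x. X1 x)" "J 4 (\<lambda>x. X2 x)" "J 2 (\<lambda>x. X3 x)"
  using J_monomial[of "\<lambda>x. 1" 3 1 0 0] J_monomial[of "\<lambda>x. 1" 4 0 1 0] J_monomial[of "\<lambda>x. 1" 2 0 0 1] by simp_all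

lemma J_mult_sm:
  assumes "J k F" "sm Q"
  shows "J k (\<lambda>x. F x * Q x)"
  using assms(1)
proof (induction rule: J.induct)
  case (J_monomial P k a b c)
  then show ?case
    using J.J_monomial[OF sm_mult[OF J_monomial(1) assms(2)] J_monomial(2)] by (simp add: mult.assoc)
next
  case (J_add k F G)
  then show ?case by (simp add: distrib_right J.J_add)
next
  case (J_ceq k F G)
  show ?case
    by (rule J.J_ceq[OF J_ceq(4) sm_mult[OF J_ceq(2) assms(2)]])
       (use J_ceq(3) in \<open>auto simp: ceq_def elim: eventually_mono\<close>)
qed

lemma J_mult:
  assumes "J k F" "J l G"
  shows "J (k + l) (\<lambda>x. F x * G x)"
  using assms
proof (induction arbitrary: l G rule: J.induct)
  case (J_monomial P k a b c)
  show ?case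
    using J_monomial(3)
  proof (induction rule: J.induct)
    case (J_monomial Q l a' b' c')
    have "J (k + l) (\<lambda>x. X1 x ^ (a + a') * X2 x ^ (b + b') * X3 x ^ (c + c') * (P x * Q x))"
      by (rule J.J_monomial) (use J_monomial \<open>sm P\<close> \<open>k \<le> 3 * a + 4 * b + 2 * c\<close> in \<open>auto\<close>)
    then show ?case by (simp add: power_add algebra_simps)
  next
    case (J_add l F G)
    then show ?case by (simp add: distrib_left J.J_add)
  next
    case (J_ceq l F G)
    show ?case
      by (rule J.J_ceq[OF J_ceq(4)])
         (use J_ceq(2,3) \<open>sm P\<close> in \<open>auto intro!: sm_mult sm_power simp: ceq_def elim: eventually_mono\<close>)
  qed
next
  case (J_add k F G)
  then show ?case by (simp add: distrib_right J.J_add)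
next
  case (J_ceq k F H)
  show ?case
    by (rule J.J_ceq[OF J_ceq(4)[OF J_ceq(5)] sm_mult[OF J_ceq(2) J_sm[OF J_ceq(5)]]])
       (use J_ceq(3) in \<open>auto simp: ceq_def elim: eventually_mono\<close>)
qed

lemma J_cmult: "J k F \<Longrightarrow> J k (\<lambda>x. c * F x)"
  using J_mult_sm[OF _ sm_const[of c], of k F] by (simp add: mult.commute)

lemma J_minus: "J k F \<Longrightarrow> J k (\<lambda>x. - F x)"
  using J_cmult[of k F "-1"] by simp

lemma J_diff: "J k F \<Longrightarrow> J k G \<Longrightarrow> J k (\<lambda>x. F x - G x)"
  using J_add[OF _ J_minus, of k F G] by simp

lemma J_zero: "J k (\<lambda>x. 0)"
  using J_cmult[of k "\<lambda>x. X1 x ^ k * X2 x ^ 0 * X3 x ^ 0 * 1" 0] J_monomial[of "\<lambda>x. 1" k k 0 0] by simp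

lemma hadamard_C:
  assumes "sm F"
  obtains F1 F2 F3 where "sm F1" "sm F2" "sm F3" "ceq F (\<lambda>x. F 0 + X1 x * F1 x + X2 x * F2 x + X3 x * F3 x)"
proof -
  obtain H where H: "\<And>j. sm (H j)" "near x. F x = F 0 + (\<Sum>j\<in>UNIV. (x - 0) $ j * H j x)"
    using hadamard[OF assms bounded_linear_zero] by blast
  have "ceq F (\<lambda>x. F 0 + X1 x * H (e 1) x + X2 x * H (e 2) x + X3 x * H (e 3) x)"
    unfolding ceq_def using H(2)
    by eventually_elim (auto simp: sum_UNIV_split C_zero)
  then show ?thesis using that H(1) by blast
qed

definition axis_proj :: "nat \<Rightarrow> real ^ 'm \<Rightarrow> real ^ 'm" where
  "axis_proj i x = x $ e i *\<^sub>R axis (e i) 1"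

lemma bl_axis_proj: "bounded_linear (axis_proj i)"
  unfolding axis_proj_def
  by (intro bounded_linear_compose[OF bounded_linear_scaleR_left] bounded_linear_vec_nth)

lemma axis_proj_0 [simp]: "axis_proj i 0 = 0" by (simp add: axis_proj_def)

lemma sm_axis_proj [intro]: "sm F \<Longrightarrow> sm (\<lambda>x. F (axis_proj i x))"
  by (rule sm_compose) (auto intro: sm_linear bl_axis_proj)

lemma axis_proj_has_derivative:
  fixes F :: "real ^ 'm \<Rightarrow> real"
  assumes "sm F"
  shows "near x. ((\<lambda>x. F (axis_proj i x)) has_derivative
    (\<lambda>v. v $ e i * fder F (axis_proj i x) (axis (e i) 1))) (at x)"
  using eventually_compose_germ[OF sm_differentiable[OF assms] sm_linear[OF bl_axis_proj[of i]] axis_proj_0]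
proof eventually_elim
  case (elim x)
  have "((\<lambda>x. F (axis_proj i x)) has_derivative (\<lambda>v. fder F (axis_proj i x) (axis_proj i v))) (at x)"
    using diff_chain_at[OF bounded_linear_imp_has_derivative[OF bl_axis_proj] has_fder[OF elim]] by (simp add: o_def)
  moreover have "fder F (axis_proj i x) (axis_proj i v) = v $ e i * fder F (axis_proj i x) (axis (e i) 1)" for v
    using linear_fder[OF elim] by (simp add: axis_proj_def linear_scale)
  ultimately show ?case by simp
qed

lemma hadamard_axis2:
  assumes "sm F"
  obtains F1 F3 where "sm F1" "sm F3" "ceq F (\<lambda>x. F (axis_proj 2 x) + X1 x * F1 x + X3 x * F3 x)"
proof -
  obtain H where H: "\<And>j. sm (H j)" "near x. F x = F (axis_proj 2 x) + (\<Sum>j\<in>UNIV. (x - axis_proj 2 x) $ j * H j x)"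
    using hadamard[OF assms bl_axis_proj] by blast
  have "ceq F (\<lambda>x. F (axis_proj 2 x) + X1 x * H (e 1) x + X3 x * H (e 3) x)"
    unfolding ceq_def using H(2)
  proof eventually_elim
    case (elim x)
    show ?case
    proof
      assume x: "x \<in> C"
      have "(\<Sum>j\<in>e ` {4..2*n}. (x - axis_proj 2 x) $ j * H j x) = 0"
      proof (rule sum.neutral, rule ballI)
        fix j assume j: "j \<in> e ` {4..2*n}"
        then have "j \<noteq> e 2" using UNIV_split(2) by blast
        then show "(x - axis_proj 2 x) $ j * H j x = 0" using C_zero[OF x j] by (simp add: axis_proj_def axis_def)
      qed
      then show "F x = F (axis_proj 2 x) + X1 x * H (e 1) x + X3 x * H (e 3) x"
        using elim by (simp add: sum_UNIV_split axis_proj_def axis_def)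
    qed
  qed
  then show ?thesis using that H(1) by blast
qed

lemma hadamard_axis3:
  assumes "sm F"
  obtains F1 F2 where "sm F1" "sm F2" "ceq F (\<lambda>x. F (axis_proj 3 x) + X1 x * F1 x + X2 x * F2 x)"
proof -
  obtain H where H: "\<And>j. sm (H j)" "near x. F x = F (axis_proj 3 x) + (\<Sum>j\<in>UNIV. (x - axis_proj 3 x) $ j * H j x)"
    using hadamard[OF assms bl_axis_proj] by blast
  have "ceq F (\<lambda>x. F (axis_proj 3 x) + X1 x * H (e 1) x + X2 x * H (e 2) x)"
    unfolding ceq_def using H(2)
  proof eventually_elim
    case (elim x)
    show ?case
    proof
      assume x: "x \<in> C"
      have "(\<Sum>j\<in>e ` {4..2*n}. (x - axis_proj 3 x) $ j * H j x) = 0"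
      proof (rule sum.neutral, rule ballI)
        fix j assume j: "j \<in> e ` {4..2*n}"
        then have "j \<noteq> e 3" using UNIV_split(2) by blast
        then show "(x - axis_proj 3 x) $ j * H j x = 0" using C_zero[OF x j] by (simp add: axis_proj_def axis_def)
      qed
      then show "F x = F (axis_proj 3 x) + X1 x * H (e 1) x + X2 x * H (e 2) x"
        using elim by (simp add: sum_UNIV_split axis_proj_def axis_def)
    qed
  qed
  then show ?thesis using that H(1) by blast
qed

text \<open>A form in one variable is closed, hence has a primitive. This settles the part of a form
  that lives on one of the two lines, about which the reductions on the cusp say nothing.\<close>

lemma exact_axis:
  assumes F: "sm F"
  shows "exact (\<lambda>x v. F (axis_proj i x) * v $ e i)"
proof -
  have cl: "near x. \<forall>v w. fder (\<lambda>x. F (axis_proj i x) * v $ e i) x w = fder (\<lambda>x. F (axis_proj i x) * w $ e i) x v"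
    using axis_proj_has_derivative[OF F, of i]
  proof eventually_elim
    case (elim x)
    have "fder (\<lambda>x. F (axis_proj i x) * v $ e i) x w = w $ e i * fder F (axis_proj i x) (axis (e i) 1) * v $ e i" for v w
      by (rule fder_eqI) (rule has_derivative_mult_left[OF elim])
    then show ?case by simp
  qed
  have lin: "near x. linear (\<lambda>v. F (axis_proj i x) * v $ e i)"
    by (rule always_eventually) (auto intro!: linearI simp: algebra_simps)
  obtain S where "sm S" "near x. \<forall>v. fder S x v = F (axis_proj i x) * v $ e i"
    by (rule poincare[OF _ lin cl]) (rule sm_mult[OF sm_axis_proj[OF F] sm_const], rule that)
  then show ?thesis by (intro exactI[of S]) (auto elim: eventually_mono)
qed

text \<open>On the curve \<open>X1^2 = - X2 X3\<close>, \<open>X1 X2 = - X1 X3^2\<close> and, from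
  both, \<open>X2^2 X3 = - X2 X3^3\<close>. These rewritings preserve weight and leave pure powers
  of \<open>X3\<close>, of \<open>X2\<close>, and powers of \<open>X3\<close> times
  \<open>X1\<close> or \<open>X2\<close>. The exponents are the least ones of weight at least
  \<open>k\<close>, rounded up; truncation at small \<open>k\<close> gives exponent
  \<open>0\<close>.\<close>

lemma J_normal:
  assumes "J k F"
  obtains P Q R T where "sm P" "sm Q" "sm R" "sm T"
    "ceq F (\<lambda>x. X3 x ^ ((k + 1) div 2) * P x + X1 x * X3 x ^ ((k - 2) div 2) * Q x +
       X2 x ^ ((k + 3) div 4) * R x + X2 x * X3 x ^ ((k - 3) div 2) * T x)"
proof -
  define N where "N P Q R T x = X3 x ^ ((k + 1) div 2) * P x + X1 x * X3 x ^ ((k - 2) div 2) * Q x +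
       X2 x ^ ((k + 3) div 4) * R x + X2 x * X3 x ^ ((k - 3) div 2) * T x" for P Q R T :: "real ^ 'm \<Rightarrow> real" and x
  have pw: "y ^ c = y ^ p * y ^ (c - p)" if "p \<le> c" for y :: real and p c :: nat
    using that by (simp add: power_add[symmetric])
  have mono: "\<exists>P Q R T. sm P \<and> sm Q \<and> sm R \<and> sm T \<and> (\<forall>x\<in>C. X1 x ^ a * X2 x ^ b * X3 x ^ c * p x = N P Q R T x)"
    if p: "sm p" and k: "k \<le> 3 * a + 4 * b + 2 * c" for p a b c
    using k
  proof (induction a arbitrary: b c rule: less_induct)
    case (less a)
    consider "a \<ge> 2" | "a = 1" | "a = 0" "b = 0" | "a = 0" "b > 0" "c = 0" | "a = 0" "b > 0" "c > 0" by linarith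
    then show ?case
    proof cases
      case 1
      obtain P Q R T where N: "sm P" "sm Q" "sm R" "sm T" "\<forall>x\<in>C. X1 x ^ (a - 2) * X2 x ^ (b + 1) * X3 x ^ (c + 1) * p x = N P Q R T x"
        using less.IH[of "a - 2" "b + 1" "c + 1"] 1 less.prems by force
      have "X1 x ^ a * X2 x ^ b * X3 x ^ c * p x = - N P Q R T x" if x: "x \<in> C" for x
      proof -
        have "X1 x ^ a = X1 x ^ (a - 2) * X1 x ^ 2" using 1 by (metis le_add_diff_inverse2 power_add)
        also have "X1 x ^ 2 = - (X2 x * X3 x)" using C_rel(1)[OF x] by simp
        finally have "X1 x ^ a * X2 x ^ b * X3 x ^ c * p x = - (X1 x ^ (a - 2) * X2 x ^ (b + 1) * X3 x ^ (c + 1) * p x)"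
          by (simp add: power_add)
        then show ?thesis using N(5) x by simp
      qed
      then have "\<forall>x\<in>C. X1 x ^ a * X2 x ^ b * X3 x ^ c * p x = N (\<lambda>x. - P x) (\<lambda>x. - Q x) (\<lambda>x. - R x) (\<lambda>x. - T x) x"
        by (auto simp: N_def)
      then show ?thesis using N(1-4) by (metis sm_minus)
    next
      case 2
      have q: "(k - 2) div 2 \<le> c + 2 * b" using less.prems 2 by linarith
      have "X1 x ^ a * X2 x ^ b * X3 x ^ c * p x = N (\<lambda>x. 0) (\<lambda>x. (- 1) ^ b * X3 x ^ (c + 2 * b - (k - 2) div 2) * p x) (\<lambda>x. 0) (\<lambda>x. 0) x"
        if x: "x \<in> C" for x
      proof -
        have s: "X1 x * X2 x = - (X1 x * X3 x ^ 2)" using C_rel(2)[OF x] by simp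
        have "X1 x * X2 x ^ b = X1 x * ((- 1) ^ b * X3 x ^ (2 * b))"
        proof (induction b)
          case (Suc b)
          have "X1 x * X2 x ^ Suc b = (X1 x * X2 x ^ b) * X2 x" by simp
          also have "\<dots> = (X1 x * X2 x) * ((- 1) ^ b * X3 x ^ (2 * b))" unfolding Suc by simp
          also have "\<dots> = X1 x * ((- 1) ^ Suc b * X3 x ^ (2 * Suc b))" unfolding s by (simp add: power2_eq_square)
          finally show ?case .
        qed simp
        then have "X1 x ^ a * X2 x ^ b * X3 x ^ c * p x = X1 x * ((- 1) ^ b * X3 x ^ (2 * b)) * X3 x ^ c * p x" using 2 by simp
        also have "\<dots> = X1 x * X3 x ^ (c + 2 * b) * ((- 1) ^ b * p x)" by (simp add: power_add)
        also have "\<dots> = N (\<lambda>x. 0) (\<lambda>x. (- 1) ^ b * X3 x ^ (c + 2 * b - (k - 2) div 2) * p x) (\<lambda>x. 0) (\<lambda>x. 0) x"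
          by (simp add: N_def pw[OF q])
        finally show ?thesis .
      qed
      moreover have "sm (\<lambda>x. (- 1) ^ b * X3 x ^ (c + 2 * b - (k - 2) div 2) * p x)"
        using p by (intro sm_mult sm_const sm_power sm_coord)
      ultimately show ?thesis using sm_const[of "0::real"] by blast
    next
      case 3
      have q: "(k + 1) div 2 \<le> c" using less.prems 3 by linarith
      have "\<forall>x\<in>C. X1 x ^ a * X2 x ^ b * X3 x ^ c * p x = N (\<lambda>x. X3 x ^ (c - (k + 1) div 2) * p x) (\<lambda>x. 0) (\<lambda>x. 0) (\<lambda>x. 0) x"
        using 3 by (simp add: N_def pw[OF q])
      moreover have "sm (\<lambda>x. X3 x ^ (c - (k + 1) div 2) * p x)" using p by (intro sm_mult sm_power sm_coord)
      ultimately show ?thesis using sm_const[of "0::real"] by blast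
    next
      case 4
      have q: "(k + 3) div 4 \<le> b" using less.prems 4 by linarith
      have "\<forall>x\<in>C. X1 x ^ a * X2 x ^ b * X3 x ^ c * p x = N (\<lambda>x. 0) (\<lambda>x. 0) (\<lambda>x. X2 x ^ (b - (k + 3) div 4) * p x) (\<lambda>x. 0) x"
        using 4 by (simp add: N_def pw[OF q])
      moreover have "sm (\<lambda>x. X2 x ^ (b - (k + 3) div 4) * p x)" using p by (intro sm_mult sm_power sm_coord)
      ultimately show ?thesis using sm_const[of "0::real"] by blast
    next
      case 5
      have q: "(k - 3) div 2 \<le> c + 2 * (b - 1)" using less.prems 5 by linarith
      have "X1 x ^ a * X2 x ^ b * X3 x ^ c * p x = N (\<lambda>x. 0) (\<lambda>x. 0) (\<lambda>x. 0) (\<lambda>x. (- 1) ^ (b - 1) * X3 x ^ (c + 2 * (b - 1) - (k - 3) div 2) * p x) x"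
        if x: "x \<in> C" for x
      proof -
        have s: "X2 x * (X2 x * X3 x) = - (X2 x * X3 x) * X3 x ^ 2" using C_rel[OF x] by algebra
        have "X2 x ^ Suc d * X3 x = X2 x * X3 x * ((- 1) ^ d * X3 x ^ (2 * d))" for d
        proof (induction d)
          case (Suc d)
          have "X2 x ^ Suc (Suc d) * X3 x = X2 x * (X2 x ^ Suc d * X3 x)" by simp
          also have "\<dots> = (X2 x * (X2 x * X3 x)) * ((- 1) ^ d * X3 x ^ (2 * d))" unfolding Suc by simp
          also have "\<dots> = X2 x * X3 x * ((- 1) ^ Suc d * X3 x ^ (2 * Suc d))" unfolding s by (simp add: power2_eq_square)
          finally show ?case .
        qed simp
        from this[of "b - 1"] have s2: "X2 x ^ b * X3 x = X2 x * X3 x * ((- 1) ^ (b - 1) * X3 x ^ (2 * (b - 1)))" using 5 by simp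
        have "X1 x ^ a * X2 x ^ b * X3 x ^ c * p x = (X2 x ^ b * X3 x) * X3 x ^ (c - 1) * p x"
          using 5 by (cases c) auto
        also have "\<dots> = X2 x * (X3 x * X3 x ^ (c - 1) * X3 x ^ (2 * (b - 1))) * ((- 1) ^ (b - 1) * p x)" unfolding s2 by simp
        also have "X3 x * X3 x ^ (c - 1) * X3 x ^ (2 * (b - 1)) = X3 x ^ (c + 2 * (b - 1))"
          using 5 by (cases c) (auto simp: power_add)
        also have "X2 x * X3 x ^ (c + 2 * (b - 1)) * ((- 1) ^ (b - 1) * p x) = N (\<lambda>x. 0) (\<lambda>x. 0) (\<lambda>x. 0) (\<lambda>x. (- 1) ^ (b - 1) * X3 x ^ (c + 2 * (b - 1) - (k - 3) div 2) * p x) x"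
          by (simp add: N_def pw[OF q])
        finally show ?thesis .
      qed
      moreover have "sm (\<lambda>x. (- 1) ^ (b - 1) * X3 x ^ (c + 2 * (b - 1) - (k - 3) div 2) * p x)"
        using p by (intro sm_mult sm_const sm_power sm_coord)
      ultimately show ?thesis using sm_const[of "0::real"] by blast
    qed
  qed
  have "J j F \<Longrightarrow> j = k \<Longrightarrow> \<exists>P Q R T. sm P \<and> sm Q \<and> sm R \<and> sm T \<and> ceq F (N P Q R T)" for j F
  proof (induction rule: J.induct)
    case (J_monomial P j a b c)
    then obtain P' Q R T where "sm P'" "sm Q" "sm R" "sm T"
      and eq: "\<forall>x\<in>C. X1 x ^ a * X2 x ^ b * X3 x ^ c * P x = N P' Q R T x"
      using mono[of P a b c] by blast
    moreover have "ceq (\<lambda>x. X1 x ^ a * X2 x ^ b * X3 x ^ c * P x) (N P' Q R T)"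
      by (rule ceqI) (use eq in blast)
    ultimately show ?case by blast
  next
    case (J_add j F G)
    obtain P Q R T where 1: "sm P" "sm Q" "sm R" "sm T" "ceq F (N P Q R T)"
      using J_add(3)[OF J_add(5)] by blast
    obtain P' Q' R' T' where 2: "sm P'" "sm Q'" "sm R'" "sm T'" "ceq G (N P' Q' R' T')"
      using J_add(4)[OF J_add(5)] by blast
    note * = 1(1-4) 2(1-4) 1(5) 2(5)
    have "ceq (\<lambda>x. F x + G x) (N (\<lambda>x. P x + P' x) (\<lambda>x. Q x + Q' x) (\<lambda>x. R x + R' x) (\<lambda>x. T x + T' x))"
      using *(9,10) unfolding ceq_def N_def by eventually_elim (auto simp: algebra_simps)
    then show ?case
      using sm_add[OF *(1,5)] sm_add[OF *(2,6)] sm_add[OF *(3,7)] sm_add[OF *(4,8)] by blast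
  next
    case (J_ceq j F G)
    then show ?case by (blast intro: ceq_trans)
  qed
  from this[OF assms refl] show ?thesis using that unfolding N_def by blast
qed

text \<open>Replace the coefficients in \<open>J_normal\<close> by their values at \<open>0\<close>;
  the differences vanish at \<open>0\<close> and raise the weight. A monomial whose exponent was
  rounded up has weight above \<open>k\<close> already, which does no harm.\<close>

lemma J_step:
  assumes "J k F"
  obtains p q r t where
    "J (k + 1) (\<lambda>x. F x - (p * X3 x ^ ((k + 1) div 2) + q * (X1 x * X3 x ^ ((k - 2) div 2)) +
       r * X2 x ^ ((k + 3) div 4) + t * (X2 x * X3 x ^ ((k - 3) div 2))))"
proof -
  obtain P Q R T where S: "sm P" "sm Q" "sm R" "sm T"
    "ceq F (\<lambda>x. X3 x ^ ((k + 1) div 2) * P x + X1 x * X3 x ^ ((k - 2) div 2) * Q x +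
       X2 x ^ ((k + 3) div 4) * R x + X2 x * X3 x ^ ((k - 3) div 2) * T x)"
    using J_normal[OF assms] by blast
  have d: "J 1 (\<lambda>x. P x - P 0)" if P: "sm P" for P
  proof -
    obtain F1 F2 F3 where F: "sm F1" "sm F2" "sm F3" "ceq P (\<lambda>x. P 0 + X1 x * F1 x + X2 x * F2 x + X3 x * F3 x)"
      using hadamard_C[OF P] by blast
    have "J 1 (\<lambda>x. X1 x * F1 x + X2 x * F2 x + X3 x * F3 x)"
      by (intro J_add J_mult_sm[OF J_antimono[OF J_X(1)]] J_mult_sm[OF J_antimono[OF J_X(2)]] J_mult_sm[OF J_antimono[OF J_X(3)]] F) auto
    then show ?thesis
      by (rule J_ceq) (use P F(4) in \<open>auto simp: ceq_def elim: eventually_mono\<close>)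
  qed
  have m: "J k (\<lambda>x. X3 x ^ ((k + 1) div 2))" "J k (\<lambda>x. X1 x * X3 x ^ ((k - 2) div 2))"
      "J k (\<lambda>x. X2 x ^ ((k + 3) div 4))" "J k (\<lambda>x. X2 x * X3 x ^ ((k - 3) div 2))"
    using J_monomial[of "\<lambda>x. 1" k 0 0 "(k + 1) div 2"] J_monomial[of "\<lambda>x. 1" k 1 0 "(k - 2) div 2"]
      J_monomial[of "\<lambda>x. 1" k 0 "(k + 3) div 4" 0] J_monomial[of "\<lambda>x. 1" k 0 1 "(k - 3) div 2"] by auto
  have "J (k + 1) (\<lambda>x. X3 x ^ ((k + 1) div 2) * (P x - P 0) + X1 x * X3 x ^ ((k - 2) div 2) * (Q x - Q 0) +
       X2 x ^ ((k + 3) div 4) * (R x - R 0) + X2 x * X3 x ^ ((k - 3) div 2) * (T x - T 0))"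
    by (intro J_add J_mult m d S)
  then have "J (k + 1) (\<lambda>x. F x - (P 0 * X3 x ^ ((k + 1) div 2) + Q 0 * (X1 x * X3 x ^ ((k - 2) div 2)) +
       R 0 * X2 x ^ ((k + 3) div 4) + T 0 * (X2 x * X3 x ^ ((k - 3) div 2))))"
    by (rule J_ceq)
       (use S(5) J_sm[OF assms] in \<open>auto intro!: sm_diff sm_add sm_mult sm_power simp: ceq_def algebra_simps elim: eventually_mono\<close>)
  then show ?thesis using that by blast
qed

subsection \<open>Forms of high weight are exact\<close>

text \<open>Total weight 12, with 2 for \<open>dX3\<close>. In the normal form of \<open>F\<close>,
  terms with a factor \<open>X1\<close> or \<open>X2 X3\<close> live on the cusp and are exact by
  \<open>exact_3e\<close> and \<open>exact_3o\<close>. The part \<open>X3^5 P dX3\<close> on the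
  line of \<open>X3\<close> is a form in one variable. The part \<open>X2^3 R dX3\<close> on the
  other line is integrated by parts, \<open>X3\<close> being zero there, and leaves terms with
  \<open>X3 X2^2 dX2\<close> that live on the cusp again.\<close>

lemma exact_J10: assumes "J 10 F" shows "exact (\<lambda>x v. F x * X3 v)"
proof -
  obtain P Q R T where S: "sm P" "sm Q" "sm R" "sm T"
    and F: "ceq F (\<lambda>x. X3 x ^ 5 * P x + X1 x * X3 x ^ 4 * Q x + X2 x ^ 3 * R x + X2 x * X3 x ^ 3 * T x)"
    by (rule J_normal[OF assms]) (rule that, assumption+, simp)
  obtain P1 P2 where P: "sm P1" "sm P2" "ceq P (\<lambda>x. P (axis_proj 3 x) + X1 x * P1 x + X2 x * P2 x)"
    using hadamard_axis3[OF S(1)] by blast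
  obtain R1 R3 where R: "sm R1" "sm R3" "ceq R (\<lambda>x. R (axis_proj 2 x) + X1 x * R1 x + X3 x * R3 x)"
    using hadamard_axis2[OF S(3)] by blast
  define r where "r x = fder R (axis_proj 2 x) (axis (e 2) 1)" for x
  have r: "sm r" unfolding r_def[abs_def] by (rule sm_axis_proj[OF sm_fder[OF S(3)]])
  define D where "D x v = X3 x ^ 5 * P (axis_proj 3 x) * X3 v + X1 x ^ 3 * X3 x * (X3 x * P1 x) * X3 v
      - X1 x ^ 2 * X3 x ^ 2 * (X3 x ^ 2 * P2 x) * X3 v + X1 x ^ 3 * X3 x * Q x * X3 v
      - X1 x ^ 3 * X3 x * (X3 x ^ 2 * R1 x) * X3 v - X1 x ^ 2 * X3 x ^ 2 * (X3 x ^ 2 * R3 x) * X3 v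
      - X1 x ^ 2 * X3 x ^ 2 * T x * X3 v
      + fder (\<lambda>x. X3 x * X2 x ^ 3 * R (axis_proj 2 x)) x v
      - X1 x ^ 2 * X3 x * (X3 x * (3 * R (axis_proj 2 x) + X2 x * r x)) * X2 v" for x v
  have p: "exact (\<lambda>x v. X3 x ^ 5 * P (axis_proj 3 x) * X3 v)"
    using exact_axis[OF sm_mult[OF sm_power[OF sm_coord[of "e 3"], of 5] S(1)], of 3] by (simp add: axis_proj_def)
  have "exact D"
    unfolding D_def
    by (intro exact_add exact_diff p exact_3o exact_3e exact_2e exact_fder sm_mult sm_power sm_add sm_coord sm_const S P R r sm_axis_proj)
  then show ?thesis
  proof (rule exact_cong)
    show "near x. x \<in> C \<longrightarrow> (\<forall>v. F x * X3 v = D x v)"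
      using F[unfolded ceq_def] P(3)[unfolded ceq_def] R(3)[unfolded ceq_def] axis_proj_has_derivative[OF S(3), of 2]
    proof eventually_elim
      case (elim x)
      show ?case
      proof (intro impI allI)
        fix v assume x: "x \<in> C"
        have Rd: "((\<lambda>x. R (axis_proj 2 x)) has_derivative (\<lambda>v. X2 v * r x)) (at x)"
          using elim(4) by (simp add: r_def)
        have d: "fder (\<lambda>x. X3 x * X2 x ^ 3 * R (axis_proj 2 x)) x v =
          X2 x ^ 3 * R (axis_proj 2 x) * X3 v + 3 * X3 x * X2 x ^ 2 * R (axis_proj 2 x) * X2 v + X3 x * X2 x ^ 3 * (X2 v * r x)"
          by (rule fder_eqI) (auto intro!: derivative_eq_intros Rd simp: algebra_simps)
        have Fx: "F x = X3 x ^ 5 * P x + X1 x * X3 x ^ 4 * Q x + X2 x ^ 3 * R x + X2 x * X3 x ^ 3 * T x" using elim x by blast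
        have Px: "P x = P (axis_proj 3 x) + X1 x * P1 x + X2 x * P2 x" using elim x by blast
        have Rx: "R x = R (axis_proj 2 x) + X1 x * R1 x + X3 x * R3 x" using elim x by blast
        show "F x * X3 v = D x v"
          unfolding D_def d Fx Px Rx using C_rel[OF x] by algebra
      qed
    qed
  qed
qed

text \<open>As \<open>exact_J10\<close> with the lines exchanged: \<open>X2^2 R dX2\<close> is the
  form in one variable and \<open>X3^4 P dX2\<close> is integrated by parts.\<close>

lemma exact_J8: assumes "J 8 F" shows "exact (\<lambda>x v. F x * X2 v)"
proof -
  obtain P Q R T where S: "sm P" "sm Q" "sm R" "sm T"
    and F: "ceq F (\<lambda>x. X3 x ^ 4 * P x + X1 x * X3 x ^ 3 * Q x + X2 x ^ 2 * R x + X2 x * X3 x ^ 2 * T x)"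
    by (rule J_normal[OF assms]) (rule that, assumption+, simp)
  obtain P1 P2 where P: "sm P1" "sm P2" "ceq P (\<lambda>x. P (axis_proj 3 x) + X1 x * P1 x + X2 x * P2 x)"
    using hadamard_axis3[OF S(1)] by blast
  obtain R1 R3 where R: "sm R1" "sm R3" "ceq R (\<lambda>x. R (axis_proj 2 x) + X1 x * R1 x + X3 x * R3 x)"
    using hadamard_axis2[OF S(3)] by blast
  define r where "r x = fder P (axis_proj 3 x) (axis (e 3) 1)" for x
  have r: "sm r" unfolding r_def[abs_def] by (rule sm_axis_proj[OF sm_fder[OF S(1)]])
  define D where "D x v = X2 x ^ 2 * R (axis_proj 2 x) * X2 v + X1 x ^ 3 * (X3 x * P1 x) * X2 v
      - X1 x ^ 2 * X3 x * (X3 x ^ 2 * P2 x) * X2 v + X1 x ^ 3 * Q x * X2 v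
      + X1 x ^ 3 * (X3 x * R1 x) * X2 v + X1 x ^ 2 * X3 x * (X3 x * R3 x) * X2 v
      - X1 x ^ 2 * X3 x * T x * X2 v
      + fder (\<lambda>x. X2 x * X3 x ^ 4 * P (axis_proj 3 x)) x v
      + X1 x ^ 2 * X3 x ^ 2 * (4 * P (axis_proj 3 x) + X3 x * r x) * X3 v" for x v
  have p: "exact (\<lambda>x v. X2 x ^ 2 * R (axis_proj 2 x) * X2 v)"
    using exact_axis[OF sm_mult[OF sm_power[OF sm_coord[of "e 2"], of 2] S(3)], of 2] by (simp add: axis_proj_def)
  have "exact D"
    unfolding D_def
    by (intro exact_add exact_diff p exact_2o exact_3e exact_2e exact_fder sm_mult sm_power sm_add sm_coord sm_const S P R r sm_axis_proj)
  then show ?thesis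
  proof (rule exact_cong)
    show "near x. x \<in> C \<longrightarrow> (\<forall>v. F x * X2 v = D x v)"
      using F[unfolded ceq_def] P(3)[unfolded ceq_def] R(3)[unfolded ceq_def] axis_proj_has_derivative[OF S(1), of 3]
    proof eventually_elim
      case (elim x)
      show ?case
      proof (intro impI allI)
        fix v assume x: "x \<in> C"
        have Pd: "((\<lambda>x. P (axis_proj 3 x)) has_derivative (\<lambda>v. X3 v * r x)) (at x)"
          using elim(4) by (simp add: r_def)
        have d: "fder (\<lambda>x. X2 x * X3 x ^ 4 * P (axis_proj 3 x)) x v =
          X3 x ^ 4 * P (axis_proj 3 x) * X2 v + 4 * X2 x * X3 x ^ 3 * P (axis_proj 3 x) * X3 v + X2 x * X3 x ^ 4 * (X3 v * r x)"
          by (rule fder_eqI) (auto intro!: derivative_eq_intros Pd simp: algebra_simps)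
        have Fx: "F x = X3 x ^ 4 * P x + X1 x * X3 x ^ 3 * Q x + X2 x ^ 2 * R x + X2 x * X3 x ^ 2 * T x" using elim x by blast
        have Px: "P x = P (axis_proj 3 x) + X1 x * P1 x + X2 x * P2 x" using elim x by blast
        have Rx: "R x = R (axis_proj 2 x) + X1 x * R1 x + X3 x * R3 x" using elim x by blast
        show "F x * X2 v = D x v"
          unfolding D_def d Fx Px Rx using C_rel[OF x] by algebra
      qed
    qed
  qed
qed

text \<open>Here both line parts are integrated by parts, since \<open>X1\<close> vanishes on either
  line.\<close>

lemma exact_J9: assumes "J 9 F" shows "exact (\<lambda>x v. F x * X1 v)"
proof -
  obtain P Q R T where S: "sm P" "sm Q" "sm R" "sm T"
    and F: "ceq F (\<lambda>x. X3 x ^ 5 * P x + X1 x * X3 x ^ 3 * Q x + X2 x ^ 3 * R x + X2 x * X3 x ^ 3 * T x)"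
    by (rule J_normal[OF assms]) (rule that, assumption+, simp)
  obtain P1 P2 where P: "sm P1" "sm P2" "ceq P (\<lambda>x. P (axis_proj 3 x) + X1 x * P1 x + X2 x * P2 x)"
    using hadamard_axis3[OF S(1)] by blast
  obtain R1 R3 where R: "sm R1" "sm R3" "ceq R (\<lambda>x. R (axis_proj 2 x) + X1 x * R1 x + X3 x * R3 x)"
    using hadamard_axis2[OF S(3)] by blast
  define p where "p x = fder P (axis_proj 3 x) (axis (e 3) 1)" for x
  have p: "sm p" unfolding p_def[abs_def] by (rule sm_axis_proj[OF sm_fder[OF S(1)]])
  define r where "r x = fder R (axis_proj 2 x) (axis (e 2) 1)" for x
  have r: "sm r" unfolding r_def[abs_def] by (rule sm_axis_proj[OF sm_fder[OF S(3)]])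
  define D where "D x v = X1 x ^ 3 * (X3 x ^ 2 * P1 x) * X1 v
      - X1 x ^ 2 * X3 x ^ 2 * (X3 x ^ 2 * P2 x) * X1 v + X1 x ^ 3 * Q x * X1 v
      - X1 x ^ 3 * (X3 x ^ 3 * R1 x) * X1 v - X1 x ^ 2 * X3 x ^ 2 * (X3 x ^ 2 * R3 x) * X1 v
      - X1 x ^ 2 * X3 x ^ 2 * T x * X1 v
      + fder (\<lambda>x. X1 x * X3 x ^ 5 * P (axis_proj 3 x)) x v
      + fder (\<lambda>x. X1 x * X2 x ^ 3 * R (axis_proj 2 x)) x v
      - X1 x ^ 3 * X3 x * (5 * P (axis_proj 3 x) + X3 x * p x) * X3 v
      - X1 x ^ 3 * (X3 x * (3 * R (axis_proj 2 x) + X2 x * r x)) * X2 v" for x v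
  have "exact D"
    unfolding D_def
    by (intro exact_add exact_diff exact_1o exact_1e exact_2o exact_3o exact_fder sm_mult sm_power sm_add sm_coord sm_const S P R p r sm_axis_proj)
  then show ?thesis
  proof (rule exact_cong)
    show "near x. x \<in> C \<longrightarrow> (\<forall>v. F x * X1 v = D x v)"
      using F[unfolded ceq_def] P(3)[unfolded ceq_def] R(3)[unfolded ceq_def] axis_proj_has_derivative[OF S(1), of 3]
         axis_proj_has_derivative[OF S(3), of 2]
    proof eventually_elim
      case (elim x)
      show ?case
      proof (intro impI allI)
        fix v assume x: "x \<in> C"
        have Pd: "((\<lambda>x. P (axis_proj 3 x)) has_derivative (\<lambda>v. X3 v * p x)) (at x)"
          using elim(4) by (simp add: p_def)
        have Rd: "((\<lambda>x. R (axis_proj 2 x)) has_derivative (\<lambda>v. X2 v * r x)) (at x)"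
          using elim(5) by (simp add: r_def)
        have d1: "fder (\<lambda>x. X1 x * X3 x ^ 5 * P (axis_proj 3 x)) x v =
          X3 x ^ 5 * P (axis_proj 3 x) * X1 v + 5 * X1 x * X3 x ^ 4 * P (axis_proj 3 x) * X3 v + X1 x * X3 x ^ 5 * (X3 v * p x)"
          by (rule fder_eqI) (auto intro!: derivative_eq_intros Pd simp: algebra_simps)
        have d2: "fder (\<lambda>x. X1 x * X2 x ^ 3 * R (axis_proj 2 x)) x v =
          X2 x ^ 3 * R (axis_proj 2 x) * X1 v + 3 * X1 x * X2 x ^ 2 * R (axis_proj 2 x) * X2 v + X1 x * X2 x ^ 3 * (X2 v * r x)"
          by (rule fder_eqI) (auto intro!: derivative_eq_intros Rd simp: algebra_simps)
        have Fx: "F x = X3 x ^ 5 * P x + X1 x * X3 x ^ 3 * Q x + X2 x ^ 3 * R x + X2 x * X3 x ^ 3 * T x" using elim x by blast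
        have Px: "P x = P (axis_proj 3 x) + X1 x * P1 x + X2 x * P2 x" using elim x by blast
        have Rx: "R x = R (axis_proj 2 x) + X1 x * R1 x + X3 x * R3 x" using elim x by blast
        show "F x * X1 v = D x v"
          unfolding D_def d1 d2 Fx Px Rx using C_rel[OF x] by algebra
      qed
    qed
  qed
qed

subsection \<open>The weight filtration on forms modulo exact forms\<close>

text \<open>Weight at least \<open>w\<close> modulo exact forms, the differentials carrying the
  weights 3, 4, 2 of their coordinates. Where the subtraction truncates to \<open>0\<close>, the
  coefficient is only asked to be smooth.\<close>

definition FF :: "nat \<Rightarrow> (real ^ 'm \<Rightarrow> real ^ 'm \<Rightarrow> real) \<Rightarrow> bool" where
  "FF w a \<longleftrightarrow> (\<exists>R1 R2 R3. J (w - 3) R1 \<and> J (w - 4) R2 \<and> J (w - 2) R3 \<and>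
     exact (\<lambda>x v. a x v - (R1 x * X1 v + R2 x * X2 v + R3 x * X3 v)))"

lemma FF_exact: "exact a \<Longrightarrow> FF w a"
  unfolding FF_def by (rule exI[of _ "\<lambda>x. 0"])+ (simp add: J_zero)

lemma FF_cong: assumes "FF w a" "exact (\<lambda>x v. b x v - a x v)" shows "FF w b"
proof -
  obtain R1 R2 R3 where R: "J (w - 3) R1" "J (w - 4) R2" "J (w - 2) R3"
     "exact (\<lambda>x v. a x v - (R1 x * X1 v + R2 x * X2 v + R3 x * X3 v))"
    using assms(1) by (auto simp: FF_def)
  have "exact (\<lambda>x v. b x v - (R1 x * X1 v + R2 x * X2 v + R3 x * X3 v))"
    by (rule exact_congC[OF exact_add[OF assms(2) R(4)]]) simp
  then show ?thesis using R(1-3) by (auto simp: FF_def)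
qed

lemma FF_congC: "FF w a \<Longrightarrow> (\<And>x v. x \<in> C \<Longrightarrow> b x v = a x v) \<Longrightarrow> FF w b"
  by (erule FF_cong) (rule exact_congC[OF exact_0], simp)

lemma FF_add: assumes "FF w a" "FF w b" shows "FF w (\<lambda>x v. a x v + b x v)"
proof -
  obtain R1 R2 R3 where R: "J (w - 3) R1" "J (w - 4) R2" "J (w - 2) R3"
     "exact (\<lambda>x v. a x v - (R1 x * X1 v + R2 x * X2 v + R3 x * X3 v))"
    using assms(1) by (auto simp: FF_def)
  obtain S1 S2 S3 where S: "J (w - 3) S1" "J (w - 4) S2" "J (w - 2) S3"
     "exact (\<lambda>x v. b x v - (S1 x * X1 v + S2 x * X2 v + S3 x * X3 v))"
    using assms(2) by (auto simp: FF_def)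
  have "exact (\<lambda>x v. a x v + b x v - ((R1 x + S1 x) * X1 v + (R2 x + S2 x) * X2 v + (R3 x + S3 x) * X3 v))"
    by (rule exact_congC[OF exact_add[OF R(4) S(4)]]) (simp add: algebra_simps)
  then show ?thesis
    unfolding FF_def using J_add[OF R(1) S(1)] J_add[OF R(2) S(2)] J_add[OF R(3) S(3)] by blast
qed

lemma FF_cmult: assumes "FF w a" shows "FF w (\<lambda>x v. c * a x v)"
proof -
  obtain R1 R2 R3 where R: "J (w - 3) R1" "J (w - 4) R2" "J (w - 2) R3"
     "exact (\<lambda>x v. a x v - (R1 x * X1 v + R2 x * X2 v + R3 x * X3 v))"
    using assms(1) by (auto simp: FF_def)
  have "exact (\<lambda>x v. c * a x v - (c * R1 x * X1 v + c * R2 x * X2 v + c * R3 x * X3 v))"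
    by (rule exact_congC[OF exact_cmult[OF R(4), of c]]) (simp add: algebra_simps)
  then show ?thesis
    unfolding FF_def using J_cmult[OF R(1), of c] J_cmult[OF R(2), of c] J_cmult[OF R(3), of c] by blast
qed

lemma FF_sum: "finite I \<Longrightarrow> (\<And>i. i \<in> I \<Longrightarrow> FF w (a i)) \<Longrightarrow> FF w (\<lambda>x v. \<Sum>i\<in>I. a i x v)"
  by (induction I rule: finite_induct) (auto intro: FF_exact[OF exact_0] FF_add)

lemma FF_antimono: "FF w a \<Longrightarrow> w' \<le> w \<Longrightarrow> FF w' a"
  unfolding FF_def
  by (elim exE conjE, intro exI conjI, assumption?)
     (erule J_antimono, simp, erule J_antimono, simp, erule J_antimono, simp, assumption)

lemma FF_X1: assumes "J k R" "w \<le> k + 3" shows "FF w (\<lambda>x v. R x * X1 v)"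
  unfolding FF_def
  by (rule exI[of _ R], (rule exI[of _ "\<lambda>x. 0"])+)
     (use J_antimono[OF assms(1), of "w - 3"] assms(2) in \<open>simp add: J_zero exact_0\<close>)

lemma FF_X2: assumes "J k R" "w \<le> k + 4" shows "FF w (\<lambda>x v. R x * X2 v)"
  unfolding FF_def
  by (rule exI[of _ "\<lambda>x. 0"], rule exI[of _ R], rule exI[of _ "\<lambda>x. 0"])
     (use J_antimono[OF assms(1), of "w - 4"] assms(2) in \<open>simp add: J_zero exact_0\<close>)

lemma FF_X3: assumes "J k R" "w \<le> k + 2" shows "FF w (\<lambda>x v. R x * X3 v)"
  unfolding FF_def
  by (rule exI[of _ "\<lambda>x. 0"], rule exI[of _ "\<lambda>x. 0"], rule exI[of _ R])
     (use J_antimono[OF assms(1), of "w - 2"] assms(2) in \<open>simp add: J_zero exact_0\<close>)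

lemma exact_transversal: "sm H \<Longrightarrow> j \<in> e ` {4..2*n} \<Longrightarrow> exact (\<lambda>x v. H x * v $ j)"
  using exact_fder_vanish[of H "\<lambda>x. x $ j"] ceqI[of "\<lambda>x. x $ j" "\<lambda>x. 0"] C_zero by auto

lemma fder_expand:
  fixes F :: "real ^ 'm \<Rightarrow> real"
  assumes "F differentiable (at x)"
  shows "fder F x v = (\<Sum>j\<in>UNIV. fder F x (axis j 1) * v $ j)"
proof -
  have "fder F x v = fder F x (\<Sum>j\<in>UNIV. v $ j *\<^sub>R axis j 1)"
    by (subst basis_expansion[of v, symmetric]) (simp only: scalar_mult_eq_scaleR)
  then show ?thesis
    using linear_fder[OF assms] by (simp add: linear_sum linear_scale mult.commute)
qed

lemma FF_covector:
  assumes "\<And>j. sm (R j)" "J (w - 3) (R (e 1))" "J (w - 4) (R (e 2))" "J (w - 2) (R (e 3))"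
  shows "FF w (\<lambda>x v. \<Sum>j\<in>UNIV. R j x * v $ j)"
proof -
  have "exact (\<lambda>x v. \<Sum>j\<in>e ` {4..2*n}. R j x * v $ j)"
    by (intro exact_sum exact_transversal assms) auto
  then have "exact (\<lambda>x v. (\<Sum>j\<in>UNIV. R j x * v $ j) - (R (e 1) x * X1 v + R (e 2) x * X2 v + R (e 3) x * X3 v))"
    by (rule exact_congC) (simp add: sum_UNIV_split)
  then show ?thesis using assms(2-4) by (auto simp: FF_def)
qed

lemma exact_leibniz:
  assumes "sm F" "sm G" "sm H"
  shows "exact (\<lambda>x v. F x * fder (\<lambda>x. G x * H x) x v - (F x * G x * fder H x v + F x * H x * fder G x v))"
  by (rule exact_cong[OF exact_0])
     (use sm_differentiable[OF assms(2)] sm_differentiable[OF assms(3)] in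
       \<open>eventually_elim, simp add: fder_mult algebra_simps\<close>)

text \<open>Induction on the generation of \<open>J l G\<close>: generators by the product rule, and
  equality on the curve by \<open>fd_ceq\<close>.\<close>

lemma FF_fd:
  assumes "J k F" "J l G"
  shows "FF (k + l) (\<lambda>x v. F x * fder G x v)"
proof -
  \<comment> \<open>Quantifying over all coefficients \<open>F\<close> makes the property
    multiplicative: in \<open>F d(G H) = F G dH + F H dG\<close> each factor joins the coefficient
    of the other.\<close>
  define Q where "Q l G \<longleftrightarrow> J l G \<and> (\<forall>k F. J k F \<longrightarrow> FF (k + l) (\<lambda>x v. F x * fder G x v))" for l G
  have Q_mult: "Q (l + l') (\<lambda>x. G x * H x)" if "Q l G" "Q l' H" for l l' G H
    unfolding Q_def
  proof (intro conjI allI impI)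
    show "J (l + l') (\<lambda>x. G x * H x)" using that J_mult by (auto simp: Q_def)
    fix k F assume F: "J k F"
    have G: "J l G" and H: "J l' H" using that by (auto simp: Q_def)
    have "FF (k + l + l') (\<lambda>x v. F x * G x * fder H x v)"
      using that(2) J_mult[OF F G] by (auto simp: Q_def)
    moreover have "FF (k + l' + l) (\<lambda>x v. F x * H x * fder G x v)"
      using that(1) J_mult[OF F H] by (auto simp: Q_def)
    ultimately have "FF (k + (l + l')) (\<lambda>x v. F x * G x * fder H x v + F x * H x * fder G x v)"
      by (intro FF_add) (auto simp: algebra_simps)
    then show "FF (k + (l + l')) (\<lambda>x v. F x * fder (\<lambda>x. G x * H x) x v)"
      by (rule FF_cong) (rule exact_leibniz[OF J_sm[OF F] J_sm[OF G] J_sm[OF H]])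
  qed
  have Q0: "Q 0 P" if P: "sm P" for P
    unfolding Q_def
  proof (intro conjI allI impI)
    show "J 0 P" by (rule J_0[OF P])
    fix k F assume F: "J k F"
    have "FF k (\<lambda>x v. \<Sum>j\<in>UNIV. (F x * fder P x (axis j 1)) * v $ j)"
      by (rule FF_covector)
         (intro sm_mult J_sm[OF F] sm_fder P, (rule J_antimono[OF J_mult_sm[OF F sm_fder[OF P]]], simp)+)
    then have "FF (k + 0) (\<lambda>x v. \<Sum>j\<in>UNIV. (F x * fder P x (axis j 1)) * v $ j)" by simp
    then show "FF (k + 0) (\<lambda>x v. F x * fder P x v)"
    proof (rule FF_cong, intro exact_cong[OF exact_0])
      show "near x. x \<in> C \<longrightarrow> (\<forall>v. F x * fder P x v - (\<Sum>j\<in>UNIV. F x * fder P x (axis j 1) * v $ j) = 0)"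
        using sm_differentiable[OF P]
      proof eventually_elim
        case (elim x)
        have "F x * fder P x v = (\<Sum>j\<in>UNIV. F x * fder P x (axis j 1) * v $ j)" for v
          unfolding fder_expand[OF elim, of v] by (simp only: sum_distrib_left mult.assoc)
        from eq_iff_diff_eq_0[THEN iffD1, OF this] show ?case by blast
      qed
    qed
  qed
  have Q_power: "Q (a * l) (\<lambda>x. G x ^ a)" if "Q l G" for a l G
  proof (induction a)
    case (Suc a)
    then show ?case using Q_mult[OF that Suc] by simp
  qed (use Q0[of "\<lambda>x. 1"] in simp)
  have QX: "Q 3 (\<lambda>x. X1 x)" "Q 4 (\<lambda>x. X2 x)" "Q 2 (\<lambda>x. X3 x)"
    unfolding Q_def using J_X FF_X1 FF_X2 FF_X3 by auto
  have "Q l G"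
    using assms(2)
  proof (induction rule: J.induct)
    case (J_monomial P k a b c)
    have q: "Q (a * 3 + b * 4 + c * 2 + 0) (\<lambda>x. X1 x ^ a * X2 x ^ b * X3 x ^ c * P x)"
      by (intro Q_mult Q_power QX Q0 J_monomial)
    show ?case
      unfolding Q_def
    proof (intro conjI allI impI)
      show "J k (\<lambda>x. X1 x ^ a * X2 x ^ b * X3 x ^ c * P x)" by (rule J.J_monomial[OF J_monomial])
      fix j F assume "J j F"
      then have "FF (j + (a * 3 + b * 4 + c * 2 + 0)) (\<lambda>x v. F x * fder (\<lambda>x. X1 x ^ a * X2 x ^ b * X3 x ^ c * P x) x v)"
        using q unfolding Q_def by blast
      then show "FF (j + k) (\<lambda>x v. F x * fder (\<lambda>x. X1 x ^ a * X2 x ^ b * X3 x ^ c * P x) x v)"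
        by (rule FF_antimono) (use J_monomial(2) in simp)
    qed
  next
    case (J_add k G H)
    show ?case
      unfolding Q_def
    proof (intro conjI allI impI)
      show "J k (\<lambda>x. G x + H x)" by (rule J.J_add[OF J_add(1,2)])
      fix j F assume "J j F"
      then have "FF (j + k) (\<lambda>x v. F x * fder G x v + F x * fder H x v)"
        using J_add(3,4) by (auto simp: Q_def intro: FF_add)
      then show "FF (j + k) (\<lambda>x v. F x * fder (\<lambda>x. G x + H x) x v)"
      proof (rule FF_cong, intro exact_cong[OF exact_0])
        show "near x. x \<in> C \<longrightarrow> (\<forall>v. F x * fder (\<lambda>x. G x + H x) x v - (F x * fder G x v + F x * fder H x v) = 0)"
          using sm_differentiable[OF J_sm[OF J_add(1)]] sm_differentiable[OF J_sm[OF J_add(2)]]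
          by eventually_elim (simp add: fder_add algebra_simps)
      qed
    qed
  next
    case (J_ceq k G H)
    show ?case
      unfolding Q_def
    proof (intro conjI allI impI)
      show "J k H" by (rule J.J_ceq[OF J_ceq(1-3)])
      fix j F assume F: "J j F"
      then have "FF (j + k) (\<lambda>x v. F x * fder G x v)"
        using J_ceq(4) by (auto simp: Q_def)
      then show "FF (j + k) (\<lambda>x v. F x * fder H x v)"
        by (rule FF_cong)
           (rule fd_ceq[OF J_sm[OF F] J_sm[OF F] J_ceq(2) J_sm[OF J_ceq(1)] ceq_refl J_ceq(3)])
    qed
  qed
  then show ?thesis using assms(1) by (auto simp: Q_def)
qed

text \<open>The indices are \<open>9 + 3 = 8 + 4 = 10 + 2 = 12\<close>.\<close>

lemma FF_12: "FF 12 a \<Longrightarrow> exact a"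
proof -
  assume "FF 12 a"
  then obtain R1 R2 R3 where R: "J 9 R1" "J 8 R2" "J 10 R3"
     "exact (\<lambda>x v. a x v - (R1 x * X1 v + R2 x * X2 v + R3 x * X3 v))"
    by (auto simp: FF_def)
  show ?thesis
    by (rule exact_congC[OF exact_add[OF R(4) exact_add[OF exact_add[OF exact_J9[OF R(1)] exact_J8[OF R(2)]] exact_J10[OF R(3)]]]]) simp
qed

lemma exact_dm:
  "exact (\<lambda>x v. of_nat a * X1 x ^ (a - 1) * X2 x ^ b * X3 x ^ c * X1 v +
     of_nat b * X1 x ^ a * X2 x ^ (b - 1) * X3 x ^ c * X2 v + of_nat c * X1 x ^ a * X2 x ^ b * X3 x ^ (c - 1) * X3 v)"
proof -
  have d: "fder (\<lambda>x. X1 x ^ a * X2 x ^ b * X3 x ^ c) x v = of_nat a * X1 x ^ (a - 1) * X2 x ^ b * X3 x ^ c * X1 v +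
     of_nat b * X1 x ^ a * X2 x ^ (b - 1) * X3 x ^ c * X2 v + of_nat c * X1 x ^ a * X2 x ^ b * X3 x ^ (c - 1) * X3 v" for x v
    by (rule fder_eqI) (auto intro!: derivative_eq_intros simp: algebra_simps)
  have "exact (fder (\<lambda>x. X1 x ^ a * X2 x ^ b * X3 x ^ c))"
    by (intro exact_fder sm_mult sm_power sm_coord)
  then show ?thesis unfolding d[symmetric] by simp
qed

lemma exact_combo1: "exact a \<Longrightarrow> (\<And>x v. x \<in> C \<Longrightarrow> t x v = k * a x v) \<Longrightarrow> exact t"
  by (rule exact_congC[OF exact_cmult])

lemma exact_combo2: "exact a \<Longrightarrow> exact b \<Longrightarrow> (\<And>x v. x \<in> C \<Longrightarrow> t x v = k * a x v + l * b x v) \<Longrightarrow> exact t"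
  by (rule exact_congC[OF exact_add[OF exact_cmult exact_cmult]])

lemma exact_combo3: "exact a \<Longrightarrow> exact b \<Longrightarrow> exact c \<Longrightarrow> (\<And>x v. x \<in> C \<Longrightarrow> t x v = k * a x v + l * b x v + m * c x v) \<Longrightarrow> exact t"
  by (rule exact_congC[OF exact_add[OF exact_add[OF exact_cmult exact_cmult] exact_cmult]])

text \<open>A basis of the one-forms modulo exact ones.\<close>

definition B :: "nat \<Rightarrow> real ^ 'm \<Rightarrow> real ^ 'm \<Rightarrow> real" where
  "B i x v = (if i = 1 then X1 x * X3 v else if i = 2 then X2 x * X3 v else if i = 3 then X1 x * X2 v
     else if i = 4 then X1 x * X3 x * X3 v else if i = 5 then X1 x ^ 2 * X3 v
     else if i = 6 then X1 x * X3 x ^ 2 * X3 v else if i = 7 then X1 x ^ 2 * X3 x * X3 v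
     else X1 x * X3 x ^ 3 * X3 v)"

lemma B_simps [simp]:
  "B 1 x v = X1 x * X3 v" "B 2 x v = X2 x * X3 v" "B 3 x v = X1 x * X2 v" "B 4 x v = X1 x * X3 x * X3 v"
  "B 5 x v = X1 x ^ 2 * X3 v" "B 6 x v = X1 x * X3 x ^ 2 * X3 v" "B 7 x v = X1 x ^ 2 * X3 x * X3 v"
  "B 8 x v = X1 x * X3 x ^ 3 * X3 v"
  by (simp_all add: B_def)

definition wt :: "nat \<Rightarrow> nat" where
  "wt i = (if i \<le> 3 then i + 4 else i + 3)"

section \<open>Reduction of monomial forms of weight at most 11 to the basis\<close>

lemma red_X3X1: "exact (\<lambda>x v. X3 x * X1 v - (-1) * B 1 x v)"
  by (rule exact_combo1[OF exact_dm[of 1 0 1], of _ 1]) simp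
lemma red_X1X1: "exact (\<lambda>x v. X1 x * X1 v)"
  by (rule exact_combo1[OF exact_dm[of 2 0 0], of _ "1/2"]) simp
lemma red_X3X2: "exact (\<lambda>x v. X3 x * X2 v - (-1) * B 2 x v)"
  by (rule exact_combo1[OF exact_dm[of 0 1 1], of _ 1]) simp
lemma red_X3X3: "exact (\<lambda>x v. X3 x ^ c * X3 v)"
  by (rule exact_combo1[OF exact_dm[of 0 0 "c + 1"], of _ "1 / of_nat (c + 1)"]) simp
text \<open>The names list the coefficient and then the coordinate differentiated, an exponent
  following its coordinate: this one is \<open>X3^2 dX1\<close>. All are combinations of
  differentials of monomials, of \<open>rel_g\<close>, and of earlier reductions, up to forms
  vanishing on the curve.\<close>

lemma red_X32X1: "exact (\<lambda>x v. X3 x ^ 2 * X1 v - (-2) * B 4 x v)"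
  by (rule exact_combo1[OF exact_dm[of 1 0 2], of _ 1]) simp
lemma red_X2X1: "exact (\<lambda>x v. X2 x * X1 v - (-1) * B 3 x v)"
  by (rule exact_combo1[OF exact_dm[of 1 1 0], of _ 1]) simp
lemma red_X1X3X1: "exact (\<lambda>x v. X1 x * X3 x * X1 v - (-1/2) * B 5 x v)"
  by (rule exact_combo1[OF exact_dm[of 2 0 1], of _ "1/2"]) (simp add: algebra_simps)
lemma red_X32X2: "exact (\<lambda>x v. X3 x ^ 2 * X2 v - 2 * B 5 x v)"
  by (rule exact_combo1[OF exact_dm[of 0 1 2], of _ 1]) (simp, drule C_rel(1), algebra)
lemma red_X2X2: "exact (\<lambda>x v. X2 x * X2 v)"
  by (rule exact_combo1[OF exact_dm[of 0 2 0], of _ "1/2"]) simp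
lemma red_X2X3X3: "exact (\<lambda>x v. X2 x * X3 x * X3 v - (-1) * B 5 x v)"
  by (rule exact_congC[OF exact_0]) (simp, drule C_rel(1), algebra)
lemma red_X33X1: "exact (\<lambda>x v. X3 x ^ 3 * X1 v - (-3) * B 6 x v)"
  by (rule exact_combo1[OF exact_dm[of 1 0 3], of _ 1]) simp
lemma red_X2X3X1: "exact (\<lambda>x v. X2 x * X3 x * X1 v)"
  by (rule exact_combo1[OF exact_dm[of 3 0 0], of _ "-1/3"]) (simp, drule C_rel(1), algebra)
lemma red_X1X3X2: "exact (\<lambda>x v. X1 x * X3 x * X2 v - 1 * B 6 x v)"
  by (rule exact_combo3[OF rel_g[OF sm_coord[of "e 3"]] exact_dm[of 1 0 3] exact_dm[of 3 0 0], of _ 1 "-1" "1/3"])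
     (simp, drule C_rel(1), algebra)
lemma red_X1X32X1: "exact (\<lambda>x v. X1 x * X3 x ^ 2 * X1 v - (-1) * B 7 x v)"
  by (rule exact_combo1[OF exact_dm[of 2 0 2], of _ "1/2"]) (simp add: algebra_simps)
lemma red_X33X2: "exact (\<lambda>x v. X3 x ^ 3 * X2 v - 3 * B 7 x v)"
  by (rule exact_combo1[OF exact_dm[of 0 1 3], of _ 1]) (simp, drule C_rel(1), algebra)
lemma red_X2X3X2: "exact (\<lambda>x v. X2 x * X3 x * X2 v - 2 * B 7 x v)"
  by (rule exact_combo1[OF rel_g[OF sm_coord[of "e 1"]], of _ "-1"]) (simp, frule C_rel(1), drule C_rel(2), algebra)
lemma red_X22X3: "exact (\<lambda>x v. X2 x ^ 2 * X3 v - (-4) * B 7 x v)"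
  by (rule exact_combo2[OF exact_dm[of 0 2 1] red_X2X3X2, of _ 1 "-2"]) simp
lemma red_X2X32X3: "exact (\<lambda>x v. X2 x * X3 x ^ 2 * X3 v - (-1) * B 7 x v)"
  by (rule exact_congC[OF exact_0]) (simp, drule C_rel(1), algebra)
lemma red_X34X1: "exact (\<lambda>x v. X3 x ^ 4 * X1 v - (-4) * B 8 x v)"
  by (rule exact_combo1[OF exact_dm[of 1 0 4], of _ 1]) simp
lemma red_X2X32X1: "exact (\<lambda>x v. X2 x * X3 x ^ 2 * X1 v - (1/3) * B 8 x v)"
  by (rule exact_combo1[OF exact_dm[of 3 0 1], of _ "-1/3"]) (simp, frule C_rel(1), drule C_rel(2), algebra)
lemma red_X1X32X2: "exact (\<lambda>x v. X1 x * X3 x ^ 2 * X2 v - (5/3) * B 8 x v)"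
  by (rule exact_combo3[OF rel_g[OF sm_power[OF sm_coord[of "e 3"], of 2]] red_X2X32X1 red_X34X1, of _ 1 "-1" "-1"])
     (simp only: B_simps, algebra)
lemma red_X22X1: "exact (\<lambda>x v. X2 x ^ 2 * X1 v - (10/3) * B 8 x v)"
  by (rule exact_combo2[OF exact_dm[of 1 2 0] red_X1X32X2, of _ 1 2]) (simp, frule C_rel(1), drule C_rel(2), algebra)

text \<open>One step of the expansion in \<open>FF_crd\<close>: up to higher weight the form is
  spanned by basis elements of weight exactly \<open>w\<close>.\<close>

definition D :: "nat \<Rightarrow> (real ^ 'm \<Rightarrow> real ^ 'm \<Rightarrow> real) \<Rightarrow> bool" where
  "D w a \<longleftrightarrow> (\<exists>c. (\<forall>i. wt i \<noteq> w \<longrightarrow> c i = 0) \<and> FF (w + 1) (\<lambda>x v. a x v - (\<Sum>i=1..8. c i * B i x v)))"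

lemma D_FF: "FF (w + 1) a \<Longrightarrow> D w a"
  unfolding D_def by (rule exI[of _ "\<lambda>i. 0"]) simp

lemma D_exact: "exact a \<Longrightarrow> D w a"
  by (rule D_FF) (rule FF_exact)

lemma sum_single_B:
  assumes "i \<in> {1..8}"
  shows "(\<Sum>j=1..8. (if j = i then k else 0) * B j x v) = k * B i x v"
proof -
  have "(\<Sum>j=1..8. (if j = i then k else 0) * B j x v) = (\<Sum>j=1..8. if j = i then k * B j x v else 0)"
    by (rule sum.cong) auto
  then show ?thesis using assms by simp
qed

lemma D_B: "exact (\<lambda>x v. a x v - k * B i x v) \<Longrightarrow> i \<in> {1..8} \<Longrightarrow> wt i = w \<Longrightarrow> D w a"
  unfolding D_def
  by (rule exI[of _ "\<lambda>j. if j = i then k else 0"]) (auto simp: sum_single_B intro: FF_exact)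

lemma D_add: assumes "D w a" "D w b" shows "D w (\<lambda>x v. a x v + b x v)"
proof -
  obtain c d where c: "\<forall>i. wt i \<noteq> w \<longrightarrow> c i = 0" "FF (w + 1) (\<lambda>x v. a x v - (\<Sum>i=1..8. c i * B i x v))"
    and d: "\<forall>i. wt i \<noteq> w \<longrightarrow> d i = 0" "FF (w + 1) (\<lambda>x v. b x v - (\<Sum>i=1..8. d i * B i x v))"
    using assms by (auto simp: D_def)
  have "FF (w + 1) (\<lambda>x v. a x v + b x v - (\<Sum>i=1..8. (c i + d i) * B i x v))"
    by (rule FF_congC[OF FF_add[OF c(2) d(2)]]) (simp add: sum.distrib algebra_simps)
  then show ?thesis unfolding D_def using c(1) d(1) by (intro exI[of _ "\<lambda>i. c i + d i"]) auto
qed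

lemma D_cmult: assumes "D w a" shows "D w (\<lambda>x v. k * a x v)"
proof -
  obtain c where c: "\<forall>i. wt i \<noteq> w \<longrightarrow> c i = 0" "FF (w + 1) (\<lambda>x v. a x v - (\<Sum>i=1..8. c i * B i x v))"
    using assms by (auto simp: D_def)
  have "FF (w + 1) (\<lambda>x v. k * a x v - (\<Sum>i=1..8. (k * c i) * B i x v))"
    by (rule FF_congC[OF FF_cmult[OF c(2), of k]]) (simp add: sum_distrib_left algebra_simps)
  then show ?thesis unfolding D_def using c(1) by (intro exI[of _ "\<lambda>i. k * c i"]) auto
qed

lemma D_cong: assumes "D w a" "FF (w + 1) (\<lambda>x v. b x v - a x v)" shows "D w b"
  by (rule D_add[OF assms(1) D_FF[OF assms(2)], simplified])

lemma D_X1: "J k R \<Longrightarrow> w < k + 3 \<Longrightarrow> D w (\<lambda>x v. R x * X1 v)"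
  by (rule D_FF) (erule FF_X1, simp)

lemma D_X2: "J k R \<Longrightarrow> w < k + 4 \<Longrightarrow> D w (\<lambda>x v. R x * X2 v)"
  by (rule D_FF) (erule FF_X2, simp)

lemma D_X3: "J k R \<Longrightarrow> w < k + 2 \<Longrightarrow> D w (\<lambda>x v. R x * X3 v)"
  by (rule D_FF) (erule FF_X3, simp)

lemma J_m: "J (2 * c) (\<lambda>x. X3 x ^ c)" "J (2 * c + 3) (\<lambda>x. X1 x * X3 x ^ c)"
    "J (4 * b) (\<lambda>x. X2 x ^ b)" "J (2 * c + 4) (\<lambda>x. X2 x * X3 x ^ c)"
  using J_monomial[of "\<lambda>x. 1" "2 * c" 0 0 c] J_monomial[of "\<lambda>x. 1" "2 * c + 3" 1 0 c]
    J_monomial[of "\<lambda>x. 1" "4 * b" 0 b 0] J_monomial[of "\<lambda>x. 1" "2 * c + 4" 0 1 c] by auto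

text \<open>By \<open>J_step\<close> each of the three coefficients has four leading monomials
  modulo higher weight, so these twelve monomial forms are all that has to be checked.\<close>

lemma FF_imp_D:
  assumes "FF w a"
    and "D w (\<lambda>x v. X3 x ^ ((w - 3 + 1) div 2) * X1 v)" "D w (\<lambda>x v. X1 x * X3 x ^ ((w - 3 - 2) div 2) * X1 v)"
      "D w (\<lambda>x v. X2 x ^ ((w - 3 + 3) div 4) * X1 v)" "D w (\<lambda>x v. X2 x * X3 x ^ ((w - 3 - 3) div 2) * X1 v)"
    and "D w (\<lambda>x v. X3 x ^ ((w - 4 + 1) div 2) * X2 v)" "D w (\<lambda>x v. X1 x * X3 x ^ ((w - 4 - 2) div 2) * X2 v)"
      "D w (\<lambda>x v. X2 x ^ ((w - 4 + 3) div 4) * X2 v)" "D w (\<lambda>x v. X2 x * X3 x ^ ((w - 4 - 3) div 2) * X2 v)"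
    and "D w (\<lambda>x v. X3 x ^ ((w - 2 + 1) div 2) * X3 v)" "D w (\<lambda>x v. X1 x * X3 x ^ ((w - 2 - 2) div 2) * X3 v)"
      "D w (\<lambda>x v. X2 x ^ ((w - 2 + 3) div 4) * X3 v)" "D w (\<lambda>x v. X2 x * X3 x ^ ((w - 2 - 3) div 2) * X3 v)"
  shows "D w a"
proof -
  obtain R1 R2 R3 where R: "J (w - 3) R1" "J (w - 4) R2" "J (w - 2) R3"
     "exact (\<lambda>x v. a x v - (R1 x * X1 v + R2 x * X2 v + R3 x * X3 v))"
    using assms(1) by (auto simp: FF_def)
  obtain p1 q1 r1 t1 where 1: "J (w - 3 + 1) (\<lambda>x. R1 x - (p1 * X3 x ^ ((w - 3 + 1) div 2) + q1 * (X1 x * X3 x ^ ((w - 3 - 2) div 2)) +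
       r1 * X2 x ^ ((w - 3 + 3) div 4) + t1 * (X2 x * X3 x ^ ((w - 3 - 3) div 2))))"
    using J_step[OF R(1)] by blast
  obtain p2 q2 r2 t2 where 2: "J (w - 4 + 1) (\<lambda>x. R2 x - (p2 * X3 x ^ ((w - 4 + 1) div 2) + q2 * (X1 x * X3 x ^ ((w - 4 - 2) div 2)) +
       r2 * X2 x ^ ((w - 4 + 3) div 4) + t2 * (X2 x * X3 x ^ ((w - 4 - 3) div 2))))"
    using J_step[OF R(2)] by blast
  obtain p3 q3 r3 t3 where 3: "J (w - 2 + 1) (\<lambda>x. R3 x - (p3 * X3 x ^ ((w - 2 + 1) div 2) + q3 * (X1 x * X3 x ^ ((w - 2 - 2) div 2)) +
       r3 * X2 x ^ ((w - 2 + 3) div 4) + t3 * (X2 x * X3 x ^ ((w - 2 - 3) div 2))))"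
    using J_step[OF R(3)] by blast
  have "D w (\<lambda>x v. p1 * (X3 x ^ ((w - 3 + 1) div 2) * X1 v) + q1 * (X1 x * X3 x ^ ((w - 3 - 2) div 2) * X1 v) +
       r1 * (X2 x ^ ((w - 3 + 3) div 4) * X1 v) + t1 * (X2 x * X3 x ^ ((w - 3 - 3) div 2) * X1 v) +
      (p2 * (X3 x ^ ((w - 4 + 1) div 2) * X2 v) + q2 * (X1 x * X3 x ^ ((w - 4 - 2) div 2) * X2 v) +
       r2 * (X2 x ^ ((w - 4 + 3) div 4) * X2 v) + t2 * (X2 x * X3 x ^ ((w - 4 - 3) div 2) * X2 v)) +
      (p3 * (X3 x ^ ((w - 2 + 1) div 2) * X3 v) + q3 * (X1 x * X3 x ^ ((w - 2 - 2) div 2) * X3 v) +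
       r3 * (X2 x ^ ((w - 2 + 3) div 4) * X3 v) + t3 * (X2 x * X3 x ^ ((w - 2 - 3) div 2) * X3 v)))"
    by (intro D_add D_cmult assms(2-))
  moreover have "FF (w + 1) (\<lambda>x v. (R1 x - (p1 * X3 x ^ ((w - 3 + 1) div 2) + q1 * (X1 x * X3 x ^ ((w - 3 - 2) div 2)) +
       r1 * X2 x ^ ((w - 3 + 3) div 4) + t1 * (X2 x * X3 x ^ ((w - 3 - 3) div 2)))) * X1 v +
      (R2 x - (p2 * X3 x ^ ((w - 4 + 1) div 2) + q2 * (X1 x * X3 x ^ ((w - 4 - 2) div 2)) +
       r2 * X2 x ^ ((w - 4 + 3) div 4) + t2 * (X2 x * X3 x ^ ((w - 4 - 3) div 2)))) * X2 v +
      (R3 x - (p3 * X3 x ^ ((w - 2 + 1) div 2) + q3 * (X1 x * X3 x ^ ((w - 2 - 2) div 2)) +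
       r3 * X2 x ^ ((w - 2 + 3) div 4) + t3 * (X2 x * X3 x ^ ((w - 2 - 3) div 2)))) * X3 v)"
    by (intro FF_add FF_X1[OF 1] FF_X2[OF 2] FF_X3[OF 3]) auto
  ultimately have "D w (\<lambda>x v. R1 x * X1 v + R2 x * X2 v + R3 x * X3 v)"
    by (rule D_cong[OF _ FF_congC]) (simp add: algebra_simps)
  then show ?thesis by (rule D_cong) (rule FF_exact[OF R(4)])
qed

lemma D_basis: "i \<in> {1..8} \<Longrightarrow> wt i = w \<Longrightarrow> (\<And>x v. a x v = B i x v) \<Longrightarrow> D w a"
  by (rule D_B[of _ 1 i]) (auto intro: exact_congC[OF exact_0])

lemma D_bs: "D 5 (\<lambda>x v. X1 x * X3 v)" "D 6 (\<lambda>x v. X2 x * X3 v)" "D 7 (\<lambda>x v. X1 x * X2 v)"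
  "D 7 (\<lambda>x v. X1 x * X3 x * X3 v)" "D 9 (\<lambda>x v. X1 x * X3 x ^ 2 * X3 v)" "D 11 (\<lambda>x v. X1 x * X3 x ^ 3 * X3 v)"
  by (rule D_basis[of 1] D_basis[of 2] D_basis[of 3] D_basis[of 4] D_basis[of 6] D_basis[of 8]; (simp add: wt_def; fail))+

lemmas D_reds = D_B[OF red_X3X1] D_exact[OF red_X1X1] D_B[OF red_X3X2] D_exact[OF red_X3X3] D_B[OF red_X32X1]
  D_B[OF red_X2X1] D_B[OF red_X1X3X1] D_B[OF red_X32X2] D_exact[OF red_X2X2] D_B[OF red_X2X3X3] D_B[OF red_X33X1]
  D_exact[OF red_X2X3X1] D_B[OF red_X1X3X2] D_B[OF red_X1X32X1] D_B[OF red_X33X2] D_B[OF red_X2X3X2]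
  D_B[OF red_X22X3] D_B[OF red_X2X32X3] D_B[OF red_X34X1] D_B[OF red_X2X32X1] D_B[OF red_X1X32X2] D_B[OF red_X22X1]

lemmas D_high = D_X1[OF J_m(1)] D_X1[OF J_m(2)] D_X1[OF J_m(3)] D_X1[OF J_m(4)] D_X1[OF J_X(1)] D_X1[OF J_X(2)] D_X1[OF J_X(3)]
    D_X1[OF J_m(2)[of 1, simplified]] D_X1[OF J_m(4)[of 1, simplified]]
  D_X2[OF J_m(1)] D_X2[OF J_m(2)] D_X2[OF J_m(3)] D_X2[OF J_m(4)] D_X2[OF J_X(1)] D_X2[OF J_X(2)] D_X2[OF J_X(3)]
    D_X2[OF J_m(2)[of 1, simplified]] D_X2[OF J_m(4)[of 1, simplified]]
  D_X3[OF J_m(1)] D_X3[OF J_m(2)] D_X3[OF J_m(3)] D_X3[OF J_m(4)] D_X3[OF J_X(1)] D_X3[OF J_X(2)] D_X3[OF J_X(3)]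
    D_X3[OF J_m(2)[of 1, simplified]] D_X3[OF J_m(4)[of 1, simplified]]

text \<open>In each weight every one of the twelve forms is a basis element, is reduced to one or to
  an exact form by \<open>D_reds\<close>, or has higher weight because its exponent was rounded
  up.\<close>

lemma FF_imp_D_all:
  assumes "FF w a" "w \<in> {5, 6, 7, 8, 9, 10, 11}"
  shows "D w a"
proof -
  consider "w = 5" | "w = 6" | "w = 7" | "w = 8" | "w = 9" | "w = 10" | "w = 11" using assms(2) by auto
  then show ?thesis
    by cases (rule FF_imp_D[OF assms(1)]; simp; (rule D_bs D_reds D_high; (simp add: wt_def; fail)))+
qed

definition crd :: "(real ^ 'm \<Rightarrow> real ^ 'm \<Rightarrow> real) \<Rightarrow> (nat \<Rightarrow> real) \<Rightarrow> bool" where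
  "crd a c \<longleftrightarrow> exact (\<lambda>x v. a x v - (\<Sum>i=1..8. c i * B i x v))"

text \<open>Induction on \<open>12 - w\<close>: the part of weight \<open>w\<close> is split off,
  and from weight 12 on the remainder is exact. The recursion also shows that no coordinate of
  weight below \<open>w\<close> is introduced.\<close>

lemma FF_crd:
  assumes "FF w a" "w \<ge> 5"
  obtains c where "crd a c" "\<And>i. wt i < w \<Longrightarrow> c i = 0"
proof -
  have "\<exists>c. crd a c \<and> (\<forall>i. wt i < w \<longrightarrow> c i = 0)"
    using assms
  proof (induction "12 - w" arbitrary: w a)
    case 0
    then have "exact a" using FF_12[OF FF_antimono] by simp
    then show ?case by (intro exI[of _ "\<lambda>i. 0"]) (simp add: crd_def)
  next
    case (Suc d)
    then have "w \<in> {5, 6, 7, 8, 9, 10, 11}" by auto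
    then have "D w a" using FF_imp_D_all Suc by blast
    then obtain c where c: "\<forall>i. wt i \<noteq> w \<longrightarrow> c i = 0" "FF (w + 1) (\<lambda>x v. a x v - (\<Sum>i=1..8. c i * B i x v))"
      by (auto simp: D_def)
    have "d = 12 - (w + 1)" using Suc.hyps(2) by simp
    then obtain c' where c': "crd (\<lambda>x v. a x v - (\<Sum>i=1..8. c i * B i x v)) c'" "\<forall>i. wt i < w + 1 \<longrightarrow> c' i = 0"
      using Suc.hyps(1)[OF _ c(2)] Suc.hyps(2) Suc.prems by force
    have "crd a (\<lambda>i. c i + c' i)"
      unfolding crd_def
      by (rule exact_congC[OF c'(1)[unfolded crd_def]]) (simp add: sum.distrib algebra_simps)
    then show ?case using c(1) c'(2) by (intro exI[of _ "\<lambda>i. c i + c' i"]) auto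
  qed
  then show ?thesis using that by blast
qed

lemma J_sub_const:
  assumes "sm F"
  shows "J 2 (\<lambda>x. F x - F 0)"
proof -
  obtain F1 F2 F3 where F: "sm F1" "sm F2" "sm F3" "ceq F (\<lambda>x. F 0 + X1 x * F1 x + X2 x * F2 x + X3 x * F3 x)"
    using hadamard_C[OF assms] by blast
  have "J 2 (\<lambda>x. X1 x * F1 x + X2 x * F2 x + X3 x * F3 x)"
    by (intro J_add J_mult_sm[OF J_antimono[OF J_X(1)]] J_mult_sm[OF J_antimono[OF J_X(2)]] J_mult_sm[OF J_X(3)] F) auto
  then show ?thesis
    by (rule J_ceq) (use assms F(4) in \<open>auto simp: ceq_def elim: eventually_mono\<close>)
qed

lemma J_sub_linear:
  assumes "sm F"
  obtains k where "J 3 (\<lambda>x. F x - F 0 - k * X3 x)"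
proof -
  obtain F1 F2 F3 where F: "sm F1" "sm F2" "sm F3" "ceq F (\<lambda>x. F 0 + X1 x * F1 x + X2 x * F2 x + X3 x * F3 x)"
    using hadamard_C[OF assms] by blast
  have "J 3 (\<lambda>x. X3 x * (F3 x - F3 0))"
    by (rule J_antimono[OF J_mult[OF J_X(3) J_sub_const[OF F(3)]]]) simp
  then have "J 3 (\<lambda>x. X1 x * F1 x + X2 x * F2 x + X3 x * (F3 x - F3 0))"
    by (intro J_add J_mult_sm[OF J_X(1)] J_mult_sm[OF J_antimono[OF J_X(2)]] F) auto
  then have "J 3 (\<lambda>x. F x - F 0 - F3 0 * X3 x)"
    by (rule J_ceq)
       (use assms F(4) in \<open>auto intro!: sm_diff sm_mult simp: ceq_def algebra_simps elim: eventually_mono\<close>)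
  then show ?thesis by (rule that)
qed

text \<open>The monomial forms of weight below 5 are \<open>dX1\<close>, \<open>dX2\<close>,
  \<open>dX3\<close> and \<open>X3 dX3\<close>, all of them exact.\<close>

lemma FF_5:
  assumes "sm R1" "sm R2" "sm R3"
  shows "FF 5 (\<lambda>x v. R1 x * X1 v + R2 x * X2 v + R3 x * X3 v)"
proof -
  obtain k where k: "J 3 (\<lambda>x. R3 x - R3 0 - k * X3 x)" using J_sub_linear[OF assms(3)] by blast
  have "exact (\<lambda>x v. R1 0 * X1 v + R2 0 * X2 v + (R3 0 * X3 v + k * (X3 x * X3 v)))"
    by (intro exact_add exact_cmult)
       (use exact_dm[of 1 0 0] exact_dm[of 0 1 0] red_X3X3[of 0] red_X3X3[of 1] in simp_all)
  moreover have "FF 5 (\<lambda>x v. (R1 x - R1 0) * X1 v + (R2 x - R2 0) * X2 v + (R3 x - R3 0 - k * X3 x) * X3 v)"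
    by (intro FF_add FF_X1[OF J_sub_const[OF assms(1)]] FF_X2[OF J_sub_const[OF assms(2)]] FF_X3[OF k]) auto
  ultimately have "FF 5 (\<lambda>x v. R1 0 * X1 v + R2 0 * X2 v + (R3 0 * X3 v + k * (X3 x * X3 v)) +
    ((R1 x - R1 0) * X1 v + (R2 x - R2 0) * X2 v + (R3 x - R3 0 - k * X3 x) * X3 v))"
    by (rule FF_add[OF FF_exact])
  then show ?thesis by (rule FF_congC) (simp add: algebra_simps)
qed

end

subsection \<open>Orders along the branches\<close>

text \<open>Order at least \<open>k\<close> in \<open>t\<close>, with a bounded quotient made
  explicit so that no smoothness in \<open>t\<close> enters.\<close>

definition Ob :: "nat \<Rightarrow> (real \<Rightarrow> real) \<Rightarrow> bool" where
  "Ob k f \<longleftrightarrow> (\<exists>h K. near t. f t = t ^ k * h t \<and> \<bar>h t\<bar> \<le> K)"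

lemma ObI: "near t. f t = t ^ k * h t \<and> \<bar>h t\<bar> \<le> K \<Longrightarrow> Ob k f"
  unfolding Ob_def by blast

lemma Ob_monomial: "j \<le> k \<Longrightarrow> Ob j (\<lambda>t. c * t ^ k)"
proof -
  assume "j \<le> k"
  have "near t::real. \<bar>t\<bar> < 1"
    unfolding eventually_nhds_metric by (rule exI[of _ 1]) (auto simp: dist_real_def)
  then have "near t. c * t ^ k = t ^ j * (c * t ^ (k - j)) \<and> \<bar>c * t ^ (k - j)\<bar> \<le> \<bar>c\<bar>"
  proof eventually_elim
    case (elim t)
    have "\<bar>t\<bar> ^ (k - j) \<le> 1" using elim by (intro power_le_one) auto
    moreover have "t ^ k = t ^ j * t ^ (k - j)" using \<open>j \<le> k\<close> by (simp add: power_add[symmetric])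
    ultimately show ?case by (simp add: abs_mult power_abs mult_left_le)
  qed
  then show ?thesis by (rule ObI)
qed

lemma Ob_0: "Ob k (\<lambda>t. 0)"
  using Ob_monomial[of k k 0] by simp

lemma Ob_mult:
  assumes "Ob k f" "Ob l g"
  shows "Ob (k + l) (\<lambda>t. f t * g t)"
proof -
  obtain h K where h: "near t. f t = t ^ k * h t \<and> \<bar>h t\<bar> \<le> K" using assms(1) by (auto simp: Ob_def)
  obtain h' K' where h': "near t. g t = t ^ l * h' t \<and> \<bar>h' t\<bar> \<le> K'" using assms(2) by (auto simp: Ob_def)
  have "near t. f t * g t = t ^ (k + l) * (h t * h' t) \<and> \<bar>h t * h' t\<bar> \<le> K * K'"
    using h h'
  proof eventually_elim
    case (elim t)
    then have "0 \<le> K" by linarith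
    then show ?case using elim by (auto simp: power_add abs_mult intro: mult_mono)
  qed
  then show ?thesis by (rule ObI)
qed

lemma Ob_antimono: "Ob k f \<Longrightarrow> j \<le> k \<Longrightarrow> Ob j f"
proof -
  assume f: "Ob k f" and j: "j \<le> k"
  obtain h K where h: "near t. f t = t ^ k * h t \<and> \<bar>h t\<bar> \<le> K" using f by (auto simp: Ob_def)
  have "Ob 0 h" by (rule ObI[of _ _ h K]) (use h in \<open>eventually_elim, simp\<close>)
  from Ob_mult[OF Ob_monomial[OF j, of 1] this] have "Ob j (\<lambda>t. t ^ k * h t)" by simp
  then obtain h' K' where "near t. t ^ k * h t = t ^ j * h' t \<and> \<bar>h' t\<bar> \<le> K'" by (auto simp: Ob_def)
  then have "near t. f t = t ^ j * h' t \<and> \<bar>h' t\<bar> \<le> K'" using h by eventually_elim simp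
  then show "Ob j f" by (rule ObI)
qed

lemma Ob_add:
  assumes "Ob k f" "Ob k g"
  shows "Ob k (\<lambda>t. f t + g t)"
proof -
  obtain h K where h: "near t. f t = t ^ k * h t \<and> \<bar>h t\<bar> \<le> K" using assms(1) by (auto simp: Ob_def)
  obtain h' K' where h': "near t. g t = t ^ k * h' t \<and> \<bar>h' t\<bar> \<le> K'" using assms(2) by (auto simp: Ob_def)
  have "near t. f t + g t = t ^ k * (h t + h' t) \<and> \<bar>h t + h' t\<bar> \<le> K + K'"
    using h h' by eventually_elim (auto simp: algebra_simps)
  then show ?thesis by (rule ObI)
qed

lemma Ob_cmult: "Ob k f \<Longrightarrow> Ob k (\<lambda>t. c * f t)"
  using Ob_mult[OF Ob_monomial[of 0 0 c], of k f] by simp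

lemma Ob_diff: "Ob k f \<Longrightarrow> Ob k g \<Longrightarrow> Ob k (\<lambda>t. f t - g t)"
  using Ob_add[OF _ Ob_cmult[of k g "-1"], of f] by simp

lemma Ob_cong: "Ob k f \<Longrightarrow> (near t. g t = f t) \<Longrightarrow> Ob k g"
proof -
  assume f: "Ob k f" and ev: "near t. g t = f t"
  obtain h K where "near t. f t = t ^ k * h t \<and> \<bar>h t\<bar> \<le> K" using f by (auto simp: Ob_def)
  then have "near t. g t = t ^ k * h t \<and> \<bar>h t\<bar> \<le> K" using ev by eventually_elim simp
  then show ?thesis by (rule ObI)
qed

lemma Ob_power: "Ob k f \<Longrightarrow> Ob (a * k) (\<lambda>t. f t ^ a)"
proof (induction a)
  case (Suc a)
  then show ?case using Ob_mult[of k f "a * k" "\<lambda>t. f t ^ a"] by simp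
qed (use Ob_monomial[of 0 0 1] in simp)

lemma small_pos_real:
  assumes "near t::real. P t" "r > 0"
  obtains t where "0 < t" "t < r" "P t" "P (- t)"
proof -
  obtain d where d: "d > 0" "\<And>t. \<bar>t\<bar> < d \<Longrightarrow> P t"
    using assms(1) unfolding eventually_nhds_metric by (auto simp: dist_real_def)
  show ?thesis
    by (rule that[of "min d r / 2"]) (use d assms(2) in auto)
qed

text \<open>Divide by \<open>t ^ k\<close> and let \<open>t\<close> tend to \<open>0\<close>. All
  comparisons of coefficients along branches rest on this.\<close>

lemma Ob_zero:
  assumes "Ob (k + 1) (\<lambda>t. c * t ^ k)"
  shows "c = 0"
proof (rule ccontr)
  assume c: "c \<noteq> 0"
  obtain h K where h: "near t. c * t ^ k = t ^ (k + 1) * h t \<and> \<bar>h t\<bar> \<le> K"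
    using assms by (auto simp: Ob_def)
  have K: "K \<ge> 0" using eventually_nhds_x_imp_x[OF h] by linarith
  obtain t where t: "0 < t" "t < \<bar>c\<bar> / (K + 1)" "c * t ^ k = t ^ (k + 1) * h t \<and> \<bar>h t\<bar> \<le> K"
    using small_pos_real[OF h, of "\<bar>c\<bar> / (K + 1)"] c K by (metis add_nonneg_pos divide_pos_pos zero_less_abs_iff zero_less_one)
  have "t ^ k * c = t ^ k * (t * h t)" using t(3) by (simp add: mult_ac power_add)
  then have "c = t * h t" using t(1) by simp
  then have "\<bar>c\<bar> \<le> t * K" using t by (simp add: abs_mult)
  also have "\<dots> \<le> t * (K + 1)" using t(1) by simp
  also have "\<dots> < \<bar>c\<bar>" using t(2) K by (simp add: pos_less_divide_eq)
  finally show False by simp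
qed

context symp_coords
begin

definition br1 :: "real \<Rightarrow> real ^ 'm" where "br1 t = t *\<^sub>R axis (e 2) 1"
definition br2 :: "real \<Rightarrow> real ^ 'm" where "br2 t = t *\<^sub>R axis (e 3) 1"
definition br3 :: "real \<Rightarrow> real ^ 'm" where
  "br3 t = t ^ 3 *\<^sub>R axis (e 1) 1 - t ^ 4 *\<^sub>R axis (e 2) 1 + t ^ 2 *\<^sub>R axis (e 3) 1"

lemma br_nth [simp]:
  "X1 (br1 t) = 0" "X2 (br1 t) = t" "X3 (br1 t) = 0"
  "X1 (br2 t) = 0" "X2 (br2 t) = 0" "X3 (br2 t) = t"
  "X1 (br3 t) = t ^ 3" "X2 (br3 t) = - (t ^ 4)" "X3 (br3 t) = t ^ 2"
  by (simp_all add: br1_def br2_def br3_def axis_def)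

lemma br_0 [simp]: "br1 0 = 0" "br2 0 = 0" "br3 0 = 0"
  by (simp_all add: br1_def br2_def br3_def)

lemma br_C [simp]: "br1 t \<in> C" "br2 t \<in> C" "br3 t \<in> C"
proof -
  have ne: "e j \<notin> {e 1, e 2, e 3}" if "j \<in> {4..2*n}" for j
    using UNIV_split(2) that by blast
  have "br1 t $ e j = 0" "br2 t $ e j = 0" "br3 t $ e j = 0" if "j \<in> {4..2*n}" for j
    using ne[OF that] by (auto simp: br1_def br2_def br3_def axis_def)
  then show "br1 t \<in> C" "br2 t \<in> C" "br3 t \<in> C"
    unfolding C_iff by (simp_all add: power_mult[symmetric] power_add[symmetric])
qed

lemma br_sm [simp]: "sm br1" "sm br2" "sm br3"
proof -
  have i: "sm (\<lambda>t::real. t)" by simp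
  show "sm br1" "sm br2" "sm br3"
    unfolding br1_def[abs_def] br2_def[abs_def] br3_def[abs_def]
    by (intro sm_add sm_diff sm_scaleR sm_power sm_const i)+
qed

lemma Ob_sm:
  assumes "sm F" "sm br" "br 0 = 0"
  shows "Ob 0 (\<lambda>t::real. F (br t :: real ^ 'm))"
proof -
  have "isCont F 0" using sm_isCont[OF assms(1)] .
  then have "\<forall>\<^sub>F x in at 0. dist (F x) (F 0) < 1"
    unfolding isCont_def by (rule tendstoD) simp
  then have "near x. dist (F x) (F 0) < 1"
    by (auto simp: eventually_at_filter elim: eventually_mono)
  from eventually_compose_germ[OF this assms(2,3)]
  have "near t. F (br t) = t ^ 0 * F (br t) \<and> \<bar>F (br t)\<bar> \<le> \<bar>F 0\<bar> + 1"
    by eventually_elim (auto simp: dist_real_def)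
  then show ?thesis by (rule ObI)
qed

lemma J_br:
  assumes br: "sm br" "br 0 = 0" "\<And>t. br t \<in> C"
    and m: "\<And>a b c. k \<le> 3 * a + 4 * b + 2 * c \<Longrightarrow> Ob k' (\<lambda>t. X1 (br t) ^ a * X2 (br t) ^ b * X3 (br t) ^ c)"
    and F: "J k F"
  shows "Ob k' (\<lambda>t. F (br t))"
proof -
  have "J j F \<Longrightarrow> j = k \<Longrightarrow> Ob k' (\<lambda>t. F (br t))" for j F
  proof (induction rule: J.induct)
    case (J_monomial P j a b c)
    then show ?case using Ob_mult[OF m[of a b c] Ob_sm[OF J_monomial(1) br(1,2)]] by simp
  next
    case (J_add j F G)
    then show ?case by (intro Ob_add) auto
  next
    case (J_ceq j F G)
    show ?case
      by (rule Ob_cong[OF J_ceq(4)[OF J_ceq(5)]])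
         (use eventually_compose_germ[OF J_ceq(3)[unfolded ceq_def] br(1,2)] br(3) in simp)
  qed
  then show ?thesis using F by blast
qed

text \<open>On this line only powers of \<open>X2\<close>, of weight 4, survive, hence the order
  \<open>k / 4\<close> rounded up; likewise \<open>k / 2\<close> on the line of \<open>X3\<close>,
  while on the cusp the order equals the weight.\<close>

lemma J_br1: "J k F \<Longrightarrow> Ob ((k + 3) div 4) (\<lambda>t. F (br1 t))"
proof (rule J_br[of br1 k])
  fix a b c :: nat assume k: "k \<le> 3 * a + 4 * b + 2 * c"
  show "Ob ((k + 3) div 4) (\<lambda>t. X1 (br1 t) ^ a * X2 (br1 t) ^ b * X3 (br1 t) ^ c)"
  proof (cases "a = 0 \<and> c = 0")
    case True
    then show ?thesis using Ob_monomial[of "(k + 3) div 4" b 1] k by simp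
  qed (auto simp: Ob_0 power_0_left)
qed auto

lemma J_br2: "J k F \<Longrightarrow> Ob ((k + 1) div 2) (\<lambda>t. F (br2 t))"
proof (rule J_br[of br2 k])
  fix a b c :: nat assume k: "k \<le> 3 * a + 4 * b + 2 * c"
  show "Ob ((k + 1) div 2) (\<lambda>t. X1 (br2 t) ^ a * X2 (br2 t) ^ b * X3 (br2 t) ^ c)"
  proof (cases "a = 0 \<and> b = 0")
    case True
    then show ?thesis using Ob_monomial[of "(k + 1) div 2" c 1] k by simp
  qed (auto simp: Ob_0 power_0_left)
qed auto

lemma J_br3: "J k F \<Longrightarrow> Ob k (\<lambda>t. F (br3 t))"
proof (rule J_br[of br3 k])
  fix a b c :: nat assume k: "k \<le> 3 * a + 4 * b + 2 * c"
  have "X1 (br3 t) ^ a * X2 (br3 t) ^ b * X3 (br3 t) ^ c = (- 1) ^ b * t ^ (3 * a + 4 * b + 2 * c)" for t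
    by (simp add: power_minus[of "t ^ 4"] power_mult[symmetric] power_add)
  then show "Ob k (\<lambda>t. X1 (br3 t) ^ a * X2 (br3 t) ^ b * X3 (br3 t) ^ c)"
    using Ob_monomial[OF k, of "(- 1) ^ b"] by simp
qed auto

subsection \<open>Independence of the basis\<close>

text \<open>Unlike \<open>J\<close>, which is an ideal on the curve, \<open>T\<close> is an ideal of germs on the whole space, so that
  derivatives of its members along the curve are controlled.\<close>

inductive T :: "nat \<Rightarrow> (real ^ 'm \<Rightarrow> real) \<Rightarrow> bool" where
  T_monomial: "sm P \<Longrightarrow> k \<le> 3 * a + 4 * b + 2 * c \<Longrightarrow> T k (\<lambda>x. X1 x ^ a * X2 x ^ b * X3 x ^ c * P x)"
| T_trans: "sm P \<Longrightarrow> j \<in> e ` {4..2*n} \<Longrightarrow> T k (\<lambda>x. x $ j * P x)"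
| T_add: "T k F \<Longrightarrow> T k G \<Longrightarrow> T k (\<lambda>x. F x + G x)"
| T_cong: "T k F \<Longrightarrow> near x. G x = F x \<Longrightarrow> T k G"

lemma T_sm: "T k F \<Longrightarrow> sm F"
proof (induction rule: T.induct)
  case (T_cong k F G)
  show ?case by (rule sm_cong[OF T_cong(3)]) (use T_cong(2) in \<open>auto elim: eventually_mono\<close>)
qed (auto intro!: sm_mult sm_power)

lemma T_0: "sm F \<Longrightarrow> T 0 F"
  using T_monomial[of F 0 0 0 0] by simp

lemma T_zero: "T k (\<lambda>x. 0)"
  using T_monomial[of "\<lambda>x. 0" k k 0 0] by simp

lemma axis_transversal:
  assumes "j \<in> e ` {4..2*n}" "i \<in> {1, 2, 3}"
  shows "axis (e i) (1::real) $ j = 0"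
proof -
  have "e i \<in> {e 1, e 2, e 3}" using assms(2) by auto
  then have "j \<noteq> e i" using UNIV_split(2) assms(1) by blast
  then show ?thesis by (simp add: axis_def)
qed

text \<open>Differentiation lowers the weight by that of the coordinate, and a generator with a
  transversal factor has derivatives vanishing on the curve. For \<open>J\<close> this fails:
  \<open>X1^2 + X2 X3\<close> lies in every \<open>J k\<close>, but its derivative
  \<open>2 X1\<close> does not.\<close>

lemma T_der:
  assumes "T k F"
  shows "J (k - 3) (\<lambda>x. fder F x (axis (e 1) 1))" "J (k - 4) (\<lambda>x. fder F x (axis (e 2) 1))"
    "J (k - 2) (\<lambda>x. fder F x (axis (e 3) 1))"
proof -
  have "J (k - 3) (\<lambda>x. fder F x (axis (e 1) 1)) \<and> J (k - 4) (\<lambda>x. fder F x (axis (e 2) 1)) \<and>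
    J (k - 2) (\<lambda>x. fder F x (axis (e 3) 1))"
    using assms
  proof (induction rule: T.induct)
    case (T_monomial P k a b c)
    let ?F = "\<lambda>x. X1 x ^ a * X2 x ^ b * X3 x ^ c * P x"
    let ?G = "\<lambda>v x. X1 x ^ (a - 1) * X2 x ^ b * X3 x ^ c * (of_nat a * X1 v * P x) +
        X1 x ^ a * X2 x ^ (b - 1) * X3 x ^ c * (of_nat b * X2 v * P x) +
        X1 x ^ a * X2 x ^ b * X3 x ^ (c - 1) * (of_nat c * X3 v * P x) +
        X1 x ^ a * X2 x ^ b * X3 x ^ c * fder P x v"
    have d: "near x. fder ?F x v = ?G v x" for v
      using sm_has_fder[OF T_monomial(1)]
    proof eventually_elim
      case (elim x)
      show ?case
        by (rule fder_eqI) (auto intro!: derivative_eq_intros elim simp: algebra_simps)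
    qed
    have cq: "ceq (\<lambda>x. fder ?F x v) (?G v)" for v
      unfolding ceq_def using d[of v] by eventually_elim simp
    have s: "sm (\<lambda>x. fder ?F x v)" for v
      by (intro sm_fder sm_mult sm_power sm_coord T_monomial)
    have main: "J j (?G v)" if a: "a > 0 \<Longrightarrow> X1 v \<noteq> 0 \<Longrightarrow> j \<le> 3 * (a - 1) + 4 * b + 2 * c"
      and b: "b > 0 \<Longrightarrow> X2 v \<noteq> 0 \<Longrightarrow> j \<le> 3 * a + 4 * (b - 1) + 2 * c"
      and c: "c > 0 \<Longrightarrow> X3 v \<noteq> 0 \<Longrightarrow> j \<le> 3 * a + 4 * b + 2 * (c - 1)" and "j \<le> k" for j v
    proof (intro J_add)
      show "J j (\<lambda>x. X1 x ^ (a - 1) * X2 x ^ b * X3 x ^ c * (of_nat a * X1 v * P x))"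
      proof (cases "a = 0 \<or> X1 v = 0")
        case False
        then show ?thesis by (intro J_monomial sm_mult sm_const T_monomial a) auto
      qed (auto simp: J_zero)
      show "J j (\<lambda>x. X1 x ^ a * X2 x ^ (b - 1) * X3 x ^ c * (of_nat b * X2 v * P x))"
      proof (cases "b = 0 \<or> X2 v = 0")
        case False
        then show ?thesis by (intro J_monomial sm_mult sm_const T_monomial b) auto
      qed (auto simp: J_zero)
      show "J j (\<lambda>x. X1 x ^ a * X2 x ^ b * X3 x ^ (c - 1) * (of_nat c * X3 v * P x))"
      proof (cases "c = 0 \<or> X3 v = 0")
        case False
        then show ?thesis by (intro J_monomial sm_mult sm_const T_monomial c) auto
      qed (auto simp: J_zero)
      show "J j (\<lambda>x. X1 x ^ a * X2 x ^ b * X3 x ^ c * fder P x v)"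
        by (rule J_monomial) (use T_monomial \<open>j \<le> k\<close> in \<open>auto intro: sm_fder\<close>)
    qed
    show ?case
    proof (intro conjI)
      show "J (k - 3) (\<lambda>x. fder ?F x (axis (e 1) 1))"
        by (rule J_ceq[OF main s cq]) (use T_monomial(2) in \<open>auto simp: axis_def\<close>)
      show "J (k - 4) (\<lambda>x. fder ?F x (axis (e 2) 1))"
        by (rule J_ceq[OF main s cq]) (use T_monomial(2) in \<open>auto simp: axis_def\<close>)
      show "J (k - 2) (\<lambda>x. fder ?F x (axis (e 3) 1))"
        by (rule J_ceq[OF main s cq]) (use T_monomial(2) in \<open>auto simp: axis_def\<close>)
    qed
  next
    case (T_trans P j k)
    have "J l (\<lambda>x. fder (\<lambda>x. x $ j * P x) x (axis (e i) 1))" if i: "i \<in> {1, 2, 3}" for l i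
    proof (rule J_ceq[OF J_zero])
      show "sm (\<lambda>x. fder (\<lambda>x. x $ j * P x) x (axis (e i) 1))" by (intro sm_fder sm_mult sm_coord T_trans)
      show "ceq (\<lambda>x. fder (\<lambda>x. x $ j * P x) x (axis (e i) 1)) (\<lambda>x. 0)"
        unfolding ceq_def using sm_has_fder[OF T_trans(1)]
      proof eventually_elim
        case (elim x)
        have "fder (\<lambda>x. x $ j * P x) x (axis (e i) 1) = x $ j * fder P x (axis (e i) 1) + axis (e i) 1 $ j * P x"
          by (rule fder_eqI) (auto intro!: derivative_eq_intros elim)
        then show ?case using C_zero[OF _ T_trans(2)] axis_transversal[OF T_trans(2) i] by auto
      qed
    qed
    then show ?case by blast
  next
    case (T_add k F G)
    have "ceq (\<lambda>x. fder (\<lambda>x. F x + G x) x v) (\<lambda>x. fder F x v + fder G x v)" for v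
      unfolding ceq_def using sm_differentiable[OF T_sm[OF T_add(1)]] sm_differentiable[OF T_sm[OF T_add(2)]]
      by eventually_elim (simp add: fder_add)
    moreover have "sm (\<lambda>x. fder (\<lambda>x. F x + G x) x v)" for v
      by (intro sm_fder sm_add T_sm[OF T_add(1)] T_sm[OF T_add(2)])
    ultimately show ?case using T_add(3,4) by (auto intro: J_ceq[OF J_add])
  next
    case (T_cong k F G)
    have "near x. \<forall>\<^sub>F y in nhds x. G y = F y"
      using T_cong(2) by (simp only: eventually_eventually)
    then have "near x. fder G x = fder F x"
      by eventually_elim (rule fder_cong_nhds)
    then have c: "ceq (\<lambda>x. fder G x v) (\<lambda>x. fder F x v)" for v
      unfolding ceq_def by eventually_elim simp
    have "T k G" by (rule T.T_cong[OF T_cong(1,2)])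
    then have "sm (\<lambda>x. fder G x v)" for v by (intro sm_fder T_sm)
    then show ?case using T_cong(3) c by (auto intro: J_ceq)
  qed
  then show "J (k - 3) (\<lambda>x. fder F x (axis (e 1) 1))" "J (k - 4) (\<lambda>x. fder F x (axis (e 2) 1))"
    "J (k - 2) (\<lambda>x. fder F x (axis (e 3) 1))" by auto
qed

definition Mon :: "nat \<Rightarrow> (nat \<times> nat \<times> nat) set" where
  "Mon w = {(a, b, c). 3 * a + 4 * b + 2 * c = w}"

definition mon :: "nat \<times> nat \<times> nat \<Rightarrow> real ^ 'm \<Rightarrow> real" where
  "mon m x = X1 x ^ fst m * X2 x ^ fst (snd m) * X3 x ^ snd (snd m)"

lemma finite_Mon: "finite (Mon w)"
  by (rule finite_subset[of _ "{..w} \<times> {..w} \<times> {..w}"]) (auto simp: Mon_def)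

text \<open>By Hadamard's lemma the coefficient of a generator of weight exactly \<open>w\<close>
  may be replaced by its value at \<open>0\<close>; the remainder gains a factor \<open>X1\<close>,
  \<open>X2\<close>, \<open>X3\<close> or a transversal coordinate.\<close>

lemma T_step:
  assumes "T w F"
  obtains s where "T (w + 1) (\<lambda>x. F x - (\<Sum>m\<in>Mon w. s m * mon m x))"
proof -
  have "\<exists>s. T (w + 1) (\<lambda>x. F x - (\<Sum>m\<in>Mon w. s m * mon m x))"
    using assms
  proof (induction rule: T.induct)
    case (T_monomial P w a b c)
    show ?case
    proof (cases "w + 1 \<le> 3 * a + 4 * b + 2 * c")
      case True
      then show ?thesis using T.T_monomial[OF T_monomial(1) True] by (intro exI[of _ "\<lambda>m. 0"]) simp
    next
      case False
      then have w: "3 * a + 4 * b + 2 * c = w" using T_monomial(2) by simp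
      obtain H where H: "\<And>j. sm (H j)" "near x. P x = P 0 + (\<Sum>j\<in>UNIV. (x - 0) $ j * H j x)"
        using hadamard[OF T_monomial(1) bounded_linear_zero] by blast
      let ?m = "\<lambda>x. X1 x ^ a * X2 x ^ b * X3 x ^ c"
      have "T (w + 1) (\<lambda>x. \<Sum>j\<in>I. x $ j * (?m x * H j x))" if "I \<subseteq> e ` {4..2*n}" "finite I" for I
        using that(2,1)
      proof (induction I rule: finite_induct)
        case (insert i I)
        have "T (w + 1) (\<lambda>x. x $ i * (?m x * H i x))"
          by (rule T_trans) (use insert.prems H(1) in \<open>auto intro!: sm_mult sm_power\<close>)
        then show ?case using insert by (auto intro!: T_add)
      qed (simp add: T_zero)
      then have t: "T (w + 1) (\<lambda>x. \<Sum>j\<in>e ` {4..2*n}. x $ j * (?m x * H j x))" by blast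
      have "T (w + 1) (\<lambda>x. X1 x ^ (a + 1) * X2 x ^ b * X3 x ^ c * H (e 1) x + X1 x ^ a * X2 x ^ (b + 1) * X3 x ^ c * H (e 2) x +
          X1 x ^ a * X2 x ^ b * X3 x ^ (c + 1) * H (e 3) x + (\<Sum>j\<in>e ` {4..2*n}. x $ j * (?m x * H j x)))"
        by (intro T_add T.T_monomial H t) (use w in auto)
      then have "T (w + 1) (\<lambda>x. ?m x * P x - (\<Sum>m\<in>Mon w. (if m = (a, b, c) then P 0 else 0) * mon m x))"
      proof (rule T_cong)
        have single: "(\<Sum>m\<in>Mon w. (if m = (a, b, c) then P 0 else 0) * mon m x) = P 0 * ?m x" for x
        proof -
          have "(\<Sum>m\<in>Mon w. (if m = (a, b, c) then P 0 else 0) * mon m x) = (\<Sum>m\<in>Mon w. if m = (a, b, c) then P 0 * ?m x else 0)"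
            by (rule sum.cong) (auto simp: mon_def)
          then show ?thesis using finite_Mon w by (simp add: Mon_def)
        qed
        show "near x. ?m x * P x - (\<Sum>m\<in>Mon w. (if m = (a, b, c) then P 0 else 0) * mon m x) =
          X1 x ^ (a + 1) * X2 x ^ b * X3 x ^ c * H (e 1) x + X1 x ^ a * X2 x ^ (b + 1) * X3 x ^ c * H (e 2) x +
          X1 x ^ a * X2 x ^ b * X3 x ^ (c + 1) * H (e 3) x + (\<Sum>j\<in>e ` {4..2*n}. x $ j * (?m x * H j x))"
          using H(2)
        proof eventually_elim
          case (elim x)
          have "(\<Sum>j\<in>e ` {4..2*n}. x $ j * (?m x * H j x)) = ?m x * (\<Sum>j\<in>e ` {4..2*n}. x $ j * H j x)"
            by (simp add: sum_distrib_left mult_ac)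
          moreover have "?m x * P x = ?m x * (P 0 + (X1 x * H (e 1) x + X2 x * H (e 2) x + X3 x * H (e 3) x + (\<Sum>j\<in>e ` {4..2*n}. x $ j * H j x)))"
            using elim by (simp add: sum_UNIV_split)
          ultimately show ?case unfolding single by (simp add: algebra_simps power_add)
        qed
      qed
      then show ?thesis by (rule exI[of _ "\<lambda>m. if m = (a, b, c) then P 0 else 0"])
    qed
  next
    case (T_trans P j w)
    then show ?case using T.T_trans[OF T_trans] by (intro exI[of _ "\<lambda>m. 0"]) simp
  next
    case (T_add w F G)
    then obtain s s' where "T (w + 1) (\<lambda>x. F x - (\<Sum>m\<in>Mon w. s m * mon m x))"
       "T (w + 1) (\<lambda>x. G x - (\<Sum>m\<in>Mon w. s' m * mon m x))" by blast
    from T.T_add[OF this] have "T (w + 1) (\<lambda>x. F x + G x - (\<Sum>m\<in>Mon w. (s m + s' m) * mon m x))"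
      by (rule T_cong) (simp add: sum.distrib algebra_simps)
    then show ?case by (rule exI[of _ "\<lambda>m. s m + s' m"])
  next
    case (T_cong w F G)
    then obtain s where "T (w + 1) (\<lambda>x. F x - (\<Sum>m\<in>Mon w. s m * mon m x))" by blast
    then have "T (w + 1) (\<lambda>x. G x - (\<Sum>m\<in>Mon w. s m * mon m x))"
      by (rule T.T_cong) (use T_cong(2) in \<open>auto elim: eventually_mono\<close>)
    then show ?case by blast
  qed
  then show ?thesis using that by blast
qed

lemma J_m': "k \<le> 2 * c + 3 \<Longrightarrow> J k (\<lambda>x. X1 x * X3 x ^ c)"
    "k \<le> 3 \<Longrightarrow> J k (\<lambda>x. X1 x)" "k \<le> 4 \<Longrightarrow> J k (\<lambda>x. X2 x)" "k \<le> 5 \<Longrightarrow> J k (\<lambda>x. X1 x * X3 x)"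
  using J_antimono[OF J_m(2)] J_antimono[OF J_X(1)] J_antimono[OF J_X(2)] J_antimono[OF J_m(2)[of 1]] by auto

lemma br_zero1: "J j F \<Longrightarrow> (\<And>t. F (br1 t) = k * t ^ m) \<Longrightarrow> m + 1 \<le> (j + 3) div 4 \<Longrightarrow> k = 0"
  by (rule Ob_zero[of m], rule Ob_antimono[of "(j + 3) div 4"]) (use J_br1[of j F] in simp_all)

lemma br_zero2: "J j F \<Longrightarrow> (\<And>t. F (br2 t) = k * t ^ m) \<Longrightarrow> m + 1 \<le> (j + 1) div 2 \<Longrightarrow> k = 0"
  by (rule Ob_zero[of m], rule Ob_antimono[of "(j + 1) div 2"]) (use J_br2[of j F] in simp_all)

lemma br_zero3: "J j F \<Longrightarrow> (\<And>t. F (br3 t) = k * t ^ m) \<Longrightarrow> m + 1 \<le> j \<Longrightarrow> k = 0"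
  by (rule Ob_zero[of m], rule Ob_antimono[of j]) (use J_br3[of j F] in simp_all)

definition dmon :: "nat \<Rightarrow> nat \<times> nat \<times> nat \<Rightarrow> real ^ 'm \<Rightarrow> real" where
  "dmon i m x = (case m of (a, b, c) \<Rightarrow>
     if i = 1 then of_nat a * X1 x ^ (a - 1) * X2 x ^ b * X3 x ^ c
     else if i = 2 then of_nat b * X1 x ^ a * X2 x ^ (b - 1) * X3 x ^ c
     else of_nat c * X1 x ^ a * X2 x ^ b * X3 x ^ (c - 1))"

lemma mon_has_derivative:
  "(mon m has_derivative (\<lambda>v. dmon 1 m x * X1 v + dmon 2 m x * X2 v + dmon 3 m x * X3 v)) (at x)"
  unfolding mon_def[abs_def] dmon_def
  by (cases m) (auto intro!: derivative_eq_intros simp: algebra_simps)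

lemma sm_dmon: "sm (dmon i m)"
proof (cases m)
  case (fields a b c)
  then show ?thesis
    unfolding dmon_def[abs_def]
    by (cases "i = 1"; cases "i = 2") (auto intro!: sm_mult sm_power)
qed

text \<open>The part of weight \<open>w\<close> of a potential \<open>S\<close>, with what it
  contributes to the three components \<open>G1\<close>, \<open>G2\<close>, \<open>G3\<close> of
  \<open>dS\<close> along the curve; the remainder is controlled by \<open>T_der\<close>.\<close>

lemma T_leading:
  assumes S: "T w S"
    and H: "ceq (\<lambda>x. fder S x (axis (e 1) 1)) G1" "ceq (\<lambda>x. fder S x (axis (e 2) 1)) G2"
      "ceq (\<lambda>x. fder S x (axis (e 3) 1)) G3" and sF: "sm G1" "sm G2" "sm G3"
  obtains s where "T (w + 1) (\<lambda>x. S x - (\<Sum>m\<in>Mon w. s m * mon m x))"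
    "J (w + 1 - 3) (\<lambda>x. G1 x - (\<Sum>m\<in>Mon w. s m * dmon 1 m x))"
    "J (w + 1 - 4) (\<lambda>x. G2 x - (\<Sum>m\<in>Mon w. s m * dmon 2 m x))"
    "J (w + 1 - 2) (\<lambda>x. G3 x - (\<Sum>m\<in>Mon w. s m * dmon 3 m x))"
proof -
  obtain s where s: "T (w + 1) (\<lambda>x. S x - (\<Sum>m\<in>Mon w. s m * mon m x))" using T_step[OF S] by blast
  have d: "near x. \<forall>v. fder (\<lambda>x. S x - (\<Sum>m\<in>Mon w. s m * mon m x)) x v =
      fder S x v - (\<Sum>m\<in>Mon w. s m * (dmon 1 m x * X1 v + dmon 2 m x * X2 v + dmon 3 m x * X3 v))"
    using sm_has_fder[OF T_sm[OF S]]
    by eventually_elim (intro allI fder_eqI has_derivative_diff has_derivative_sum has_derivative_mult_right mon_has_derivative)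
  show ?thesis
  proof (rule that[OF s])
    show "J (w + 1 - 3) (\<lambda>x. G1 x - (\<Sum>m\<in>Mon w. s m * dmon 1 m x))"
    proof (rule J_ceq[OF T_der(1)[OF s]])
      show "ceq (\<lambda>x. G1 x - (\<Sum>m\<in>Mon w. s m * dmon 1 m x)) (\<lambda>x. fder (\<lambda>x. S x - (\<Sum>m\<in>Mon w. s m * mon m x)) x (axis (e 1) 1))"
        using d H(1) unfolding ceq_def by eventually_elim (simp add: axis_def)
    qed (intro sm_diff sF sm_sum sm_mult sm_const sm_dmon)
    show "J (w + 1 - 4) (\<lambda>x. G2 x - (\<Sum>m\<in>Mon w. s m * dmon 2 m x))"
    proof (rule J_ceq[OF T_der(2)[OF s]])
      show "ceq (\<lambda>x. G2 x - (\<Sum>m\<in>Mon w. s m * dmon 2 m x)) (\<lambda>x. fder (\<lambda>x. S x - (\<Sum>m\<in>Mon w. s m * mon m x)) x (axis (e 2) 1))"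
        using d H(2) unfolding ceq_def by eventually_elim (simp add: axis_def)
    qed (intro sm_diff sF sm_sum sm_mult sm_const sm_dmon)
    show "J (w + 1 - 2) (\<lambda>x. G3 x - (\<Sum>m\<in>Mon w. s m * dmon 3 m x))"
    proof (rule J_ceq[OF T_der(3)[OF s]])
      show "ceq (\<lambda>x. G3 x - (\<Sum>m\<in>Mon w. s m * dmon 3 m x)) (\<lambda>x. fder (\<lambda>x. S x - (\<Sum>m\<in>Mon w. s m * mon m x)) x (axis (e 3) 1))"
        using d H(3) unfolding ceq_def by eventually_elim (simp add: axis_def)
    qed (intro sm_diff sF sm_sum sm_mult sm_const sm_dmon)
  qed
qed

lemma T_pos_at_0: "T k F \<Longrightarrow> k \<ge> 1 \<Longrightarrow> F 0 = 0"
proof (induction rule: T.induct)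
  case (T_monomial P k a b c)
  then have "a > 0 \<or> b > 0 \<or> c > 0" by auto
  then show ?case by auto
next
  case (T_cong k F G)
  then show ?case using eventually_nhds_x_imp_x[OF T_cong(2)] by simp
qed auto

lemma Mon_bound:
  assumes "(a, b, c) \<in> Mon w" "w \<le> 11"
  shows "a \<in> {0, 1, 2, 3}" "b \<in> {0, 1, 2}"
  using assms by (auto simp: Mon_def)

lemma Mon_eqI:
  assumes "w \<le> 11" "A \<subseteq> Mon w"
    and "\<And>a b c. a \<in> {0, 1, 2, 3} \<Longrightarrow> b \<in> {0, 1, 2} \<Longrightarrow> 3 * a + 4 * b + 2 * c = w \<Longrightarrow> (a, b, c) \<in> A"
  shows "Mon w = A"
  using assms Mon_bound by (auto simp: Mon_def)

lemma Mon_simps: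
  "Mon 0 = {(0,0,0)}"
  "Mon 1 = {}"
  "Mon 2 = {(0,0,1)}"
  "Mon 3 = {(1,0,0)}"
  "Mon 4 = {(0,0,2), (0,1,0)}"
  "Mon 5 = {(1,0,1)}"
  "Mon 6 = {(2,0,0), (0,1,1), (0,0,3)}"
  "Mon 7 = {(1,1,0), (1,0,2)}"
  "Mon 8 = {(2,0,1), (0,2,0), (0,1,2), (0,0,4)}"
  "Mon 9 = {(3,0,0), (1,1,1), (1,0,3)}"
  "Mon 10 = {(2,1,0), (2,0,2), (0,2,1), (0,1,3), (0,0,5)}"
  "Mon 11 = {(3,0,1), (1,2,0), (1,1,2), (1,0,4)}"
  by (rule Mon_eqI; (simp add: Mon_def; fail)?; elim insertE emptyE; simp; presburger?)+

lemma sum18: "(\<Sum>i=1..8. f i) = f 1 + f 2 + f 3 + f 4 + f 5 + f 6 + f 7 + (f (8::nat) :: real)"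
proof -
  have "{1..8::nat} = {1,2,3,4,5,6,7,8}" by auto
  then show ?thesis by (simp add: add.assoc)
qed

text \<open>A primitive \<open>S\<close> of the combination is stripped weight by weight. In weight
  \<open>w\<close> the components of \<open>dS\<close> are compared with the combination along the
  three branches; all coefficients of \<open>S\<close> of that weight vanish, and so do the
  \<open>c i\<close> belonging to it, so that \<open>S\<close> lies in the next
  \<open>T\<close>.\<close>

lemma B_independent:
  assumes "exact (\<lambda>x v. \<Sum>i=1..8. c i * B i x v)" "i \<in> {1..8}"
  shows "c i = 0"
proof -
  obtain S0 where S0: "sm S0" "near x. x \<in> C \<longrightarrow> (\<forall>v. (\<Sum>i=1..8. c i * B i x v) = fder S0 x v)"
    using assms(1) by (auto simp: exact_def)
  \<comment> \<open>Normalised to vanish at \<open>0\<close>, so that the constant coefficient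
    disappears.\<close>
  define S where "S x = S0 x - S0 0" for x
  have sS: "sm S" unfolding S_def by (intro sm_diff S0 sm_const)
  have S: "near x. x \<in> C \<longrightarrow> (\<forall>v. fder S x v = (\<Sum>i=1..8. c i * B i x v))"
    using S0(2) sm_differentiable[OF S0(1)]
    by eventually_elim (simp add: S_def[abs_def] fder_diff)
  let ?F3 = "\<lambda>x. c 1 * X1 x + c 2 * X2 x + c 4 * (X1 x * X3 x) + c 5 * X1 x ^ 2 + c 6 * (X1 x * X3 x ^ 2) + c 7 * (X1 x ^ 2 * X3 x) + c 8 * (X1 x * X3 x ^ 3)"
  have H: "ceq (\<lambda>x. fder S x (axis (e 1) 1)) (\<lambda>x. 0)" "ceq (\<lambda>x. fder S x (axis (e 2) 1)) (\<lambda>x. c 3 * X1 x)"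
      "ceq (\<lambda>x. fder S x (axis (e 3) 1)) ?F3"
    unfolding ceq_def using S by (eventually_elim, simp add: sum18 axis_def)+
  note lead = T_leading[OF _ H sm_const sm_mult[OF sm_const sm_coord]]
  have sF3: "sm ?F3" by (intro sm_add sm_mult sm_const sm_power sm_coord)
  have jm: "J k (\<lambda>x. X1 x ^ 2)" if "k \<le> 6" for k using J_monomial[of "\<lambda>x. 1" k 2 0 0] that by simp
  have jm': "J k (\<lambda>x. X1 x ^ 2 * X3 x)" if "k \<le> 8" for k using J_monomial[of "\<lambda>x. 1" k 2 0 1] that by simp
  note J_r = J_add J_cmult J_m' jm jm'
  note expand = Mon_simps dmon_def
  have "T 0 S" by (rule T_0[OF sS])
  then obtain s where s: "T (0 + 1) (\<lambda>x. S x - (\<Sum>m\<in>Mon 0. s m * mon m x))" using T_step by blast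
  then have "s (0,0,0) = 0" using T_pos_at_0[OF s] by (simp add: Mon_simps mon_def S_def)
  then have T1: "T 1 S" using s by (simp add: Mon_simps)
  then obtain s where s: "T (1 + 1) (\<lambda>x. S x - (\<Sum>m\<in>Mon 1. s m * mon m x))" using T_step by blast
  then have T2: "T 2 S" by (simp add: Mon_simps)
  obtain s where s: "T (2 + 1) (\<lambda>x. S x - (\<Sum>m\<in>Mon 2. s m * mon m x))"
    "J (2 + 1 - 2) (\<lambda>x. ?F3 x - (\<Sum>m\<in>Mon 2. s m * dmon 3 m x))"
    using lead[OF T2 sF3] by blast
  have "J 1 (\<lambda>x. ?F3 x - (?F3 x - (\<Sum>m\<in>Mon 2. s m * dmon 3 m x)))"
    by (rule J_diff, (intro J_r; simp)) (use s(2) in \<open>simp add: One_nat_def\<close>)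
  then have "s (0,0,1) = 0"
    by (rule br_zero3[of _ _ _ 0]) (simp_all add: expand)
  then have T3: "T 3 S" using s by (simp add: Mon_simps)
  obtain s where s: "T (3 + 1) (\<lambda>x. S x - (\<Sum>m\<in>Mon 3. s m * mon m x))"
    "J (3 + 1 - 3) (\<lambda>x. 0 - (\<Sum>m\<in>Mon 3. s m * dmon 1 m x))"
    using lead[OF T3 sF3] by blast
  have "- s (1,0,0) = 0"
    by (rule br_zero3[OF s(2), of _ 0]) (simp_all add: expand)
  then have T4: "T 4 S" using s by (simp add: Mon_simps)
  obtain s where s: "T (4 + 1) (\<lambda>x. S x - (\<Sum>m\<in>Mon 4. s m * mon m x))"
    "J (4 + 1 - 4) (\<lambda>x. c 3 * X1 x - (\<Sum>m\<in>Mon 4. s m * dmon 2 m x))"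
    "J (4 + 1 - 2) (\<lambda>x. ?F3 x - (\<Sum>m\<in>Mon 4. s m * dmon 3 m x))"
    using lead[OF T4 sF3] by blast
  have a: "J 1 (\<lambda>x. c 3 * X1 x - (c 3 * X1 x - (\<Sum>m\<in>Mon 4. s m * dmon 2 m x)))"
    by (rule J_diff, (intro J_r; simp)) (use s(2) in \<open>simp add: One_nat_def\<close>)
  have b: "J 3 (\<lambda>x. ?F3 x - (?F3 x - (\<Sum>m\<in>Mon 4. s m * dmon 3 m x)))"
    by (rule J_diff, (intro J_r; simp)) (use s(3) in simp)
  have 1: "s (0,1,0) = 0"
    by (rule br_zero2[OF a, of _ 0]) (simp_all add: expand)
  have "2 * s (0,0,2) = 0"
    by (rule br_zero2[OF b, of _ 1]) (simp_all add: expand)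
  then have T5: "T 5 S" using s 1 by (simp add: Mon_simps)
  obtain s where s: "T (5 + 1) (\<lambda>x. S x - (\<Sum>m\<in>Mon 5. s m * mon m x))"
    "J (5 + 1 - 3) (\<lambda>x. 0 - (\<Sum>m\<in>Mon 5. s m * dmon 1 m x))"
    "J (5 + 1 - 2) (\<lambda>x. ?F3 x - (\<Sum>m\<in>Mon 5. s m * dmon 3 m x))"
    using lead[OF T5 sF3] by blast
  have 1: "- s (1,0,1) = 0"
    by (rule br_zero2[OF s(2), of _ 1]) (simp_all add: expand)
  have "J 4 (\<lambda>x. ?F3 x - (\<Sum>m\<in>Mon 5. s m * dmon 3 m x) - (?F3 x - c 1 * X1 x))"
    by (rule J_diff, use s(3) in simp, simp, (intro J_r; simp))
  then have c1: "c 1 = 0"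
    by (rule br_zero3[of _ _ _ 3]) (use 1 in \<open>simp_all add: expand\<close>)
  have T6: "T 6 S" using s 1 by (simp add: Mon_simps)
  obtain s where s: "T (6 + 1) (\<lambda>x. S x - (\<Sum>m\<in>Mon 6. s m * mon m x))"
    "J (6 + 1 - 3) (\<lambda>x. 0 - (\<Sum>m\<in>Mon 6. s m * dmon 1 m x))"
    "J (6 + 1 - 4) (\<lambda>x. c 3 * X1 x - (\<Sum>m\<in>Mon 6. s m * dmon 2 m x))"
    "J (6 + 1 - 2) (\<lambda>x. ?F3 x - (\<Sum>m\<in>Mon 6. s m * dmon 3 m x))"
    using lead[OF T6 sF3] by blast
  \<comment> \<open>Here and below the branch is chosen so that a single unknown survives on it; the
    number supplied is the exponent of \<open>t\<close> with which it occurs.\<close>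
  have 1: "- (2 * s (2,0,0)) = 0"
    by (rule br_zero3[OF s(2), of _ 3]) (simp_all add: expand)
  have 2: "- s (0,1,1) = 0"
    by (rule br_zero2[OF s(3), of _ 1]) (simp_all add: expand)
  have "J 5 (\<lambda>x. ?F3 x - (\<Sum>m\<in>Mon 6. s m * dmon 3 m x) - (?F3 x - c 2 * X2 x))"
    by (rule J_diff, use s(4) in simp, simp add: c1, (intro J_r; simp))
  note a = this
  have c2: "c 2 = 0"
    by (rule br_zero1[OF a, of _ 1]) (use 2 in \<open>simp_all add: expand\<close>)
  have 3: "- (3 * s (0,0,3)) = 0"
    by (rule br_zero2[OF a, of _ 2]) (use 2 in \<open>simp_all add: expand\<close>)
  have T7: "T 7 S" using s 1 2 3 by (simp add: Mon_simps)
  obtain s where s: "T (7 + 1) (\<lambda>x. S x - (\<Sum>m\<in>Mon 7. s m * mon m x))"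
    "J (7 + 1 - 3) (\<lambda>x. 0 - (\<Sum>m\<in>Mon 7. s m * dmon 1 m x))"
    "J (7 + 1 - 4) (\<lambda>x. c 3 * X1 x - (\<Sum>m\<in>Mon 7. s m * dmon 2 m x))"
    "J (7 + 1 - 2) (\<lambda>x. ?F3 x - (\<Sum>m\<in>Mon 7. s m * dmon 3 m x))"
    using lead[OF T7 sF3] by blast
  have 1: "- s (1,1,0) = 0"
    by (rule br_zero1[OF s(2), of _ 1]) (simp_all add: expand)
  have 2: "- s (1,0,2) = 0"
    by (rule br_zero2[OF s(2), of _ 2]) (simp_all add: expand)
  have c3: "c 3 = 0"
    by (rule br_zero3[OF s(3), of _ 3]) (use 1 in \<open>simp_all add: expand\<close>)
  have "J 6 (\<lambda>x. ?F3 x - (\<Sum>m\<in>Mon 7. s m * dmon 3 m x) - (?F3 x - c 4 * (X1 x * X3 x)))"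
    by (rule J_diff, use s(4) in simp, simp add: c1 c2, (intro J_r; simp))
  then have c4: "c 4 = 0"
    by (rule br_zero3[of _ _ _ 5]) (use 2 in \<open>simp_all add: expand\<close>)
  have T8: "T 8 S" using s 1 2 by (simp add: Mon_simps)
  obtain s where s: "T (8 + 1) (\<lambda>x. S x - (\<Sum>m\<in>Mon 8. s m * mon m x))"
    "J (8 + 1 - 3) (\<lambda>x. 0 - (\<Sum>m\<in>Mon 8. s m * dmon 1 m x))"
    "J (8 + 1 - 4) (\<lambda>x. c 3 * X1 x - (\<Sum>m\<in>Mon 8. s m * dmon 2 m x))"
    "J (8 + 1 - 2) (\<lambda>x. ?F3 x - (\<Sum>m\<in>Mon 8. s m * dmon 3 m x))"
    using lead[OF T8 sF3] by blast
  have 1: "- (2 * s (2,0,1)) = 0"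
    by (rule br_zero3[OF s(2), of _ 5]) (simp_all add: expand)
  have 2: "- (2 * s (0,2,0)) = 0"
    by (rule br_zero1[OF s(3), of _ 1]) (simp_all add: expand)
  have 3: "- s (0,1,2) = 0"
    by (rule br_zero2[OF s(3), of _ 2]) (simp_all add: expand)
  have a: "J 7 (\<lambda>x. ?F3 x - (\<Sum>m\<in>Mon 8. s m * dmon 3 m x) - (?F3 x - c 5 * X1 x ^ 2))"
    by (rule J_diff, use s(4) in simp, simp add: c1 c2 c4, (intro J_r; simp))
  have 4: "- (4 * s (0,0,4)) = 0"
    by (rule br_zero2[OF a, of _ 3]) (use 1 2 3 in \<open>simp_all add: expand\<close>)
  have c5: "c 5 = 0"
    by (rule br_zero3[OF a, of _ 6]) (use 1 2 3 4 in \<open>simp_all add: expand\<close>)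
  have T9: "T 9 S" using s 1 2 3 4 by (simp add: Mon_simps)
  obtain s where s: "T (9 + 1) (\<lambda>x. S x - (\<Sum>m\<in>Mon 9. s m * mon m x))"
    "J (9 + 1 - 3) (\<lambda>x. 0 - (\<Sum>m\<in>Mon 9. s m * dmon 1 m x))"
    "J (9 + 1 - 4) (\<lambda>x. c 3 * X1 x - (\<Sum>m\<in>Mon 9. s m * dmon 2 m x))"
    "J (9 + 1 - 2) (\<lambda>x. ?F3 x - (\<Sum>m\<in>Mon 9. s m * dmon 3 m x))"
    using lead[OF T9 sF3] by blast
  have 1: "- s (1,0,3) = 0"
    by (rule br_zero2[OF s(2), of _ 3]) (simp_all add: expand)
  have 2: "- s (1,1,1) = 0"
    by (rule br_zero3[OF s(3), of _ 5]) (simp_all add: expand c3)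
  have 3: "- (3 * s (3,0,0)) = 0"
    by (rule br_zero3[OF s(2), of _ 6]) (use 1 2 in \<open>simp_all add: expand\<close>)
  have a: "J 8 (\<lambda>x. ?F3 x - (\<Sum>m\<in>Mon 9. s m * dmon 3 m x) - (?F3 x - c 6 * (X1 x * X3 x ^ 2)))"
    by (rule J_diff, use s(4) in simp, simp add: c1 c2 c4 c5, (intro J_r; simp))
  have c6: "c 6 = 0"
    by (rule br_zero3[OF a, of _ 7]) (use 1 2 3 in \<open>simp_all add: expand\<close>)
  have T10: "T 10 S" using s 1 2 3 by (simp add: Mon_simps)
  obtain s where s: "T (10 + 1) (\<lambda>x. S x - (\<Sum>m\<in>Mon 10. s m * mon m x))"
    "J (10 + 1 - 3) (\<lambda>x. 0 - (\<Sum>m\<in>Mon 10. s m * dmon 1 m x))"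
    "J (10 + 1 - 4) (\<lambda>x. c 3 * X1 x - (\<Sum>m\<in>Mon 10. s m * dmon 2 m x))"
    "J (10 + 1 - 2) (\<lambda>x. ?F3 x - (\<Sum>m\<in>Mon 10. s m * dmon 3 m x))"
    using lead[OF T10 sF3] by blast
  have a: "J 9 (\<lambda>x. ?F3 x - (\<Sum>m\<in>Mon 10. s m * dmon 3 m x) - (?F3 x - c 7 * (X1 x ^ 2 * X3 x)))"
    by (rule J_diff, use s(4) in simp, simp add: c1 c2 c4 c5 c6, (intro J_r; simp))
  have 1: "- s (0,2,1) = 0"
    by (rule br_zero1[OF a, of _ 2]) (simp_all add: expand)
  have 2: "- (5 * s (0,0,5)) = 0"
    by (rule br_zero2[OF a, of _ 4]) (simp_all add: expand)
  have 3: "- s (0,1,3) = 0"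
    by (rule br_zero2[OF s(3), of _ 3]) (simp_all add: expand)
  have 4: "- s (2,1,0) = 0"
    by (rule br_zero3[OF s(3), of _ 6]) (use 1 3 in \<open>simp_all add: expand c3\<close>)
  have 5: "- (2 * s (2,0,2)) = 0"
    by (rule br_zero3[OF s(2), of _ 7]) (use 4 in \<open>simp_all add: expand\<close>)
  have c7: "c 7 = 0"
    by (rule br_zero3[OF a, of _ 8]) (use 1 2 3 4 5 in \<open>simp_all add: expand\<close>)
  have T11: "T 11 S" using s 1 2 3 4 5 by (simp add: Mon_simps)
  obtain s where s: "J (11 + 1 - 3) (\<lambda>x. 0 - (\<Sum>m\<in>Mon 11. s m * dmon 1 m x))"
    "J (11 + 1 - 4) (\<lambda>x. c 3 * X1 x - (\<Sum>m\<in>Mon 11. s m * dmon 2 m x))"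
    "J (11 + 1 - 2) (\<lambda>x. ?F3 x - (\<Sum>m\<in>Mon 11. s m * dmon 3 m x))"
    using lead[OF T11 sF3] by blast
  have 1: "- s (1,2,0) = 0"
    by (rule br_zero1[OF s(1), of _ 2]) (simp_all add: expand)
  have 2: "- s (1,0,4) = 0"
    by (rule br_zero2[OF s(1), of _ 4]) (simp_all add: expand)
  have 3: "- s (1,1,2) = 0"
    by (rule br_zero3[OF s(2), of _ 7]) (use 1 in \<open>simp_all add: expand c3\<close>)
  have 4: "- (3 * s (3,0,1)) = 0"
    by (rule br_zero3[OF s(1), of _ 8]) (use 1 2 3 in \<open>simp_all add: expand\<close>)
  have c8: "c 8 = 0"
    by (rule br_zero3[OF s(3), of _ 9]) (use 1 2 3 4 in \<open>simp_all add: expand c1 c2 c4 c5 c6 c7\<close>)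
  have "i \<in> {1, 2, 3, 4, 5, 6, 7, 8}" using assms(2) by auto
  then show ?thesis using c1 c2 c3 c4 c5 c6 c7 c8 by auto
qed

end

subsection \<open>Diffeomorphisms preserving the curve\<close>

text \<open>\<open>f\<close> has leading term \<open>c t\<^sup>k\<close>, where \<open>c = 0\<close> is allowed.\<close>

definition Ld :: "nat \<Rightarrow> real \<Rightarrow> (real \<Rightarrow> real) \<Rightarrow> bool" where
  "Ld k c f \<longleftrightarrow> Ob (k + 1) (\<lambda>t. f t - c * t ^ k)"

lemma Ld_Ob: "Ld k c f \<Longrightarrow> Ob k f"
  unfolding Ld_def
  using Ob_add[OF Ob_antimono[of "k + 1" "\<lambda>t. f t - c * t ^ k" k] Ob_monomial[of k k c]] by simp

lemma Ob_Ld0: "Ob (k + 1) f \<Longrightarrow> Ld k 0 f"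
  by (simp add: Ld_def)

lemma Ld_add: "Ld k c f \<Longrightarrow> Ld k d g \<Longrightarrow> Ld k (c + d) (\<lambda>t. f t + g t)"
  unfolding Ld_def by (drule (1) Ob_add) (simp add: algebra_simps)

lemma Ld_mult:
  assumes "Ld k c f" "Ld l d g"
  shows "Ld (k + l) (c * d) (\<lambda>t. f t * g t)"
proof -
  have 1: "Ob (k + 1 + l) (\<lambda>t. (f t - c * t ^ k) * g t)"
    using Ob_mult[OF assms(1)[unfolded Ld_def] Ld_Ob[OF assms(2)]] .
  have 2: "Ob (k + (l + 1)) (\<lambda>t. (c * t ^ k) * (g t - d * t ^ l))"
    using Ob_mult[OF Ob_monomial[OF order_refl] assms(2)[unfolded Ld_def]] .
  have "Ob (k + l + 1) (\<lambda>t. (f t - c * t ^ k) * g t + (c * t ^ k) * (g t - d * t ^ l))"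
    using 1 2 by (intro Ob_add) (simp_all add: algebra_simps)
  then show ?thesis unfolding Ld_def by (simp add: algebra_simps power_add)
qed

lemma Ld_zero: "Ld k c f \<Longrightarrow> near t. f t = 0 \<Longrightarrow> c = 0"
proof -
  assume f: "Ld k c f" "near t. f t = 0"
  have "Ob (k + 1) (\<lambda>t. - c * t ^ k)"
    by (rule Ob_cong[OF f(1)[unfolded Ld_def]]) (use f(2) in \<open>eventually_elim, simp\<close>)
  then show "c = 0" using Ob_zero[of k "- c"] by simp
qed

lemma Ld_nonzero:
  assumes "Ld k c f" "c \<noteq> 0"
  shows "near t. t \<noteq> 0 \<longrightarrow> f t * (c * t ^ k) > 0"
proof -
  obtain h K where h: "near t. f t - c * t ^ k = t ^ (k + 1) * h t \<and> \<bar>h t\<bar> \<le> K"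
    using assms(1) by (auto simp: Ld_def Ob_def)
  have K: "K \<ge> 0" using eventually_nhds_x_imp_x[OF h] by linarith
  have "near t::real. \<bar>t\<bar> < \<bar>c\<bar> / (K + 1)"
    unfolding eventually_nhds_metric
    by (rule exI[of _ "\<bar>c\<bar> / (K + 1)"]) (use assms(2) K in \<open>auto simp: dist_real_def\<close>)
  then show ?thesis using h
  proof eventually_elim
    case (elim t)
    show ?case
    proof
      assume t: "t \<noteq> 0"
      have "\<bar>t * h t\<bar> \<le> \<bar>t\<bar> * K" using elim by (simp add: abs_mult mult_left_mono)
      also have "\<dots> \<le> \<bar>t\<bar> * (K + 1)" by (simp add: algebra_simps)
      also have "\<dots> < \<bar>c\<bar>" using elim(1) K by (simp add: pos_less_divide_eq)
      finally have "\<bar>t * h t\<bar> < \<bar>c\<bar>" .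
      then have "c * (c + t * h t) > 0"
        by (cases "c > 0") (auto simp: zero_less_mult_iff abs_less_iff abs_if split: if_splits)
      moreover have "f t * (c * t ^ k) = (t ^ k) ^ 2 * (c * (c + t * h t))"
      proof -
        have "f t = c * t ^ k + t ^ (k + 1) * h t" using elim(2) by simp
        then show ?thesis by (simp add: power2_eq_square power_add algebra_simps)
      qed
      ultimately show "f t * (c * t ^ k) > 0"
        by (metis mult_pos_pos power_not_zero t zero_less_power2)
    qed
  qed
qed

text \<open>The substitution restricts to the half line with the sign of \<open>c\<close>, for
  identities that are only known on one side of \<open>0\<close>.\<close>

lemma Ob_quadratic_subst:
  assumes "Ob k f"
  shows "Ob (2 * k) (\<lambda>t. f (c * t ^ 2))"
proof -
  obtain h K where h: "near t. f t = t ^ k * h t \<and> \<bar>h t\<bar> \<le> K"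
    using assms by (auto simp: Ob_def)
  have i: "sm (\<lambda>t::real. t)" by simp
  have "sm (\<lambda>t::real. c * t ^ 2)" by (intro sm_mult sm_const sm_power i)
  from eventually_compose_germ[OF h this]
  have "near t. f (c * t ^ 2) = (c * t ^ 2) ^ k * h (c * t ^ 2) \<and> \<bar>h (c * t ^ 2)\<bar> \<le> K"
    by simp
  then have "near t. f (c * t ^ 2) = t ^ (2 * k) * (c ^ k * h (c * t ^ 2)) \<and> \<bar>c ^ k * h (c * t ^ 2)\<bar> \<le> \<bar>c\<bar> ^ k * K"
  proof eventually_elim
    case (elim t)
    then show ?case by (simp add: power_mult_distrib power_mult abs_mult power_abs mult_left_mono)
  qed
  then show ?thesis by (rule ObI)
qed

lemma Ob_poly4:
  assumes "Ob (k + 4) (\<lambda>t. a * t ^ k + b * t ^ (k + 1) + c * t ^ (k + 2) + d * t ^ (k + 3))"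
  shows "a = 0" "b = 0" "c = 0" "d = 0"
proof -
  let ?f = "\<lambda>t. a * t ^ k + b * t ^ (k + 1) + c * t ^ (k + 2) + d * t ^ (k + 3)"
  have "Ob (k + 1) (\<lambda>t. ?f t - b * t ^ (k + 1) - c * t ^ (k + 2) - d * t ^ (k + 3))"
    by (intro Ob_diff Ob_monomial Ob_antimono[OF assms]) auto
  then show a: "a = 0" by (intro Ob_zero[of k]) simp
  have "Ob (k + 1 + 1) (\<lambda>t. ?f t - c * t ^ (k + 2) - d * t ^ (k + 3))"
    by (intro Ob_diff Ob_monomial Ob_antimono[OF assms]) auto
  then show b: "b = 0" using a by (intro Ob_zero[of "k + 1"]) simp
  have "Ob (k + 2 + 1) (\<lambda>t. ?f t - d * t ^ (k + 3))"
    by (intro Ob_diff Ob_monomial Ob_antimono[OF assms]) auto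
  then show c: "c = 0" using a b by (intro Ob_zero[of "k + 2"]) simp
  have "Ob (k + 3 + 1) ?f"
    by (intro Ob_antimono[OF assms]) auto
  then show d: "d = 0" using a b c by (intro Ob_zero[of "k + 3"]) simp
qed

context symp_coords
begin

lemma T_imp_J: "T k F \<Longrightarrow> J k F"
proof (induction rule: T.induct)
  case (T_trans P j k)
  show ?case
    by (rule J_ceq[OF J_zero]) (use T_trans C_zero in \<open>auto intro!: sm_mult ceqI\<close>)
next
  case (T_cong k F G)
  have "T k G" by (rule T.T_cong[OF T_cong(1,2)])
  moreover have "ceq G F" unfolding ceq_def using T_cong(2) by eventually_elim simp
  ultimately show ?case using J_ceq[OF T_cong(3) T_sm] by blast
qed (auto intro: J.intros)

lemma J_at_0: "J k F \<Longrightarrow> k \<ge> 1 \<Longrightarrow> F 0 = 0"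
proof (induction rule: J.induct)
  case (J_monomial P k a b c)
  then have "a > 0 \<or> b > 0 \<or> c > 0" by auto
  then show ?case by auto
next
  case (J_ceq k F G)
  then show ?case using eventually_nhds_x_imp_x[OF J_ceq(3)[unfolded ceq_def]] by simp
qed auto

text \<open>Up to weight 4 a germ is \<open>a + b X3 + c X1 + d X3^2 + k X2\<close> modulo
  \<open>T 5\<close>. The cusp gives \<open>a = b = c = 0\<close> and \<open>d = k\<close>, as it
  does not tell \<open>X3^2\<close> from \<open>- X2\<close>; the line of \<open>X2\<close> then
  gives \<open>k = 0\<close>. Thus values on the curve determine the linear part in these three
  directions.\<close>

lemma J5_der0:
  assumes "J 5 F" "i \<in> {1, 2, 3}"
  shows "fder F 0 (axis (e i) 1) = 0"
proof -
  have sF: "sm F" by (rule J_sm[OF assms(1)])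
  let ?p = "\<lambda>s x. \<Sum>w<5. \<Sum>m\<in>Mon w. s w m * mon m x"
  have "\<exists>s. T k (\<lambda>x. F x - (\<Sum>w<k. \<Sum>m\<in>Mon w. s w m * mon m x))" for k
  proof (induction k)
    case 0
    then show ?case using T_0[OF sF] by simp
  next
    case (Suc k)
    then obtain s where "T k (\<lambda>x. F x - (\<Sum>w<k. \<Sum>m\<in>Mon w. s w m * mon m x))" by blast
    then obtain s' where "T (k + 1) (\<lambda>x. F x - (\<Sum>w<k. \<Sum>m\<in>Mon w. s w m * mon m x) - (\<Sum>m\<in>Mon k. s' m * mon m x))"
      using T_step by blast
    moreover have "(\<Sum>w<k. \<Sum>m\<in>Mon w. (s(k := s')) w m * mon m x) = (\<Sum>w<k. \<Sum>m\<in>Mon w. s w m * mon m x)" for x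
      by (rule sum.cong) auto
    then have "(\<Sum>w<Suc k. \<Sum>m\<in>Mon w. (s(k := s')) w m * mon m x) =
        (\<Sum>w<k. \<Sum>m\<in>Mon w. s w m * mon m x) + (\<Sum>m\<in>Mon k. s' m * mon m x)" for x
      by (subst sum.lessThan_Suc) simp
    ultimately show ?case by (intro exI[of _ "s(k := s')"]) (simp only: diff_diff_eq Suc_eq_plus1)
  qed
  then obtain s where "T 5 (\<lambda>x. F x - ?p s x)" by blast
  moreover have "(\<Sum>w<5. \<Sum>m\<in>Mon w. s w m * mon m x) = s 0 (0,0,0) + s 2 (0,0,1) * X3 x + s 3 (1,0,0) * X1 x +
      s 4 (0,0,2) * X3 x ^ 2 + s 4 (0,1,0) * X2 x" for x
  proof -
    have "{..<5::nat} = {0, 1, 2, 3, 4}" by auto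
    then show ?thesis by (simp add: Mon_simps mon_def)
  qed
  ultimately obtain a b c d k where T: "T 5 (\<lambda>x. F x - (a + b * X3 x + c * X1 x + d * X3 x ^ 2 + k * X2 x))"
    by auto
  have J5: "J 5 (\<lambda>x. F x - (F x - (a + b * X3 x + c * X1 x + d * X3 x ^ 2 + k * X2 x)))"
    by (rule J_diff[OF assms(1) T_imp_J[OF T]])
  have Ob5: "Ob 5 (\<lambda>t. a + b * t ^ 2 + c * t ^ 3 + (d - k) * t ^ 4)"
    using J_br3[OF J5] by (simp add: algebra_simps power_mult[symmetric])
  have "Ob (0 + 1) (\<lambda>t. a + b * t ^ 2 + c * t ^ 3 + (d - k) * t ^ 4 - b * t ^ 2 - c * t ^ 3 - (d - k) * t ^ 4)"
    by (intro Ob_diff Ob_monomial Ob_antimono[OF Ob5]) auto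
  then have a: "a = 0" by (intro Ob_zero[of 0]) simp
  have "Ob (2 + 1) (\<lambda>t. a + b * t ^ 2 + c * t ^ 3 + (d - k) * t ^ 4 - c * t ^ 3 - (d - k) * t ^ 4)"
    by (intro Ob_diff Ob_monomial Ob_antimono[OF Ob5]) auto
  then have b: "b = 0" using a by (intro Ob_zero[of 2]) simp
  have "Ob (3 + 1) (\<lambda>t. a + b * t ^ 2 + c * t ^ 3 + (d - k) * t ^ 4 - (d - k) * t ^ 4)"
    by (intro Ob_diff Ob_monomial Ob_antimono[OF Ob5]) auto
  then have c: "c = 0" using a b by (intro Ob_zero[of 3]) simp
  have k: "k = 0"
    by (rule br_zero1[OF J5, of _ 1]) (use a in simp_all)
  have T': "T 5 (\<lambda>x. F x - d * X3 x ^ 2)" using T a b c k by simp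
  have z: "fder (\<lambda>x. F x - d * X3 x ^ 2) 0 (axis (e i) 1) = 0"
    using assms(2) J_at_0[OF T_der(1)[OF T']] J_at_0[OF T_der(2)[OF T']] J_at_0[OF T_der(3)[OF T']] by auto
  have dF: "(F has_derivative fder F 0) (at 0)" using sm_has_fder_0[OF sF] .
  have "fder (\<lambda>x. F x - d * X3 x ^ 2) 0 v = fder F 0 v" for v
    by (rule fder_eqI) (auto intro!: derivative_eq_intros dF)
  then show ?thesis using z by simp
qed

lemma J_step_ex:
  "J k F \<Longrightarrow> \<exists>p q r t. J (k + 1) (\<lambda>x. F x - (p * X3 x ^ ((k + 1) div 2) + q * (X1 x * X3 x ^ ((k - 2) div 2)) +
       r * X2 x ^ ((k + 3) div 4) + t * (X2 x * X3 x ^ ((k - 3) div 2))))"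
  by (erule J_step) blast

text \<open>Six applications of \<open>J_step\<close>, for the weights 2 to 7, with repeated
  monomials collected and those of weight 8 discarded.\<close>

lemma taylor_C:
  assumes "sm F" "F 0 = 0"
  obtains p1 p2 p3 p4 p5 p6 p7 p8 where
    "J 8 (\<lambda>x. F x - (p1 * X3 x + p2 * X1 x + p3 * X3 x ^ 2 + p4 * X2 x + p5 * (X1 x * X3 x) + p6 * X3 x ^ 3 +
      p7 * (X2 x * X3 x) + p8 * (X1 x * X3 x ^ 2)))"
proof -
  have "J 2 F" using J_sub_const[OF assms(1)] assms(2) by simp
  from J_step_ex[of 2, simplified, OF this] obtain a1 b1 c1 d1 where "J 3 (\<lambda>x. F x - (a1 * X3 x + b1 * X1 x + c1 * X2 x + d1 * X2 x))" by blast
  from J_step_ex[of 3, simplified, OF this] obtain a2 b2 c2 d2 where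
    "J 4 (\<lambda>x. F x - (a1 * X3 x + b1 * X1 x + c1 * X2 x + d1 * X2 x) - (a2 * X3 x ^ 2 + b2 * X1 x + c2 * X2 x + d2 * X2 x))" by blast
  from J_step_ex[of 4, simplified, OF this] obtain a3 b3 c3 d3 where
    "J 5 (\<lambda>x. F x - (a1 * X3 x + b1 * X1 x + c1 * X2 x + d1 * X2 x) - (a2 * X3 x ^ 2 + b2 * X1 x + c2 * X2 x + d2 * X2 x)
     - (a3 * X3 x ^ 2 + b3 * (X1 x * X3 x) + c3 * X2 x + d3 * X2 x))" by blast
  from J_step_ex[of 5, simplified, OF this] obtain a4 b4 c4 d4 where
    "J 6 (\<lambda>x. F x - (a1 * X3 x + b1 * X1 x + c1 * X2 x + d1 * X2 x) - (a2 * X3 x ^ 2 + b2 * X1 x + c2 * X2 x + d2 * X2 x)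
     - (a3 * X3 x ^ 2 + b3 * (X1 x * X3 x) + c3 * X2 x + d3 * X2 x)
     - (a4 * X3 x ^ 3 + b4 * (X1 x * X3 x) + c4 * X2 x ^ 2 + d4 * (X2 x * X3 x)))" by blast
  from J_step_ex[of 6, simplified, OF this] obtain a5 b5 c5 d5 where
    "J 7 (\<lambda>x. F x - (a1 * X3 x + b1 * X1 x + c1 * X2 x + d1 * X2 x) - (a2 * X3 x ^ 2 + b2 * X1 x + c2 * X2 x + d2 * X2 x)
     - (a3 * X3 x ^ 2 + b3 * (X1 x * X3 x) + c3 * X2 x + d3 * X2 x)
     - (a4 * X3 x ^ 3 + b4 * (X1 x * X3 x) + c4 * X2 x ^ 2 + d4 * (X2 x * X3 x))
     - (a5 * X3 x ^ 3 + b5 * (X1 x * X3 x ^ 2) + c5 * X2 x ^ 2 + d5 * (X2 x * X3 x)))" by blast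
  from J_step_ex[of 7, simplified, OF this] obtain a6 b6 c6 d6 where
    J: "J 8 (\<lambda>x. F x - (a1 * X3 x + b1 * X1 x + c1 * X2 x + d1 * X2 x) - (a2 * X3 x ^ 2 + b2 * X1 x + c2 * X2 x + d2 * X2 x)
     - (a3 * X3 x ^ 2 + b3 * (X1 x * X3 x) + c3 * X2 x + d3 * X2 x)
     - (a4 * X3 x ^ 3 + b4 * (X1 x * X3 x) + c4 * X2 x ^ 2 + d4 * (X2 x * X3 x))
     - (a5 * X3 x ^ 3 + b5 * (X1 x * X3 x ^ 2) + c5 * X2 x ^ 2 + d5 * (X2 x * X3 x))
     - (a6 * X3 x ^ 4 + b6 * (X1 x * X3 x ^ 2) + c6 * X2 x ^ 2 + d6 * (X2 x * X3 x ^ 2)))" by blast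
  have m: "J 8 (\<lambda>x. X3 x ^ 4)" "J 8 (\<lambda>x. X2 x ^ 2)" "J 8 (\<lambda>x. X2 x * X3 x ^ 2)"
    using J_m(1)[of 4] J_m(3)[of 2] J_m(4)[of 2] by simp_all
  have "J 8 (\<lambda>x. F x - (a1 * X3 x + b1 * X1 x + c1 * X2 x + d1 * X2 x) - (a2 * X3 x ^ 2 + b2 * X1 x + c2 * X2 x + d2 * X2 x)
     - (a3 * X3 x ^ 2 + b3 * (X1 x * X3 x) + c3 * X2 x + d3 * X2 x)
     - (a4 * X3 x ^ 3 + b4 * (X1 x * X3 x) + c4 * X2 x ^ 2 + d4 * (X2 x * X3 x))
     - (a5 * X3 x ^ 3 + b5 * (X1 x * X3 x ^ 2) + c5 * X2 x ^ 2 + d5 * (X2 x * X3 x))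
     - (a6 * X3 x ^ 4 + b6 * (X1 x * X3 x ^ 2) + c6 * X2 x ^ 2 + d6 * (X2 x * X3 x ^ 2))
     + (a6 * X3 x ^ 4 + (c4 + c5 + c6) * X2 x ^ 2 + d6 * (X2 x * X3 x ^ 2)))"
    by (rule J_add[OF J]) (intro J_add J_cmult m)
  then have "J 8 (\<lambda>x. F x - (a1 * X3 x + (b1 + b2) * X1 x + (a2 + a3) * X3 x ^ 2 + (c1 + d1 + c2 + d2 + c3 + d3) * X2 x
     + (b3 + b4) * (X1 x * X3 x) + (a4 + a5) * X3 x ^ 3 + (d4 + d5) * (X2 x * X3 x) + (b5 + b6) * (X1 x * X3 x ^ 2)))"
    by (simp add: algebra_simps)
  then show ?thesis by (rule that)
qed

lemma taylor_br:
  assumes "J 8 (\<lambda>x. F x - (p1 * X3 x + p2 * X1 x + p3 * X3 x ^ 2 + p4 * X2 x + p5 * (X1 x * X3 x) + p6 * X3 x ^ 3 +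
      p7 * (X2 x * X3 x) + p8 * (X1 x * X3 x ^ 2)))"
  shows "Ld 1 p4 (\<lambda>t. F (br1 t))" "Ob 4 (\<lambda>t. F (br2 t) - (p1 * t + p3 * t ^ 2 + p6 * t ^ 3))"
    "Ob 8 (\<lambda>t. F (br3 t) - (p1 * t ^ 2 + p2 * t ^ 3 + (p3 - p4) * t ^ 4 + p5 * t ^ 5 + (p6 - p7) * t ^ 6 + p8 * t ^ 7))"
    "fder F 0 (axis (e 1) 1) = p2" "fder F 0 (axis (e 2) 1) = p4" "fder F 0 (axis (e 3) 1) = p1"
proof -
  let ?p = "\<lambda>x. p1 * X3 x + p2 * X1 x + p3 * X3 x ^ 2 + p4 * X2 x + p5 * (X1 x * X3 x) + p6 * X3 x ^ 3 +
      p7 * (X2 x * X3 x) + p8 * (X1 x * X3 x ^ 2)"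
  have "Ob 2 (\<lambda>t. F (br1 t) - p4 * t)"
    using Ob_antimono[OF J_br1[OF assms], of 2] by simp
  then show "Ld 1 p4 (\<lambda>t. F (br1 t))" by (simp add: Ld_def)
  show "Ob 4 (\<lambda>t. F (br2 t) - (p1 * t + p3 * t ^ 2 + p6 * t ^ 3))"
    using Ob_antimono[OF J_br2[OF assms], of 4] by simp
  have e: "?p (br3 t) = p1 * t ^ 2 + p2 * t ^ 3 + (p3 - p4) * t ^ 4 + p5 * t ^ 5 + (p6 - p7) * t ^ 6 + p8 * t ^ 7" for t
    by (simp, algebra)
  show "Ob 8 (\<lambda>t. F (br3 t) - (p1 * t ^ 2 + p2 * t ^ 3 + (p3 - p4) * t ^ 4 + p5 * t ^ 5 + (p6 - p7) * t ^ 6 + p8 * t ^ 7))"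
    using J_br3[OF assms] unfolding e .
  have "sm (\<lambda>x. F x - ?p x + ?p x)"
    by (rule sm_add[OF J_sm[OF assms]]) (intro sm_add sm_mult sm_const sm_power sm_coord)
  then have sF: "sm F" by simp
  have dF: "(F has_derivative fder F 0) (at 0)" using sm_has_fder_0[OF sF] .
  have "fder (\<lambda>x. F x - ?p x) 0 v = fder F 0 v - (p1 * X3 v + p2 * X1 v + p4 * X2 v)" for v
    by (rule fder_eqI) (auto intro!: derivative_eq_intros dF simp: algebra_simps)
  moreover have "J 5 (\<lambda>x. F x - ?p x)" by (rule J_antimono[OF assms]) simp
  ultimately show "fder F 0 (axis (e 1) 1) = p2" "fder F 0 (axis (e 2) 1) = p4" "fder F 0 (axis (e 3) 1) = p1"
    using J5_der0[of "\<lambda>x. F x - ?p x" 1] J5_der0[of "\<lambda>x. F x - ?p x" 2] J5_der0[of "\<lambda>x. F x - ?p x" 3]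
    by (auto simp: axis_def)
qed

lemma br_rel:
  assumes "near x. x \<in> C \<longrightarrow> G x \<in> C" "sm br" "br 0 = 0" "\<And>t. br t \<in> C"
  shows "near t::real. X1 (G (br t)) ^ 2 + X2 (G (br t)) * X3 (G (br t)) = 0 \<and>
     X1 (G (br t)) * (X2 (G (br t)) + X3 (G (br t)) ^ 2) = 0"
  using eventually_compose_germ[OF assms(1-3)]
proof eventually_elim
  case (elim t)
  then show ?case using C_rel[of "G (br t)"] assms(4) by (simp add: algebra_simps)
qed

text \<open>The terms of order 2 of the two equations are \<open>p^2 + r q = 0\<close> and
  \<open>p r = 0\<close>.\<close>

lemma deg1_orders:
  assumes "Ld 1 p y1" "Ld 1 r y2" "Ld 1 q y3"
    and ev: "near t::real. y1 t ^ 2 + y2 t * y3 t = 0 \<and> y1 t * (y2 t + y3 t ^ 2) = 0"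
  shows "p = 0" "r * q = 0"
proof -
  have "Ld (1 + 1) (p * p + r * q) (\<lambda>t. y1 t * y1 t + y2 t * y3 t)"
    by (intro Ld_add Ld_mult assms)
  then have 1: "p * p + r * q = 0"
    by (rule Ld_zero) (use ev in \<open>eventually_elim, simp add: power2_eq_square\<close>)
  have "Ob (1 + 1) (\<lambda>t. y3 t * y3 t)" by (rule Ob_mult[OF Ld_Ob[OF assms(3)] Ld_Ob[OF assms(3)]])
  then have "Ld (1 + 1) (p * (r + 0)) (\<lambda>t. y1 t * (y2 t + y3 t * y3 t))"
    by (intro Ld_add Ld_mult assms Ob_Ld0)
  then have "p * (r + 0) = 0"
    by (rule Ld_zero) (use ev in \<open>eventually_elim, simp add: power2_eq_square\<close>)
  then show "p = 0" "r * q = 0" using 1 by auto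
qed

text \<open>The expansions of the components of \<open>G\<close> are put into the equations of the
  curve along each branch. Lowest orders and invertibility fix the linear part; the identities
  \<open>X1^2 = X3^3\<close> and \<open>X2 = - X3^2\<close> on the cusp then express the remaining
  coefficients by \<open>a\<close>, \<open>b\<close>, \<open>d\<close>.\<close>

theorem curve_diffeo_structure:
  assumes G: "ld G" "near x. x \<in> C \<longrightarrow> G x \<in> C"
  obtains a b d where "a \<noteq> 0"
    "J 7 (\<lambda>x. X1 (G x) - (a ^ 3 * X1 x + 3 * a ^ 2 * (X1 x * (b * X3 x + d * X1 x))))"
    "J 8 (\<lambda>x. X2 (G x) - (a ^ 4 * X2 x + 4 * a ^ 3 * (X2 x * (b * X3 x + d * X1 x))))"
    "J 6 (\<lambda>x. X3 (G x) - (a ^ 2 * X3 x + 2 * a * (X3 x * (b * X3 x + d * X1 x))))"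
proof -
  have sG: "sm G" "G 0 = 0" "inj (fder G 0)" using G(1) by (auto simp: ld_def)
  have s: "sm (\<lambda>x. G x $ j)" for j using sG(1) by auto
  have z: "(\<lambda>x. G x $ j) 0 = 0" for j using sG(2) by simp
  obtain p1 p2 p3 p4 p5 p6 p7 p8 where P:
    "J 8 (\<lambda>x. X1 (G x) - (p1 * X3 x + p2 * X1 x + p3 * X3 x ^ 2 + p4 * X2 x + p5 * (X1 x * X3 x) + p6 * X3 x ^ 3 +
      p7 * (X2 x * X3 x) + p8 * (X1 x * X3 x ^ 2)))"
    using taylor_C[OF s z] by blast
  obtain r1 r2 r3 r4 r5 r6 r7 r8 where R:
    "J 8 (\<lambda>x. X2 (G x) - (r1 * X3 x + r2 * X1 x + r3 * X3 x ^ 2 + r4 * X2 x + r5 * (X1 x * X3 x) + r6 * X3 x ^ 3 +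
      r7 * (X2 x * X3 x) + r8 * (X1 x * X3 x ^ 2)))"
    using taylor_C[OF s z] by blast
  obtain q1 q2 q3 q4 q5 q6 q7 q8 where Q:
    "J 8 (\<lambda>x. X3 (G x) - (q1 * X3 x + q2 * X1 x + q3 * X3 x ^ 2 + q4 * X2 x + q5 * (X1 x * X3 x) + q6 * X3 x ^ 3 +
      q7 * (X2 x * X3 x) + q8 * (X1 x * X3 x ^ 2)))"
    using taylor_C[OF s z] by blast
  note Pb = taylor_br[OF P] and Rb = taylor_br[OF R] and Qb = taylor_br[OF Q]
  have dG: "fder G 0 v $ j = fder (\<lambda>x. G x $ j) 0 v" for v j
    using fder_nth[OF sm_differentiable_0[OF sG(1)]] by simp
  have lG: "linear (fder G 0)" by (rule linear_fder[OF sm_differentiable_0[OF sG(1)]])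
  \<comment> \<open>Transversal components of \<open>G\<close> vanish on the curve, so the
    derivative maps the three coordinate directions into their own span, and injectivity becomes a
    condition on a 3 by 3 matrix.\<close>
  have tr: "fder G 0 (axis (e i) 1) $ j = 0" if i: "i \<in> {1, 2, 3}" and j: "j \<in> e ` {4..2*n}" for i j
  proof -
    have "J 5 (\<lambda>x. G x $ j)"
      by (rule J_ceq[OF J_zero s]) (use G(2) C_zero[OF _ j] in \<open>auto simp: ceq_def elim: eventually_mono\<close>)
    then show ?thesis using J5_der0[OF _ i] dG by simp
  qed
  have inj: "\<alpha> = 0 \<and> \<beta> = 0 \<and> \<gamma> = 0"
    if "p2 * \<alpha> + p4 * \<beta> + p1 * \<gamma> = 0" "r2 * \<alpha> + r4 * \<beta> + r1 * \<gamma> = 0" "q2 * \<alpha> + q4 * \<beta> + q1 * \<gamma> = 0" for \<alpha> \<beta> \<gamma>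
  proof -
    let ?v = "\<alpha> *\<^sub>R axis (e 1) 1 + \<beta> *\<^sub>R axis (e 2) 1 + \<gamma> *\<^sub>R axis (e 3) (1::real)"
    have "fder G 0 ?v $ j = 0" for j
    proof -
      have ex: "fder G 0 ?v $ j = \<alpha> * fder G 0 (axis (e 1) 1) $ j + \<beta> * fder G 0 (axis (e 2) 1) $ j + \<gamma> * fder G 0 (axis (e 3) 1) $ j"
        by (simp add: linear_add[OF lG] linear_scale[OF lG])
      have "j \<in> {e 1, e 2, e 3} \<or> j \<in> e ` {4..2*n}" using UNIV_split(1) by blast
      then consider "j = e 1" | "j = e 2" | "j = e 3" | "j \<in> e ` {4..2*n}" by blast
      then show ?thesis
      proof cases
        case 1
        show ?thesis using that(1) Pb(4-6) unfolding ex unfolding 1 dG by (simp add: algebra_simps)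
      next
        case 2
        show ?thesis using that(2) Rb(4-6) unfolding ex unfolding 2 dG by (simp add: algebra_simps)
      next
        case 3
        show ?thesis using that(3) Qb(4-6) unfolding ex unfolding 3 dG by (simp add: algebra_simps)
      next
        case 4
        show ?thesis unfolding ex by (simp add: tr[OF _ 4])
      qed
    qed
    then have "fder G 0 ?v = fder G 0 0" by (simp add: vec_eq_iff linear_0[OF lG])
    then have "?v = 0" using sG(3) by (simp add: inj_eq)
    then have "X1 ?v = 0" "X2 ?v = 0" "X3 ?v = 0" by simp_all
    then show ?thesis by (simp add: axis_def)
  qed
  note rel1 = br_rel[OF G(2) br_sm(1) br_0(1) br_C(1)] and rel2 = br_rel[OF G(2) br_sm(2) br_0(2) br_C(2)]
    and rel3 = br_rel[OF G(2) br_sm(3) br_0(3) br_C(3)]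
  have L2: "Ld 1 c1 f" if "Ob 4 (\<lambda>t. f t - (c1 * t + c2 * t ^ 2 + c3 * t ^ 3))" for c1 c2 c3 f
  proof -
    have "Ob 2 (\<lambda>t. f t - (c1 * t + c2 * t ^ 2 + c3 * t ^ 3) + c2 * t ^ 2 + c3 * t ^ 3)"
      by (intro Ob_add Ob_monomial Ob_antimono[OF that]) auto
    then show ?thesis by (simp add: Ld_def algebra_simps)
  qed
  have p4: "p4 = 0" and rq4: "r4 * q4 = 0"
    using deg1_orders[OF Pb(1) Rb(1) Qb(1) rel1] by auto
  have p1: "p1 = 0" and rq1: "r1 * q1 = 0"
    using deg1_orders[OF L2[OF Pb(2)] L2[OF Rb(2)] L2[OF Qb(2)] rel2] by auto
  have col2: "r4 \<noteq> 0 \<or> q4 \<noteq> 0" using inj[of 0 1 0] p4 by auto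
  have col3: "r1 \<noteq> 0 \<or> q1 \<noteq> 0" using inj[of 0 0 1] p1 by auto
  have d: "\<not> (r4 = 0 \<and> r1 = 0)" using inj[of 0 q1 "- q4"] p1 p4 col2 by (auto simp: algebra_simps)
  have d': "\<not> (q4 = 0 \<and> q1 = 0)" using inj[of 0 r1 "- r4"] p1 p4 col2 by (auto simp: algebra_simps)
  \<comment> \<open>Otherwise the first row of this matrix would be zero, \<open>p1\<close> and
    \<open>p4\<close> being zero already.\<close>
  have p2: "p2 \<noteq> 0"
  proof
    assume p2: "p2 = 0"
    show False
    proof (cases "q4 = 0")
      case True
      then have q: "q1 \<noteq> 0" "r1 = 0" "r4 \<noteq> 0" using d' rq1 d by auto
      show False using inj[of 1 "- (r2 / r4)" "- (q2 / q1)"] p1 p4 p2 True q by auto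
    next
      case False
      then have q: "r4 = 0" "r1 \<noteq> 0" "q1 = 0" using d rq4 rq1 by auto
      show False using inj[of 1 "- (q2 / q4)" "- (r2 / r1)"] p1 p4 p2 False q by auto
    qed
  qed
  have L3: "Ob k (\<lambda>t. f t - g t)" if "Ob 8 (\<lambda>t. f t - (g t + h t))" "k \<le> 8" "Ob k h" for f g h k
  proof -
    have "Ob k (\<lambda>t. f t - (g t + h t) + h t)" by (intro Ob_add that Ob_antimono[OF that(1)])
    then show ?thesis by simp
  qed
  have y1: "Ld 3 p2 (\<lambda>t. X1 (G (br3 t)))"
    unfolding Ld_def
    by (rule L3[where h = "\<lambda>t. (p3 - p4) * t ^ 4 + p5 * t ^ 5 + (p6 - p7) * t ^ 6 + p8 * t ^ 7"])
       (use Pb(3) p1 in \<open>auto intro!: Ob_add Ob_monomial simp: add.assoc\<close>)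
  have y1n: "near t. t \<noteq> 0 \<longrightarrow> X1 (G (br3 t)) \<noteq> 0"
    using Ld_nonzero[OF y1 p2] by eventually_elim auto
  \<comment> \<open>As \<open>p2\<close> is nonzero, points of the cusp other than \<open>0\<close>
    have images with \<open>X1\<close> nonzero, and the factor \<open>X1\<close> cancels from the
    second equation.\<close>
  have cusp: "near t. X2 (G (br3 t)) + X3 (G (br3 t)) ^ 2 = 0 \<and> X1 (G (br3 t)) ^ 2 - X3 (G (br3 t)) ^ 3 = 0"
    using y1n rel3
  proof eventually_elim
    case (elim t)
    show ?case
    proof (cases "t = 0")
      case True
      then show ?thesis using sG(2) by simp
    next
      case False
      then have "X2 (G (br3 t)) + X3 (G (br3 t)) ^ 2 = 0" using elim by simp
      then show ?thesis using elim(2) by (auto, algebra)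
    qed
  qed
  \<comment> \<open>This excludes an exchange of the two lines: it would give \<open>X2\<close>
    order 2 along the image of the cusp, whereas \<open>X3^2\<close> would have order at least
    6.\<close>
  have q1: "q1 \<noteq> 0"
  proof
    assume q1: "q1 = 0"
    then have r: "r1 \<noteq> 0" using col3 by simp
    have "Ld 2 r1 (\<lambda>t. X2 (G (br3 t)))"
      unfolding Ld_def
      by (rule L3[where h = "\<lambda>t. r2 * t ^ 3 + (r3 - r4) * t ^ 4 + r5 * t ^ 5 + (r6 - r7) * t ^ 6 + r8 * t ^ 7"])
         (use Rb(3) in \<open>auto intro!: Ob_add Ob_monomial simp: add.assoc\<close>)
    moreover have "Ob 3 (\<lambda>t. X3 (G (br3 t)) - 0)"
      by (rule L3[where h = "\<lambda>t. q2 * t ^ 3 + (q3 - q4) * t ^ 4 + q5 * t ^ 5 + (q6 - q7) * t ^ 6 + q8 * t ^ 7"])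
         (use Qb(3) q1 in \<open>auto intro!: Ob_add Ob_monomial simp: add.assoc\<close>)
    then have "Ob (2 * 3) (\<lambda>t. X3 (G (br3 t)) ^ 2)" using Ob_power[of 3 "\<lambda>t. X3 (G (br3 t))" 2] by simp
    then have "Ld 2 0 (\<lambda>t. X3 (G (br3 t)) ^ 2)" by (intro Ob_Ld0) (rule Ob_antimono, auto)
    ultimately have "Ld 2 (r1 + 0) (\<lambda>t. X2 (G (br3 t)) + X3 (G (br3 t)) ^ 2)" by (rule Ld_add)
    then have "r1 + 0 = 0" by (rule Ld_zero) (use cusp in \<open>eventually_elim, simp\<close>)
    then show False using r by simp
  qed
  then have r1: "r1 = 0" and r4: "r4 \<noteq> 0" and q4: "q4 = 0" using rq1 d rq4 by auto
  \<comment> \<open>On the half of the \<open>X3\<close> axis whose image has \<open>X3 < 0\<close>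
    the image avoids the cusp, where \<open>X3\<close> is a square, and so stays on the line. On the
    other half it might lie on the cusp, so the coefficients are compared after the substitution
    \<open>- q1 * t ^ 2\<close>.\<close>
  have half: "near t. X1 (G (br2 (- q1 * t ^ 2))) = 0 \<and> X2 (G (br2 (- q1 * t ^ 2))) = 0"
  proof -
    have ev: "near t. (X1 (G (br2 t)) ^ 2 + X2 (G (br2 t)) * X3 (G (br2 t)) = 0 \<and>
        X1 (G (br2 t)) * (X2 (G (br2 t)) + X3 (G (br2 t)) ^ 2) = 0) \<and> (t \<noteq> 0 \<longrightarrow> X3 (G (br2 t)) * (q1 * t ^ 1) > 0)"
      using rel2 Ld_nonzero[OF L2[OF Qb(2)] q1] by eventually_elim blast
    have i: "sm (\<lambda>t::real. t)" by simp
    have "sm (\<lambda>t::real. - q1 * t ^ 2)" by (intro sm_mult sm_const sm_power i)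
    from eventually_compose_germ[OF ev this] have "near t. (X1 (G (br2 (- q1 * t ^ 2))) ^ 2 + X2 (G (br2 (- q1 * t ^ 2))) * X3 (G (br2 (- q1 * t ^ 2))) = 0 \<and>
        X1 (G (br2 (- q1 * t ^ 2))) * (X2 (G (br2 (- q1 * t ^ 2))) + X3 (G (br2 (- q1 * t ^ 2))) ^ 2) = 0) \<and>
        (- q1 * t ^ 2 \<noteq> 0 \<longrightarrow> X3 (G (br2 (- q1 * t ^ 2))) * (q1 * (- q1 * t ^ 2) ^ 1) > 0)"
      by simp
    then show ?thesis
    proof eventually_elim
      case (elim t)
      show ?case
      proof (cases "t = 0")
        case True
        then show ?thesis using sG(2) by simp
      next
        case False
        let ?a = "X1 (G (br2 (- q1 * t ^ 2)))" and ?b = "X2 (G (br2 (- q1 * t ^ 2)))" and ?c = "X3 (G (br2 (- q1 * t ^ 2)))"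
        have "?c * (q1 * (q1 * t ^ 2)) < 0" using elim False q1 by simp
        then have c: "?c < 0"
          using q1 False by (metis mult.assoc mult_less_0_iff not_square_less_zero power2_eq_square zero_less_power2 mult_pos_pos less_asym)
        have "?a = 0"
        proof (rule ccontr)
          assume a: "?a \<noteq> 0"
          then have "?b = - (?c ^ 2)" using elim by (simp add: eq_neg_iff_add_eq_0)
          then have "?a ^ 2 = ?c ^ 3" using elim by (simp add: power2_eq_square power3_eq_cube)
          moreover have "?c ^ 3 < 0" using c by (simp add: power_less_zero_eq)
          ultimately show False by (metis not_less zero_le_power2)
        qed
        then show ?thesis using elim c by auto
      qed
    qed
  qed
  have zero23: "c2 = 0 \<and> c3 = 0"
    if "Ob 4 (\<lambda>t. f t - (0 * t + c2 * t ^ 2 + c3 * t ^ 3))" "near t. f (- q1 * t ^ 2) = 0" for f c2 c3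
  proof -
    have "Ob (4 + 4) (\<lambda>t. f (- q1 * t ^ 2) - (c2 * (- q1 * t ^ 2) ^ 2 + c3 * (- q1 * t ^ 2) ^ 3))"
      using Ob_quadratic_subst[OF that(1), of "- q1"] by simp
    then have "Ob (4 + 4) (\<lambda>t. - (c2 * q1 ^ 2) * t ^ 4 + 0 * t ^ (4 + 1) + (c3 * q1 ^ 3) * t ^ (4 + 2) + 0 * t ^ (4 + 3))"
      by (rule Ob_cong) (use that(2) in \<open>eventually_elim, simp add: power_mult_distrib power_mult[symmetric]\<close>)
    from Ob_poly4(1)[OF this] Ob_poly4(3)[OF this] show ?thesis using q1 by simp
  qed
  have p36: "p3 = 0 \<and> p6 = 0"
    by (rule zero23[of "\<lambda>t. X1 (G (br2 t))"]) (use Pb(2) p1 half in \<open>auto elim: eventually_mono\<close>)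
  have r36: "r3 = 0 \<and> r6 = 0"
    by (rule zero23[of "\<lambda>t. X2 (G (br2 t))"]) (use Rb(2) r1 half in \<open>auto elim: eventually_mono\<close>)
  \<comment> \<open>Truncations with errors of order 7, 6 and 8. They determine
    \<open>P^2 - Q^3\<close> up to order 10 and \<open>R + Q^2\<close> up to order 8, which is four
    coefficients beyond the leading order, in each case.\<close>
  let ?P = "\<lambda>t. p2 * t ^ 3 + p5 * t ^ 5 - p7 * t ^ 6"
  let ?Q = "\<lambda>t. q1 * t ^ 2 + q2 * t ^ 3 + q3 * t ^ 4 + q5 * t ^ 5"
  let ?R = "\<lambda>t. r2 * t ^ 3 - r4 * t ^ 4 + r5 * t ^ 5 - r7 * t ^ 6 + r8 * t ^ 7"
  have YP: "Ob 7 (\<lambda>t. X1 (G (br3 t)) - ?P t)"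
    by (rule L3[where h = "\<lambda>t. p8 * t ^ 7"]) (use Pb(3) p1 p4 p36 in \<open>auto intro!: Ob_monomial simp: algebra_simps\<close>)
  have YQ: "Ob 6 (\<lambda>t. X3 (G (br3 t)) - ?Q t)"
    by (rule L3[where h = "\<lambda>t. (q6 - q7) * t ^ 6 + q8 * t ^ 7"])
       (use Qb(3) q4 in \<open>auto intro!: Ob_add Ob_monomial simp: add.assoc\<close>)
  have YR: "Ob 8 (\<lambda>t. X2 (G (br3 t)) - ?R t)"
    using Rb(3) r1 r36 by (simp add: algebra_simps)
  have oP: "Ob 3 ?P" by (intro Ob_add Ob_diff Ob_monomial) auto
  have oQ: "Ob 2 ?Q" by (intro Ob_add Ob_monomial) auto
  have oY1: "Ob 3 (\<lambda>t. X1 (G (br3 t)))"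
    using Ob_add[OF Ob_antimono[OF YP] oP] by simp
  have oY3: "Ob 2 (\<lambda>t. X3 (G (br3 t)))"
    using Ob_add[OF Ob_antimono[OF YQ] oQ] by simp
  have s1: "Ob 10 (\<lambda>t. X1 (G (br3 t)) ^ 2 - ?P t ^ 2)"
    using Ob_mult[OF YP Ob_add[OF oY1 oP]] by (simp add: algebra_simps power2_eq_square)
  have o4: "Ob 4 (\<lambda>t. X3 (G (br3 t)) * X3 (G (br3 t)) + X3 (G (br3 t)) * ?Q t + ?Q t * ?Q t)"
    using Ob_add[OF Ob_add[OF Ob_mult[OF oY3 oY3] Ob_mult[OF oY3 oQ]] Ob_mult[OF oQ oQ]] by simp
  have cube: "(x - y) * (x * x + x * y + y * y) = x ^ 3 - y ^ 3" for x y :: real by algebra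
  have s2: "Ob 10 (\<lambda>t. X3 (G (br3 t)) ^ 3 - ?Q t ^ 3)"
    using Ob_mult[OF YQ o4] unfolding cube by simp
  have s3: "Ob 8 (\<lambda>t. X3 (G (br3 t)) ^ 2 - ?Q t ^ 2)"
    using Ob_mult[OF YQ Ob_add[OF oY3 oQ]] by (simp add: algebra_simps power2_eq_square)
  have PQ: "Ob 10 (\<lambda>t. ?P t ^ 2 - ?Q t ^ 3)"
  proof (rule Ob_cong[OF Ob_diff[OF s2 s1]])
    show "near t. ?P t ^ 2 - ?Q t ^ 3 = X3 (G (br3 t)) ^ 3 - ?Q t ^ 3 - (X1 (G (br3 t)) ^ 2 - ?P t ^ 2)"
      using cusp by eventually_elim simp
  qed
  have RQ: "Ob 8 (\<lambda>t. ?R t + ?Q t ^ 2)"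
  proof (rule Ob_cong[OF Ob_cmult[OF Ob_add[OF YR s3], of "-1"]])
    show "near t. ?R t + ?Q t ^ 2 = - 1 * (X2 (G (br3 t)) - ?R t + (X3 (G (br3 t)) ^ 2 - ?Q t ^ 2))"
      using cusp by eventually_elim simp
  qed
  \<comment> \<open>The part of the polynomial from \<open>t^10\<close> on, written out so that the
    four coefficients before it can be read off.\<close>
  obtain h1 where h1: "\<And>t. ?P t ^ 2 - ?Q t ^ 3 = (p2 ^ 2 - q1 ^ 3) * t ^ 6 + (- 3 * q1 ^ 2 * q2) * t ^ (6 + 1) +
      (2 * p2 * p5 - 3 * q1 ^ 2 * q3 - 3 * q1 * q2 ^ 2) * t ^ (6 + 2) +
      (- 2 * p2 * p7 - 3 * q1 ^ 2 * q5 - 6 * q1 * q2 * q3 - q2 ^ 3) * t ^ (6 + 3) + t ^ 10 * h1 t"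
    and oh1: "Ob 0 h1"
  proof (rule that)
    show "?P t ^ 2 - ?Q t ^ 3 = (p2 ^ 2 - q1 ^ 3) * t ^ 6 + (- 3 * q1 ^ 2 * q2) * t ^ (6 + 1) +
      (2 * p2 * p5 - 3 * q1 ^ 2 * q3 - 3 * q1 * q2 ^ 2) * t ^ (6 + 2) +
      (- 2 * p2 * p7 - 3 * q1 ^ 2 * q5 - 6 * q1 * q2 * q3 - q2 ^ 3) * t ^ (6 + 3) +
      t ^ 10 * (p5 ^ 2 - 2 * p5 * p7 * t + p7 ^ 2 * t ^ 2 - (3 * q1 * q3 ^ 2 + 6 * q1 * q2 * q5 + 3 * q2 ^ 2 * q3)
        - (6 * q1 * q3 * q5 + 3 * q2 ^ 2 * q5 + 3 * q2 * q3 ^ 2) * t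
        - (3 * q1 * q5 ^ 2 + 6 * q2 * q3 * q5 + q3 ^ 3) * t ^ 2 - (3 * q2 * q5 ^ 2 + 3 * q3 ^ 2 * q5) * t ^ 3
        - 3 * q3 * q5 ^ 2 * t ^ 4 - q5 ^ 3 * t ^ 5)" for t
      by (simp, algebra)
    show "Ob 0 (\<lambda>t. p5 ^ 2 - 2 * p5 * p7 * t + p7 ^ 2 * t ^ 2 - (3 * q1 * q3 ^ 2 + 6 * q1 * q2 * q5 + 3 * q2 ^ 2 * q3)
        - (6 * q1 * q3 * q5 + 3 * q2 ^ 2 * q5 + 3 * q2 * q3 ^ 2) * t
        - (3 * q1 * q5 ^ 2 + 6 * q2 * q3 * q5 + q3 ^ 3) * t ^ 2 - (3 * q2 * q5 ^ 2 + 3 * q3 ^ 2 * q5) * t ^ 3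
        - 3 * q3 * q5 ^ 2 * t ^ 4 - q5 ^ 3 * t ^ 5)"
      using Ob_monomial[of 0 0] Ob_monomial[of 0 1] by (intro Ob_diff Ob_add Ob_monomial) simp_all
  qed
  have "Ob 10 (\<lambda>t. 1 * t ^ 10 * h1 t)" using Ob_mult[OF Ob_monomial[of 10 10 1] oh1] by simp
  from Ob_diff[OF PQ this] have "Ob (6 + 4) (\<lambda>t. (p2 ^ 2 - q1 ^ 3) * t ^ 6 + (- 3 * q1 ^ 2 * q2) * t ^ (6 + 1) +
      (2 * p2 * p5 - 3 * q1 ^ 2 * q3 - 3 * q1 * q2 ^ 2) * t ^ (6 + 2) +
      (- 2 * p2 * p7 - 3 * q1 ^ 2 * q5 - 6 * q1 * q2 * q3 - q2 ^ 3) * t ^ (6 + 3))"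
    unfolding h1 by simp
  note e1 = Ob_poly4[OF this]
  have q2: "q2 = 0" using e1(2) q1 by simp
  have "Ob (4 + 4) (\<lambda>t. ?R t + ?Q t ^ 2)" using RQ by simp
  moreover have r2: "r2 = 0"
  proof -
    have "Ob (3 + 1) (\<lambda>t. ?R t + ?Q t ^ 2 - (q1 ^ 2 - r4) * t ^ 4 - (r5 + 2 * q1 * q2) * t ^ 5 - (2 * q1 * q3 + q2 ^ 2 - r7) * t ^ 6
        - (r8 + 2 * q1 * q5 + 2 * q2 * q3) * t ^ 7 - (q3 ^ 2 + 2 * q2 * q5) * t ^ 8 - (2 * q3 * q5) * t ^ 9 - q5 ^ 2 * t ^ 10)"
      by (intro Ob_diff[OF Ob_diff[OF Ob_diff[OF Ob_diff[OF Ob_diff[OF Ob_diff[OF Ob_diff]]]]]] Ob_monomial Ob_antimono[OF RQ]) auto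
    moreover have "?R t + ?Q t ^ 2 - (q1 ^ 2 - r4) * t ^ 4 - (r5 + 2 * q1 * q2) * t ^ 5 - (2 * q1 * q3 + q2 ^ 2 - r7) * t ^ 6
        - (r8 + 2 * q1 * q5 + 2 * q2 * q3) * t ^ 7 - (q3 ^ 2 + 2 * q2 * q5) * t ^ 8 - (2 * q3 * q5) * t ^ 9 - q5 ^ 2 * t ^ 10 = r2 * t ^ 3" for t
      by algebra
    ultimately show ?thesis using Ob_zero[of 3 r2] by simp
  qed
  have "Ob (4 + 4) (\<lambda>t. ?R t + ?Q t ^ 2 - q3 ^ 2 * t ^ 8 - (2 * q3 * q5) * t ^ 9 - q5 ^ 2 * t ^ 10)"
    by (intro Ob_diff[OF Ob_diff[OF Ob_diff]] Ob_monomial Ob_antimono[OF RQ]) auto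
  moreover have "?R t + ?Q t ^ 2 - q3 ^ 2 * t ^ 8 - (2 * q3 * q5) * t ^ 9 - q5 ^ 2 * t ^ 10 =
      (q1 ^ 2 - r4) * t ^ 4 + r5 * t ^ (4 + 1) + (2 * q1 * q3 - r7) * t ^ (4 + 2) + (r8 + 2 * q1 * q5) * t ^ (4 + 3)" for t
    by (simp add: r2 q2, algebra)
  ultimately have "Ob (4 + 4) (\<lambda>t. (q1 ^ 2 - r4) * t ^ 4 + r5 * t ^ (4 + 1) + (2 * q1 * q3 - r7) * t ^ (4 + 2) + (r8 + 2 * q1 * q5) * t ^ (4 + 3))"
    by simp
  note e2 = Ob_poly4[OF this]
  \<comment> \<open>Since \<open>p2^2 = q1^3\<close>, this quotient has square \<open>q1\<close> and
    cube \<open>p2\<close>.\<close>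
  define a where "a = p2 / q1"
  define b where "b = q3 / (2 * a)"
  define d where "d = q5 / (2 * a)"
  have a0: "a \<noteq> 0" using p2 q1 by (simp add: a_def)
  have a2: "q1 = a ^ 2" using e1(1) q1 by (simp add: a_def field_simps power2_eq_square power3_eq_cube)
  have a3: "p2 = a ^ 3"
  proof -
    have "p2 = a * q1" using q1 by (simp add: a_def)
    then show ?thesis using a2 by (simp add: power2_eq_square power3_eq_cube)
  qed
  have q3: "q3 = 2 * a * b" and q5: "q5 = 2 * a * d" using a0 by (auto simp: b_def d_def)
  have p5: "p5 = 3 * a ^ 2 * b"
  proof -
    have "2 * p2 * p5 - 3 * q1 ^ 2 * q3 = 0" using e1(3) q2 by simp
    then have "a ^ 3 * p5 = a ^ 3 * (3 * a ^ 2 * b)" unfolding q3 a3 a2 by algebra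
    then show ?thesis using a0 by simp
  qed
  \<comment> \<open>The sign arises because \<open>X2 X3\<close>, of which \<open>p7\<close> is the
    coefficient, is \<open>- X1^2\<close> on the curve.\<close>
  have p7: "p7 = - 3 * a ^ 2 * d"
  proof -
    have "2 * p2 * p7 + 3 * q1 ^ 2 * q5 = 0" using e1(4) q2 by simp
    then have "a ^ 3 * p7 = a ^ 3 * (- 3 * a ^ 2 * d)" unfolding q5 a3 a2 by algebra
    then show ?thesis using a0 by (subst (asm) mult_left_cancel) simp_all
  qed
  have r: "r4 = a ^ 4" "r5 = 0" "r7 = 4 * a ^ 3 * b" "r8 = - 4 * a ^ 3 * d"
    using e2 unfolding a2 q3 q5 by (auto simp: power2_eq_square power3_eq_cube power4_eq_xxxx algebra_simps)
  show ?thesis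
  proof (rule that[OF a0])
    have "J 7 (\<lambda>x. X1 (G x) - (p1 * X3 x + p2 * X1 x + p3 * X3 x ^ 2 + p4 * X2 x + p5 * (X1 x * X3 x) + p6 * X3 x ^ 3 +
      p7 * (X2 x * X3 x) + p8 * (X1 x * X3 x ^ 2)) + p8 * (X1 x * X3 x ^ 2))"
      by (intro J_add J_cmult J_antimono[OF P] J_m') auto
    then show "J 7 (\<lambda>x. X1 (G x) - (a ^ 3 * X1 x + 3 * a ^ 2 * (X1 x * (b * X3 x + d * X1 x))))"
    proof (rule J_ceq)
      show "sm (\<lambda>x. X1 (G x) - (a ^ 3 * X1 x + 3 * a ^ 2 * (X1 x * (b * X3 x + d * X1 x))))"
        by (intro sm_diff sm_add sm_mult s sm_const sm_coord)
      show "ceq (\<lambda>x. X1 (G x) - (a ^ 3 * X1 x + 3 * a ^ 2 * (X1 x * (b * X3 x + d * X1 x))))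
        (\<lambda>x. X1 (G x) - (p1 * X3 x + p2 * X1 x + p3 * X3 x ^ 2 + p4 * X2 x + p5 * (X1 x * X3 x) + p6 * X3 x ^ 3 +
      p7 * (X2 x * X3 x) + p8 * (X1 x * X3 x ^ 2)) + p8 * (X1 x * X3 x ^ 2))"
      proof (rule ceqI)
        fix x assume "x \<in> C"
        from C_rel[OF this] show "X1 (G x) - (a ^ 3 * X1 x + 3 * a ^ 2 * (X1 x * (b * X3 x + d * X1 x))) =
          X1 (G x) - (p1 * X3 x + p2 * X1 x + p3 * X3 x ^ 2 + p4 * X2 x + p5 * (X1 x * X3 x) + p6 * X3 x ^ 3 +
      p7 * (X2 x * X3 x) + p8 * (X1 x * X3 x ^ 2)) + p8 * (X1 x * X3 x ^ 2)"
          unfolding p1 p4 p36[THEN conjunct1] p36[THEN conjunct2] p5 p7 a3 by algebra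
      qed
    qed
    show "J 8 (\<lambda>x. X2 (G x) - (a ^ 4 * X2 x + 4 * a ^ 3 * (X2 x * (b * X3 x + d * X1 x))))"
    proof (rule J_ceq[OF R])
      show "sm (\<lambda>x. X2 (G x) - (a ^ 4 * X2 x + 4 * a ^ 3 * (X2 x * (b * X3 x + d * X1 x))))"
        by (intro sm_diff sm_add sm_mult s sm_const sm_coord)
      show "ceq (\<lambda>x. X2 (G x) - (a ^ 4 * X2 x + 4 * a ^ 3 * (X2 x * (b * X3 x + d * X1 x))))
        (\<lambda>x. X2 (G x) - (r1 * X3 x + r2 * X1 x + r3 * X3 x ^ 2 + r4 * X2 x + r5 * (X1 x * X3 x) + r6 * X3 x ^ 3 +
      r7 * (X2 x * X3 x) + r8 * (X1 x * X3 x ^ 2)))"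
      proof (rule ceqI)
        fix x assume "x \<in> C"
        from C_rel[OF this] show "X2 (G x) - (a ^ 4 * X2 x + 4 * a ^ 3 * (X2 x * (b * X3 x + d * X1 x))) =
          X2 (G x) - (r1 * X3 x + r2 * X1 x + r3 * X3 x ^ 2 + r4 * X2 x + r5 * (X1 x * X3 x) + r6 * X3 x ^ 3 +
      r7 * (X2 x * X3 x) + r8 * (X1 x * X3 x ^ 2))"
          unfolding r1 r2 r36[THEN conjunct1] r36[THEN conjunct2] r by algebra
      qed
    qed
    have m: "J 6 (\<lambda>x. X3 x ^ 3)" "J 6 (\<lambda>x. X2 x * X3 x)" "J 6 (\<lambda>x. X1 x * X3 x ^ 2)"
      using J_m(1)[of 3] J_m(4)[of 1] J_antimono[OF J_m(2)[of 2], of 6] by simp_all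
    have "J 6 (\<lambda>x. X3 (G x) - (q1 * X3 x + q2 * X1 x + q3 * X3 x ^ 2 + q4 * X2 x + q5 * (X1 x * X3 x) + q6 * X3 x ^ 3 +
      q7 * (X2 x * X3 x) + q8 * (X1 x * X3 x ^ 2)) + (q6 * X3 x ^ 3 + q7 * (X2 x * X3 x) + q8 * (X1 x * X3 x ^ 2)))"
      by (intro J_add J_cmult J_antimono[OF Q] m) auto
    then show "J 6 (\<lambda>x. X3 (G x) - (a ^ 2 * X3 x + 2 * a * (X3 x * (b * X3 x + d * X1 x))))"
      by (simp add: q2 q4 q3 q5 a2 algebra_simps power2_eq_square)
  qed
qed

subsection \<open>Action of diffeomorphisms on the coordinates of a form\<close>

definition pb :: "(real ^ 'm \<Rightarrow> real ^ 'm \<Rightarrow> real) \<Rightarrow> (real ^ 'm \<Rightarrow> real ^ 'm) \<Rightarrow> real ^ 'm \<Rightarrow> real ^ 'm \<Rightarrow> real" where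
  "pb a G x v = a (G x) (fder G x v)"

lemma exact_pb:
  assumes "exact a" "sm G" "G 0 = 0" "near x. x \<in> C \<longrightarrow> G x \<in> C"
  shows "exact (pb a G)"
proof -
  obtain S where S: "sm S" "near x. x \<in> C \<longrightarrow> (\<forall>v. a x v = fder S x v)"
    using assms(1) by (auto simp: exact_def)
  show ?thesis
  proof (rule exactI)
    show "sm (\<lambda>x. S (G x))" by (rule sm_compose[OF S(1) assms(2,3)])
    show "near x. x \<in> C \<longrightarrow> (\<forall>v. pb a G x v = fder (\<lambda>x. S (G x)) x v)"
      using assms(4) eventually_compose_germ[OF S(2) assms(2,3)] sm_differentiable[OF assms(2)]
        eventually_compose_germ[OF sm_differentiable[OF S(1)] assms(2,3)]
      by eventually_elim (auto simp: pb_def fder_compose)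
  qed
qed

text \<open>\<open>F'\<close> is the image of the weight \<open>w\<close> function \<open>F\<close> under a substitution that is,
  up to order \<open>2\<kappa>\<close>, the quasihomogeneous scaling by \<open>a + \<mu>\<close>.\<close>

definition hom :: "nat \<Rightarrow> real \<Rightarrow> (real ^ 'm \<Rightarrow> real) \<Rightarrow> nat \<Rightarrow> (real ^ 'm \<Rightarrow> real) \<Rightarrow> (real ^ 'm \<Rightarrow> real) \<Rightarrow> bool" where
  "hom \<kappa> a \<mu> w F F' \<longleftrightarrow> w \<ge> 1 \<and> J \<kappa> \<mu> \<and> J w F \<and>
     J (w + 2 * \<kappa>) (\<lambda>x. F' x - (a ^ w * F x + real w * a ^ (w - 1) * (F x * \<mu> x)))"

lemma hom_main: "hom \<kappa> a \<mu> w F F' \<Longrightarrow> J w (\<lambda>x. a ^ w * F x + real w * a ^ (w - 1) * (F x * \<mu> x))"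
  unfolding hom_def by (intro J_add J_cmult J_mult_sm) (auto intro: J_sm)

lemma hom_J: "hom \<kappa> a \<mu> w F F' \<Longrightarrow> J w F'"
proof -
  assume h: "hom \<kappa> a \<mu> w F F'"
  let ?P = "\<lambda>x. a ^ w * F x + real w * a ^ (w - 1) * (F x * \<mu> x)"
  have "J w (\<lambda>x. F' x - ?P x)" using h by (auto simp: hom_def elim: J_antimono)
  from J_add[OF this hom_main[OF h]] show "J w F'" by simp
qed

lemma power_weights:
  assumes "w \<ge> 1" "l \<ge> 1"
  shows "a ^ (w - 1) * a ^ l = (a :: real) ^ (w + l - 1)" "a ^ w * a ^ (l - 1) = a ^ (w + l - 1)"
  using assms by (simp_all add: power_add[symmetric])

text \<open>The letters \<open>p\<close>, \<open>p'\<close>, \<open>q\<close>, \<open>q'\<close>,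
  \<open>r\<close> stand for the powers of \<open>a\<close> with exponents \<open>w\<close>,
  \<open>w - 1\<close>, \<open>l\<close>, \<open>l - 1\<close>, \<open>w + l - 1\<close>; kept
  abstract, they make the identity polynomial.\<close>

lemma hom_mult_identity:
  fixes p p' q q' r :: real
  assumes "p' * q = r" "p * q' = r"
  shows "(p * F + w * p' * (F * m)) * (G' - (q * G + l * q' * (G * m))) + (F' - (p * F + w * p' * (F * m))) * G' +
    (w * p' * l * q') * ((F * m) * (G * m)) = F' * G' - (p * q * (F * G) + (w + l) * r * (F * G * m))"
proof -
  have "(w + l) * r = w * (p' * q) + l * (p * q')" using assms by (simp add: algebra_simps)
  then show ?thesis by (simp only:) (simp add: algebra_simps)
qed

lemma hom_act_identity:
  fixes p p' q q' r :: real
  assumes "p' * q = r" "p * q' = r"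
  shows "F' * dY' - (p * q * (F * dY) + r * ((w + l) * (F * m * dY) + l * (F * Y * dm))) -
    (F' * (dY' - (q * dY + l * q' * (Y * dm + dY * m))) +
     (F' - (p * F + w * p' * (F * m))) * (q * dY + l * q' * (Y * dm + dY * m)) +
     w * p' * l * q' * (F * m * (Y * dm + dY * m))) = 0"
proof -
  have "r * ((w + l) * (F * m * dY) + l * (F * Y * dm)) = w * (p' * q) * (F * m * dY) + l * (p * q') * (F * m * dY + F * Y * dm)"
    using assms by (simp add: algebra_simps)
  then show ?thesis by (simp only:) (simp add: algebra_simps)
qed

lemma hom_mult:
  assumes "hom \<kappa> a \<mu> w F F'" "hom \<kappa> a \<mu> l G G'"
  shows "hom \<kappa> a \<mu> (w + l) (\<lambda>x. F x * G x) (\<lambda>x. F' x * G' x)"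
proof -
  have ix: "w + (l + 2 * \<kappa>) = w + l + 2 * \<kappa>" "w + 2 * \<kappa> + l = w + l + 2 * \<kappa>" "w + \<kappa> + (l + \<kappa>) = w + l + 2 * \<kappa>"
    by simp_all
  let ?P = "\<lambda>x. a ^ w * F x + real w * a ^ (w - 1) * (F x * \<mu> x)"
  let ?Q = "\<lambda>x. a ^ l * G x + real l * a ^ (l - 1) * (G x * \<mu> x)"
  have f: "w \<ge> 1" "l \<ge> 1" "J \<kappa> \<mu>" "J w F" "J l G" "J (w + 2 * \<kappa>) (\<lambda>x. F' x - ?P x)" "J (l + 2 * \<kappa>) (\<lambda>x. G' x - ?Q x)"
    using assms by (auto simp: hom_def)
  have "J (w + (l + 2 * \<kappa>)) (\<lambda>x. ?P x * (G' x - ?Q x))" by (rule J_mult[OF hom_main[OF assms(1)] f(7)])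
  moreover have "J (w + 2 * \<kappa> + l) (\<lambda>x. (F' x - ?P x) * G' x)" by (rule J_mult[OF f(6) hom_J[OF assms(2)]])
  moreover have "J ((w + \<kappa>) + (l + \<kappa>)) (\<lambda>x. (F x * \<mu> x) * (G x * \<mu> x))"
    by (rule J_mult[OF J_mult[OF f(4,3)] J_mult[OF f(5,3)]])
  ultimately have "J (w + l + 2 * \<kappa>) (\<lambda>x. ?P x * (G' x - ?Q x) + (F' x - ?P x) * G' x +
     (real w * a ^ (w - 1) * real l * a ^ (l - 1)) * ((F x * \<mu> x) * (G x * \<mu> x)))"
    unfolding ix by (intro J_add J_cmult)
  moreover have "?P x * (G' x - ?Q x) + (F' x - ?P x) * G' x +
     (real w * a ^ (w - 1) * real l * a ^ (l - 1)) * ((F x * \<mu> x) * (G x * \<mu> x)) =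
     F' x * G' x - (a ^ (w + l) * (F x * G x) + real (w + l) * a ^ (w + l - 1) * (F x * G x * \<mu> x))" for x
    unfolding power_add of_nat_add by (rule hom_mult_identity[OF power_weights[OF f(1,2)]])
  ultimately have "J (w + l + 2 * \<kappa>) (\<lambda>x. F' x * G' x - (a ^ (w + l) * (F x * G x) + real (w + l) * a ^ (w + l - 1) * (F x * G x * \<mu> x)))"
    by simp
  then show ?thesis using f J_mult[OF f(4,5)] by (simp add: hom_def)
qed

text \<open>\<open>F' dY'\<close> is expanded by the product rule; every product of two corrections
  has weight at least \<open>w + l + 2 * \<kappa>\<close>. The term with \<open>d\<mu>\<close>
  carries only the weight \<open>l\<close>, since it comes from \<open>Y\<close> alone.\<close>

lemma hom_act:
  assumes "hom \<kappa> a \<mu> w F F'" "hom \<kappa> a \<mu> l Y Y'"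
  shows "FF (w + l + 2 * \<kappa>) (\<lambda>x v. F' x * fder Y' x v - (a ^ (w + l) * (F x * fder Y x v) +
    a ^ (w + l - 1) * (real (w + l) * (F x * \<mu> x * fder Y x v) + real l * (F x * Y x * fder \<mu> x v))))"
proof -
  have ix: "w + (l + 2 * \<kappa>) = w + l + 2 * \<kappa>" "w + 2 * \<kappa> + l = w + l + 2 * \<kappa>" "w + \<kappa> + (l + \<kappa>) = w + l + 2 * \<kappa>"
    by simp_all
  let ?P = "\<lambda>x. a ^ w * F x + real w * a ^ (w - 1) * (F x * \<mu> x)"
  let ?Q = "\<lambda>x. a ^ l * Y x + real l * a ^ (l - 1) * (Y x * \<mu> x)"
  have f: "w \<ge> 1" "l \<ge> 1" "J \<kappa> \<mu>" "J w F" "J l Y" "J (w + 2 * \<kappa>) (\<lambda>x. F' x - ?P x)" "J (l + 2 * \<kappa>) (\<lambda>x. Y' x - ?Q x)"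
    using assms by (auto simp: hom_def)
  have "FF (w + (l + 2 * \<kappa>)) (\<lambda>x v. F' x * fder (\<lambda>x. Y' x - ?Q x) x v)" by (rule FF_fd[OF hom_J[OF assms(1)] f(7)])
  moreover have "FF (w + 2 * \<kappa> + l) (\<lambda>x v. (F' x - ?P x) * fder ?Q x v)" by (rule FF_fd[OF f(6) hom_main[OF assms(2)]])
  moreover have "FF ((w + \<kappa>) + (l + \<kappa>)) (\<lambda>x v. (F x * \<mu> x) * fder (\<lambda>x. Y x * \<mu> x) x v)"
    by (rule FF_fd[OF J_mult[OF f(4,3)] J_mult[OF f(5,3)]])
  ultimately have F: "FF (w + l + 2 * \<kappa>) (\<lambda>x v. F' x * fder (\<lambda>x. Y' x - ?Q x) x v + (F' x - ?P x) * fder ?Q x v +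
     (real w * a ^ (w - 1) * real l * a ^ (l - 1)) * ((F x * \<mu> x) * fder (\<lambda>x. Y x * \<mu> x) x v))"
    unfolding ix by (intro FF_add FF_cmult)
  have sY: "sm Y" "sm Y'" "sm \<mu>" using J_sm f(3,5) hom_J[OF assms(2)] by auto
  show ?thesis
  proof (rule FF_cong[OF F], rule exact_cong[OF exact_0])
    show "near x. x \<in> C \<longrightarrow> (\<forall>v. F' x * fder Y' x v - (a ^ (w + l) * (F x * fder Y x v) +
         a ^ (w + l - 1) * (real (w + l) * (F x * \<mu> x * fder Y x v) + real l * (F x * Y x * fder \<mu> x v))) -
        (F' x * fder (\<lambda>x. Y' x - ?Q x) x v + (F' x - ?P x) * fder ?Q x v +
        (real w * a ^ (w - 1) * real l * a ^ (l - 1)) * ((F x * \<mu> x) * fder (\<lambda>x. Y x * \<mu> x) x v)) = 0)"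
      using sm_differentiable[OF sY(1)] sm_differentiable[OF sY(2)] sm_differentiable[OF sY(3)]
    proof eventually_elim
      case (elim x)
      have d1: "fder (\<lambda>x. Y x * \<mu> x) x v = Y x * fder \<mu> x v + fder Y x v * \<mu> x" for v
        using elim by (simp add: fder_mult)
      have dQ: "(?Q has_derivative (\<lambda>v. a ^ l * fder Y x v + real l * a ^ (l - 1) * (Y x * fder \<mu> x v + fder Y x v * \<mu> x))) (at x)"
        using has_derivative_mult[OF has_fder[OF elim(1)] has_fder[OF elim(3)]] has_fder[OF elim(1)]
        by (intro has_derivative_add has_derivative_mult_right)
      then have d2: "fder ?Q x v = a ^ l * fder Y x v + real l * a ^ (l - 1) * (Y x * fder \<mu> x v + fder Y x v * \<mu> x)" for v
        by (rule fder_eqI)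
      have d3: "fder (\<lambda>x. Y' x - ?Q x) x v = fder Y' x v - fder ?Q x v" for v
        using elim(2) dQ by (intro fder_diff) (auto simp: differentiable_def)
      show ?case
        unfolding d3 d2 d1 power_add of_nat_add using hom_act_identity[OF power_weights[OF f(1,2)]] by blast
    qed
  qed
qed

text \<open>The coefficients of the basis forms as iterated products instead of powers, the shape in
  which \<open>hom_mult\<close> applies.\<close>

definition bm :: "nat \<Rightarrow> real ^ 'm \<Rightarrow> real" where
  "bm i x = (if i = 1 then X1 x else if i = 2 then X2 x else if i = 3 then X1 x
     else if i = 4 then X1 x * X3 x else if i = 5 then X1 x * X1 x
     else if i = 6 then X1 x * X3 x * X3 x else if i = 7 then X1 x * X1 x * X3 x
     else X1 x * X3 x * X3 x * X3 x)"

definition bj :: "nat \<Rightarrow> nat" where "bj i = (if i = 3 then 2 else 3)"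

definition cw :: "nat \<Rightarrow> nat" where "cw j = (if j = 1 then 3 else if j = 2 then 4 else 2)"

lemma B_bm: "B i x v = bm i x * v $ e (bj i)"
  by (simp add: B_def bm_def bj_def power2_eq_square power3_eq_cube)

text \<open>To first order in \<mu> each coordinate is multiplied by the power of
  \<open>a + \<mu>\<close> given by its weight. A general diffeomorphism preserving the curve has
  this form with \<kappa> = 2; the substitutions that remove coordinates use larger \<kappa> as
  well.\<close>

definition adapted :: "nat \<Rightarrow> real \<Rightarrow> (real ^ 'm \<Rightarrow> real) \<Rightarrow> (real ^ 'm \<Rightarrow> real ^ 'm) \<Rightarrow> bool" where
  "adapted \<kappa> a \<mu> G \<longleftrightarrow> sm G \<and> G 0 = 0 \<and> (near x. x \<in> C \<longrightarrow> G x \<in> C) \<and> J \<kappa> \<mu> \<and>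
     (\<forall>j\<in>{1,2,3}. J (cw j + 2 * \<kappa>) (\<lambda>x. G x $ e j - (a ^ cw j * x $ e j + real (cw j) * a ^ (cw j - 1) * (x $ e j * \<mu> x))))"

lemma adapted_hom: "adapted \<kappa> a \<mu> G \<Longrightarrow> j \<in> {1,2,3} \<Longrightarrow> hom \<kappa> a \<mu> (cw j) (\<lambda>x. x $ e j) (\<lambda>x. G x $ e j)"
  using J_X by (auto simp: adapted_def hom_def cw_def)

lemma adapted_bm:
  assumes "adapted \<kappa> a \<mu> G" "i \<in> {1..8}"
  shows "hom \<kappa> a \<mu> (wt i - cw (bj i)) (bm i) (\<lambda>x. bm i (G x))"
proof -
  have h: "hom \<kappa> a \<mu> 3 (\<lambda>x. X1 x) (\<lambda>x. X1 (G x))" "hom \<kappa> a \<mu> 4 (\<lambda>x. X2 x) (\<lambda>x. X2 (G x))"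
     "hom \<kappa> a \<mu> 2 (\<lambda>x. X3 x) (\<lambda>x. X3 (G x))"
    using adapted_hom[OF assms(1), of 1] adapted_hom[OF assms(1), of 2] adapted_hom[OF assms(1), of 3] by (simp_all add: cw_def)
  note m13 = hom_mult[OF h(1,3)] and m11 = hom_mult[OF h(1,1)]
  note m133 = hom_mult[OF m13 h(3)]
  have "i \<in> {1,2,3,4,5,6,7,8}" using assms(2) by auto
  then show ?thesis
    using h m13 m11 m133 hom_mult[OF m11 h(3)] hom_mult[OF m133 h(3)]
    by (auto simp: wt_def cw_def bj_def bm_def[abs_def])
qed

text \<open>The first-order change of \<open>B i\<close> under the quasihomogeneous scaling by \<open>1 + \<mu>\<close>.\<close>

definition Tm :: "nat \<Rightarrow> (real ^ 'm \<Rightarrow> real) \<Rightarrow> real ^ 'm \<Rightarrow> real ^ 'm \<Rightarrow> real" where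
  "Tm i \<mu> x v = real (wt i) * (bm i x * \<mu> x * v $ e (bj i)) + real (cw (bj i)) * (bm i x * x $ e (bj i) * fder \<mu> x v)"

lemma wt_split: "i \<in> {1..8} \<Longrightarrow> wt i - cw (bj i) + cw (bj i) = wt i"
  by (auto simp: wt_def cw_def bj_def)

lemma pb_B:
  assumes G: "adapted \<kappa> a \<mu> G" and i: "i \<in> {1..8}"
  shows "FF (wt i + 2 * \<kappa>) (\<lambda>x v. pb (B i) G x v - (a ^ wt i * B i x v + a ^ (wt i - 1) * Tm i \<mu> x v))"
proof -
  have j: "bj i \<in> {1,2,3}" by (simp add: bj_def)
  have sG: "sm G" using G by (simp add: adapted_def)
  note F = hom_act[OF adapted_bm[OF G i] adapted_hom[OF G j], unfolded wt_split[OF i] fder_coord]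
  show ?thesis
  proof (rule FF_cong[OF F], rule exact_cong[OF exact_0])
    show "near x. x \<in> C \<longrightarrow> (\<forall>v. pb (B i) G x v - (a ^ wt i * B i x v + a ^ (wt i - 1) * Tm i \<mu> x v) -
       (bm i (G x) * fder (\<lambda>x. G x $ e (bj i)) x v - (a ^ wt i * (bm i x * v $ e (bj i)) +
         a ^ (wt i - 1) * (real (wt i) * (bm i x * \<mu> x * v $ e (bj i)) + real (cw (bj i)) * (bm i x * x $ e (bj i) * fder \<mu> x v)))) = 0)"
      using sm_differentiable[OF sG] by eventually_elim (simp add: pb_def B_bm Tm_def fder_nth)
  qed
qed

lemma J_bm: "i \<in> {1..8} \<Longrightarrow> J (wt i - cw (bj i)) (bm i)"
proof -
  assume "i \<in> {1..8}"
  then have "i \<in> {1,2,3,4,5,6,7,8}" by auto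
  note m13 = J_mult[OF J_X(1,3)] and m11 = J_mult[OF J_X(1,1)]
  note m133 = J_mult[OF m13 J_X(3)]
  show ?thesis
    using \<open>i \<in> {1,2,3,4,5,6,7,8}\<close> J_X m13 m11 m133 J_mult[OF m11 J_X(3)] J_mult[OF m133 J_X(3)]
    by (auto simp: wt_def cw_def bj_def bm_def[abs_def])
qed

lemma FF_Tm:
  assumes "J \<kappa> \<mu>" "i \<in> {1..8}"
  shows "FF (wt i + \<kappa>) (Tm i \<mu>)"
proof -
  have x: "J (cw (bj i)) (\<lambda>x. x $ e (bj i))" using J_X by (auto simp: cw_def bj_def)
  have "FF (wt i - cw (bj i) + \<kappa> + cw (bj i)) (\<lambda>x v. bm i x * \<mu> x * fder (\<lambda>x. x $ e (bj i)) x v)"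
    by (rule FF_fd[OF J_mult[OF J_bm[OF assms(2)] assms(1)] x])
  moreover have "FF (wt i - cw (bj i) + cw (bj i) + \<kappa>) (\<lambda>x v. bm i x * x $ e (bj i) * fder \<mu> x v)"
    by (rule FF_fd[OF J_mult[OF J_bm[OF assms(2)] x] assms(1)])
  moreover have "wt i - cw (bj i) + \<kappa> + cw (bj i) = wt i + \<kappa>" using wt_split[OF assms(2)] by simp
  ultimately show ?thesis unfolding Tm_def[abs_def] using wt_split[OF assms(2)]
    by (intro FF_add FF_cmult) simp_all
qed

lemmas Tm_simps = Tm_def bm_def bj_def cw_def wt_def

text \<open>The changes not listed have weight at least 12 and are exact by \<open>FF_12_Tm\<close>.
  The entries 3 and 9 for \<open>B 3\<close> and \<open>B 4\<close> cancel for
  \<open>B 3 - 1/3 B 4\<close>: the first resonance.\<close>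

lemma Tm_X3:
  "exact (\<lambda>x v. Tm 1 (\<lambda>x. X3 x) x v - 7 * B 4 x v)"
  "exact (\<lambda>x v. Tm 2 (\<lambda>x. X3 x) x v - (-8) * B 5 x v)"
  "exact (\<lambda>x v. Tm 3 (\<lambda>x. X3 x) x v - 3 * B 6 x v)"
  "exact (\<lambda>x v. Tm 4 (\<lambda>x. X3 x) x v - 9 * B 6 x v)"
  "exact (\<lambda>x v. Tm 5 (\<lambda>x. X3 x) x v - 10 * B 7 x v)"
  "exact (\<lambda>x v. Tm 6 (\<lambda>x. X3 x) x v - 11 * B 8 x v)"
proof -
  show "exact (\<lambda>x v. Tm 1 (\<lambda>x. X3 x) x v - 7 * B 4 x v)"
    by (rule exact_congC[OF exact_0]) (simp add: Tm_simps)
  show "exact (\<lambda>x v. Tm 2 (\<lambda>x. X3 x) x v - (-8) * B 5 x v)"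
    by (rule exact_combo1[OF red_X2X3X3, of _ 8]) (simp add: Tm_simps)
  show "exact (\<lambda>x v. Tm 3 (\<lambda>x. X3 x) x v - 3 * B 6 x v)"
    by (rule exact_combo1[OF red_X1X3X2, of _ 7]) (simp add: Tm_simps, drule C_rel(2), algebra)
  show "exact (\<lambda>x v. Tm 4 (\<lambda>x. X3 x) x v - 9 * B 6 x v)"
    by (rule exact_congC[OF exact_0]) (simp add: Tm_simps power2_eq_square)
  show "exact (\<lambda>x v. Tm 5 (\<lambda>x. X3 x) x v - 10 * B 7 x v)"
    by (rule exact_congC[OF exact_0]) (simp add: Tm_simps power2_eq_square)
  show "exact (\<lambda>x v. Tm 6 (\<lambda>x. X3 x) x v - 11 * B 8 x v)"
    by (rule exact_congC[OF exact_0]) (simp add: Tm_simps power3_eq_cube)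
qed

text \<open>The entries -10 and 5 for \<open>B 3\<close> and \<open>B 4\<close> cancel for
  \<open>B 3 + 2 B 4\<close>: the second resonance.\<close>

lemma Tm_X1:
  "exact (\<lambda>x v. Tm 1 (\<lambda>x. X1 x) x v - 4 * B 5 x v)"
  "exact (\<lambda>x v. Tm 2 (\<lambda>x. X1 x) x v - (-6) * B 6 x v)"
  "exact (\<lambda>x v. Tm 3 (\<lambda>x. X1 x) x v - (-10) * B 7 x v)"
  "exact (\<lambda>x v. Tm 4 (\<lambda>x. X1 x) x v - 5 * B 7 x v)"
  "exact (\<lambda>x v. Tm 5 (\<lambda>x. X1 x) x v - (22/3) * B 8 x v)"
proof -
  show "exact (\<lambda>x v. Tm 1 (\<lambda>x. X1 x) x v - 4 * B 5 x v)"
    by (rule exact_combo1[OF red_X1X3X1, of _ 2]) (simp add: Tm_simps power2_eq_square)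
  show "exact (\<lambda>x v. Tm 2 (\<lambda>x. X1 x) x v - (-6) * B 6 x v)"
    by (rule exact_combo1[OF red_X2X3X1, of _ 2]) (simp add: Tm_simps, drule C_rel(2), algebra)
  show "exact (\<lambda>x v. Tm 3 (\<lambda>x. X1 x) x v - (-10) * B 7 x v)"
    by (rule exact_combo2[OF red_X2X3X2 red_X1X32X1, of _ "-7" "-4"]) (simp add: Tm_simps, frule C_rel(1), drule C_rel(2), algebra)
  show "exact (\<lambda>x v. Tm 4 (\<lambda>x. X1 x) x v - 5 * B 7 x v)"
    by (rule exact_combo1[OF red_X1X32X1, of _ 2]) (simp add: Tm_simps, algebra)
  show "exact (\<lambda>x v. Tm 5 (\<lambda>x. X1 x) x v - (22/3) * B 8 x v)"
    by (rule exact_combo1[OF red_X2X32X1, of _ "-2"]) (simp add: Tm_simps, frule C_rel(1), drule C_rel(2), algebra)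
qed

lemma fder_mono: "fder (\<lambda>x. X3 x ^ 2) x v = 2 * X3 x * X3 v" "fder (\<lambda>x. X1 x * X3 x) x v = X1 x * X3 v + X3 x * X1 v"
   "fder (\<lambda>x. X3 x ^ 3) x v = 3 * X3 x ^ 2 * X3 v"
  by (rule fder_eqI, auto intro!: derivative_eq_intros simp: power2_eq_square algebra_simps)+

lemma Tm_X32:
  "exact (\<lambda>x v. Tm 1 (\<lambda>x. X3 x ^ 2) x v - 9 * B 6 x v)"
  "exact (\<lambda>x v. Tm 2 (\<lambda>x. X3 x ^ 2) x v - (-10) * B 7 x v)"
  "exact (\<lambda>x v. Tm 3 (\<lambda>x. X3 x ^ 2) x v - (11/3) * B 8 x v)"
  "exact (\<lambda>x v. Tm 4 (\<lambda>x. X3 x ^ 2) x v - 11 * B 8 x v)"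
proof -
  show "exact (\<lambda>x v. Tm 1 (\<lambda>x. X3 x ^ 2) x v - 9 * B 6 x v)"
    by (rule exact_congC[OF exact_0]) (simp add: Tm_simps fder_mono, algebra)
  show "exact (\<lambda>x v. Tm 2 (\<lambda>x. X3 x ^ 2) x v - (-10) * B 7 x v)"
    by (rule exact_combo1[OF red_X2X32X3, of _ 10]) (simp add: Tm_simps fder_mono, algebra)
  show "exact (\<lambda>x v. Tm 3 (\<lambda>x. X3 x ^ 2) x v - (11/3) * B 8 x v)"
    by (rule exact_combo1[OF red_X1X32X2, of _ 7]) (simp add: Tm_simps fder_mono, drule C_rel(2), algebra)
  show "exact (\<lambda>x v. Tm 4 (\<lambda>x. X3 x ^ 2) x v - 11 * B 8 x v)"
    by (rule exact_congC[OF exact_0]) (simp add: Tm_simps fder_mono, algebra)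
qed

lemma Tm_X13:
  "exact (\<lambda>x v. Tm 1 (\<lambda>x. X1 x * X3 x) x v - 5 * B 7 x v)"
  "exact (\<lambda>x v. Tm 2 (\<lambda>x. X1 x * X3 x) x v - (-22/3) * B 8 x v)"
proof -
  show "exact (\<lambda>x v. Tm 1 (\<lambda>x. X1 x * X3 x) x v - 5 * B 7 x v)"
    by (rule exact_combo1[OF red_X1X32X1, of _ 2]) (simp add: Tm_simps fder_mono, algebra)
  show "exact (\<lambda>x v. Tm 2 (\<lambda>x. X1 x * X3 x) x v - (-22/3) * B 8 x v)"
    by (rule exact_combo1[OF red_X2X32X1, of _ 2]) (simp add: Tm_simps fder_mono, drule C_rel(2), algebra)
qed

lemma Tm_X33: "exact (\<lambda>x v. Tm 1 (\<lambda>x. X3 x ^ 3) x v - 11 * B 8 x v)"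
  by (rule exact_congC[OF exact_0]) (simp add: Tm_simps fder_mono, algebra)

text \<open>Needed at the first resonance only. There \<open>X3^2\<close>, with entries 11/3 and 11,
  has no effect on the coordinate of weight 11, but \<open>X2\<close> has one.\<close>

lemma Tm_X2:
  "exact (\<lambda>x v. Tm 3 (\<lambda>x. X2 x) x v - (-55/3) * B 8 x v)"
  "exact (\<lambda>x v. Tm 4 (\<lambda>x. X2 x) x v - (-11/3) * B 8 x v)"
proof -
  show "exact (\<lambda>x v. Tm 3 (\<lambda>x. X2 x) x v - (-55/3) * B 8 x v)"
    by (rule exact_combo1[OF red_X1X32X2, of _ "-11"]) (simp add: Tm_simps, drule C_rel(2), algebra)
  show "exact (\<lambda>x v. Tm 4 (\<lambda>x. X2 x) x v - (-11/3) * B 8 x v)"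
    by (rule exact_combo1[OF red_X1X32X2, of _ 2]) (simp add: Tm_simps, drule C_rel(2), algebra)
qed

lemma Tm_combination:
  assumes "sm \<mu>" "sm \<nu>"
  shows "exact (\<lambda>x v. Tm i (\<lambda>x. b * \<mu> x + d * \<nu> x) x v - (b * Tm i \<mu> x v + d * Tm i \<nu> x v))"
proof (rule exact_cong[OF exact_0])
  show "near x. x \<in> C \<longrightarrow> (\<forall>v. Tm i (\<lambda>x. b * \<mu> x + d * \<nu> x) x v - (b * Tm i \<mu> x v + d * Tm i \<nu> x v) = 0)"
    using sm_differentiable[OF assms(1)] sm_differentiable[OF assms(2)]
  proof eventually_elim
    case (elim x)
    have "((\<lambda>x. b * \<mu> x + d * \<nu> x) has_derivative (\<lambda>v. b * fder \<mu> x v + d * fder \<nu> x v)) (at x)"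
      by (intro has_derivative_add has_derivative_mult_right has_fder elim)
    then have "fder (\<lambda>x. b * \<mu> x + d * \<nu> x) x v = b * fder \<mu> x v + d * fder \<nu> x v" for v by (rule fder_eqI)
    then show ?case by (simp add: Tm_def algebra_simps)
  qed
qed

text \<open>The first-order formula for \<open>B i\<close> has an error of weight
  \<open>wt i + 2 * \<kappa>\<close>, which only counts where \<open>c i\<close> is nonzero.
  Vanishing of the low coordinates therefore improves the precision.\<close>

lemma pb_crd:
  assumes "adapted \<kappa> a \<mu> G" "crd \<alpha> c" "\<And>i. i \<in> {1..8} \<Longrightarrow> c i \<noteq> 0 \<Longrightarrow> w \<le> wt i + 2 * \<kappa>"
  shows "FF w (\<lambda>x v. pb \<alpha> G x v - (\<Sum>i=1..8. c i * (a ^ wt i * B i x v + a ^ (wt i - 1) * Tm i \<mu> x v)))"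
proof -
  have G: "sm G" "G 0 = 0" "near x. x \<in> C \<longrightarrow> G x \<in> C" using assms(1) by (auto simp: adapted_def)
  have e: "exact (pb (\<lambda>x v. \<alpha> x v - (\<Sum>i=1..8. c i * B i x v)) G)"
    by (rule exact_pb[OF assms(2)[unfolded crd_def] G])
  have F: "FF w (\<lambda>x v. \<Sum>i=1..8. c i * (pb (B i) G x v - (a ^ wt i * B i x v + a ^ (wt i - 1) * Tm i \<mu> x v)))"
  proof (rule FF_sum)
    fix i :: nat assume i: "i \<in> {1..8}"
    show "FF w (\<lambda>x v. c i * (pb (B i) G x v - (a ^ wt i * B i x v + a ^ (wt i - 1) * Tm i \<mu> x v)))"
    proof (cases "c i = 0")
      case True
      then show ?thesis using FF_exact[OF exact_0] by simp
    next
      case False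
      then show ?thesis using i by (intro FF_cmult FF_antimono[OF pb_B[OF assms(1)]] assms(3))
    qed
  qed simp
  show ?thesis
    by (rule FF_congC[OF FF_add[OF FF_exact[OF e] F]])
       (simp add: pb_def sum_subtractf right_diff_distrib)
qed

lemma crd_unique: "crd a c \<Longrightarrow> crd a d \<Longrightarrow> i \<in> {1..8} \<Longrightarrow> c i = d i"
  using B_independent[of "\<lambda>i. d i - c i" i]
    exact_congC[OF exact_diff[of "\<lambda>x v. a x v - (\<Sum>i=1..8. c i * B i x v)" "\<lambda>x v. a x v - (\<Sum>i=1..8. d i * B i x v)"]]
  by (simp add: crd_def left_diff_distrib sum_subtractf)

lemma FF_12_Tm: "J \<kappa> \<mu> \<Longrightarrow> i \<in> {1..8} \<Longrightarrow> 12 \<le> wt i + \<kappa> \<Longrightarrow> exact (Tm i \<mu>)"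
  by (rule FF_12) (rule FF_antimono[OF FF_Tm])

lemma Tm_linear:
  assumes "\<mu> = (\<lambda>x. b * X3 x + d * X1 x)"
  shows "exact (\<lambda>x v. Tm 1 \<mu> x v - (7 * b * B 4 x v + 4 * d * B 5 x v))"
    "exact (\<lambda>x v. Tm 2 \<mu> x v - (- 8 * b * B 5 x v - 6 * d * B 6 x v))"
    "exact (\<lambda>x v. Tm 3 \<mu> x v - (3 * b * B 6 x v - 10 * d * B 7 x v))"
    "exact (\<lambda>x v. Tm 4 \<mu> x v - (9 * b * B 6 x v + 5 * d * B 7 x v))"
    "exact (\<lambda>x v. Tm 5 \<mu> x v - (10 * b * B 7 x v + 22/3 * d * B 8 x v))"
    "exact (\<lambda>x v. Tm 6 \<mu> x v - 11 * b * B 8 x v)"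
    "exact (\<lambda>x v. Tm 7 \<mu> x v)"
    "exact (\<lambda>x v. Tm 8 \<mu> x v)"
proof -
  have s: "exact (\<lambda>x v. Tm i \<mu> x v - (b * Tm i (\<lambda>x. X3 x) x v + d * Tm i (\<lambda>x. X1 x) x v))" for i
    unfolding assms by (rule Tm_combination) auto
  have z: "exact (\<lambda>x v. Tm 6 (\<lambda>x. X1 x) x v)" "exact (\<lambda>x v. Tm 7 (\<lambda>x. X3 x) x v)" "exact (\<lambda>x v. Tm 8 (\<lambda>x. X3 x) x v)"
    "exact (\<lambda>x v. Tm 7 (\<lambda>x. X1 x) x v)" "exact (\<lambda>x v. Tm 8 (\<lambda>x. X1 x) x v)"
    by (rule FF_12_Tm[OF J_X(1)] FF_12_Tm[OF J_X(3)]; (simp add: wt_def; fail))+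
  show "exact (\<lambda>x v. Tm 1 \<mu> x v - (7 * b * B 4 x v + 4 * d * B 5 x v))"
    by (rule exact_combo3[OF s Tm_X3(1) Tm_X1(1), where k = 1 and l = b and m = d]) (simp add: algebra_simps)
  show "exact (\<lambda>x v. Tm 2 \<mu> x v - (- 8 * b * B 5 x v - 6 * d * B 6 x v))"
    by (rule exact_combo3[OF s Tm_X3(2) Tm_X1(2), where k = 1 and l = b and m = d]) (simp add: algebra_simps)
  show "exact (\<lambda>x v. Tm 3 \<mu> x v - (3 * b * B 6 x v - 10 * d * B 7 x v))"
    by (rule exact_combo3[OF s Tm_X3(3) Tm_X1(3), where k = 1 and l = b and m = d]) (simp add: algebra_simps)
  show "exact (\<lambda>x v. Tm 4 \<mu> x v - (9 * b * B 6 x v + 5 * d * B 7 x v))"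
    by (rule exact_combo3[OF s Tm_X3(4) Tm_X1(4), where k = 1 and l = b and m = d]) (simp add: algebra_simps)
  show "exact (\<lambda>x v. Tm 5 \<mu> x v - (10 * b * B 7 x v + 22/3 * d * B 8 x v))"
    by (rule exact_combo3[OF s Tm_X3(5) Tm_X1(5), where k = 1 and l = b and m = d]) (simp add: algebra_simps)
  show "exact (\<lambda>x v. Tm 6 \<mu> x v - 11 * b * B 8 x v)"
    by (rule exact_combo3[OF s Tm_X3(6) z(1), where k = 1 and l = b and m = d]) (simp add: algebra_simps)
  show "exact (\<lambda>x v. Tm 7 \<mu> x v)"
    by (rule exact_combo3[OF s z(2) z(4), where k = 1 and l = b and m = d]) (simp add: algebra_simps)
  show "exact (\<lambda>x v. Tm 8 \<mu> x v)"
    by (rule exact_combo3[OF s z(3) z(5), where k = 1 and l = b and m = d]) (simp add: algebra_simps)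
qed

text \<open>With \<kappa> = 2 the error begins 4 above the leading weight. A leading weight 5 leaves
  weights up to 8 reliable; weight 9 needs \<open>c 1 = 0\<close>, weight 10 also
  \<open>c 2 = 0\<close>, and weight 11 a leading weight of at least 8. This is the reason for the
  conditions on the last three formulas.\<close>

theorem pb_coordinates:
  assumes G: "adapted 2 a (\<lambda>x. b * X3 x + d * X1 x) G" and c: "crd \<alpha> c" and c': "crd (pb \<alpha> G) c'"
  shows "c' 1 = a ^ 5 * c 1" "c' 2 = a ^ 6 * c 2" "c' 3 = a ^ 7 * c 3" "c' 4 = a ^ 7 * c 4 + 7 * a ^ 4 * b * c 1"
    "c' 5 = a ^ 8 * c 5 + 4 * a ^ 4 * d * c 1 - 8 * a ^ 5 * b * c 2"
    "c 1 = 0 \<Longrightarrow> c' 6 = a ^ 9 * c 6 - 6 * a ^ 5 * d * c 2 + a ^ 6 * b * (3 * c 3 + 9 * c 4)"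
    "c 1 = 0 \<Longrightarrow> c 2 = 0 \<Longrightarrow> c' 7 = a ^ 10 * c 7 + a ^ 6 * d * (5 * c 4 - 10 * c 3) + 10 * a ^ 7 * b * c 5"
    "(\<And>i. i \<in> {1..4} \<Longrightarrow> c i = 0) \<Longrightarrow> c' 8 = a ^ 11 * c 8 + 22/3 * a ^ 7 * d * c 5 + 11 * a ^ 8 * b * c 6"
proof -
  define \<mu> where "\<mu> = (\<lambda>x. b * X3 x + d * X1 x)"
  define u where "u = (\<lambda>i::nat. if i = 4 then 7 * a ^ 4 * b * c 1 else if i = 5 then 4 * a ^ 4 * d * c 1 - 8 * a ^ 5 * b * c 2
     else if i = 6 then - 6 * a ^ 5 * d * c 2 + a ^ 6 * b * (3 * c 3 + 9 * c 4)
     else if i = 7 then a ^ 6 * d * (5 * c 4 - 10 * c 3) + 10 * a ^ 7 * b * c 5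
     else if i = 8 then 22/3 * a ^ 7 * d * c 5 + 11 * a ^ 8 * b * c 6 else 0)"
  have u: "exact (\<lambda>x v. (\<Sum>i=1..8. c i * (a ^ wt i * B i x v + a ^ (wt i - 1) * Tm i \<mu> x v)) -
      (\<Sum>i=1..8. (a ^ wt i * c i + u i) * B i x v))"
  proof -
    note T = Tm_linear[OF \<mu>_def]
    have "exact (\<lambda>x v. c 1 * a ^ 4 * (Tm 1 \<mu> x v - (7 * b * B 4 x v + 4 * d * B 5 x v)) +
      c 2 * a ^ 5 * (Tm 2 \<mu> x v - (- 8 * b * B 5 x v - 6 * d * B 6 x v)) +
      c 3 * a ^ 6 * (Tm 3 \<mu> x v - (3 * b * B 6 x v - 10 * d * B 7 x v)) +
      c 4 * a ^ 6 * (Tm 4 \<mu> x v - (9 * b * B 6 x v + 5 * d * B 7 x v)) +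
      c 5 * a ^ 7 * (Tm 5 \<mu> x v - (10 * b * B 7 x v + 22/3 * d * B 8 x v)) +
      c 6 * a ^ 8 * (Tm 6 \<mu> x v - 11 * b * B 8 x v) +
      c 7 * a ^ 9 * Tm 7 \<mu> x v + c 8 * a ^ 10 * Tm 8 \<mu> x v)" (is "exact ?E")
      by (intro exact_add exact_cmult T)
    then show ?thesis
      by (rule exact_congC) (simp add: sum18 wt_def u_def del: B_simps, algebra)
  qed
  \<comment> \<open>The precision \<open>w\<close> is left open: 9 in general, and up to 12 under
    the additional conditions.\<close>
  have main: "c' i = a ^ wt i * c i + u i" if w: "w \<ge> 5" "\<And>i. i \<in> {1..8} \<Longrightarrow> c i \<noteq> 0 \<Longrightarrow> w \<le> wt i + 2 * 2"
     and i: "i \<in> {1..8}" "wt i < w" for w i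
  proof -
    have "FF w (\<lambda>x v. pb \<alpha> G x v - (\<Sum>i=1..8. c i * (a ^ wt i * B i x v + a ^ (wt i - 1) * Tm i \<mu> x v)))"
      unfolding \<mu>_def by (rule pb_crd[OF G c w(2)])
    from FF_add[OF this FF_exact[OF u]] have "FF w (\<lambda>x v. pb \<alpha> G x v - (\<Sum>i=1..8. (a ^ wt i * c i + u i) * B i x v))"
      by (rule FF_congC) simp
    then obtain z where z: "crd (\<lambda>x v. pb \<alpha> G x v - (\<Sum>i=1..8. (a ^ wt i * c i + u i) * B i x v)) z" "\<And>i. wt i < w \<Longrightarrow> z i = 0"
      using FF_crd[OF _ w(1)] by blast
    have "crd (pb \<alpha> G) (\<lambda>i. a ^ wt i * c i + u i + z i)"
      unfolding crd_def by (rule exact_congC[OF z(1)[unfolded crd_def]]) (simp add: distrib_right sum.distrib)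
    from crd_unique[OF c' this i(1)] z(2)[OF i(2)] show ?thesis by simp
  qed
  have w9: "9 \<le> wt i + 2 * 2" if "i \<in> {1..8}" for i using that by (auto simp: wt_def)
  show "c' 1 = a ^ 5 * c 1" "c' 2 = a ^ 6 * c 2" "c' 3 = a ^ 7 * c 3" "c' 4 = a ^ 7 * c 4 + 7 * a ^ 4 * b * c 1"
    "c' 5 = a ^ 8 * c 5 + 4 * a ^ 4 * d * c 1 - 8 * a ^ 5 * b * c 2"
    using main[of 9 1] main[of 9 2] main[of 9 3] main[of 9 4] main[of 9 5] w9 by (simp_all add: wt_def u_def)
  show "c' 6 = a ^ 9 * c 6 - 6 * a ^ 5 * d * c 2 + a ^ 6 * b * (3 * c 3 + 9 * c 4)" if "c 1 = 0"
  proof -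
    have "10 \<le> wt i + 2 * 2" if "i \<in> {1..8}" "c i \<noteq> 0" for i
      using that \<open>c 1 = 0\<close> by (cases "i = 1") (auto simp: wt_def)
    from main[OF _ this, of 6] show ?thesis by (simp add: wt_def u_def)
  qed
  show "c' 7 = a ^ 10 * c 7 + a ^ 6 * d * (5 * c 4 - 10 * c 3) + 10 * a ^ 7 * b * c 5" if "c 1 = 0" "c 2 = 0"
  proof -
    have "11 \<le> wt i + 2 * 2" if "i \<in> {1..8}" "c i \<noteq> 0" for i
      using that \<open>c 1 = 0\<close> \<open>c 2 = 0\<close> by (cases "i = 1"; cases "i = 2") (auto simp: wt_def)
    from main[OF _ this, of 7] show ?thesis by (simp add: wt_def u_def)
  qed
  show "c' 8 = a ^ 11 * c 8 + 22/3 * a ^ 7 * d * c 5 + 11 * a ^ 8 * b * c 6" if z: "\<And>i. i \<in> {1..4} \<Longrightarrow> c i = 0"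
  proof -
    have "12 \<le> wt i + 2 * 2" if "i \<in> {1..8}" "c i \<noteq> 0" for i
    proof -
      have "i \<notin> {1..4}" using z that(2) by blast
      then show ?thesis using that(1) by (auto simp: wt_def)
    qed
    from main[OF _ this, of 8] show ?thesis by (simp add: wt_def u_def)
  qed
qed

subsection \<open>Reduction of the coordinates to normal form\<close>

definition admissible :: "(real ^ 'm \<Rightarrow> real ^ 'm) \<Rightarrow> bool" where
  "admissible G \<longleftrightarrow> ld G \<and> (near x. x \<in> C \<longleftrightarrow> G x \<in> C)"

definition Reach :: "(real ^ 'm \<Rightarrow> real ^ 'm \<Rightarrow> real) \<Rightarrow> (nat \<Rightarrow> real) \<Rightarrow> bool" where
  "Reach \<alpha> c \<longleftrightarrow> (\<exists>G. admissible G \<and> crd (pb \<alpha> G) c)"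

lemma admissible_compose:
  assumes "admissible G" "admissible H"
  shows "admissible (\<lambda>x. G (H x))"
proof -
  have l: "ld G" "ld H" and e: "near x. x \<in> C \<longleftrightarrow> G x \<in> C" "near x. x \<in> C \<longleftrightarrow> H x \<in> C"
    using assms by (auto simp: admissible_def)
  have s: "sm H" "H 0 = 0" using l(2) by (auto simp: ld_def)
  have "near x. x \<in> C \<longleftrightarrow> G (H x) \<in> C"
    using e(2) eventually_compose_germ[OF e(1) s] by eventually_elim simp
  then show ?thesis using ld_compose[OF l(2,1)] by (simp add: admissible_def)
qed

lemma pb_compose:
  assumes "sm G" "sm H" "H 0 = 0"
  shows "near x. \<forall>v. pb (pb \<alpha> G) H x v = pb \<alpha> (\<lambda>x. G (H x)) x v"
  using sm_differentiable[OF assms(2)] eventually_compose_germ[OF sm_differentiable[OF assms(1)] assms(2,3)]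
  by eventually_elim (simp add: pb_def fder_compose)

lemma crd_cong:
  assumes "crd a c" "near x. \<forall>v. a x v = b x v" "\<And>i. i \<in> {1..8} \<Longrightarrow> c i = d i"
  shows "crd b d"
proof -
  have "(\<Sum>i=1..8. c i * B i x v) = (\<Sum>i=1..8. d i * B i x v)" for x v
    by (rule sum.cong) (use assms(3) in auto)
  then show ?thesis using assms(1) unfolding crd_def
    by (elim exact_cong) (use assms(2) in \<open>eventually_elim, simp\<close>)
qed

lemma Reach_trans:
  assumes "Reach \<alpha> c" "\<And>\<beta>. crd \<beta> c \<Longrightarrow> \<exists>G. admissible G \<and> crd (pb \<beta> G) d"
  shows "Reach \<alpha> d"
proof -
  obtain G where G: "admissible G" "crd (pb \<alpha> G) c" using assms(1) by (auto simp: Reach_def)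
  obtain H where H: "admissible H" "crd (pb (pb \<alpha> G) H) d" using assms(2)[OF G(2)] by blast
  have s: "sm G" "sm H" "H 0 = 0" using G(1) H(1) by (auto simp: admissible_def ld_def)
  have "crd (pb \<alpha> (\<lambda>x. G (H x))) d"
    by (rule crd_cong[OF H(2) pb_compose[OF s]]) simp
  then show ?thesis using admissible_compose[OF G(1) H(1)] unfolding Reach_def by blast
qed

definition Lam :: "(real ^ 'm \<Rightarrow> real) \<Rightarrow> real ^ 'm \<Rightarrow> real ^ 'm" where
  "Lam l x = x + ((l x ^ 3 - 1) * X1 x) *\<^sub>R axis (e 1) 1 + ((l x ^ 4 - 1) * X2 x) *\<^sub>R axis (e 2) 1 +
     ((l x ^ 2 - 1) * X3 x) *\<^sub>R axis (e 3) 1"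

lemma Lam_nth: "Lam l x $ j = (if j = e 1 then l x ^ 3 * X1 x else if j = e 2 then l x ^ 4 * X2 x
   else if j = e 3 then l x ^ 2 * X3 x else x $ j)"
  by (auto simp: Lam_def axis_def algebra_simps)

text \<open>Because these identities hold pointwise, the factor in \<open>Lam\<close> may vary with
  the point; the curve is preserved as long as it does not vanish.\<close>

lemma quasihomogeneous:
  "(l ^ 3 * a) ^ 2 + (l ^ 4 * b) * (l ^ 2 * c) = l ^ 6 * (a ^ 2 + b * (c :: real))"
  "(l ^ 3 * a) * (l ^ 4 * b) + (l ^ 3 * a) * (l ^ 2 * c) ^ 2 = l ^ 7 * (a * b + a * (c :: real) ^ 2)"
proof -
  have l: "l ^ 3 * l ^ 4 = l ^ 7" "l ^ 3 * (l ^ 2) ^ 2 = l ^ 7" "(l ^ 3) ^ 2 = l ^ 6" "l ^ 4 * l ^ 2 = l ^ 6"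
    by (simp_all flip: power_add power_mult)
  have "l ^ 6 * (a ^ 2 + b * c) = (l ^ 3) ^ 2 * a ^ 2 + (l ^ 4 * l ^ 2) * (b * c)" unfolding l by (rule distrib_left)
  then show "(l ^ 3 * a) ^ 2 + (l ^ 4 * b) * (l ^ 2 * c) = l ^ 6 * (a ^ 2 + b * c)"
    unfolding power_mult_distrib by (simp add: mult_ac)
  have "l ^ 7 * (a * b + a * c ^ 2) = (l ^ 3 * l ^ 4) * (a * b) + (l ^ 3 * (l ^ 2) ^ 2) * (a * c ^ 2)" unfolding l by (rule distrib_left)
  then show "(l ^ 3 * a) * (l ^ 4 * b) + (l ^ 3 * a) * (l ^ 2 * c) ^ 2 = l ^ 7 * (a * b + a * c ^ 2)"
    unfolding power_mult_distrib by (simp only: mult_ac)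
qed

lemma Lam_C: "l x \<noteq> 0 \<Longrightarrow> x \<in> C \<longleftrightarrow> Lam l x \<in> C"
proof -
  assume l: "l x \<noteq> 0"
  have j: "e j \<noteq> e 1 \<and> e j \<noteq> e 2 \<and> e j \<noteq> e 3" if "j \<in> {4..2*n}" for j
    using e_eq_iff[of j 1] e_eq_iff[of j 2] e_eq_iff[of j 3] n2 that by simp
  have "Lam l x $ e j = x $ e j" if "j \<in> {4..2*n}" for j
    using j[OF that] by (simp add: Lam_nth)
  moreover have "X1 (Lam l x) ^ 2 + X2 (Lam l x) * X3 (Lam l x) = l x ^ 6 * (X1 x ^ 2 + X2 x * X3 x)"
    using quasihomogeneous(1)[of "l x"] by (simp add: Lam_nth)
  moreover have "X1 (Lam l x) * X2 (Lam l x) + X1 (Lam l x) * X3 (Lam l x) ^ 2 = l x ^ 7 * (X1 x * X2 x + X1 x * X3 x ^ 2)"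
    using quasihomogeneous(2)[of "l x"] by (simp add: Lam_nth)
  ultimately show ?thesis using l by (simp add: C_iff)
qed

lemma Lam_admissible:
  assumes "sm l" "l 0 \<noteq> 0"
  shows "admissible (Lam l)"
proof -
  have s: "sm (Lam l)"
    unfolding Lam_def[abs_def]
    by (intro sm_add sm_scaleR sm_const sm_mult sm_diff sm_power assms sm_coord) (simp add: sm_linear[OF bounded_linear_ident])
  have dl: "(l has_derivative fder l 0) (at 0)" by (rule sm_has_fder_0[OF assms(1)])
  have "(Lam l has_derivative (\<lambda>v. v + ((l 0 ^ 3 - 1) * X1 v) *\<^sub>R axis (e 1) 1 + ((l 0 ^ 4 - 1) * X2 v) *\<^sub>R axis (e 2) 1 +
     ((l 0 ^ 2 - 1) * X3 v) *\<^sub>R axis (e 3) 1)) (at 0)"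
    unfolding Lam_def[abs_def] by (auto intro!: derivative_eq_intros dl)
  then have d: "fder (Lam l) 0 v = v + ((l 0 ^ 3 - 1) * X1 v) *\<^sub>R axis (e 1) 1 + ((l 0 ^ 4 - 1) * X2 v) *\<^sub>R axis (e 2) 1 +
     ((l 0 ^ 2 - 1) * X3 v) *\<^sub>R axis (e 3) 1" for v by (rule fder_eqI)
  have dn: "fder (Lam l) 0 v $ j = (if j = e 1 then l 0 ^ 3 * X1 v else if j = e 2 then l 0 ^ 4 * X2 v
   else if j = e 3 then l 0 ^ 2 * X3 v else v $ j)" for v j
    unfolding d by (auto simp: axis_def algebra_simps)
  have "inj (fder (Lam l) 0)"
  proof (rule injI)
    fix v w assume vw: "fder (Lam l) 0 v = fder (Lam l) 0 w"
    show "v = w"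
      unfolding vec_eq_iff
    proof
      fix j
      have "fder (Lam l) 0 v $ j = fder (Lam l) 0 w $ j" using vw by simp
      then show "v $ j = w $ j" unfolding dn using assms(2) by (auto split: if_splits)
    qed
  qed
  moreover have "Lam l 0 = 0" by (simp add: Lam_def)
  moreover have "near x. l x \<noteq> 0"
    using sm_isCont[OF assms(1)] assms(2) by (simp add: isCont_def tendsto_at_iff_tendsto_nhds tendsto_imp_eventually_ne)
  then have "near x. x \<in> C \<longleftrightarrow> Lam l x \<in> C" by eventually_elim (rule Lam_C)
  ultimately show ?thesis using s by (simp add: admissible_def ld_def)
qed

lemma Lam_adapted:
  assumes "J \<kappa> \<mu>" "\<kappa> \<ge> 1"
  shows "adapted \<kappa> 1 \<mu> (Lam (\<lambda>x. 1 + \<mu> x))" "admissible (Lam (\<lambda>x. 1 + \<mu> x))"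
proof -
  have s: "sm \<mu>" "\<mu> 0 = 0" using J_sm[OF assms(1)] J_at_0[OF assms] by auto
  show a: "admissible (Lam (\<lambda>x. 1 + \<mu> x))" by (rule Lam_admissible) (use s in \<open>auto intro: sm_add\<close>)
  have m: "J (\<kappa> + \<kappa>) (\<lambda>x. \<mu> x * \<mu> x)" by (rule J_mult[OF assms(1,1)])
  \<comment> \<open>The terms of \<open>(1 + \<mu>) ^ w\<close> beyond first order are
    \<open>\<mu>^2\<close> times \<open>3 + \<mu>\<close>, \<open>6 + 4 \<mu> + \<mu>^2\<close> and
    \<open>1\<close> for the weights 3, 4 and 2.\<close>
  have q: "J (k + 2 * \<kappa>) (\<lambda>x. F x * (\<mu> x * \<mu> x) * g x)" if "J k F" "sm g" for k F g
    using J_mult_sm[OF J_mult[OF that(1) m] that(2)] by (simp add: mult_2)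
  have "J (3 + 2 * \<kappa>) (\<lambda>x. X1 (Lam (\<lambda>x. 1 + \<mu> x) x) - (1 ^ 3 * X1 x + real 3 * 1 ^ (3 - 1) * (X1 x * \<mu> x)))"
    using q[OF J_X(1), of "\<lambda>x. 3 + \<mu> x"] s(1) by (simp add: Lam_nth algebra_simps power3_eq_cube sm_add)
  moreover have "J (4 + 2 * \<kappa>) (\<lambda>x. X2 (Lam (\<lambda>x. 1 + \<mu> x) x) - (1 ^ 4 * X2 x + real 4 * 1 ^ (4 - 1) * (X2 x * \<mu> x)))"
    using q[OF J_X(2), of "\<lambda>x. 6 + 4 * \<mu> x + \<mu> x * \<mu> x"] s(1)
    by (simp add: Lam_nth algebra_simps power4_eq_xxxx sm_add sm_mult)
  moreover have "J (2 + 2 * \<kappa>) (\<lambda>x. X3 (Lam (\<lambda>x. 1 + \<mu> x) x) - (1 ^ 2 * X3 x + real 2 * 1 ^ (2 - 1) * (X3 x * \<mu> x)))"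
    using q[OF J_X(3), of "\<lambda>x. 1"] by (simp add: Lam_nth algebra_simps power2_eq_square)
  moreover have "near x. x \<in> C \<longrightarrow> Lam (\<lambda>x. 1 + \<mu> x) x \<in> C"
    using a unfolding admissible_def by (auto elim: eventually_mono)
  ultimately show "adapted \<kappa> 1 \<mu> (Lam (\<lambda>x. 1 + \<mu> x))"
    using a assms(1) by (simp add: adapted_def admissible_def ld_def cw_def)
qed

lemma Tm_cmult: "sm \<mu> \<Longrightarrow> exact (\<lambda>x v. Tm i (\<lambda>x. b * \<mu> x) x v - b * Tm i \<mu> x v)"
  using Tm_combination[of \<mu> \<mu> i b 0] by simp

lemma Reach_scale:
  assumes "Reach \<alpha> c" "a \<noteq> 0"
  shows "Reach \<alpha> (\<lambda>i. a ^ wt i * c i)"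
proof (rule Reach_trans[OF assms(1)])
  fix \<beta> assume b: "crd \<beta> c"
  have ad: "admissible (Lam (\<lambda>x. a))" by (rule Lam_admissible) (use assms(2) in auto)
  have "near x. x \<in> C \<longrightarrow> Lam (\<lambda>x. a) x \<in> C"
    using ad unfolding admissible_def by (auto elim: eventually_mono)
  \<comment> \<open>A constant factor has no correction, so any order may be claimed; 6 raises the
    precision to 12, beyond which forms are exact.\<close>
  then have "adapted 6 a (\<lambda>x. 0) (Lam (\<lambda>x. a))"
    using ad by (auto simp: adapted_def admissible_def ld_def cw_def Lam_nth J_zero)
  from FF_12[OF pb_crd[OF this b]]
  have "exact (\<lambda>x v. pb \<beta> (Lam (\<lambda>x. a)) x v - (\<Sum>i=1..8. c i * (a ^ wt i * B i x v + a ^ (wt i - 1) * Tm i (\<lambda>x. 0) x v)))"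
    by simp
  moreover have "Tm i (\<lambda>x. 0) x v = 0" for i x v
    by (simp add: Tm_def fder_eqI[OF has_derivative_const])
  ultimately have "crd (pb \<beta> (Lam (\<lambda>x. a))) (\<lambda>i. a ^ wt i * c i)"
    by (simp add: crd_def mult_ac)
  then show "\<exists>G. admissible G \<and> crd (pb \<beta> G) (\<lambda>i. a ^ wt i * c i)" using ad by blast
qed

text \<open>Scaling by \<open>1 + \<epsilon> * \<mu>\<close> adds \<epsilon> times the first-order
  change of the leading part, which by the last hypothesis is \<open>t * B j\<close> modulo exact
  forms. Coordinates up to the weight of \<open>B j\<close> are otherwise untouched, those above may
  change; hence coordinates are removed in the order of increasing weight.\<close>

lemma kill:
  assumes R: "Reach \<alpha> c" and \<mu>: "J \<kappa> \<mu>" "\<kappa> \<ge> 1" and j: "j \<in> {1..8}" "wt j = w + \<kappa>" and w: "w \<ge> 5"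
    and c: "\<And>i. i \<in> {1..8} \<Longrightarrow> wt i < w \<Longrightarrow> c i = 0" and t: "t \<noteq> 0"
    and T: "exact (\<lambda>x v. (\<Sum>i=1..8. if wt i = w then c i * Tm i \<mu> x v else 0) - t * B j x v)"
  obtains c' where "Reach \<alpha> c'" "c' j = 0" "\<And>i. i \<noteq> j \<Longrightarrow> wt i \<le> wt j \<Longrightarrow> c' i = c i"
proof -
  \<comment> \<open>Chosen so that the added term \<open>\<epsilon> * t\<close> cancels
    \<open>c j\<close>.\<close>
  define \<epsilon> where "\<epsilon> = - c j / t"
  define G where "G = Lam (\<lambda>x. 1 + \<epsilon> * \<mu> x)"
  have G: "adapted \<kappa> 1 (\<lambda>x. \<epsilon> * \<mu> x) G" "admissible G"
    unfolding G_def by (rule Lam_adapted[OF J_cmult[OF \<mu>(1)] \<mu>(2)])+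
  have s: "sm \<mu>" by (rule J_sm[OF \<mu>(1)])
  have E: "exact (\<lambda>x v. \<Sum>i=1..8. c i * (Tm i (\<lambda>x. \<epsilon> * \<mu> x) x v - \<epsilon> * Tm i \<mu> x v))"
    by (intro exact_sum exact_cmult Tm_cmult s) simp
  \<comment> \<open>Components of weight above \<open>w\<close> are changed only from weight
    \<open>w + \<kappa> + 1\<close> on.\<close>
  have H: "FF (w + \<kappa> + 1) (\<lambda>x v. \<Sum>i=1..8. if wt i = w then 0 else c i * Tm i \<mu> x v)"
  proof (rule FF_sum)
    fix i :: nat assume i: "i \<in> {1..8}"
    consider "wt i < w" | "wt i = w" | "wt i > w" by linarith
    then show "FF (w + \<kappa> + 1) (\<lambda>x v. if wt i = w then 0 else c i * Tm i \<mu> x v)"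
    proof cases
      case 3
      then show ?thesis using FF_cmult[OF FF_antimono[OF FF_Tm[OF \<mu>(1) i]]] by simp
    qed (use c[OF i] FF_exact[OF exact_0] in auto)
  qed simp
  define k where "k = (\<lambda>i. c i + (if i = j then \<epsilon> * t else 0))"
  have split: "(\<Sum>i=1..8. c i * Tm i \<mu> x v) = (\<Sum>i=1..8. if wt i = w then c i * Tm i \<mu> x v else 0) +
      (\<Sum>i=1..8. if wt i = w then 0 else c i * Tm i \<mu> x v)" for x v
    unfolding sum.distrib[symmetric] by (rule sum.cong) auto
  have sk: "(\<Sum>i=1..8. k i * B i x v) = (\<Sum>i=1..8. c i * B i x v) + \<epsilon> * t * B j x v" for x v
    unfolding k_def by (simp only: distrib_right sum.distrib sum_single_B[OF j(1)])
  have id: "p - (C' + u * r * b) = p - (C' + T') + (T' - u * (S1 + S2)) + (u * (S1 - r * b) + u * S2)"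
    for p C' u r b T' S1 S2 :: real by (simp add: algebra_simps)
  have main: "\<exists>d. crd (pb \<beta> G) (\<lambda>i. k i + d i) \<and> (\<forall>i. wt i < w + \<kappa> + 1 \<longrightarrow> d i = 0)" if b: "crd \<beta> c" for \<beta>
  proof -
    have "FF (w + \<kappa> + 1) (\<lambda>x v. pb \<beta> G x v - (\<Sum>i=1..8. c i * (1 ^ wt i * B i x v + 1 ^ (wt i - 1) * Tm i (\<lambda>x. \<epsilon> * \<mu> x) x v)))"
    proof (rule pb_crd[OF G(1) b])
      fix i assume "i \<in> {1..8}" "c i \<noteq> 0"
      then have "w \<le> wt i" using c[of i] by force
      then show "w + \<kappa> + 1 \<le> wt i + 2 * \<kappa>" using \<mu>(2) by simp
    qed
    from FF_add[OF FF_add[OF this FF_exact[OF E]] FF_add[OF FF_exact[OF exact_cmult[OF T, of \<epsilon>]] FF_cmult[OF H, of \<epsilon>]]]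
    have F: "FF (w + \<kappa> + 1) (\<lambda>x v. pb \<beta> G x v - (\<Sum>i=1..8. k i * B i x v))"
    proof (rule FF_congC)
      fix x v
      have e1: "(\<Sum>i=1..8. c i * (1 ^ wt i * B i x v + 1 ^ (wt i - 1) * Tm i (\<lambda>x. \<epsilon> * \<mu> x) x v)) =
          (\<Sum>i=1..8. c i * B i x v) + (\<Sum>i=1..8. c i * Tm i (\<lambda>x. \<epsilon> * \<mu> x) x v)"
        by (simp add: distrib_left sum.distrib)
      have e2: "(\<Sum>i=1..8. c i * (Tm i (\<lambda>x. \<epsilon> * \<mu> x) x v - \<epsilon> * Tm i \<mu> x v)) =
          (\<Sum>i=1..8. c i * Tm i (\<lambda>x. \<epsilon> * \<mu> x) x v) - \<epsilon> * (\<Sum>i=1..8. c i * Tm i \<mu> x v)"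
        by (simp add: right_diff_distrib sum_subtractf sum_distrib_left mult.left_commute)
      show "pb \<beta> G x v - (\<Sum>i=1..8. k i * B i x v) =
          pb \<beta> G x v - (\<Sum>i=1..8. c i * (1 ^ wt i * B i x v + 1 ^ (wt i - 1) * Tm i (\<lambda>x. \<epsilon> * \<mu> x) x v)) +
          (\<Sum>i=1..8. c i * (Tm i (\<lambda>x. \<epsilon> * \<mu> x) x v - \<epsilon> * Tm i \<mu> x v)) +
          (\<epsilon> * ((\<Sum>i=1..8. if wt i = w then c i * Tm i \<mu> x v else 0) - t * B j x v) +
           \<epsilon> * (\<Sum>i=1..8. if wt i = w then 0 else c i * Tm i \<mu> x v))"
        by (subst e1, subst e2, subst sk, subst split) (rule id)
    qed
    obtain d where d: "crd (\<lambda>x v. pb \<beta> G x v - (\<Sum>i=1..8. k i * B i x v)) d" "\<And>i. wt i < w + \<kappa> + 1 \<Longrightarrow> d i = 0"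
      by (rule FF_crd[OF F _ that]) (use w in simp)
    have "crd (pb \<beta> G) (\<lambda>i. k i + d i)"
      unfolding crd_def by (rule exact_congC[OF d(1)[unfolded crd_def]]) (simp add: distrib_right sum.distrib)
    then show ?thesis using d(2) by blast
  qed
  obtain G0 where G0: "admissible G0" "crd (pb \<alpha> G0) c" using R by (auto simp: Reach_def)
  obtain d where d: "crd (pb (pb \<alpha> G0) G) (\<lambda>i. k i + d i)" "\<And>i. wt i < w + \<kappa> + 1 \<Longrightarrow> d i = 0"
    using main[OF G0(2)] by blast
  have s0: "sm G0" "sm G" "G 0 = 0" using G0(1) G(2) by (auto simp: admissible_def ld_def)
  have "crd (pb \<alpha> (\<lambda>x. G0 (G x))) (\<lambda>i. k i + d i)"
    by (rule crd_cong[OF d(1) pb_compose[OF s0]]) simp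
  then have "Reach \<alpha> (\<lambda>i. k i + d i)" using admissible_compose[OF G0(1) G(2)] unfolding Reach_def by blast
  then show ?thesis
    by (rule that) (use d(2) j(2) t in \<open>auto simp: k_def \<epsilon>_def\<close>)
qed

lemma kill1:
  assumes "Reach \<alpha> c" "J \<kappa> \<mu>" "exact (\<lambda>x v. Tm l \<mu> x v - s * B j x v)"
    "l \<in> {1,2,5,6,7,8}" "j \<in> {1..8}" "wt j = wt l + \<kappa>" "\<kappa> \<ge> 1" "s * c l \<noteq> 0" "\<forall>i\<in>{1..8}. i < l \<longrightarrow> c i = 0"
  shows "\<exists>c'. Reach \<alpha> c' \<and> c' j = 0 \<and> (\<forall>i. i \<noteq> j \<longrightarrow> wt i \<le> wt j \<longrightarrow> c' i = c i)"
proof (rule kill[OF assms(1,2,7,5,6)])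
  have l: "l \<in> {1..8}" using assms(4) by auto
  show "5 \<le> wt l" using l by (auto simp: wt_def)
  show "c i = 0" if "i \<in> {1..8}" "wt i < wt l" for i
  proof -
    have "i < l" using that(2) by (auto simp: wt_def split: if_splits)
    then show ?thesis using assms(9) that by auto
  qed
  have "(if wt i = wt l then c i * Tm i \<mu> x v else 0) = (if i = l then c l * Tm l \<mu> x v else 0)"
    if "i \<in> {1..8}" for i x v
    using assms(4) that by (auto simp: wt_def split: if_splits)
  then have "(\<Sum>i=1..8. if wt i = wt l then c i * Tm i \<mu> x v else 0) = (\<Sum>i=1..8. if i = l then c l * Tm l \<mu> x v else 0)" for x v
    by (intro sum.cong) auto
  then have sum: "(\<Sum>i=1..8. if wt i = wt l then c i * Tm i \<mu> x v else 0) = c l * Tm l \<mu> x v" for x v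
    using l by simp
  show "exact (\<lambda>x v. (\<Sum>i=1..8. if wt i = wt l then c i * Tm i \<mu> x v else 0) - (s * c l) * B j x v)"
    unfolding sum by (rule exact_congC[OF exact_cmult[OF assms(3), of "c l"]]) (simp add: algebra_simps)
  show "s * c l \<noteq> 0" by (rule assms(8))
qed blast

text \<open>In weight 7 both \<open>B 3\<close> and \<open>B 4\<close> contribute, so the divisor is
  \<open>s * c 3 + t * c 4\<close>; where it vanishes, the substitution is resonant.\<close>

lemma kill7:
  assumes "Reach \<alpha> c" "J \<kappa> \<mu>" "exact (\<lambda>x v. Tm 3 \<mu> x v - s * B j x v)" "exact (\<lambda>x v. Tm 4 \<mu> x v - t * B j x v)"
    "j \<in> {1..8}" "wt j = 7 + \<kappa>" "\<kappa> \<ge> 1" "s * c 3 + t * c 4 \<noteq> 0" "c 1 = 0" "c 2 = 0"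
  shows "\<exists>c'. Reach \<alpha> c' \<and> c' j = 0 \<and> (\<forall>i. i \<noteq> j \<longrightarrow> wt i \<le> wt j \<longrightarrow> c' i = c i)"
proof (rule kill[OF assms(1,2,7,5,6)])
  show "5 \<le> (7::nat)" by simp
  show "c i = 0" if "i \<in> {1..8}" "wt i < 7" for i
  proof -
    have "i = 1 \<or> i = 2" using that by (auto simp: wt_def split: if_splits)
    then show ?thesis using assms by auto
  qed
  have sum: "(\<Sum>i=1..8. if wt i = 7 then c i * Tm i \<mu> x v else 0) = c 3 * Tm 3 \<mu> x v + c 4 * Tm 4 \<mu> x v" for x v
    unfolding sum18 by (simp add: wt_def)
  show "exact (\<lambda>x v. (\<Sum>i=1..8. if wt i = 7 then c i * Tm i \<mu> x v else 0) - (s * c 3 + t * c 4) * B j x v)"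
    unfolding sum by (rule exact_combo2[OF assms(3,4), of _ "c 3" "c 4"]) (simp add: algebra_simps)
  show "s * c 3 + t * c 4 \<noteq> 0" by (rule assms(8))
qed blast

definition cl :: "real list \<Rightarrow> nat \<Rightarrow> real" where "cl L i = L ! (i - 1)"

lemma cl_simps [simp]: "cl [a,b,c,d,p,q,r,s] 1 = a" "cl [a,b,c,d,p,q,r,s] 2 = b" "cl [a,b,c,d,p,q,r,s] 3 = c"
  "cl [a,b,c,d,p,q,r,s] 4 = d" "cl [a,b,c,d,p,q,r,s] 5 = p" "cl [a,b,c,d,p,q,r,s] 6 = q" "cl [a,b,c,d,p,q,r,s] 7 = r"
  "cl [a,b,c,d,p,q,r,s] 8 = s"
  by (simp_all add: cl_def)

lemma Reach_cl: "Reach \<alpha> c \<Longrightarrow> Reach \<alpha> (cl [c 1, c 2, c 3, c 4, c 5, c 6, c 7, c 8])"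
  unfolding Reach_def
proof (elim exE conjE, intro exI conjI)
  fix G assume "crd (pb \<alpha> G) c"
  then show "crd (pb \<alpha> G) (cl [c 1, c 2, c 3, c 4, c 5, c 6, c 7, c 8])"
  proof (rule crd_cong)
    fix i :: nat assume "i \<in> {1..8}"
    then have "i \<in> {1,2,3,4,5,6,7,8}" by auto
    then show "c i = cl [c 1, c 2, c 3, c 4, c 5, c 6, c 7, c 8] i" by auto
  qed simp
qed

text \<open>Coordinates, in the basis \<open>B\<close>, of the forms induced by the listed germs, as
  verified in \<open>param_normal_form\<close>. The factors 1/2 and the sign in \<open>F6\<close>
  are inherited from the defining equations.\<close>

fun nfc :: "normal_form \<Rightarrow> real \<Rightarrow> real \<Rightarrow> real \<Rightarrow> real list" where
  "nfc F0 s a b = [1, a, b, 0, 0, 0, 0, 0]"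
| "nfc F1 s a b = [0, s, a, b, 0, 0, 0, 0]"
| "nfc F2 s a b = [0, 0, 1, a, b / 2, 0, 0, 0]"
| "nfc F30_5 s a b = [0, 0, 1, - 1 / 3, a / 2, b, 0, 0]"
| "nfc F30_inf s a b = [0, 0, 1, 2, a / 2, 0, b / 2, 0]"
| "nfc F31 s a b = [0, 0, 0, 1, a / 2, 0, 0, 0]"
| "nfc F4 s a b = [0, 0, 0, 0, s / 2, a, 0, 0]"
| "nfc F5 s a b = [0, 0, 0, 0, 0, 1, a / 2, 0]"
| "nfc F6 s a b = [0, 0, 0, 0, 0, 0, s / 2, - a]"
| "nfc F7 s a b = [0, 0, 0, 0, 0, 0, 0, 1]"
| "nfc F8 s a b = [0, 0, 0, 0, 0, 0, 0, 0]"

lemma odd_scaling: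
  assumes "x \<noteq> (0::real)" "odd k"
  obtains a where "a \<noteq> 0" "a ^ k * x = 1"
proof -
  have "root k (1 / x) ^ k = 1 / x" using assms(2) by (rule odd_real_root_pow)
  moreover from this have "root k (1 / x) \<noteq> 0" using assms odd_pos by (metis divide_eq_0_iff power_eq_0_iff one_neq_zero)
  ultimately show ?thesis using assms(1) by (intro that[of "root k (1 / x)"]) auto
qed

text \<open>An even power cannot change a sign. Hence a sign remains exactly when the leading weight
  is 6, 8 or 10, that is for \<open>F1\<close>, \<open>F4\<close> and \<open>F6\<close>.\<close>

lemma even_scaling:
  assumes "x \<noteq> (0::real)" "k > 0"
  obtains a s where "a \<noteq> 0" "s \<in> {1, -1}" "a ^ k * x = s"
proof -
  have r: "root k (1 / \<bar>x\<bar>) ^ k = 1 / \<bar>x\<bar>" using assms by (intro real_root_pow_pos2) auto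
  then have "root k (1 / \<bar>x\<bar>) \<noteq> 0" using assms by (auto simp: power_0_left)
  moreover have "root k (1 / \<bar>x\<bar>) ^ k * x = sgn x" unfolding r using assms(1) by (simp add: sgn_if abs_if)
  ultimately show ?thesis using assms(1) by (intro that[of "root k (1 / \<bar>x\<bar>)" "sgn x"]) (auto simp: sgn_if)
qed

text \<open>The first nonzero coordinate selects the family. It is scaled to \<open>1\<close>, to a
  sign or to half a sign, and every later coordinate for which a suitable non-resonant monomial
  exists is removed; those that are left become the parameters.\<close>

theorem Reach_normal:
  assumes "Reach \<alpha> c"
  shows "\<exists>F s a b. s \<in> {1, -1} \<and> (F = F2 \<longrightarrow> (a, b) \<in> U8_2_params) \<and> Reach \<alpha> (cl (nfc F s a b))"
proof -
  have fin: ?thesis if "Reach \<alpha> d" "[d 1, d 2, d 3, d 4, d 5, d 6, d 7, d 8] = nfc F s a b" "s \<in> {1, -1}"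
    "F = F2 \<longrightarrow> (a, b) \<in> U8_2_params" for d F s a b
    using Reach_cl[OF that(1)] that by metis
  have z: "\<forall>i\<in>{1..8}. i < 1 \<longrightarrow> d i = (0::real)" for d :: "nat \<Rightarrow> real" by simp
  note m = J_m(1)[of 2, simplified] J_m(1)[of 3, simplified] J_m(2)[of 1, simplified]
  show ?thesis
  proof (cases "c 1 = 0")
    case False
    obtain a where a: "a \<noteq> 0" "a ^ 5 * c 1 = 1" using odd_scaling[OF False, of 5] by auto
    define d where "d = (\<lambda>i. a ^ wt i * c i)"
    have d: "Reach \<alpha> d" "d 1 = 1" using Reach_scale[OF assms a(1)] a(2) by (simp_all add: d_def wt_def)
    \<comment> \<open>No function has weight 1, and \<open>X3\<close> moves only the coordinate of
      \<open>B 4\<close>, so the coordinates of \<open>B 2\<close> and \<open>B 3\<close> stay as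
      parameters.\<close>
    obtain d4 where d4: "Reach \<alpha> d4" "d4 4 = 0" "\<forall>i. i \<noteq> 4 \<longrightarrow> wt i \<le> wt 4 \<longrightarrow> d4 i = d i"
      using kill1[OF d(1) J_X(3) Tm_X3(1)] d(2) by (auto simp: wt_def)
    obtain d5 where d5: "Reach \<alpha> d5" "d5 5 = 0" "\<forall>i. i \<noteq> 5 \<longrightarrow> wt i \<le> wt 5 \<longrightarrow> d5 i = d4 i"
      using kill1[OF d4(1) J_X(1) Tm_X1(1)] d(2) d4(3) by (auto simp: wt_def)
    obtain d6 where d6: "Reach \<alpha> d6" "d6 6 = 0" "\<forall>i. i \<noteq> 6 \<longrightarrow> wt i \<le> wt 6 \<longrightarrow> d6 i = d5 i"
      using kill1[OF d5(1) m(1) Tm_X32(1)] d(2) d4(3) d5(3) by (auto simp: wt_def)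
    obtain d7 where d7: "Reach \<alpha> d7" "d7 7 = 0" "\<forall>i. i \<noteq> 7 \<longrightarrow> wt i \<le> wt 7 \<longrightarrow> d7 i = d6 i"
      using kill1[OF d6(1) m(3) Tm_X13(1)] d(2) d4(3) d5(3) d6(3) by (auto simp: wt_def)
    obtain d8 where d8: "Reach \<alpha> d8" "d8 8 = 0" "\<forall>i. i \<noteq> 8 \<longrightarrow> wt i \<le> wt 8 \<longrightarrow> d8 i = d7 i"
      using kill1[OF d7(1) m(2) Tm_X33] d(2) d4(3) d5(3) d6(3) d7(3) by (auto simp: wt_def)
    show ?thesis
      by (rule fin[OF d8(1), of F0 1 "d 2" "d 3"])
         (use d d4(2,3) d5(2,3) d6(2,3) d7(2,3) d8(2,3) in \<open>simp_all add: wt_def\<close>)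
  next
    case c1: True
    show ?thesis
    proof (cases "c 2 = 0")
      case False
      obtain a s where a: "a \<noteq> 0" "s \<in> {1, -1}" "a ^ 6 * c 2 = s" using even_scaling[OF False, of 6] by auto
      define d where "d = (\<lambda>i. a ^ wt i * c i)"
      have d: "Reach \<alpha> d" "d 1 = 0" "d 2 = s" using Reach_scale[OF assms a(1)] a(3) c1 by (simp_all add: d_def wt_def)
      have s0: "s \<noteq> 0" using a(2) by auto
      have lt2: "i < 2 \<Longrightarrow> i \<in> {1..8} \<Longrightarrow> i = 1" for i :: nat by auto
      obtain d5 where d5: "Reach \<alpha> d5" "d5 5 = 0" "\<forall>i. i \<noteq> 5 \<longrightarrow> wt i \<le> wt 5 \<longrightarrow> d5 i = d i"
        using kill1[OF d(1) J_X(3) Tm_X3(2)] d(2,3) s0 by (auto simp: wt_def dest!: lt2)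
      obtain d6 where d6: "Reach \<alpha> d6" "d6 6 = 0" "\<forall>i. i \<noteq> 6 \<longrightarrow> wt i \<le> wt 6 \<longrightarrow> d6 i = d5 i"
        using kill1[OF d5(1) J_X(1) Tm_X1(2)] d(2,3) s0 d5(3) by (auto simp: wt_def dest!: lt2)
      obtain d7 where d7: "Reach \<alpha> d7" "d7 7 = 0" "\<forall>i. i \<noteq> 7 \<longrightarrow> wt i \<le> wt 7 \<longrightarrow> d7 i = d6 i"
        using kill1[OF d6(1) m(1) Tm_X32(2)] d(2,3) s0 d5(3) d6(3) by (auto simp: wt_def dest!: lt2)
      obtain d8 where d8: "Reach \<alpha> d8" "d8 8 = 0" "\<forall>i. i \<noteq> 8 \<longrightarrow> wt i \<le> wt 8 \<longrightarrow> d8 i = d7 i"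
        using kill1[OF d7(1) m(3) Tm_X13(2)] d(2,3) s0 d5(3) d6(3) d7(3) by (auto simp: wt_def dest!: lt2)
      show ?thesis
        by (rule fin[OF d8(1), of F1 s "d 3" "d 4"])
           (use d d5(2,3) d6(2,3) d7(2,3) d8(2,3) a(2) in \<open>simp_all add: wt_def\<close>)
    next
      case c2: True
      show ?thesis
      proof (cases "c 3 = 0")
        case False
        obtain a where a: "a \<noteq> 0" "a ^ 7 * c 3 = 1" using odd_scaling[OF False, of 7] by auto
        define d where "d = (\<lambda>i. a ^ wt i * c i)"
        have d: "Reach \<alpha> d" "d 1 = 0" "d 2 = 0" "d 3 = 1"
          using Reach_scale[OF assms a(1)] a(2) c1 c2 by (simp_all add: d_def wt_def)
        consider "d 4 = -1/3" | "d 4 = 2" | "d 4 \<noteq> -1/3" "d 4 \<noteq> 2" by blast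
        then show ?thesis
        proof cases
          case 1
          \<comment> \<open>Since \<open>3 * 1 + 9 * (-1/3) = 0\<close>, the coordinate of weight 9
            cannot be removed by \<open>X3\<close> and becomes a parameter; weight 11 is cleared
            with \<open>X2\<close>.\<close>
          obtain d7 where d7: "Reach \<alpha> d7" "d7 7 = 0" "\<forall>i. i \<noteq> 7 \<longrightarrow> wt i \<le> wt 7 \<longrightarrow> d7 i = d i"
            using kill7[OF d(1) J_X(1) Tm_X1(3,4)] d(2-4) 1 by (auto simp: wt_def)
          obtain d8 where d8: "Reach \<alpha> d8" "d8 8 = 0" "\<forall>i. i \<noteq> 8 \<longrightarrow> wt i \<le> wt 8 \<longrightarrow> d8 i = d7 i"
            using kill7[OF d7(1) J_X(2) Tm_X2] d(2-4) 1 d7(3) by (auto simp: wt_def)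
          show ?thesis
            by (rule fin[OF d8(1), of F30_5 1 "2 * d 5" "d 6"])
               (use d 1 d7(2,3) d8(2,3) in \<open>simp_all add: wt_def\<close>)
        next
          case 2
          \<comment> \<open>Here \<open>5 * 2 - 10 * 1 = 0\<close>, so \<open>X1\<close> is of no
            help in weight 10, whose coordinate becomes a parameter.\<close>
          obtain d6 where d6: "Reach \<alpha> d6" "d6 6 = 0" "\<forall>i. i \<noteq> 6 \<longrightarrow> wt i \<le> wt 6 \<longrightarrow> d6 i = d i"
            using kill7[OF d(1) J_X(3) Tm_X3(3,4)] d(2-4) 2 by (auto simp: wt_def)
          obtain d8 where d8: "Reach \<alpha> d8" "d8 8 = 0" "\<forall>i. i \<noteq> 8 \<longrightarrow> wt i \<le> wt 8 \<longrightarrow> d8 i = d6 i"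
            using kill7[OF d6(1) m(1) Tm_X32(3,4)] d(2-4) 2 d6(3) by (auto simp: wt_def)
          show ?thesis
            by (rule fin[OF d8(1), of F30_inf 1 "2 * d 5" "2 * d6 7"])
               (use d 2 d6(2,3) d8(2,3) in \<open>simp_all add: wt_def\<close>)
        next
          case 3
          obtain d6 where d6: "Reach \<alpha> d6" "d6 6 = 0" "\<forall>i. i \<noteq> 6 \<longrightarrow> wt i \<le> wt 6 \<longrightarrow> d6 i = d i"
            using kill7[OF d(1) J_X(3) Tm_X3(3,4)] d(2-4) 3 by (auto simp: wt_def)
          obtain d7 where d7: "Reach \<alpha> d7" "d7 7 = 0" "\<forall>i. i \<noteq> 7 \<longrightarrow> wt i \<le> wt 7 \<longrightarrow> d7 i = d6 i"
            using kill7[OF d6(1) J_X(1) Tm_X1(3,4)] d(2-4) 3 d6(3) by (auto simp: wt_def)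
          obtain d8 where d8: "Reach \<alpha> d8" "d8 8 = 0" "\<forall>i. i \<noteq> 8 \<longrightarrow> wt i \<le> wt 8 \<longrightarrow> d8 i = d7 i"
            using kill7[OF d7(1) m(1) Tm_X32(3,4)] d(2-4) 3 d6(3) d7(3) by (auto simp: wt_def)
          show ?thesis
            by (rule fin[OF d8(1), of F2 1 "d 4" "2 * d 5"])
               (use d 3 d6(2,3) d7(2,3) d8(2,3) in \<open>simp_all add: wt_def U8_2_params_def\<close>)
        qed
      next
        case c3: True
        show ?thesis
        proof (cases "c 4 = 0")
          case False
          obtain a where a: "a \<noteq> 0" "a ^ 7 * c 4 = 1" using odd_scaling[OF False, of 7] by auto
          define d where "d = (\<lambda>i. a ^ wt i * c i)"
          have d: "Reach \<alpha> d" "d 1 = 0" "d 2 = 0" "d 3 = 0" "d 4 = 1"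
            using Reach_scale[OF assms a(1)] a(2) c1 c2 c3 by (simp_all add: d_def wt_def)
          obtain d6 where d6: "Reach \<alpha> d6" "d6 6 = 0" "\<forall>i. i \<noteq> 6 \<longrightarrow> wt i \<le> wt 6 \<longrightarrow> d6 i = d i"
            using kill7[OF d(1) J_X(3) Tm_X3(3,4)] d(2-5) by (auto simp: wt_def)
          obtain d7 where d7: "Reach \<alpha> d7" "d7 7 = 0" "\<forall>i. i \<noteq> 7 \<longrightarrow> wt i \<le> wt 7 \<longrightarrow> d7 i = d6 i"
            using kill7[OF d6(1) J_X(1) Tm_X1(3,4)] d(2-5) d6(3) by (auto simp: wt_def)
          obtain d8 where d8: "Reach \<alpha> d8" "d8 8 = 0" "\<forall>i. i \<noteq> 8 \<longrightarrow> wt i \<le> wt 8 \<longrightarrow> d8 i = d7 i"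
            using kill7[OF d7(1) m(1) Tm_X32(3,4)] d(2-5) d6(3) d7(3) by (auto simp: wt_def)
          show ?thesis
            by (rule fin[OF d8(1), of F31 1 "2 * d 5" 0])
               (use d d6(2,3) d7(2,3) d8(2,3) in \<open>simp_all add: wt_def\<close>)
        next
          case c4: True
          have lt: "i \<in> {1..8} \<Longrightarrow> i < 5 \<Longrightarrow> i \<in> {1,2,3,4}" "i \<in> {1..8} \<Longrightarrow> i < 6 \<Longrightarrow> i \<in> {1,2,3,4,5}" for i :: nat
            by auto
          consider (5) "c 5 \<noteq> 0" | (6) "c 5 = 0" "c 6 \<noteq> 0" | (7) "c 5 = 0" "c 6 = 0" "c 7 \<noteq> 0" |
            (8) "c 5 = 0" "c 6 = 0" "c 7 = 0" "c 8 \<noteq> 0" | (9) "c 5 = 0" "c 6 = 0" "c 7 = 0" "c 8 = 0" by blast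
          then show ?thesis
          proof cases
            case 5
            obtain a s where a: "a \<noteq> 0" "s \<in> {1, -1}" "a ^ 8 * (2 * c 5) = s" using even_scaling[of "2 * c 5" 8] 5 by auto
            define d where "d = (\<lambda>i. a ^ wt i * c i)"
            have d: "Reach \<alpha> d" "d 1 = 0" "d 2 = 0" "d 3 = 0" "d 4 = 0" "d 5 = s / 2"
              using Reach_scale[OF assms a(1)] a(3) c1 c2 c3 c4 by (simp_all add: d_def wt_def)
            have s0: "s \<noteq> 0" using a(2) by auto
            obtain d7 where d7: "Reach \<alpha> d7" "d7 7 = 0" "\<forall>i. i \<noteq> 7 \<longrightarrow> wt i \<le> wt 7 \<longrightarrow> d7 i = d i"
              using kill1[OF d(1) J_X(3) Tm_X3(5)] d(2-6) s0 lt by (fastforce simp: wt_def)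
            obtain d8 where d8: "Reach \<alpha> d8" "d8 8 = 0" "\<forall>i. i \<noteq> 8 \<longrightarrow> wt i \<le> wt 8 \<longrightarrow> d8 i = d7 i"
              using kill1[OF d7(1) J_X(1) Tm_X1(5)] d(2-6) s0 d7(3) lt by (fastforce simp: wt_def)
            show ?thesis
              by (rule fin[OF d8(1), of F4 s "d 6" 0])
                 (use d d7(2,3) d8(2,3) a(2) in \<open>simp_all add: wt_def\<close>)
          next
            case 6
            obtain a where a: "a \<noteq> 0" "a ^ 9 * c 6 = 1" using odd_scaling[OF 6(2), of 9] by auto
            define d where "d = (\<lambda>i. a ^ wt i * c i)"
            have d: "Reach \<alpha> d" "d 1 = 0" "d 2 = 0" "d 3 = 0" "d 4 = 0" "d 5 = 0" "d 6 = 1"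
              using Reach_scale[OF assms a(1)] a(2) c1 c2 c3 c4 6 by (simp_all add: d_def wt_def)
            obtain d8 where d8: "Reach \<alpha> d8" "d8 8 = 0" "\<forall>i. i \<noteq> 8 \<longrightarrow> wt i \<le> wt 8 \<longrightarrow> d8 i = d i"
              using kill1[OF d(1) J_X(3) Tm_X3(6)] d(2-7) lt by (fastforce simp: wt_def)
            show ?thesis
              by (rule fin[OF d8(1), of F5 1 "2 * d 7" 0])
                 (use d d8(2,3) in \<open>simp_all add: wt_def\<close>)
          next
            case 7
            obtain a s where a: "a \<noteq> 0" "s \<in> {1, -1}" "a ^ 10 * (2 * c 7) = s" using even_scaling[of "2 * c 7" 10] 7 by auto
            \<comment> \<open>Passing from weight 10 to weight 11 would need a function of weight 1,
              so the last coordinate stays.\<close>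
            show ?thesis
              by (rule fin[OF Reach_scale[OF assms a(1)], of F6 s "- (a ^ 11 * c 8)" 0])
                 (use a c1 c2 c3 c4 7 in \<open>simp_all add: wt_def\<close>)
          next
            case 8
            obtain a where a: "a \<noteq> 0" "a ^ 11 * c 8 = 1" using odd_scaling[OF 8(4), of 11] by auto
            show ?thesis
              by (rule fin[OF Reach_scale[OF assms a(1)], of F7 1 0 0])
                 (use a c1 c2 c3 c4 8 in \<open>simp_all add: wt_def\<close>)
          next
            case 9
            show ?thesis
              by (rule fin[OF assms, of F8 1 0 0]) (use c1 c2 c3 c4 9 in simp_all)
          qed
        qed
      qed
    qed
  qed
qed

subsection \<open>Symplectic linear algebra\<close>

abbreviation om :: "real ^ 'm \<Rightarrow> real ^ 'm \<Rightarrow> real" where "om \<equiv> symp_form e n"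

lemma om_def: "om v w = (\<Sum>i=1..n. v $ e (2 * i - 1) * w $ e (2 * i) - v $ e (2 * i) * w $ e (2 * i - 1))"
  by (simp add: symp_form_def pc_def qc_def xc_def)

lemma bilinear_om: "bilinear om"
proof -
  have "linear (om v)" for v
    unfolding om_def[abs_def]
    by (rule linearI) (simp_all add: algebra_simps sum.distrib sum_distrib_left sum_subtractf)
  moreover have "linear (\<lambda>v. om v w)" for w
    unfolding om_def[abs_def]
    by (rule linearI) (simp_all add: algebra_simps sum.distrib sum_distrib_left sum_subtractf)
  ultimately show ?thesis by (simp add: bilinear_def)
qed

lemmas bb_om = bilinear_om[unfolded bilinear_conv_bounded_bilinear]
lemmas om_simps = bounded_bilinear.add_left[OF bb_om] bounded_bilinear.add_right[OF bb_om]
  bounded_bilinear.diff_left[OF bb_om] bounded_bilinear.diff_right[OF bb_om]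
  bounded_bilinear.scaleR_left[OF bb_om] bounded_bilinear.scaleR_right[OF bb_om]
  bounded_bilinear.zero_left[OF bb_om] bounded_bilinear.zero_right[OF bb_om]
  bounded_bilinear.minus_left[OF bb_om] bounded_bilinear.minus_right[OF bb_om]

lemma om_skew: "om v w = - om w v"
  unfolding om_def sum_negf[symmetric] by (rule sum.cong) auto

lemma om_self [simp]: "om v v = 0" using om_skew[of v v] by simp

lemma om_axis_odd:
  assumes "i \<in> {1..n}"
  shows "om (axis (e (2 * i - 1)) 1) v = v $ e (2 * i)"
proof -
  have "om (axis (e (2 * i - 1)) 1) v = (\<Sum>k=1..n. if k = i then v $ e (2 * i) else 0)"
    unfolding om_def
  proof (rule sum.cong[OF refl])
    fix k assume k: "k \<in> {1..n}"
    have r: "2 * i - 1 \<in> {1..2*n}" "2 * k - 1 \<in> {1..2*n}" "2 * k \<in> {1..2*n}" using assms k by auto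
    have "2 * k \<noteq> 2 * i - 1" using assms by auto presburger
    moreover have "2 * k - 1 = 2 * i - 1 \<longleftrightarrow> k = i" using assms k by auto
    ultimately show "axis (e (2 * i - 1)) 1 $ e (2 * k - 1) * v $ e (2 * k) - axis (e (2 * i - 1)) 1 $ e (2 * k) * v $ e (2 * k - 1) =
       (if k = i then v $ e (2 * i) else 0)"
      by (simp add: axis_def e_eq_iff[OF r(2,1)] e_eq_iff[OF r(3,1)])
  qed
  then show ?thesis using assms by simp
qed

lemma om_axis_even:
  assumes "i \<in> {1..n}"
  shows "om (axis (e (2 * i)) 1) v = - v $ e (2 * i - 1)"
proof -
  have "om (axis (e (2 * i)) 1) v = (\<Sum>k=1..n. if k = i then - v $ e (2 * i - 1) else 0)"
    unfolding om_def
  proof (rule sum.cong[OF refl])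
    fix k assume k: "k \<in> {1..n}"
    have r: "2 * i \<in> {1..2*n}" "2 * k - 1 \<in> {1..2*n}" "2 * k \<in> {1..2*n}" using assms k by auto
    have "2 * k - 1 \<noteq> 2 * i" using k by auto presburger
    then show "axis (e (2 * i)) 1 $ e (2 * k - 1) * v $ e (2 * k) - axis (e (2 * i)) 1 $ e (2 * k) * v $ e (2 * k - 1) =
       (if k = i then - v $ e (2 * i - 1) else 0)"
      by (simp add: axis_def e_eq_iff[OF r(2,1)] e_eq_iff[OF r(3,1)])
  qed
  then show ?thesis using assms by simp
qed

lemma om_dual: "\<exists>s. \<forall>v. om s v = v $ j"
proof -
  obtain k where k: "k \<in> {1..2*n}" "j = e k" by (rule e_obtain)
  show ?thesis
  proof (cases "even k")
    case True
    then obtain i where i: "k = 2 * i" by blast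
    then have "i \<in> {1..n}" using k(1) by auto
    from om_axis_odd[OF this] show ?thesis using i k by blast
  next
    case False
    then obtain i where i: "k = 2 * i - 1" "i \<in> {1..n}"
      using k(1) by (intro that[of "(k + 1) div 2"]) (auto elim!: oddE)
    then have "\<forall>v. om (- axis (e (2 * i)) 1) v = v $ j" using om_axis_even[OF i(2)] k by (simp add: om_simps)
    then show ?thesis by blast
  qed
qed

definition dual :: "'m \<Rightarrow> real ^ 'm" where "dual j = (SOME s. \<forall>v. om s v = v $ j)"

lemma dual: "om (dual j) v = v $ j"
  using someI_ex[OF om_dual, of j] unfolding dual_def by blast

lemma om_nondegenerate: "(\<And>u. om v u = 0) \<Longrightarrow> v = 0"
  using om_skew[of "dual _" v] by (simp add: vec_eq_iff dual)

definition lsymp :: "(real ^ 'm \<Rightarrow> real ^ 'm) \<Rightarrow> bool" where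
  "lsymp L \<longleftrightarrow> linear L \<and> (\<forall>v w. om (L v) (L w) = om v w)"

lemma lsymp_inj: "lsymp L \<Longrightarrow> inj L"
  using om_nondegenerate by (auto simp: lsymp_def linear_injective_0) (metis om_simps(7))

lemma lsymp_compose: "lsymp L \<Longrightarrow> lsymp M \<Longrightarrow> lsymp (\<lambda>x. M (L x))"
  by (auto simp: lsymp_def intro: linear_compose[unfolded o_def])

text \<open>Represents \<open>om u\<close> by the inner product, so that questions on symplectic
  complements become questions on orthogonal ones.\<close>

definition flat :: "real ^ 'm \<Rightarrow> real ^ 'm" where
  "flat u = (\<Sum>j\<in>UNIV. om u (axis j 1) *\<^sub>R axis j 1)"

lemma flat_inner: "flat u \<bullet> y = om u y"
proof -
  have "om u y = om u (\<Sum>j\<in>UNIV. y $ j *\<^sub>R axis j 1)" by (simp only: basis_expansion[of y, unfolded scalar_mult_eq_scaleR])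
  also have "\<dots> = (\<Sum>j\<in>UNIV. y $ j * om u (axis j 1))"
    by (simp add: linear_sum[OF bounded_linear.linear[OF bounded_bilinear.bounded_linear_right[OF bb_om]]] om_simps)
  also have "\<dots> = flat u \<bullet> y" by (simp add: flat_def inner_sum_left inner_axis' mult.commute)
  finally show ?thesis by simp
qed

lemma linear_flat: "linear flat"
  unfolding flat_def[abs_def] by (rule linearI) (simp_all add: om_simps scaleR_add_left sum.distrib scaleR_sum_right)

lemma inj_flat: "inj flat"
proof -
  have "flat u = 0 \<Longrightarrow> u = 0" for u using om_nondegenerate[of u] flat_inner[of u] by simp
  then show ?thesis using linear_flat by (simp add: linear_injective_0)
qed

text \<open>The witness is the component of \<open>flat a\<close> orthogonal to the span of
  \<open>flat\<close> on \<open>V\<close>; it is nonzero as \<open>flat\<close> is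
  injective.\<close>

lemma om_separate:
  assumes "a \<notin> span V"
  shows "\<exists>y. (\<forall>v\<in>V. om v y = 0) \<and> om a y \<noteq> 0"
proof -
  have nK: "flat a \<notin> span (flat ` V)"
    using assms inj_flat by (auto simp: linear_span_image[OF linear_flat] dest: injD)
  obtain y z where yz: "y \<in> span (flat ` V)" "\<And>w. w \<in> span (flat ` V) \<Longrightarrow> orthogonal z w" "flat a = y + z"
    using orthogonal_subspace_decomp_exists[of "flat ` V" "flat a"] by blast
  have "z \<noteq> 0" using yz(1,3) nK by auto
  have "om a z = y \<bullet> z + z \<bullet> z" using flat_inner[of a z] yz(3) by (simp add: inner_add_left)
  moreover have "y \<bullet> z = 0" using yz(2)[OF yz(1)] by (simp add: orthogonal_def inner_commute)
  ultimately have "om a z \<noteq> 0" using \<open>z \<noteq> 0\<close> by simp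
  moreover have "om v z = 0" if "v \<in> V" for v
    using yz(2)[of "flat v"] that flat_inner[of v z] by (simp add: orthogonal_def inner_commute span_base)
  ultimately show ?thesis by blast
qed

text \<open>The symplectic transvection along \<open>b - a\<close>, with coefficient
  \<open>1 / om a b\<close>; it fixes every vector on which \<open>a\<close> and \<open>b\<close>
  take the same value.\<close>

lemma transvection:
  assumes "om a b \<noteq> 0" "\<And>v. v \<in> V \<Longrightarrow> om v a = om v b"
  shows "\<exists>M. lsymp M \<and> M a = b \<and> (\<forall>v\<in>V. M v = v)"
proof -
  define d where "d = b - a"
  define M where "M x = x + (om x d / om a b) *\<^sub>R d" for x
  have "lsymp M"
    unfolding lsymp_def
  proof (intro conjI allI)
    show "linear M" unfolding M_def
      by (rule linearI) (simp_all add: om_simps add_divide_distrib algebra_simps)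
    fix v w
    show "om (M v) (M w) = om v w"
      using om_skew[of d w] by (simp add: M_def om_simps algebra_simps)
  qed
  moreover have "M a = b" using assms(1) by (simp add: M_def d_def om_simps)
  moreover have "M v = v" if "v \<in> V" for v using assms(2)[OF that] by (simp add: M_def d_def om_simps)
  ultimately show ?thesis by blast
qed

text \<open>If \<open>om a b = 0\<close>, no transvection maps \<open>a\<close> to \<open>b\<close>
  directly. A detour through \<open>a + y\<close> works when \<open>y\<close> is
  \<open>om\<close>-orthogonal to \<open>V\<close> but to neither \<open>a\<close> nor
  \<open>b\<close>.\<close>

lemma witt_step:
  assumes "a \<notin> span V" "b \<notin> span V" "\<And>v. v \<in> V \<Longrightarrow> om v a = om v b"
  shows "\<exists>M. lsymp M \<and> M a = b \<and> (\<forall>v\<in>V. M v = v)"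
proof (cases "om a b = 0")
  case False
  then show ?thesis by (rule transvection[OF _ assms(3)])
next
  case True
  obtain y1 y2 where y1: "\<forall>v\<in>V. om v y1 = 0" "om a y1 \<noteq> 0" and y2: "\<forall>v\<in>V. om v y2 = 0" "om b y2 \<noteq> 0"
    using om_separate[OF assms(1)] om_separate[OF assms(2)] by blast
  \<comment> \<open>If neither \<open>y1\<close> nor \<open>y2\<close> serves both vectors, their
    sum does.\<close>
  obtain y where y: "\<forall>v\<in>V. om v y = 0" "om a y \<noteq> 0" "om b y \<noteq> 0"
  proof (cases "om b y1 = 0 \<and> om a y2 = 0")
    case True
    show ?thesis by (rule that[of "y1 + y2"]) (use True y1 y2 in \<open>auto simp: om_simps\<close>)
  next
    case False
    then show ?thesis using that[of y1] that[of y2] y1 y2 by blast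
  qed
  have "om a (a + y) \<noteq> 0" using y(2) by (simp add: om_simps)
  then obtain M1 where M1: "lsymp M1" "M1 a = a + y" "\<forall>v\<in>V. M1 v = v"
    using transvection[of a "a + y" V] y(1) by (auto simp: om_simps)
  have "om (a + y) b \<noteq> 0" using y(3) True om_skew[of y b] by (simp add: om_simps)
  then obtain M2 where M2: "lsymp M2" "M2 (a + y) = b" "\<forall>v\<in>V. M2 v = v"
    using transvection[of "a + y" b V] y(1) assms(3) by (auto simp: om_simps)
  have "lsymp (\<lambda>x. M2 (M1 x))" "M2 (M1 a) = b" "\<forall>v\<in>V. M2 (M1 v) = v"
    using lsymp_compose[OF M1(1) M2(1)] M1 M2 by auto
  then show ?thesis by (intro exI[of _ "\<lambda>x. M2 (M1 x)"]) blast
qed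

text \<open>Independence is stated successively, each vector outside the span of its predecessors,
  to match the extension by one vector in \<open>witt_step\<close>.\<close>

lemma witt:
  fixes u u' :: "nat \<Rightarrow> real ^ 'm"
  assumes "\<And>i. i < k \<Longrightarrow> u i \<notin> span (u ` {..<i})" "\<And>i. i < k \<Longrightarrow> u' i \<notin> span (u' ` {..<i})"
    and "\<And>i j. i < k \<Longrightarrow> j < k \<Longrightarrow> om (u i) (u j) = om (u' i) (u' j)"
  shows "\<exists>L. lsymp L \<and> (\<forall>i<k. L (u i) = u' i)"
  using assms
proof (induction k)
  case 0
  have "lsymp (\<lambda>x. x)" by (simp add: lsymp_def linear_ident)
  then show ?case by (intro exI[of _ "\<lambda>x. x"]) simp
next
  case (Suc k)
  then obtain L where L: "lsymp L" "\<forall>i<k. L (u i) = u' i" by (metis less_SucI)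
  have lL: "linear L" using L(1) by (simp add: lsymp_def)
  have im: "u' ` {..<k} = L ` (u ` {..<k})" using L(2) by (auto simp: image_iff)
  have "L (u k) \<notin> span (u' ` {..<k})"
    using Suc.prems(1)[of k] lsymp_inj[OF L(1)] unfolding im linear_span_image[OF lL] by (auto dest: injD)
  moreover have "u' k \<notin> span (u' ` {..<k})" using Suc.prems(2)[of k] by simp
  moreover have "om v (L (u k)) = om v (u' k)" if v: "v \<in> u' ` {..<k}" for v
  proof -
    obtain i where i: "i < k" "v = u' i" using v by auto
    then have "om v (L (u k)) = om (L (u i)) (L (u k))" using L(2) by simp
    also have "\<dots> = om (u i) (u k)" using L(1) by (simp add: lsymp_def)
    also have "\<dots> = om v (u' k)" using Suc.prems(3)[of i k] i by simp
    finally show ?thesis .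
  qed
  ultimately obtain M where M: "lsymp M" "M (L (u k)) = u' k" "\<forall>v\<in>u' ` {..<k}. M v = v"
    using witt_step by blast
  have "\<forall>i<Suc k. M (L (u i)) = u' i" using L(2) M(2,3) by (auto simp: less_Suc_eq)
  then show ?case using lsymp_compose[OF L(1) M(1)] by (intro exI[of _ "\<lambda>x. M (L x)"]) blast
qed

subsection \<open>Symplectic germs\<close>

abbreviation smap :: "(real ^ 'm \<Rightarrow> real ^ 'm) \<Rightarrow> bool" where "smap \<equiv> sympl e n"

lemma smap_ld: "smap f \<Longrightarrow> ld f" by (simp add: sympl_def)

lemma lsymp_smap: assumes "lsymp L" shows "smap L"
proof -
  have l: "linear L" using assms by (simp add: lsymp_def)
  then have bl: "bounded_linear L" by (simp add: linear_conv_bounded_linear)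
  have d: "fder L x = L" for x by (rule ext) (rule fder_linear[OF bl])
  show ?thesis using lsymp_inj[OF assms] sm_linear[OF bl] linear_0[OF l] assms
    by (simp add: sympl_def ld_def d lsymp_def)
qed

lemma smap_compose:
  assumes "smap f" "smap g"
  shows "smap (\<lambda>x. g (f x))"
proof -
  have l: "ld f" "ld g" using assms by (auto simp: sympl_def)
  have s: "sm f" "f 0 = 0" "sm g" using l by (auto simp: ld_def)
  have f: "near x. \<forall>v w. om (fder f x v) (fder f x w) = om v w"
    and g: "near x. \<forall>v w. om (fder g x v) (fder g x w) = om v w"
    using assms by (auto simp: sympl_def)
  have "near x. \<forall>v w. om (fder (\<lambda>x. g (f x)) x v) (fder (\<lambda>x. g (f x)) x w) = om v w"
    using f eventually_compose_germ[OF g s(1,2)] sm_differentiable[OF s(1)]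
      eventually_compose_germ[OF sm_differentiable[OF s(3)] s(1,2)]
    by eventually_elim (simp add: fder_compose)
  then show ?thesis using ld_compose[OF l] by (simp add: sympl_def)
qed

lemma fder_inverse:
  fixes f g :: "real ^ 'm \<Rightarrow> real ^ 'm"
  assumes "sm f" "f 0 = 0" "sm g" "g 0 = 0" "near y. f (g y) = y"
  shows "near y. \<forall>v. fder f (g y) (fder g y v) = v"
proof -
  have "near y. \<forall>\<^sub>F z in nhds y. f (g z) = z"
    using assms(5) by (simp add: eventually_eventually)
  then show ?thesis
    using sm_differentiable[OF assms(3)] eventually_compose_germ[OF sm_differentiable[OF assms(1)] assms(3,4)]
  proof eventually_elim
    case (elim y)
    have "fder (\<lambda>y. f (g y)) y = fder (\<lambda>y. y) y" by (rule fder_cong_nhds[OF elim(1)])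
    moreover have "fder (\<lambda>y. y) y v = v" for v :: "real ^ 'm" by (rule fder_linear[OF bounded_linear_ident])
    ultimately show ?case using fder_compose[OF elim(3,2)] by metis
  qed
qed

lemma smap_inverse:
  assumes "smap f"
  obtains g where "smap g" "near x. g (f x) = x" "near y. f (g y) = y"
proof -
  obtain g where g: "ld g" "near x. g (f x) = x" "near y. f (g y) = y"
    using ld_inverse[OF smap_ld[OF assms]] by blast
  have s: "sm f" "f 0 = 0" "sm g" "g 0 = 0" using g(1) smap_ld[OF assms] by (auto simp: ld_def)
  have f: "near x. \<forall>v w. om (fder f x v) (fder f x w) = om v w" using assms by (simp add: sympl_def)
  have "near y. \<forall>v w. om (fder g y v) (fder g y w) = om v w"
    using eventually_compose_germ[OF f s(3,4)] fder_inverse[OF s g(3)] by eventually_elim metis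
  then show ?thesis using that[of g] g by (simp add: sympl_def)
qed

lemma symp_equiv_sym: assumes "symp_equiv e n N M" shows "symp_equiv e n M N"
proof -
  obtain f where f: "smap f" "near x. x \<in> N \<longleftrightarrow> f x \<in> M" using assms unfolding symp_equiv_iff by blast
  obtain g where g: "smap g" "near x. g (f x) = x" "near y. f (g y) = y" by (rule smap_inverse[OF f(1)])
  have s: "sm g" "g 0 = 0" using smap_ld[OF g(1)] by (auto simp: ld_def)
  have "near y. y \<in> M \<longleftrightarrow> g y \<in> N"
    using eventually_compose_germ[OF f(2) s] g(3) by eventually_elim simp
  then show ?thesis using g(1) unfolding symp_equiv_iff by blast
qed

lemma symp_equiv_trans: assumes "symp_equiv e n N M" "symp_equiv e n M K" shows "symp_equiv e n N K"
proof -
  obtain f where f: "smap f" "near x. x \<in> N \<longleftrightarrow> f x \<in> M" using assms unfolding symp_equiv_iff by blast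
  obtain g where g: "smap g" "near x. x \<in> M \<longleftrightarrow> g x \<in> K" using assms unfolding symp_equiv_iff by blast
  have s: "sm f" "f 0 = 0" using smap_ld[OF f(1)] by (auto simp: ld_def)
  have "near x. x \<in> N \<longleftrightarrow> g (f x) \<in> K"
    using f(2) eventually_compose_germ[OF g(2) s] by eventually_elim simp
  then show ?thesis using smap_compose[OF f(1) g(1)] unfolding symp_equiv_iff by blast
qed

text \<open>The map \<Phi> is only related to the parametrisations at points of the curve; that it
  carries \<open>N\<close> onto \<open>M\<close> near \<open>0\<close> is derived with local
  inverses of both.\<close>

lemma symp_equivI_param:
  assumes f: "ld f0" "ld f1" and N: "near x. x \<in> C \<longleftrightarrow> f0 x \<in> N" and M: "near x. x \<in> C \<longleftrightarrow> f1 x \<in> M"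
    and \<Phi>: "smap \<Phi>" "near x. x \<in> C \<longrightarrow> \<Phi> (f0 x) = f1 x"
  shows "symp_equiv e n N M"
proof -
  obtain g0 where g0: "ld g0" "near x. g0 (f0 x) = x" "near y. f0 (g0 y) = y" by (rule ld_inverse[OF f(1)])
  obtain g1 where g1: "ld g1" "near x. g1 (f1 x) = x" "near y. f1 (g1 y) = y" by (rule ld_inverse[OF f(2)])
  obtain \<Psi> where \<Psi>: "smap \<Psi>" "near x. \<Psi> (\<Phi> x) = x" by (rule smap_inverse[OF \<Phi>(1)])
  have s: "sm g0" "g0 0 = 0" "sm g1" "g1 0 = 0" "sm \<Phi>" "\<Phi> 0 = 0" "sm f0" "f0 0 = 0"
    using f g0(1) g1(1) smap_ld[OF \<Phi>(1)] by (auto simp: ld_def)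
  have fwd: "near y. y \<in> N \<longrightarrow> \<Phi> y \<in> M"
    using eventually_compose_germ[OF N s(1,2)] g0(3) eventually_compose_germ[OF \<Phi>(2) s(1,2)]
      eventually_compose_germ[OF M s(1,2)]
    by eventually_elim metis
  have sh: "sm (\<lambda>y. g1 (\<Phi> y))" "g1 (\<Phi> 0) = 0" using sm_compose[OF s(3,5,6)] s by auto
  \<comment> \<open>If \<open>\<Phi> y\<close> lies in \<open>M\<close>, then
    \<open>x = g1 (\<Phi> y)\<close> is a point of the curve with
    \<open>\<Phi> (f0 x) = f1 x = \<Phi> y\<close>, and the inverse of \<Phi> yields
    \<open>y = f0 x\<close>.\<close>
  have bwd: "near y. \<Phi> y \<in> M \<longrightarrow> y \<in> N"
    using eventually_compose_germ[OF N sh] eventually_compose_germ[OF M sh] eventually_compose_germ[OF \<Phi>(2) sh]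
      eventually_compose_germ[OF g1(3) s(5,6)] \<Psi>(2)
      eventually_compose_germ[OF eventually_compose_germ[OF \<Psi>(2) s(7,8)] sh]
    by eventually_elim metis
  have "near y. y \<in> N \<longleftrightarrow> \<Phi> y \<in> M" using fwd bwd by eventually_elim blast
  then show ?thesis using \<Phi>(1) unfolding symp_equiv_iff by blast
qed

subsection \<open>The form induced by a parametrisation\<close>

definition theta :: "(real ^ 'm \<Rightarrow> real ^ 'm) \<Rightarrow> real ^ 'm \<Rightarrow> real ^ 'm \<Rightarrow> real" where
  "theta f x v = om (f x) (fder f x v) / 2"

lemma has_derivative_divide_const:
  "(f has_derivative f') F \<Longrightarrow> ((\<lambda>x. f x / c) has_derivative (\<lambda>v. f' v / (c :: real))) F"
  using has_derivative_mult_left[of f f' F "inverse c"] by (simp add: divide_inverse)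

lemma sm_om: "sm f \<Longrightarrow> sm g \<Longrightarrow> sm (\<lambda>x. om (f x) (g x))"
  by (rule sm_bilinear[OF bb_om])

lemma fder_om:
  assumes "f differentiable (at x)" "g differentiable (at x)"
  shows "fder (\<lambda>x. om (f x) (g x)) x v = om (f x) (fder g x v) + om (fder f x v) (g x)"
  by (rule fder_eqI) (rule bounded_bilinear.FDERIV[OF bb_om has_fder[OF assms(1)] has_fder[OF assms(2)]])

lemma theta_pb:
  assumes "sm f" "sm G" "G 0 = 0"
  shows "near x. \<forall>v. theta (\<lambda>x. f (G x)) x v = pb (theta f) G x v"
  using sm_differentiable[OF assms(2)] eventually_compose_germ[OF sm_differentiable[OF assms(1)] assms(2,3)]
  by eventually_elim (simp add: pb_def theta_def fder_compose)

text \<open>Differentials of transversal coordinates are negligible, and any form in the other three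
  starts in weight 5 by \<open>FF_5\<close>.\<close>

lemma theta_crd:
  assumes "sm f"
  shows "\<exists>c. crd (theta f) c"
proof -
  define R where "R j x = om (f x) (fder f x (axis j 1)) / 2" for j x
  have sR: "sm (R j)" for j unfolding R_def[abs_def] by (intro sm_divide_const sm_om assms sm_fder)
  have "exact (\<lambda>x v. \<Sum>j\<in>e ` {4..2*n}. R j x * v $ j)"
    by (intro exact_sum exact_transversal sR) auto
  then have "exact (\<lambda>x v. theta f x v - (R (e 1) x * X1 v + R (e 2) x * X2 v + R (e 3) x * X3 v))"
  proof (rule exact_cong)
    show "near x. x \<in> C \<longrightarrow> (\<forall>v. theta f x v - (R (e 1) x * X1 v + R (e 2) x * X2 v + R (e 3) x * X3 v) =
        (\<Sum>j\<in>e ` {4..2*n}. R j x * v $ j))"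
      using sm_differentiable[OF assms]
    proof eventually_elim
      case (elim x)
      have l: "linear (\<lambda>v. om (f x) (fder f x v))"
        using linear_compose[OF linear_fder[OF elim] bounded_linear.linear[OF bounded_bilinear.bounded_linear_right[OF bb_om]], unfolded o_def] .
      have "theta f x v = (\<Sum>j\<in>UNIV. R j x * v $ j)" for v
      proof -
        have "om (f x) (fder f x v) = om (f x) (fder f x (\<Sum>j\<in>UNIV. v $ j *\<^sub>R axis j 1))"
          by (simp only: basis_expansion[of v, unfolded scalar_mult_eq_scaleR])
        also have "\<dots> = (\<Sum>j\<in>UNIV. v $ j * om (f x) (fder f x (axis j 1)))"
          using linear_sum[OF l, of "\<lambda>j. v $ j *\<^sub>R axis j 1" UNIV] linear_scale[OF l] by simp
        finally show ?thesis by (simp add: theta_def R_def sum_divide_distrib mult.commute)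
      qed
      then show ?case by (simp add: sum_UNIV_split)
    qed
  qed
  then have "FF 5 (theta f)" by (intro FF_cong[OF FF_5[OF sR[of "e 1"] sR[of "e 2"] sR[of "e 3"]]])
  then show ?thesis by (rule FF_crd) auto
qed

text \<open>Writing \<open>theta\<close> in coordinates as a sum of terms \<open>F dG\<close>
  reduces this to \<open>fd_ceq\<close>. It allows a parametrisation to be altered off the
  curve.\<close>

lemma theta_ceq:
  assumes "sm f" "sm g" "\<And>j. ceq (\<lambda>x. f x $ j) (\<lambda>x. g x $ j)"
  shows "exact (\<lambda>x v. theta f x v - theta g x v)"
proof -
  have s: "sm (\<lambda>x. f x $ j)" "sm (\<lambda>x. g x $ j)" for j using assms by auto
  have E: "exact (\<lambda>x v. f x $ j * fder (\<lambda>x. f x $ k) x v - g x $ j * fder (\<lambda>x. g x $ k) x v)" for j k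
    by (rule fd_ceq[OF s s assms(3,3)])
  have "exact (\<lambda>x v. \<Sum>i=1..n. 1 / 2 * ((f x $ e (2 * i - 1) * fder (\<lambda>x. f x $ e (2 * i)) x v - g x $ e (2 * i - 1) * fder (\<lambda>x. g x $ e (2 * i)) x v) -
     (f x $ e (2 * i) * fder (\<lambda>x. f x $ e (2 * i - 1)) x v - g x $ e (2 * i) * fder (\<lambda>x. g x $ e (2 * i - 1)) x v)))"
    by (intro exact_sum exact_cmult exact_diff E) simp
  then show ?thesis
  proof (rule exact_cong)
    show "near x. x \<in> C \<longrightarrow> (\<forall>v. theta f x v - theta g x v = (\<Sum>i=1..n. 1 / 2 * ((f x $ e (2 * i - 1) * fder (\<lambda>x. f x $ e (2 * i)) x v - g x $ e (2 * i - 1) * fder (\<lambda>x. g x $ e (2 * i)) x v) -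
     (f x $ e (2 * i) * fder (\<lambda>x. f x $ e (2 * i - 1)) x v - g x $ e (2 * i) * fder (\<lambda>x. g x $ e (2 * i - 1)) x v))))"
      using sm_differentiable[OF assms(1)] sm_differentiable[OF assms(2)]
    proof eventually_elim
      case (elim x)
      show ?case
        by (simp add: theta_def om_def fder_nth[OF elim(1)] fder_nth[OF elim(2)] sum_divide_distrib flip: sum_subtractf)
           (auto intro!: sum.cong simp: field_simps)
    qed
  qed
qed

lemma sm_fder_differentiable:
  "sm f \<Longrightarrow> near x. \<forall>v. (\<lambda>x. fder f x v) differentiable (at x)"
  unfolding sm_def eventually_nhds using smooth_on_differentiable smooth_on_fder by metis

lemma sm_schwarz_vec:
  fixes f :: "real ^ 'm \<Rightarrow> real ^ 'm"
  assumes "sm f"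
  shows "near p. \<forall>v w. fder (\<lambda>x. fder f x v) p w = fder (\<lambda>x. fder f x w) p v"
proof -
  have "near p. \<forall>j. \<forall>v w. fder (\<lambda>x. fder (\<lambda>x. f x $ j) x v) p w = fder (\<lambda>x. fder (\<lambda>x. f x $ j) x w) p v"
    using sm_schwarz[OF sm_nth[OF assms]] by (simp add: eventually_all_finite)
  moreover have "near p. \<forall>\<^sub>F x in nhds p. f differentiable (at x)"
    using sm_differentiable[OF assms] by (simp add: eventually_eventually)
  ultimately show ?thesis using sm_fder_differentiable[OF assms]
  proof eventually_elim
    case (elim p)
    have "fder (\<lambda>x. fder f x v) p w $ j = fder (\<lambda>x. fder (\<lambda>x. f x $ j) x v) p w" for v w j
    proof -
      have "fder (\<lambda>x. fder (\<lambda>x. f x $ j) x v) p = fder (\<lambda>x. fder f x v $ j) p"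
        by (rule fder_cong_nhds) (use elim(2) in \<open>eventually_elim, simp add: fder_nth\<close>)
      then show ?thesis using elim(3) by (simp add: fder_nth)
    qed
    then show ?case using elim(1) by (simp add: vec_eq_iff)
  qed
qed

text \<open>The form \<open>b\<close> is the pullback under \<Phi> of the standard primitive of the
  symplectic form, minus that primitive. It is closed because \<Phi> is symplectic, so it has a
  potential, and this is pulled back by \<open>f\<close>.\<close>

lemma theta_smap:
  assumes "smap \<Phi>" "sm f" "f 0 = 0"
  shows "exact (\<lambda>x v. theta (\<lambda>x. \<Phi> (f x)) x v - theta f x v)"
proof -
  have s: "sm \<Phi>" "\<Phi> 0 = 0" using smap_ld[OF assms(1)] by (auto simp: ld_def)
  define b where "b y v = (om (\<Phi> y) (fder \<Phi> y v) - om y v) / 2" for y v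
  have sy: "near x. \<forall>v w. om (fder \<Phi> x v) (fder \<Phi> x w) = om v w" using assms(1) by (simp add: sympl_def)
  have 1: "sm (\<lambda>y. b y v)" for v
    unfolding b_def by (intro sm_divide_const sm_diff sm_om s sm_fder sm_const sm_ident)
  have 2: "near y. linear (b y)"
    using sm_differentiable[OF s(1)]
  proof eventually_elim
    case (elim y)
    show ?case
      by (rule linearI) (simp_all add: b_def linear_add[OF linear_fder[OF elim]] linear_scale[OF linear_fder[OF elim]]
        om_simps field_simps)
  qed
  have 3: "near y. \<forall>v w. fder (\<lambda>y. b y v) y w = fder (\<lambda>y. b y w) y v"
    using sm_differentiable[OF s(1)] sm_fder_differentiable[OF s(1)] sm_schwarz_vec[OF s(1)] sy
  proof eventually_elim
    case (elim y)
    have d: "fder (\<lambda>y. b y v) y w = (om (\<Phi> y) (fder (\<lambda>x. fder \<Phi> x v) y w) + om (fder \<Phi> y w) (fder \<Phi> y v) - om w v) / 2" for v w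
    proof (rule fder_eqI)
      have "(\<lambda>x. fder \<Phi> x v) differentiable at y" using elim(2) by blast
      from bounded_bilinear.FDERIV[OF bb_om has_fder[OF elim(1)] has_fder[OF this]]
      have "((\<lambda>y. om (\<Phi> y) (fder \<Phi> y v)) has_derivative (\<lambda>w. om (\<Phi> y) (fder (\<lambda>x. fder \<Phi> x v) y w) + om (fder \<Phi> y w) (fder \<Phi> y v))) (at y)" .
      moreover have "((\<lambda>y. om y v) has_derivative (\<lambda>w. om w v)) (at y)"
        by (rule bounded_linear_imp_has_derivative) (rule bounded_bilinear.bounded_linear_left[OF bb_om])
      ultimately show "((\<lambda>y. b y v) has_derivative (\<lambda>w. (om (\<Phi> y) (fder (\<lambda>x. fder \<Phi> x v) y w) + om (fder \<Phi> y w) (fder \<Phi> y v) - om w v) / 2)) (at y)"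
        unfolding b_def by (intro has_derivative_divide_const has_derivative_diff) 
    qed
    show ?case unfolding d using elim(3,4) by simp
  qed
  obtain S where S: "sm S" "near x. \<forall>v. fder S x v = b x v" using poincare[OF 1 2 3] by blast
  show ?thesis
  proof (rule exactI)
    show "sm (\<lambda>x. S (f x))" by (rule sm_compose[OF S(1) assms(2,3)])
    show "near x. x \<in> C \<longrightarrow> (\<forall>v. theta (\<lambda>x. \<Phi> (f x)) x v - theta f x v = fder (\<lambda>x. S (f x)) x v)"
      using eventually_compose_germ[OF S(2) assms(2,3)] sm_differentiable[OF assms(2)]
        eventually_compose_germ[OF sm_differentiable[OF S(1)] assms(2,3)]
        eventually_compose_germ[OF sm_differentiable[OF s(1)] assms(2,3)]
      by eventually_elim (simp add: theta_def b_def fder_compose diff_divide_distrib)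
  qed
qed

lemma ceq_0_der:
  assumes "sm F" "ceq F (\<lambda>x. 0)" "i \<in> {1, 2, 3}"
  shows "fder F 0 (axis (e i) 1) = 0"
  by (rule J5_der0[OF J_ceq[OF J_zero assms(1,2)] assms(3)])

subsection \<open>Symplectic extension of a parametrisation\<close>

text \<open>The symplectomorphism is the one with midpoint generating function \<open>h\<close>: with \<open>X\<close> the Hamiltonian
  vector field of \<open>h\<close>, it maps \<open>w - X w / 2\<close> to \<open>w + X w / 2\<close>. On the curve \<open>h\<close> is a primitive of
  \<open>theta f1 - theta f0\<close>, up to an exact form, transported by the midpoint map \<open>m\<close>.\<close>

lemma symplectic_extension:
  assumes f: "sm f0" "sm f1" "f0 0 = 0" "f1 0 = 0" "fder f0 0 = fder f1 0" "inj (fder f0 0)"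
    and ex: "exact (\<lambda>x v. theta f1 x v - theta f0 x v)"
  obtains \<Phi> where "smap \<Phi>" "near x. x \<in> C \<longrightarrow> \<Phi> (f0 x) = f1 x"
proof -
  define m where "m x = (1 / 2) *\<^sub>R (f0 x + f1 x)" for x
  define d where "d x = f1 x - f0 x" for x
  have s: "sm m" "sm d" unfolding m_def[abs_def] d_def[abs_def] by (intro sm_scaleR sm_add sm_diff sm_const f)+
  have dm: "(m has_derivative (\<lambda>v. (1 / 2) *\<^sub>R (fder f0 x v + fder f1 x v))) (at x)"
    and dd: "(d has_derivative (\<lambda>v. fder f1 x v - fder f0 x v)) (at x)"
    if "f0 differentiable (at x)" "f1 differentiable (at x)" for x
    unfolding m_def[abs_def] d_def[abs_def]
    by (intro has_derivative_scaleR_right has_derivative_add has_derivative_diff has_fder that)+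
  have z: "f0 differentiable (at 0)" "f1 differentiable (at 0)" using sm_differentiable_0 f by auto
  have fm0: "fder m 0 = fder f0 0" using fder_eqI[OF dm[OF z]] f(5) by (auto simp flip: scaleR_2)
  have fd0: "fder d 0 v = 0" for v using fder_eqI[OF dd[OF z]] f(5) by simp
  have m0: "m 0 = 0" "d 0 = 0" using f by (simp_all add: m_def d_def)
  have ldm: "ld m" using s m0 fm0 f(6) by (simp add: ld_def)
  \<comment> \<open>At points of the curve this is what the differential of the generating function,
    pulled back by \<open>m\<close>, has to be.\<close>
  define \<eta> where "\<eta> x v = om (d x) (fder m x v)" for x v
  have s\<eta>: "sm (\<lambda>x. \<eta> x v)" for v unfolding \<eta>_def by (intro sm_om s sm_fder)
  \<comment> \<open>Expanding \<open>om (f1 - f0)\<close> against the derivative of the midpoint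
    gives \<open>theta f1 - theta f0\<close> plus half the differential of
    \<open>om f1 f0\<close>.\<close>
  have "exact \<eta>"
  proof (rule exact_cong[OF exact_add[OF ex exact_cmult[OF exact_fder[OF sm_om[OF f(2,1)]], of "1/2"]]])
    show "near x. x \<in> C \<longrightarrow> (\<forall>v. \<eta> x v = theta f1 x v - theta f0 x v + 1 / 2 * fder (\<lambda>x. om (f1 x) (f0 x)) x v)"
      using sm_differentiable[OF f(1)] sm_differentiable[OF f(2)]
    proof eventually_elim
      case (elim x)
      show ?case
        using om_skew[of "f0 x"] by (simp add: \<eta>_def fder_eqI[OF dm[OF elim]] d_def theta_def fder_om[OF elim(2,1)] om_simps field_simps)
    qed
  qed
  then obtain S where S: "sm S" "near x. x \<in> C \<longrightarrow> (\<forall>v. \<eta> x v = fder S x v)" by (auto simp: exact_def)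
  define H where "H w v = fder (\<lambda>y. fder S y v) 0 w" for w v
  have Hsym: "H w v = H v w" for v w
    using eventually_nhds_x_imp_x[OF sm_schwarz[OF S(1)]] by (simp add: H_def)
  have Hlin: "linear (\<lambda>w. H w v)" for v
    unfolding H_def by (intro linear_fder sm_differentiable_0 sm_fder S)
  have "linear (H w)" for w
  proof -
    have "H w = (\<lambda>v. H v w)" by (rule ext) (rule Hsym)
    then show ?thesis using Hlin by simp
  qed
  then have "bilinear H" unfolding bilinear_def using Hlin by blast
  then have bbH: "bounded_bilinear H" by (simp add: bilinear_conv_bounded_bilinear)
  \<comment> \<open>Since \<eta> vanishes to second order at \<open>0\<close>, as \<open>d\<close>
    does, and agrees with the differential of \<open>S\<close> on the curve, the Hessian
    \<open>H\<close> of \<open>S\<close> is zero in the three coordinate directions.\<close>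
  have Hax: "H (axis (e i) 1) v = 0" if "i \<in> {1,2,3}" for i v
  proof -
    have "fder (\<lambda>x. fder S x v - \<eta> x v) 0 (axis (e i) 1) = 0"
      by (rule ceq_0_der[OF _ _ that]) (use S in \<open>auto intro!: sm_diff sm_fder s\<eta> simp: ceq_def elim: eventually_mono\<close>)
    moreover have "fder (\<lambda>x. \<eta> x v) 0 w = 0" for w
      unfolding \<eta>_def using fder_om[OF sm_differentiable_0[OF s(2)] sm_differentiable_0[OF sm_fder[OF s(1)]]]
      by (simp add: m0 fd0 om_simps)
    ultimately show ?thesis
      using fder_diff[OF sm_differentiable_0[OF sm_fder[OF S(1)]] sm_differentiable_0[OF s\<eta>]] by (simp add: H_def)
  qed
  have HC: "H x v = 0" if "x \<in> C" for x v
  proof -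
    have "H (P3 x) v = 0" unfolding P3_def using Hax by (simp add: linear_add[OF Hlin] linear_scale[OF Hlin])
    then show ?thesis using P3_C[OF that] by simp
  qed
  \<comment> \<open>Removing the quadratic part leaves the differential at points of the curve
    unchanged, because \<open>H x\<close> is zero there. It makes the derivative of the Hamiltonian
    field vanish at \<open>0\<close>, so that the maps \<open>Z c\<close> are local
    diffeomorphisms.\<close>
  define S' where "S' x = S x - H x x / 2" for x
  have sS': "sm S'" unfolding S'_def[abs_def] by (intro sm_diff sm_divide_const sm_bilinear[OF bbH] S sm_ident)
  have fS': "near x. \<forall>v. fder S' x v = fder S x v - H x v"
    using sm_differentiable[OF S(1)]
  proof eventually_elim
    case (elim x)
    have "((\<lambda>x. H x x) has_derivative (\<lambda>v. H x v + H v x)) (at x)"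
      using bounded_bilinear.FDERIV[OF bbH has_derivative_ident has_derivative_ident] .
    from has_derivative_diff[OF has_fder[OF elim] has_derivative_divide_const[OF this, of 2]]
    have "(S' has_derivative (\<lambda>v. fder S x v - (H x v + H v x) / 2)) (at x)" unfolding S'_def[abs_def] .
    from fder_eqI[OF this] show ?case using Hsym by simp
  qed
  have S'C: "near x. x \<in> C \<longrightarrow> (\<forall>v. fder S' x v = \<eta> x v)"
    using fS' S(2) by eventually_elim (simp add: HC)
  have S'0: "fder S' 0 v = 0" for v
    using eventually_nhds_x_imp_x[OF S'C] by (simp add: \<eta>_def m0 om_simps)
  have S'2: "fder (\<lambda>y. fder S' y v) 0 w = 0" for v w
  proof -
    have "fder (\<lambda>y. fder S' y v) 0 = fder (\<lambda>y. fder S y v - H y v) 0"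
      by (rule fder_cong_nhds) (use fS' in \<open>auto elim: eventually_mono\<close>)
    moreover have bl: "bounded_linear (\<lambda>y. H y v)" using bounded_bilinear.bounded_linear_left[OF bbH] .
    have "fder (\<lambda>y. fder S y v - H y v) 0 w = H w v - H w v"
      using fder_diff[OF sm_differentiable_0[OF sm_fder[OF S(1)]] sm_differentiable_0[OF sm_linear[OF bl]]]
      by (simp add: fder_linear[OF bl]) (simp add: H_def)
    ultimately show ?thesis by simp
  qed
  obtain g where g: "ld g" "near x. g (m x) = x" "near y. m (g y) = y" by (rule ld_inverse[OF ldm])
  have sg: "sm g" "g 0 = 0" using g(1) by (auto simp: ld_def)
  define h where "h y = S' (g y)" for y
  have sh: "sm h" unfolding h_def[abs_def] by (rule sm_compose[OF sS' sg])
  have fh: "near y. \<forall>v. fder h y v = fder S' (g y) (fder g y v)"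
    using sm_differentiable[OF sg(1)] eventually_compose_germ[OF sm_differentiable[OF sS'] sg]
    unfolding h_def[abs_def] by eventually_elim (simp add: fder_compose)
  define X where "X w = (\<Sum>j\<in>UNIV. fder h w (axis j 1) *\<^sub>R dual j)" for w
  have sX: "sm X" unfolding X_def[abs_def] by (intro sm_sum sm_scaleR sm_fder sh sm_const)
  have omX: "near w. \<forall>v. om (X w) v = fder h w v"
    using sm_differentiable[OF sh]
  proof eventually_elim
    case (elim w)
    show ?case
    proof
      fix v
      have "om (X w) v = (\<Sum>j\<in>UNIV. fder h w (axis j 1) * v $ j)"
        by (simp add: X_def linear_sum[OF bounded_linear.linear[OF bounded_bilinear.bounded_linear_left[OF bb_om]]] om_simps dual)
      then show "om (X w) v = fder h w v" by (simp only: fder_expand[OF elim, of v])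
    qed
  qed
  have X0: "X 0 = 0"
  proof (rule om_nondegenerate)
    show "om (X 0) u = 0" for u
      using eventually_nhds_x_imp_x[OF omX] eventually_nhds_x_imp_x[OF fh] sg(2) S'0 by simp
  qed
  have X'0: "fder X 0 w = 0" for w
  proof (rule om_nondegenerate)
    fix u
    let ?G = "\<lambda>j y. fder S' (g y) (axis j 1)" and ?K = "\<lambda>j y. fder g y u $ j"
    have sGj: "sm (?G j)" for j by (rule sm_compose[OF sm_fder[OF sS'] sg])
    have sKj: "sm (?K j)" for j by (intro sm_nth sm_fder sg)
    have G': "fder (?G j) 0 w = 0" for j
      using fder_compose[of "\<lambda>z. fder S' z (axis j 1)" g 0 w] sm_differentiable_0[OF sm_fder[OF sS']]
        sm_differentiable_0[OF sg(1)] S'2 sg(2) by simp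
    have "om (fder X 0 w) u = fder (\<lambda>y. om (X y) u) 0 w"
      using fder_om[OF sm_differentiable_0[OF sX], of "\<lambda>y. u"] by (simp add: fder_eqI[OF has_derivative_const] om_simps)
    also have "fder (\<lambda>y. om (X y) u) 0 = fder (\<lambda>y. \<Sum>j\<in>UNIV. ?G j y * ?K j y) 0"
    proof (rule fder_cong_nhds)
      show "near y. om (X y) u = (\<Sum>j\<in>UNIV. ?G j y * ?K j y)"
        using omX fh eventually_compose_germ[OF sm_differentiable[OF sS'] sg]
        by eventually_elim (simp add: fder_expand[of S' _ "fder g _ u"])
    qed
    also have "fder (\<lambda>y. \<Sum>j\<in>UNIV. ?G j y * ?K j y) 0 w = (\<Sum>j\<in>UNIV. fder (\<lambda>y. ?G j y * ?K j y) 0 w)"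
      by (intro fder_sum sm_differentiable_0 sm_mult sGj sKj)
    also have "\<dots> = 0"
      by (intro sum.neutral ballI) (simp add: fder_mult[OF sm_differentiable_0[OF sGj] sm_differentiable_0[OF sKj]] G' sg(2) S'0)
    finally show "om (fder X 0 w) u = 0" .
  qed
  have Xm: "near x. x \<in> C \<longrightarrow> X (m x) = d x"
    using eventually_compose_germ[OF omX s(1) m0(1)] eventually_compose_germ[OF fh s(1) m0(1)] g(2) S'C
      eventually_compose_germ[OF fder_inverse[OF s(1) m0(1) sg g(3)] s(1) m0(1)]
  proof eventually_elim
    case (elim x)
    show ?case
    proof
      assume x: "x \<in> C"
      have "om (X (m x) - d x) u = 0" for u
      proof -
        have "om (X (m x)) u = fder S' x (fder g (m x) u)" using elim(1,2,3) by simp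
        also have "\<dots> = om (d x) (fder m x (fder g (m x) u))" using elim(4) x by (simp add: \<eta>_def)
        also have "\<dots> = om (d x) u" using elim(3,5) by simp
        finally show ?thesis by (simp add: om_simps)
      qed
      from om_nondegenerate[OF this] show "X (m x) = d x" by simp
    qed
  qed
  define Z where "Z c w = w + c *\<^sub>R X w" for c :: real and w
  have fZ: "fder (Z c) w v = v + c *\<^sub>R fder X w v" if "X differentiable (at w)" for c w v
    unfolding Z_def[abs_def]
    by (rule fder_eqI) (intro has_derivative_add has_derivative_ident has_derivative_scaleR_right has_fder that)
  have ldZ: "ld (Z c)" for c
  proof -
    have "sm (Z c)" unfolding Z_def[abs_def] by (intro sm_add sm_ident sm_scaleR sm_const sX)
    moreover have "fder (Z c) 0 v = v" for v using fZ[OF sm_differentiable_0[OF sX]] X'0 by simp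
    then have "inj (fder (Z c) 0)" by (simp add: inj_def)
    ultimately show ?thesis by (simp add: ld_def Z_def X0)
  qed
  obtain Y where Y: "ld Y" "near x. Y (Z (-1/2) x) = x" "near y. Z (-1/2) (Y y) = y" by (rule ld_inverse[OF ldZ])
  have sY: "sm Y" "Y 0 = 0" and sZ: "sm (Z c)" "Z c 0 = 0" for c using Y(1) ldZ[of c] by (auto simp: ld_def)
  define \<Phi> where "\<Phi> y = Z (1/2) (Y y)" for y
  \<comment> \<open>The derivative of a Hamiltonian field is infinitesimally symplectic, since
    second derivatives of \<open>h\<close> are symmetric.\<close>
  have Xsym: "near w. X differentiable (at w) \<and> (\<forall>u v. om (fder X w v) u = om (fder X w u) v)"
  proof -
    have "near w. \<forall>\<^sub>F z in nhds w. \<forall>v. om (X z) v = fder h z v" using omX by (simp add: eventually_eventually)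
    then show ?thesis using sm_differentiable[OF sX] sm_schwarz[OF sh]
    proof eventually_elim
      case (elim w)
      have "om (fder X w v) u = fder (\<lambda>z. fder h z u) w v" for u v
      proof -
        have "fder (\<lambda>z. fder h z u) w = fder (\<lambda>z. om (X z) u) w"
          by (rule fder_cong_nhds) (use elim(1) in \<open>auto elim: eventually_mono\<close>)
        then show ?thesis using fder_om[OF elim(2), of "\<lambda>z. u"] by (simp add: fder_eqI[OF has_derivative_const] om_simps)
      qed
      then show ?case using elim(2,3) by simp
    qed
  qed
  have "near y. \<forall>v w. om (fder \<Phi> y v) (fder \<Phi> y w) = om v w"
    using eventually_compose_germ[OF Xsym sY] fder_inverse[OF sZ sY Y(3)] sm_differentiable[OF sY(1)]
      eventually_compose_germ[OF sm_differentiable[OF sZ(1)[of "1/2"]] sY]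
  proof eventually_elim
    case (elim y)
    \<comment> \<open>The derivative of \<Phi> is the Cayley transform of this map: it sends
      \<open>a - \<xi> a / 2\<close> to \<open>a + \<xi> a / 2\<close>, and for infinitesimally
      symplectic \<xi> the mixed terms cancel while the quadratic ones agree.\<close>
    let ?\<xi> = "fder X (Y y)"
    have dX: "X differentiable (at (Y y))" using elim(1) by blast
    have p: "fder \<Phi> y v = fder Y y v + (1/2) *\<^sub>R ?\<xi> (fder Y y v)" for v
      unfolding \<Phi>_def[abs_def] using fder_compose[OF elim(4,3)] fZ[OF dX] by simp
    have q: "v = fder Y y v - (1/2) *\<^sub>R ?\<xi> (fder Y y v)" for v
      using elim(2) fZ[OF dX, of "-1/2"] by simp
    show ?case
    proof (intro allI)
      fix v w
      define a where "a = fder Y y v"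
      define b where "b = fder Y y w"
      have sym: "om (?\<xi> a) b = om (?\<xi> b) a" using elim(1) by blast
      have "om v w = om (a - (1/2) *\<^sub>R ?\<xi> a) (b - (1/2) *\<^sub>R ?\<xi> b)" using q[of v] q[of w] by (simp add: a_def b_def)
      moreover have "om (fder \<Phi> y v) (fder \<Phi> y w) = om (a + (1/2) *\<^sub>R ?\<xi> a) (b + (1/2) *\<^sub>R ?\<xi> b)" by (simp add: p a_def b_def)
      ultimately show "om (fder \<Phi> y v) (fder \<Phi> y w) = om v w"
        using sym om_skew[of a "?\<xi> b"] by (simp add: om_simps algebra_simps)
    qed
  qed
  then have "smap \<Phi>" using ld_compose[OF Y(1) ldZ] by (simp add: sympl_def \<Phi>_def[abs_def])
  moreover have "near x. x \<in> C \<longrightarrow> \<Phi> (f0 x) = f1 x"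
    using Xm eventually_compose_germ[OF Y(2) s(1) m0(1)]
  proof eventually_elim
    case (elim x)
    show ?case
    proof
      assume "x \<in> C"
      then have X: "X (m x) = d x" using elim(1) by blast
      have "m x + (-1/2) *\<^sub>R d x = f0 x" "m x + (1/2) *\<^sub>R d x = f1 x"
        by (simp_all add: m_def d_def vec_eq_iff field_simps)
      then have "Z (-1/2) (m x) = f0 x" "Z (1/2) (m x) = f1 x" by (simp_all only: Z_def X)
      then show "\<Phi> (f0 x) = f1 x" using elim(2) by (simp add: \<Phi>_def)
    qed
  qed
  ultimately show ?thesis by (rule that)
qed

text \<open>Exactness forces the derivatives of \<open>f0\<close> and \<open>f1\<close> at \<open>0\<close> to induce the same form on the span of
  \<open>e 1, e 2, e 3\<close>, so Witt's theorem matches them there; a linear term vanishing on the curve does the rest.\<close>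

theorem symp_equivI_theta:
  assumes f: "ld f0" "ld f1" and N: "near x. x \<in> C \<longleftrightarrow> f0 x \<in> N" and M: "near x. x \<in> C \<longleftrightarrow> f1 x \<in> M"
    and ex: "exact (\<lambda>x v. theta f1 x v - theta f0 x v)"
  shows "symp_equiv e n N M"
proof -
  have s: "sm f0" "f0 0 = 0" "inj (fder f0 0)" "sm f1" "f1 0 = 0" "inj (fder f1 0)" using f by (auto simp: ld_def)
  have l: "linear (fder f0 0)" "linear (fder f1 0)" using s by (auto intro!: linear_fder sm_differentiable_0)
  \<comment> \<open>The derivative of \<open>theta f\<close> at \<open>0\<close> is half the pulled
    back symplectic form, hence skew; the derivative of a differential is symmetric. Their equality
    in the three directions makes the skew difference vanish.\<close>
  have om_eq: "om (fder f0 0 (axis (e i) 1)) (fder f0 0 (axis (e j) 1)) = om (fder f1 0 (axis (e i) 1)) (fder f1 0 (axis (e j) 1))"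
    if ij: "i \<in> {1,2,3}" "j \<in> {1,2,3}" for i j
  proof -
    obtain S where S: "sm S" "near x. x \<in> C \<longrightarrow> (\<forall>v. theta f1 x v - theta f0 x v = fder S x v)"
      using ex by (auto simp: exact_def)
    have st: "sm (\<lambda>x. theta f x v)" if "sm f" for f v unfolding theta_def by (intro sm_divide_const sm_om that sm_fder)
    have dt: "fder (\<lambda>x. theta f x v) 0 w = om (fder f 0 w) (fder f 0 v) / 2" if "sm f" "f 0 = 0" for f v w
    proof -
      have "((\<lambda>x. om (f x) (fder f x v)) has_derivative (\<lambda>w. om (f 0) (fder (\<lambda>x. fder f x v) 0 w) + om (fder f 0 w) (fder f 0 v))) (at 0)"
        using bounded_bilinear.FDERIV[OF bb_om sm_has_fder_0[OF that(1)] sm_has_fder_0[OF sm_fder[OF that(1)]]] .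
      from fder_eqI[OF has_derivative_divide_const[OF this, of 2]] show ?thesis
        unfolding theta_def using that(2) by (simp add: om_simps)
    qed
    have k: "om (fder f1 0 w) (fder f1 0 v) / 2 - om (fder f0 0 w) (fder f0 0 v) / 2 = fder (\<lambda>x. fder S x v) 0 w"
      if "w = axis (e i) 1" "i \<in> {1,2,3}" for v w i
    proof -
      have "fder (\<lambda>x. theta f1 x v - theta f0 x v - fder S x v) 0 (axis (e i) 1) = 0"
        by (rule ceq_0_der[OF _ _ that(2)])
           (use S in \<open>auto intro!: sm_diff sm_fder st s simp: ceq_def elim: eventually_mono\<close>)
      moreover have "fder (\<lambda>x. theta f1 x v - theta f0 x v - fder S x v) 0 w =
          fder (\<lambda>x. theta f1 x v) 0 w - fder (\<lambda>x. theta f0 x v) 0 w - fder (\<lambda>x. fder S x v) 0 w" for w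
        by (subst fder_diff fder_diff[OF sm_differentiable_0 sm_differentiable_0];
            (intro sm_differentiable_0 sm_diff st s sm_fder S)?)+ simp
      ultimately show ?thesis using that(1) dt[OF s(1,2)] dt[OF s(4,5)] by simp
    qed
    have "fder (\<lambda>x. fder S x v) 0 w = fder (\<lambda>x. fder S x w) 0 v" for v w
      using eventually_nhds_x_imp_x[OF sm_schwarz[OF S(1)]] by blast
    then show ?thesis
      using k[OF refl ij(1), of "axis (e j) 1"] k[OF refl ij(2), of "axis (e i) 1"]
        om_skew[of "fder f0 0 (axis (e i) 1)" "fder f0 0 (axis (e j) 1)"] om_skew[of "fder f1 0 (axis (e i) 1)" "fder f1 0 (axis (e j) 1)"]
      by simp
  qed
  have indep: "A (axis (e (k + 1)) 1) \<notin> span ((\<lambda>i. A (axis (e (i + 1)) 1)) ` {..<k})"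
    if A: "linear A" "inj A" and k: "k < 3" for A :: "real ^ 'm \<Rightarrow> real ^ 'm" and k
  proof
    assume *: "A (axis (e (k + 1)) 1) \<in> span ((\<lambda>i. A (axis (e (i + 1)) 1)) ` {..<k})"
    have im: "(\<lambda>i. A (axis (e (i + 1)) 1)) ` {..<k} = A ` (\<lambda>i. axis (e (i + 1)) 1) ` {..<k}" by auto
    have "axis (e (k + 1)) 1 \<in> span ((\<lambda>i. axis (e (i + 1)) 1) ` {..<k} :: (real ^ 'm) set)"
      using * A(2) unfolding im linear_span_image[OF A(1)] by (auto dest: injD)
    then have "axis (e (k + 1)) 1 \<in> {x :: real ^ 'm. x $ e (k + 1) = 0}"
    proof (rule span_induct[where P = "\<lambda>x. x \<in> {x :: real ^ 'm. x $ e (k + 1) = 0}"])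
      show "subspace (Collect (\<lambda>x. x \<in> {x :: real ^ 'm. x $ e (k + 1) = 0}))" by (simp add: subspace_def)
      fix x :: "real ^ 'm" assume "x \<in> (\<lambda>i. axis (e (i + 1)) 1) ` {..<k}"
      then obtain i where i: "i < k" "x = axis (e (i + 1)) 1" by blast
      have "e (k + 1) \<noteq> e (i + 1)" using e_eq_iff[of "k + 1" "i + 1"] i(1) k n2 by auto
      then show "x \<in> {x. x $ e (k + 1) = 0}" using i(2) by (simp add: axis_def)
    qed
    then show False by (simp add: axis_def)
  qed
  have "\<exists>L. lsymp L \<and> (\<forall>i<3. L (fder f0 0 (axis (e (i + 1)) 1)) = fder f1 0 (axis (e (i + 1)) 1))"
  proof (rule witt[where u = "\<lambda>i. fder f0 0 (axis (e (i + 1)) 1)" and u' = "\<lambda>i. fder f1 0 (axis (e (i + 1)) 1)"])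
    show "om (fder f0 0 (axis (e (i + 1)) 1)) (fder f0 0 (axis (e (j + 1)) 1)) =
        om (fder f1 0 (axis (e (i + 1)) 1)) (fder f1 0 (axis (e (j + 1)) 1))" if "i < 3" "j < 3" for i j
      by (rule om_eq) (use that in auto)
  qed (rule indep[OF l(1) s(3)] indep[OF l(2) s(6)]; assumption)+
  then obtain L where L: "lsymp L" "\<And>i. i < 3 \<Longrightarrow> L (fder f0 0 (axis (e (i + 1)) 1)) = fder f1 0 (axis (e (i + 1)) 1)" by blast
  have L3: "L (fder f0 0 (axis (e i) 1)) = fder f1 0 (axis (e i) 1)" if "i \<in> {1,2,3}" for i
    using L(2)[of "i - 1"] that by auto
  have sL: "sm L" "L 0 = 0" "bounded_linear L" "linear L"
    using smap_ld[OF lsymp_smap[OF L(1)]] L(1) by (auto simp: ld_def lsymp_def linear_conv_bounded_linear)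
  define D where "D v = fder f1 0 v - L (fder f0 0 v)" for v
  have lD: "linear D" unfolding D_def by (intro linear_compose_sub l linear_compose[OF l(1) sL(4), unfolded o_def])
  have DP: "D (P3 x) = 0" for x
    unfolding P3_def using L3 by (simp add: linear_add[OF lD] linear_scale[OF lD]) (simp add: D_def)
  define f0' where "f0' x = L (f0 x) + D x" for x
  have blD: "bounded_linear D" using lD by (simp add: linear_conv_bounded_linear)
  have sLf: "sm (\<lambda>x. L (f0 x))" by (rule sm_compose[OF sL(1) s(1,2)])
  have s0': "sm f0'" "f0' 0 = 0"
    unfolding f0'_def[abs_def] using sm_add[OF sLf sm_linear[OF blD]] s(2) sL(2) linear_0[OF lD] by simp_all
  have fL: "fder (\<lambda>x. L (f0 x)) 0 v = L (fder f0 0 v)" for v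
    using fder_linear[OF sL(3)] fder_compose[of L f0 0 v] sm_differentiable_0[OF sL(1)] sm_differentiable_0[OF s(1)] s(2) by simp
  have f': "fder f0' 0 v = fder f1 0 v" for v
    unfolding f0'_def[abs_def]
    using fder_add[OF sm_differentiable_0[OF sLf] sm_differentiable_0[OF sm_linear[OF blD]]] fL fder_linear[OF blD] by (simp add: D_def)
  have onC: "f0' x = L (f0 x)" if "x \<in> C" for x
    using DP[of x] P3_C[OF that] by (simp add: f0'_def)
  have "exact (\<lambda>x v. theta f0' x v - theta (\<lambda>x. L (f0 x)) x v)"
    by (rule theta_ceq[OF s0'(1) sLf]) (simp add: ceq_def onC)
  from exact_diff[OF ex exact_add[OF this theta_smap[OF lsymp_smap[OF L(1)] s(1,2)]]]
  have ex': "exact (\<lambda>x v. theta f1 x v - theta f0' x v)" by simp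
  have "inj (fder f0' 0)" using s(6) f' by (simp add: inj_def)
  then obtain \<Phi> where \<Phi>: "smap \<Phi>" "near x. x \<in> C \<longrightarrow> \<Phi> (f0' x) = f1 x"
    using symplectic_extension[OF s0'(1) s(4) s0'(2) s(5) ext[OF f'] _ ex'] by blast
  show ?thesis
    by (rule symp_equivI_param[OF f N M smap_compose[OF lsymp_smap[OF L(1)] \<Phi>(1)]])
       (use \<Phi>(2) onC in \<open>auto elim: eventually_mono\<close>)
qed

end

lemma odd_power_eq_1:
  assumes "odd k" "a ^ k = (1 :: real)"
  shows "a = 1"
proof -
  have "a ^ k = 1 ^ k" using assms(2) by simp
  then show ?thesis using assms(1) by (metis odd_real_root_power_cancel)
qed

lemma even_power_eq_1:
  assumes "even k" "k > 0" "a ^ k = (1 :: real)"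
  shows "a \<in> {1, -1}"
proof -
  have "\<bar>a\<bar> ^ k = 1" using assms by (simp flip: power_abs)
  then have "\<bar>a\<bar> = 1" using power_eq_imp_eq_base[of "\<bar>a\<bar>" k 1] assms(2) by simp
  then show ?thesis by auto
qed

lemma even_power_sign:
  assumes "even k" "k > 0" "s = a ^ k * t" "s \<in> {1, -1}" "t \<in> {1, -1 :: real}"
  shows "s = t \<and> a \<in> {1, -1}"
proof -
  have "a ^ k \<ge> 0" using assms(1) by (rule zero_le_even_power)
  then have "s = t \<and> a ^ k = 1" using assms(3-5) by auto
  then show ?thesis using even_power_eq_1[OF assms(1,2)] by blast
qed

context symp_coords
begin

subsection \<open>Parametrised germs and their coordinates\<close>

definition param :: "(real ^ 'm \<Rightarrow> real ^ 'm) \<Rightarrow> (real ^ 'm) set \<Rightarrow> bool" where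
  "param f M \<longleftrightarrow> ld f \<and> (near x. x \<in> C \<longleftrightarrow> f x \<in> M)"

lemma param_sm: "param f M \<Longrightarrow> sm f" "param f M \<Longrightarrow> f 0 = 0" by (auto simp: param_def ld_def)

lemma param_admissible:
  assumes "param f M" "admissible G"
  shows "param (\<lambda>x. f (G x)) M"
proof -
  have l: "ld f" "ld G" and e: "near x. x \<in> C \<longleftrightarrow> f x \<in> M" "near x. x \<in> C \<longleftrightarrow> G x \<in> C"
    using assms by (auto simp: param_def admissible_def)
  have s: "sm G" "G 0 = 0" using l(2) by (auto simp: ld_def)
  have "near x. x \<in> C \<longleftrightarrow> f (G x) \<in> M"
    using e(2) eventually_compose_germ[OF e(1) s] by eventually_elim simp
  then show ?thesis using ld_compose[OF l(2,1)] by (simp add: param_def)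
qed

lemma Reach_param:
  assumes "param f M" "Reach (theta f) c"
  shows "\<exists>f'. param f' M \<and> crd (theta f') c"
proof -
  obtain G where G: "admissible G" "crd (pb (theta f) G) c" using assms(2) by (auto simp: Reach_def)
  have s: "sm G" "G 0 = 0" using G(1) by (auto simp: admissible_def ld_def)
  have "near x. \<forall>v. pb (theta f) G x v = theta (\<lambda>x. f (G x)) x v"
    using theta_pb[OF param_sm(1)[OF assms(1)] s] by eventually_elim simp
  from crd_cong[OF G(2) this] have "crd (theta (\<lambda>x. f (G x))) c" by simp
  then show ?thesis using param_admissible[OF assms(1) G(1)] by blast
qed

lemma symp_equivI_crd:
  assumes "param f N" "param f' M" "crd (theta f) c" "crd (theta f') c"
  shows "symp_equiv e n N M"
  using assms(1,2) exact_congC[OF exact_diff[OF assms(4,3)[unfolded crd_def]]]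
  by (intro symp_equivI_theta[of f f']) (auto simp: param_def)

text \<open>What \<open>pb_coordinates\<close> leaves once the diffeomorphism is forgotten: a
  necessary condition on the coordinates of equivalent germs, with its clauses for high weight
  conditional as there.\<close>

definition rel8 :: "(nat \<Rightarrow> real) \<Rightarrow> (nat \<Rightarrow> real) \<Rightarrow> bool" where
  "rel8 c' c \<longleftrightarrow> (\<exists>a b d. a \<noteq> 0 \<and> c' 1 = a ^ 5 * c 1 \<and> c' 2 = a ^ 6 * c 2 \<and> c' 3 = a ^ 7 * c 3 \<and>
     c' 4 = a ^ 7 * c 4 + 7 * a ^ 4 * b * c 1 \<and>
     c' 5 = a ^ 8 * c 5 + 4 * a ^ 4 * d * c 1 - 8 * a ^ 5 * b * c 2 \<and>
     (c 1 = 0 \<longrightarrow> c' 6 = a ^ 9 * c 6 - 6 * a ^ 5 * d * c 2 + a ^ 6 * b * (3 * c 3 + 9 * c 4)) \<and>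
     (c 1 = 0 \<longrightarrow> c 2 = 0 \<longrightarrow> c' 7 = a ^ 10 * c 7 + a ^ 6 * d * (5 * c 4 - 10 * c 3) + 10 * a ^ 7 * b * c 5) \<and>
     (c 1 = 0 \<longrightarrow> c 2 = 0 \<longrightarrow> c 3 = 0 \<longrightarrow> c 4 = 0 \<longrightarrow> c' 8 = a ^ 11 * c 8 + 22/3 * a ^ 7 * d * c 5 + 11 * a ^ 8 * b * c 6))"

text \<open>With a local inverse \<open>g\<close> of \<open>f'\<close>, the map
  \<open>G = g \<circ> \<Phi> \<circ> f\<close> sends the curve to itself, and
  \<open>f' \<circ> G = \<Phi> \<circ> f\<close>. So the pullback of \<open>theta f'\<close> by
  \<open>G\<close> is \<open>theta f\<close> modulo exact forms, and the structure theorem for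
  \<open>G\<close> applies.\<close>

lemma symp_equiv_rel8:
  assumes "param f N" "param f' M" "crd (theta f) c'" "crd (theta f') c" "symp_equiv e n N M"
  shows "rel8 c' c"
proof -
  obtain \<Phi> where \<Phi>: "smap \<Phi>" "near x. x \<in> N \<longleftrightarrow> \<Phi> x \<in> M" using assms(5) unfolding symp_equiv_iff by blast
  have l: "ld f" "ld f'" and N: "near x. x \<in> C \<longleftrightarrow> f x \<in> N" and M: "near x. x \<in> C \<longleftrightarrow> f' x \<in> M"
    using assms(1,2) by (auto simp: param_def)
  obtain g where g: "ld g" "near x. g (f' x) = x" "near y. f' (g y) = y" by (rule ld_inverse[OF l(2)])
  define G where "G x = g (\<Phi> (f x))" for x
  have s: "sm f" "f 0 = 0" "sm \<Phi>" "\<Phi> 0 = 0" "sm g" "g 0 = 0" "sm f'"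
    using l g(1) smap_ld[OF \<Phi>(1)] by (auto simp: ld_def)
  have ldG: "ld G" unfolding G_def[abs_def] by (intro ld_compose[of "\<lambda>x. \<Phi> (f x)" g] ld_compose[of f \<Phi>] l g smap_ld \<Phi>)
  have sG: "sm G" "G 0 = 0" using ldG by (auto simp: ld_def)
  have s\<Phi>f: "sm (\<lambda>x. \<Phi> (f x))" "\<Phi> (f 0) = 0" using sm_compose[OF s(3,1,2)] s by auto
  have fG: "near x. f' (G x) = \<Phi> (f x)"
    unfolding G_def by (rule eventually_compose_germ[OF g(3) s\<Phi>f])
  have GC: "near x. x \<in> C \<longrightarrow> G x \<in> C"
    using N eventually_compose_germ[OF \<Phi>(2) s(1,2)] fG eventually_compose_germ[OF M sG] by eventually_elim simp
  have "exact (\<lambda>x v. pb (theta f') G x v - theta f x v)"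
  proof (rule exact_cong[OF theta_smap[OF \<Phi>(1) s(1,2)]])
    have "near x. \<forall>\<^sub>F y in nhds x. f' (G y) = \<Phi> (f y)" using fG by (simp add: eventually_eventually)
    then show "near x. x \<in> C \<longrightarrow> (\<forall>v. pb (theta f') G x v - theta f x v = theta (\<lambda>x. \<Phi> (f x)) x v - theta f x v)"
      using theta_pb[OF s(7) sG]
    proof eventually_elim
      case (elim x)
      have "theta (\<lambda>x. f' (G x)) x v = theta (\<lambda>x. \<Phi> (f x)) x v" for v
        unfolding theta_def fder_cong_nhds[OF elim(1)] eventually_nhds_x_imp_x[OF elim(1)] ..
      then show ?case using elim(2) by simp
    qed
  qed
  from exact_add[OF this assms(3)[unfolded crd_def]] have c': "crd (pb (theta f') G) c'"
    unfolding crd_def by simp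
  obtain a b d where a: "a \<noteq> 0"
    and J: "J 7 (\<lambda>x. X1 (G x) - (a ^ 3 * X1 x + 3 * a ^ 2 * (X1 x * (b * X3 x + d * X1 x))))"
    "J 8 (\<lambda>x. X2 (G x) - (a ^ 4 * X2 x + 4 * a ^ 3 * (X2 x * (b * X3 x + d * X1 x))))"
    "J 6 (\<lambda>x. X3 (G x) - (a ^ 2 * X3 x + 2 * a * (X3 x * (b * X3 x + d * X1 x))))"
    by (rule curve_diffeo_structure[OF ldG GC])
  have "J 2 (\<lambda>x. b * X3 x + d * X1 x)" by (intro J_add J_cmult J_X J_antimono[OF J_X(1)]) simp
  then have "adapted 2 a (\<lambda>x. b * X3 x + d * X1 x) G"
    using J sG GC by (simp add: adapted_def cw_def)
  note P = pb_coordinates[OF this assms(4) c']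
  show ?thesis
    unfolding rel8_def
  proof (rule exI[of _ a], rule exI[of _ b], rule exI[of _ d], intro conjI impI)
    assume z: "c 1 = 0" "c 2 = 0" "c 3 = 0" "c 4 = 0"
    show "c' 8 = a ^ 11 * c 8 + 22 / 3 * a ^ 7 * d * c 5 + 11 * a ^ 8 * b * c 6"
    proof (rule P(8))
      fix i :: nat assume "i \<in> {1..4}"
      then have "i \<in> {1, 2, 3, 4}" by auto
      then show "c i = 0" using z by auto
    qed
  qed (rule a P(1-5) | rule P(6,7), assumption+)+
qed

text \<open>\<open>(p dq - q dp) / 2\<close> is \<open>p dq - d (p q) / 2\<close>, and
  \<open>p dq\<close> drops out where \<open>p\<close> vanishes on the curve.\<close>

lemma theta_pdq:
  assumes "sm f" "k \<le> n" "\<And>i x. i \<in> {1..n} \<Longrightarrow> k < i \<Longrightarrow> x \<in> C \<Longrightarrow> f x $ e (2 * i - 1) = 0"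
  shows "exact (\<lambda>x v. theta f x v - (\<Sum>i=1..k. f x $ e (2 * i - 1) * fder (\<lambda>x. f x $ e (2 * i)) x v))"
proof -
  have s: "sm (\<lambda>x. f x $ j)" for j using assms(1) by auto
  have "exact (\<lambda>x v. \<Sum>i=1..n. - (1/2) * (f x $ e (2 * i - 1) * fder (\<lambda>x. f x $ e (2 * i)) x v + f x $ e (2 * i) * fder (\<lambda>x. f x $ e (2 * i - 1)) x v))"
    by (intro exact_sum exact_cmult exact_by_parts s) simp
  moreover have "exact (\<lambda>x v. \<Sum>i=k+1..n. f x $ e (2 * i - 1) * fder (\<lambda>x. f x $ e (2 * i)) x v)"
    by (intro exact_sum exact_vanish) (use assms(3) in \<open>auto simp: ceq_def\<close>)
  ultimately have "exact (\<lambda>x v. (\<Sum>i=1..n. - (1/2) * (f x $ e (2 * i - 1) * fder (\<lambda>x. f x $ e (2 * i)) x v + f x $ e (2 * i) * fder (\<lambda>x. f x $ e (2 * i - 1)) x v)) +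
     (\<Sum>i=k+1..n. f x $ e (2 * i - 1) * fder (\<lambda>x. f x $ e (2 * i)) x v))" by (rule exact_add)
  then show ?thesis
  proof (rule exact_cong)
    show "near x. x \<in> C \<longrightarrow> (\<forall>v. theta f x v - (\<Sum>i=1..k. f x $ e (2 * i - 1) * fder (\<lambda>x. f x $ e (2 * i)) x v) =
       (\<Sum>i=1..n. - (1/2) * (f x $ e (2 * i - 1) * fder (\<lambda>x. f x $ e (2 * i)) x v + f x $ e (2 * i) * fder (\<lambda>x. f x $ e (2 * i - 1)) x v)) +
       (\<Sum>i=k+1..n. f x $ e (2 * i - 1) * fder (\<lambda>x. f x $ e (2 * i)) x v))"
      using sm_differentiable[OF assms(1)]
    proof eventually_elim
      case (elim x)
      show ?case
      proof (intro impI allI)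
        fix v
        let ?t = "\<lambda>i. f x $ e (2 * i - 1) * fder f x v $ e (2 * i)" and ?u = "\<lambda>i. f x $ e (2 * i) * fder f x v $ e (2 * i - 1)"
        have "{1..n} = {1..k} \<union> {k+1..n}" "{1..k} \<inter> {k+1..n} = {}" using assms(2) by auto
        then have "sum ?t {1..n} = sum ?t {1..k} + sum ?t {k+1..n}" by (simp add: sum.union_disjoint)
        moreover have "theta f x v = (sum ?t {1..n} - sum ?u {1..n}) / 2"
          by (simp add: theta_def om_def sum_subtractf)
        moreover have "(\<Sum>i=1..n. - (1/2) * (?t i + ?u i)) = - (1/2) * (sum ?t {1..n} + sum ?u {1..n})"
          by (simp only: sum_distrib_left[symmetric] sum.distrib)
        ultimately show "theta f x v - (\<Sum>i=1..k. f x $ e (2 * i - 1) * fder (\<lambda>x. f x $ e (2 * i)) x v) =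
       (\<Sum>i=1..n. - (1/2) * (f x $ e (2 * i - 1) * fder (\<lambda>x. f x $ e (2 * i)) x v + f x $ e (2 * i) * fder (\<lambda>x. f x $ e (2 * i - 1)) x v)) +
       (\<Sum>i=k+1..n. f x $ e (2 * i - 1) * fder (\<lambda>x. f x $ e (2 * i)) x v)"
          unfolding fder_nth[OF elim] by (simp add: field_simps)
      qed
    qed
  qed
qed

text \<open>The coefficients of the basis forms after \<open>B 3\<close> are at least quadratic, so
  under the assumption the symplectic form would vanish at \<open>0\<close> on the image of the
  three coordinate directions.\<close>

lemma not_isotropic:
  assumes "n = 2" "param f N" "crd (theta f) c"
  shows "\<not> (c 1 = 0 \<and> c 2 = 0 \<and> c 3 = 0)"
proof
  assume c: "c 1 = 0 \<and> c 2 = 0 \<and> c 3 = 0"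
  have s: "sm f" "f 0 = 0" "inj (fder f 0)" using assms(2) by (auto simp: param_def ld_def)
  have lA: "linear (fder f 0)" by (intro linear_fder sm_differentiable_0 s)
  obtain S where S: "sm S" "near x. x \<in> C \<longrightarrow> (\<forall>v. theta f x v - (\<Sum>i=1..8. c i * B i x v) = fder S x v)"
    using assms(3) by (auto simp: crd_def exact_def)
  have st: "sm (\<lambda>x. theta f x v)" for v unfolding theta_def by (intro sm_divide_const sm_om s sm_fder)
  have dt: "fder (\<lambda>x. theta f x v) 0 w = om (fder f 0 w) (fder f 0 v) / 2" for v w
  proof -
    have "((\<lambda>x. om (f x) (fder f x v)) has_derivative (\<lambda>w. om (f 0) (fder (\<lambda>x. fder f x v) 0 w) + om (fder f 0 w) (fder f 0 v))) (at 0)"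
      using bounded_bilinear.FDERIV[OF bb_om sm_has_fder_0[OF s(1)] sm_has_fder_0[OF sm_fder[OF s(1)]]] .
    from fder_eqI[OF has_derivative_divide_const[OF this, of 2]] show ?thesis
      unfolding theta_def using s(2) by (simp add: om_simps)
  qed
  let ?B = "\<lambda>v x. \<Sum>i=1..8. c i * B i x v"
  have sB: "sm (?B v)" for v
    unfolding sum18 B_simps by (intro sm_add sm_mult sm_const sm_coord sm_power)
  have dB: "fder (?B v) 0 w = 0" for v w
  proof (rule fder_eqI)
    show "(?B v has_derivative (\<lambda>w. 0)) (at 0)"
      unfolding sum18 B_simps using c by (auto intro!: derivative_eq_intros)
  qed
  have k: "om (fder f 0 w) (fder f 0 v) / 2 = fder (\<lambda>x. fder S x v) 0 w" if "w = axis (e i) 1" "i \<in> {1,2,3}" for v w i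
  proof -
    have "fder (\<lambda>x. theta f x v - ?B v x - fder S x v) 0 (axis (e i) 1) = 0"
      by (rule ceq_0_der[OF _ _ that(2)])
         (use S in \<open>auto intro!: sm_diff sm_fder st sB simp: ceq_def elim: eventually_mono\<close>)
    moreover have "fder (\<lambda>x. theta f x v - ?B v x - fder S x v) 0 w =
        fder (\<lambda>x. theta f x v) 0 w - fder (?B v) 0 w - fder (\<lambda>x. fder S x v) 0 w" for w
      by (subst fder_diff fder_diff[OF sm_differentiable_0 sm_differentiable_0];
          (intro sm_differentiable_0 sm_diff st sB sm_fder S)?)+ simp
    ultimately show ?thesis using that(1) dt dB by simp
  qed
  have "fder (\<lambda>x. fder S x v) 0 w = fder (\<lambda>x. fder S x w) 0 v" for v w
    using eventually_nhds_x_imp_x[OF sm_schwarz[OF S(1)]] by blast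
  then have iso: "om (fder f 0 (axis (e i) 1)) (fder f 0 (axis (e j) 1)) = 0" if "i \<in> {1,2,3}" "j \<in> {1,2,3}" for i j
    using k[OF refl that(1), of "axis (e j) 1"] k[OF refl that(2), of "axis (e i) 1"]
      om_skew[of "fder f 0 (axis (e i) 1)" "fder f 0 (axis (e j) 1)"] by simp
  define W :: "(real ^ 'm) set" where "W = (\<lambda>i. axis (e i) 1) ` {1,2,3}"
  have "card W = 3" unfolding W_def by (simp add: axis_eq_axis)
  moreover have "W \<subseteq> Basis" by (auto simp: W_def Basis_vec_def)
  then have "independent W" by (rule independent_mono[OF independent_Basis])
  ultimately have dW: "dim W = 3" by (simp add: dim_eq_card_independent)
  let ?V = "fder f 0 ` W"
  have dV: "dim ?V = 3" using dim_image_eq[OF lA inj_on_subset[OF s(3)], of W] dW by simp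
  have dK: "dim (flat ` ?V) = 3" using dim_image_eq[OF linear_flat inj_on_subset[OF inj_flat], of ?V] dV by simp
  \<comment> \<open>An isotropic space is orthogonal to its image under \<open>flat\<close>, so the
    two would span dimension 6 in a space of dimension 4.\<close>
  have "dim (flat ` ?V \<union> ?V) = dim (flat ` ?V) + dim ?V"
  proof (rule dim_orthogonal_sum)
    fix x y assume "x \<in> flat ` ?V" "y \<in> ?V"
    then show "x \<bullet> y = 0" using iso by (auto simp: W_def flat_inner)
  qed
  then have "dim (flat ` ?V \<union> ?V) = 6" using dV dK by simp
  moreover have "CARD('m) = 2 * n" using bij_betw_same_card[OF bij] by simp
  then have "dim (flat ` ?V \<union> ?V) \<le> 4" using dim_subset_UNIV[of "flat ` ?V \<union> ?V"] assms(1) by simp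
  ultimately show False by simp
qed

subsection \<open>Parametrisations of the normal forms\<close>

text \<open>A rescaled coordinate permutation with a function added to one component: each normal
  form is a graph of this kind over a three-dimensional coordinate space.\<close>

definition nmap :: "('m \<Rightarrow> 'm) \<Rightarrow> ('m \<Rightarrow> real) \<Rightarrow> 'm \<Rightarrow> (real ^ 'm \<Rightarrow> real) \<Rightarrow> real ^ 'm \<Rightarrow> real ^ 'm" where
  "nmap \<pi> s k g x = (\<chi> j. s j * x $ \<pi> j + (if j = k then g x else 0))"

lemma nmap_nth: "nmap \<pi> s k g x $ j = s j * x $ \<pi> j + (if j = k then g x else 0)"
  by (simp add: nmap_def)

text \<open>The derivative is triangular: \<open>g\<close> depends on the first three coordinates
  only, while component \<open>k\<close> contains a different one.\<close>

lemma ld_nmap: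
  assumes "inj \<pi>" "\<And>j. s j \<noteq> 0" "\<pi> k \<notin> {e 1, e 2, e 3}" "sm g" "g 0 = 0" "\<And>x. g (P3 x) = g x"
  shows "ld (nmap \<pi> s k g)"
proof -
  let ?f = "nmap \<pi> s k g"
  have sf: "sm ?f"
  proof (rule sm_vec)
    show "sm (\<lambda>x. ?f x $ j)" for j
      unfolding nmap_nth using assms(4) by (cases "j = k") (auto intro!: sm_add sm_mult)
  qed
  have dg: "fder g 0 v = fder g 0 (P3 v)" for v
    using fder_compose[of g P3 0 v] sm_differentiable_0[OF assms(4)] sm_differentiable_0[OF sm_linear[OF bl_P3]]
      fder_linear[OF bl_P3] by (simp add: assms(6))
  have df: "fder ?f 0 v $ j = s j * v $ \<pi> j + (if j = k then fder g 0 v else 0)" for v j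
  proof -
    have "fder ?f 0 v $ j = fder (\<lambda>x. ?f x $ j) 0 v" by (rule fder_nth[OF sm_differentiable_0[OF sf], symmetric])
    also have "\<dots> = s j * v $ \<pi> j + (if j = k then fder g 0 v else 0)"
      unfolding nmap_nth
      by (rule fder_eqI) (use sm_has_fder_0[OF assms(4)] in \<open>cases "j = k"; auto intro!: derivative_eq_intros\<close>)
    finally show ?thesis .
  qed
  have "inj (fder ?f 0)"
    unfolding linear_injective_0[OF linear_fder[OF sm_differentiable_0[OF sf]]]
  proof (intro allI impI)
    fix v assume v: "fder ?f 0 v = 0"
    have sur: "\<exists>i. \<pi> i = j" for j using finite_UNIV_inj_surj[OF finite assms(1)] by (metis surj_def)
    have z: "v $ j = 0" if "j \<noteq> \<pi> k" for j
    proof -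
      obtain i where i: "\<pi> i = j" using sur by blast
      then have "i \<noteq> k" using that by auto
      then show ?thesis using df[of v i] v assms(2) i by simp
    qed
    then have "P3 v = 0" using assms(3) by (auto simp: vec_eq_iff P3_nth)
    then have "fder g 0 v = 0" using dg[of v] linear_0[OF linear_fder[OF sm_differentiable_0[OF assms(4)]]] by simp
    then have "v $ \<pi> k = 0" using df[of v k] v assms(2) by simp
    then show "v = 0" using z by (metis vec_eq_iff zero_index)
  qed
  moreover have "?f 0 = 0" using assms(5) by (simp add: vec_eq_iff nmap_nth)
  ultimately show ?thesis using sf by (simp add: ld_def)
qed

lemma range4: "(\<forall>j\<in>{4..2*n}. P j) \<longleftrightarrow> P 4 \<and> (\<forall>i\<in>{3..n}. P (2 * i - 1) \<and> P (2 * i))"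
proof -
  have "{4..2*n} = {4} \<union> (\<lambda>i. 2 * i - 1) ` {3..n} \<union> (\<lambda>i. 2 * i) ` {3..n}"
  proof (intro equalityI subsetI)
    fix j assume j: "j \<in> {4..2*n}"
    show "j \<in> {4} \<union> (\<lambda>i. 2 * i - 1) ` {3..n} \<union> (\<lambda>i. 2 * i) ` {3..n}"
    proof (cases "even j")
      case True
      then obtain i where "j = 2 * i" by blast
      then show ?thesis using j by (cases "i = 2") auto
    next
      case False
      then obtain i where "j = 2 * i + 1" by (auto elim: oddE)
      then have "j = 2 * (i + 1) - 1" "i + 1 \<in> {3..n}" using j by auto
      then show ?thesis by blast
    qed
  qed (use n2 in auto)
  then show ?thesis by auto
qed

lemma range6: "n \<ge> 3 \<Longrightarrow> (\<forall>i\<in>{3..n}. P i) \<longleftrightarrow> P 3 \<and> (\<forall>i\<in>{4..n}. P i)"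
proof -
  assume "n \<ge> 3"
  then have "{3..n} = {3} \<union> {4..n}" by auto
  then show ?thesis by auto
qed

lemma pq_simps: "pc e 1 z = z $ e 1" "qc e 1 z = z $ e 2" "pc e 2 z = z $ e 3" "qc e 2 z = z $ e 4"
  "pc e 3 z = z $ e 5" "qc e 3 z = z $ e 6"
  by (simp_all add: pc_def qc_def xc_def One_nat_def[symmetric])

lemma pq_zero_iff: "pq_zero_from e n k z \<longleftrightarrow> (\<forall>i\<in>{k..n}. z $ e (2 * i - 1) = 0 \<and> z $ e (2 * i) = 0)"
  by (simp add: pq_zero_from_def pc_def qc_def xc_def)

lemma C_iff4: "x \<in> C \<longleftrightarrow> X1 x ^ 2 + X2 x * X3 x = 0 \<and> X1 x * X2 x + X1 x * X3 x ^ 2 = 0 \<and> x $ e 4 = 0 \<and>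
    pq_zero_from e n 3 x"
  unfolding C_iff range4 pq_zero_iff ..

lemma e_neq4 [simp]: "e 1 \<noteq> e 4" "e 2 \<noteq> e 4" "e 3 \<noteq> e 4" "e 4 \<noteq> e 1" "e 4 \<noteq> e 2" "e 4 \<noteq> e 3"
  using e_eq_iff n2 by auto

lemma e_high:
  assumes "i \<in> {3..n}" "j \<in> {1, 2, 3, 4}"
  shows "e (2 * i - 1) \<noteq> e j" "e (2 * i) \<noteq> e j"
proof -
  have "j \<in> {1..2*n}" "2 * i - 1 \<in> {1..2*n}" "2 * i \<in> {1..2*n}" "2 * i - 1 \<noteq> j" "2 * i \<noteq> j" using assms n2 by auto
  then show "e (2 * i - 1) \<noteq> e j" "e (2 * i) \<noteq> e j" by (simp_all only: e_eq_iff not_False_eq_True)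
qed

lemma pq_zero_nmap:
  assumes "\<And>j. j \<notin> {e 1, e 2, e 3, e 4} \<Longrightarrow> \<pi> j = j \<and> s j = 1" "k \<in> {e 1, e 2, e 3, e 4}"
  shows "pq_zero_from e n 3 (nmap \<pi> s k g x) \<longleftrightarrow> pq_zero_from e n 3 x"
proof -
  have "nmap \<pi> s k g x $ j = x $ j" if "j \<notin> {e 1, e 2, e 3, e 4}" for j
    using assms(1)[OF that] assms(2) that by (auto simp: nmap_nth)
  moreover have "e (2 * i - 1) \<notin> {e 1, e 2, e 3, e 4}" "e (2 * i) \<notin> {e 1, e 2, e 3, e 4}" if "i \<in> {3..n}" for i
    using e_high[OF that] by auto
  ultimately show ?thesis unfolding pq_zero_iff by auto
qed

lemma param_nmap: "ld (nmap \<pi> s k g) \<Longrightarrow> (\<And>x. x \<in> C \<longleftrightarrow> nmap \<pi> s k g x \<in> M) \<Longrightarrow> param (nmap \<pi> s k g) M"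
  by (simp add: param_def)

lemma theta_pdq2:
  assumes "sm f" "\<And>i x. i \<in> {3..n} \<Longrightarrow> x \<in> C \<Longrightarrow> f x $ e (2 * i - 1) = 0"
  shows "exact (\<lambda>x v. theta f x v - (f x $ e 1 * fder (\<lambda>x. f x $ e 2) x v + f x $ e 3 * fder (\<lambda>x. f x $ e 4) x v))"
proof -
  have "{1..2::nat} = {1, 2}" by auto
  then show ?thesis using theta_pdq[OF assms(1), of 2] n2 assms(2) by (simp add: One_nat_def[symmetric])
qed

lemma theta_pdq3:
  assumes "sm f" "n \<ge> 3" "\<And>i x. i \<in> {4..n} \<Longrightarrow> x \<in> C \<Longrightarrow> f x $ e (2 * i - 1) = 0"
  shows "exact (\<lambda>x v. theta f x v - (f x $ e 1 * fder (\<lambda>x. f x $ e 2) x v + f x $ e 3 * fder (\<lambda>x. f x $ e 4) x v +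
    f x $ e 5 * fder (\<lambda>x. f x $ e 6) x v))"
proof -
  have "{1..3::nat} = {1, 2, 3}" by auto
  then show ?thesis using theta_pdq[OF assms(1,2)] assms(3) by (simp add: add.assoc One_nat_def[symmetric])
qed

lemma crdI: "exact (\<lambda>x v. a x v - b x v) \<Longrightarrow> exact (\<lambda>x v. b x v - (\<Sum>i=1..8. c i * B i x v)) \<Longrightarrow> crd a c"
  unfolding crd_def using exact_add by force

text \<open>\<open>p1\<close>, \<open>p2\<close>, \<open>q1\<close> play the roles of
  \<open>X1\<close>, \<open>X2\<close>, \<open>X3\<close>, so \<open>p dq\<close> is
  \<open>X1 dX3 + X2 d(c1 X3 - c2 X1)\<close>. As \<open>X2 dX1\<close> is \<open>- B 3\<close>
  modulo exact forms, the minus sign in the equation turns into the coordinate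
  \<open>c2\<close>.\<close>

lemma param_F0: "\<exists>f. param f (U8_0 e n c1 c2) \<and> crd (theta f) (cl [1, c1, c2, 0, 0, 0, 0, 0])"
proof -
  define \<pi> where "\<pi> j = (if j = e 2 then e 3 else if j = e 3 then e 2 else j)" for j
  define g :: "real ^ 'm \<Rightarrow> real" where "g x = c1 * X3 x - c2 * X1 x" for x
  have sg: "sm g" unfolding g_def[abs_def] by (intro sm_diff sm_mult sm_const sm_coord)
  have dg: "fder g x v = c1 * X3 v - c2 * X1 v" for x v
    unfolding g_def[abs_def] by (rule fder_eqI) (auto intro!: derivative_eq_intros)
  let ?f = "nmap \<pi> (\<lambda>j. 1) (e 4) g"
  have f: "?f x $ e 1 = X1 x" "?f x $ e 2 = X3 x" "?f x $ e 3 = X2 x" "?f x $ e 4 = x $ e 4 + g x" for x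
    by (simp_all add: nmap_nth \<pi>_def)
  have l: "ld ?f"
    by (rule ld_nmap) (auto simp: \<pi>_def inj_def sg g_def P3_nth split: if_splits)
  have pq: "pq_zero_from e n 3 (?f x) \<longleftrightarrow> pq_zero_from e n 3 x" for x
    by (rule pq_zero_nmap) (auto simp: \<pi>_def)
  have p: "param ?f (U8_0 e n c1 c2)"
    by (rule param_nmap[OF l]) (auto simp: C_iff4 U8_0_def pq pq_simps f g_def)
  have s: "sm ?f" using l by (simp add: ld_def)
  have "exact (\<lambda>x v. theta ?f x v - (?f x $ e 1 * fder (\<lambda>x. ?f x $ e 2) x v + ?f x $ e 3 * fder (\<lambda>x. ?f x $ e 4) x v))"
  proof (rule theta_pdq2[OF s])
    fix i x assume "i \<in> {3..n}" "x \<in> C"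
    then show "?f x $ e (2 * i - 1) = 0" using pq[of x] by (auto simp: C_iff4 pq_zero_iff)
  qed
  moreover have "fder (\<lambda>x. x $ e 4 + g x) x v = v $ e 4 + (c1 * X3 v - c2 * X1 v)" for x v
    unfolding g_def by (rule fder_eqI) (auto intro!: derivative_eq_intros)
  ultimately have "exact (\<lambda>x v. theta ?f x v - (X1 x * X3 v + X2 x * (v $ e 4 + (c1 * X3 v - c2 * X1 v))))"
    unfolding f by simp
  then have "crd (theta ?f) (cl [1, c1, c2, 0, 0, 0, 0, 0])"
  proof (rule crdI)
    have "exact (\<lambda>x v. X2 x * v $ e 4)" by (rule exact_transversal) (use n2 in auto)
    then show "exact (\<lambda>x v. X1 x * X3 v + X2 x * (v $ e 4 + (c1 * X3 v - c2 * X1 v)) -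
        (\<Sum>i=1..8. cl [1, c1, c2, 0, 0, 0, 0, 0] i * B i x v))"
      by (rule exact_combo2[OF _ red_X2X1, of _ _ 1 "-c2"]) (simp add: sum18 algebra_simps)
  qed
  then show ?thesis using p by blast
qed

text \<open>Here \<open>q2\<close> is \<open>t * X3\<close> for the sign \<open>t\<close>; since
  \<open>t * t = 1\<close>, the sign disappears from the equations of the curve and reappears in
  front of \<open>X2 dX3\<close>.\<close>

lemma param_F1:
  assumes "t \<in> {1, -1}"
  shows "\<exists>f. param f (U8_1 e n t c1 c2) \<and> crd (theta f) (cl [0, t, c1, c2, 0, 0, 0, 0])"
proof -
  have t: "t * t = 1" "t \<noteq> 0" using assms by auto
  define \<pi> where "\<pi> j = (if j = e 2 then e 4 else if j = e 3 then e 2 else if j = e 4 then e 3 else j)" for j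
  define s where "s j = (if j = e 4 then t else 1)" for j
  define g :: "real ^ 'm \<Rightarrow> real" where "g x = c1 * X2 x + c2 / 2 * X3 x ^ 2" for x
  have sg: "sm g" unfolding g_def[abs_def] by (intro sm_add sm_mult sm_const sm_coord sm_power)
  let ?f = "nmap \<pi> s (e 2) g"
  have f: "?f x $ e 1 = X1 x" "?f x $ e 2 = x $ e 4 + g x" "?f x $ e 3 = X2 x" "?f x $ e 4 = t * X3 x" for x
    by (simp_all add: nmap_nth \<pi>_def s_def)
  have l: "ld ?f"
    by (rule ld_nmap) (use t(2) in \<open>auto simp: \<pi>_def inj_def sg g_def P3_nth s_def split: if_splits\<close>)
  have pq: "pq_zero_from e n 3 (?f x) \<longleftrightarrow> pq_zero_from e n 3 x" for x
    by (rule pq_zero_nmap) (auto simp: \<pi>_def s_def)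
  have tt: "(t * a) ^ 2 = a ^ 2" "t * (b * (t * a)) = b * a" for a b
  proof -
    have "(t * a) ^ 2 = (t * t) * a ^ 2" "t * (b * (t * a)) = (t * t) * (b * a)" by (simp_all add: power2_eq_square)
    then show "(t * a) ^ 2 = a ^ 2" "t * (b * (t * a)) = b * a" using t(1) by simp_all
  qed
  have p: "param ?f (U8_1 e n t c1 c2)"
    by (rule param_nmap[OF l]) (auto simp: C_iff4 U8_1_def pq pq_simps f g_def tt)
  have sf: "sm ?f" using l by (simp add: ld_def)
  have "exact (\<lambda>x v. theta ?f x v - (?f x $ e 1 * fder (\<lambda>x. ?f x $ e 2) x v + ?f x $ e 3 * fder (\<lambda>x. ?f x $ e 4) x v))"
  proof (rule theta_pdq2[OF sf])
    fix i x assume "i \<in> {3..n}" "x \<in> C"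
    then show "?f x $ e (2 * i - 1) = 0" using pq[of x] by (auto simp: C_iff4 pq_zero_iff)
  qed
  moreover have "fder (\<lambda>x. x $ e 4 + g x) x v = v $ e 4 + (c1 * X2 v + c2 * X3 x * X3 v)" for x v
    unfolding g_def by (rule fder_eqI) (auto intro!: derivative_eq_intros)
  moreover have "fder (\<lambda>x. t * X3 x) x v = t * X3 v" for x v
    by (rule fder_eqI) (auto intro!: derivative_eq_intros)
  ultimately have "exact (\<lambda>x v. theta ?f x v - (X1 x * (v $ e 4 + (c1 * X2 v + c2 * X3 x * X3 v)) + X2 x * (t * X3 v)))"
    unfolding f by simp
  then have "crd (theta ?f) (cl [0, t, c1, c2, 0, 0, 0, 0])"
  proof (rule crdI)
    have "exact (\<lambda>x v. X1 x * v $ e 4)" by (rule exact_transversal) (use n2 in auto)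
    then show "exact (\<lambda>x v. X1 x * (v $ e 4 + (c1 * X2 v + c2 * X3 x * X3 v)) + X2 x * (t * X3 v) -
        (\<Sum>i=1..8. cl [0, t, c1, c2, 0, 0, 0, 0] i * B i x v))"
      by (rule exact_congC) (simp add: sum18 algebra_simps)
  qed
  then show ?thesis using p by blast
qed

text \<open>With \<open>p1\<close>, \<open>q1\<close>, \<open>q2\<close> as \<open>X1\<close>,
  \<open>X2\<close>, \<open>X3\<close>, the form is \<open>X1 dX2 + p2 dX3\<close>; this covers the
  families with leading term \<open>B 3\<close>.\<close>

lemma param_graph_p2:
  fixes G :: "real \<Rightarrow> real \<Rightarrow> real"
  assumes "sm (\<lambda>x. G (X1 x) (X3 x))" "G 0 0 = 0"
    "\<And>z. z \<in> M \<longleftrightarrow> pc e 1 z ^ 2 + qc e 1 z * qc e 2 z = 0 \<and> pc e 1 z * qc e 1 z + pc e 1 z * qc e 2 z ^ 2 = 0 \<and>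
       pc e 2 z = G (pc e 1 z) (qc e 2 z) \<and> pq_zero_from e n 3 z"
  shows "\<exists>f. param f M \<and> exact (\<lambda>x v. theta f x v - (X1 x * X2 v + G (X1 x) (X3 x) * X3 v))"
proof -
  define \<pi> where "\<pi> j = (if j = e 3 then e 4 else if j = e 4 then e 3 else j)" for j
  let ?g = "\<lambda>x. G (X1 x) (X3 x)"
  let ?f = "nmap \<pi> (\<lambda>j. 1) (e 3) ?g"
  have f: "?f x $ e 1 = X1 x" "?f x $ e 2 = X2 x" "?f x $ e 3 = x $ e 4 + ?g x" "?f x $ e 4 = X3 x" for x
    by (simp_all add: nmap_nth \<pi>_def)
  have l: "ld ?f"
    by (rule ld_nmap) (use assms in \<open>auto simp: \<pi>_def inj_def P3_nth split: if_splits\<close>)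
  have pq: "pq_zero_from e n 3 (?f x) \<longleftrightarrow> pq_zero_from e n 3 x" for x
    by (rule pq_zero_nmap) (auto simp: \<pi>_def)
  have p: "param ?f M"
    by (rule param_nmap[OF l]) (auto simp: C_iff4 assms(3) pq pq_simps f)
  have s: "sm ?f" using l by (simp add: ld_def)
  have "exact (\<lambda>x v. theta ?f x v - (?f x $ e 1 * fder (\<lambda>x. ?f x $ e 2) x v + ?f x $ e 3 * fder (\<lambda>x. ?f x $ e 4) x v))"
  proof (rule theta_pdq2[OF s])
    fix i x assume "i \<in> {3..n}" "x \<in> C"
    then show "?f x $ e (2 * i - 1) = 0" using pq[of x] by (auto simp: C_iff4 pq_zero_iff)
  qed
  then have "exact (\<lambda>x v. theta ?f x v - (X1 x * X2 v + ?g x * X3 v))"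
    by (rule exact_congC) (simp add: f C_iff4)
  then show ?thesis using p by blast
qed

text \<open>With \<open>p1\<close>, \<open>p2\<close>, \<open>p3\<close> as \<open>X1\<close>,
  \<open>X2\<close>, \<open>X3\<close>, only \<open>q3\<close> may be nonzero on the germ. The form
  \<open>X3 dG\<close> is \<open>- G dX3\<close> modulo exact forms, which explains the signs in
  these normal forms.\<close>

lemma param_graph_q3:
  fixes G :: "real \<Rightarrow> real \<Rightarrow> real"
  assumes n3: "n \<ge> 3" and G: "sm (\<lambda>x. G (X1 x) (X3 x))" "G 0 0 = 0"
    "\<And>z. z \<in> M \<longleftrightarrow> pc e 1 z ^ 2 + pc e 2 z * pc e 3 z = 0 \<and> pc e 1 z * pc e 2 z + pc e 1 z * pc e 3 z ^ 2 = 0 \<and>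
       qc e 1 z = 0 \<and> qc e 2 z = 0 \<and> qc e 3 z = G (pc e 1 z) (pc e 3 z) \<and> pq_zero_from e n 4 z"
  shows "\<exists>f. param f M \<and> exact (\<lambda>x v. theta f x v - - G (X1 x) (X3 x) * X3 v)"
proof -
  have ne: "e i \<noteq> e j" if "i \<in> {1..6}" "j \<in> {1..6}" "i \<noteq> j" for i j
    using e_eq_iff[of i j] that n3 by auto
  have ne6 [simp]: "e 5 \<noteq> e 1" "e 5 \<noteq> e 2" "e 5 \<noteq> e 3" "e 5 \<noteq> e 4" "e 5 \<noteq> e 6" "e 6 \<noteq> e 1" "e 6 \<noteq> e 2" "e 6 \<noteq> e 3" "e 6 \<noteq> e 4" "e 6 \<noteq> e 5"
     "e 1 \<noteq> e 5" "e 2 \<noteq> e 5" "e 3 \<noteq> e 5" "e 4 \<noteq> e 5" "e 1 \<noteq> e 6" "e 2 \<noteq> e 6" "e 3 \<noteq> e 6" "e 4 \<noteq> e 6"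
    by (rule ne; simp)+
  define \<pi> where "\<pi> j = (if j = e 2 then e 4 else if j = e 3 then e 2 else if j = e 4 then e 5 else if j = e 5 then e 3 else j)" for j
  let ?g = "\<lambda>x. G (X1 x) (X3 x)"
  let ?f = "nmap \<pi> (\<lambda>j. 1) (e 6) ?g"
  have f: "?f x $ e 1 = X1 x" "?f x $ e 2 = x $ e 4" "?f x $ e 3 = X2 x" "?f x $ e 4 = x $ e 5" "?f x $ e 5 = X3 x"
     "?f x $ e 6 = x $ e 6 + ?g x" for x
    by (simp_all add: nmap_nth \<pi>_def)
  have l: "ld ?f"
    by (rule ld_nmap) (use G in \<open>auto simp: \<pi>_def inj_def P3_nth split: if_splits\<close>)
  have high: "?f x $ e (2 * i - 1) = x $ e (2 * i - 1)" "?f x $ e (2 * i) = x $ e (2 * i)" if "i \<in> {4..n}" for i x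
  proof -
    have "e k \<notin> {e 2, e 3, e 4, e 5, e 6}" if "k \<in> {1..2*n}" "k \<ge> 7" for k
      using e_eq_iff[of k 2] e_eq_iff[of k 3] e_eq_iff[of k 4] e_eq_iff[of k 5] e_eq_iff[of k 6] that n3 by auto
    moreover have "2 * i - 1 \<in> {1..2*n}" "2 * i \<in> {1..2*n}" "2 * i - 1 \<ge> 7" "2 * i \<ge> 7" using that by auto
    ultimately have "e (2 * i - 1) \<notin> {e 2, e 3, e 4, e 5, e 6}" "e (2 * i) \<notin> {e 2, e 3, e 4, e 5, e 6}" by blast+
    then show "?f x $ e (2 * i - 1) = x $ e (2 * i - 1)" "?f x $ e (2 * i) = x $ e (2 * i)" by (auto simp: nmap_nth \<pi>_def)
  qed
  have pq: "pq_zero_from e n 4 (?f x) \<longleftrightarrow> pq_zero_from e n 4 x" for x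
    unfolding pq_zero_iff using high by auto
  have C6: "x \<in> C \<longleftrightarrow> X1 x ^ 2 + X2 x * X3 x = 0 \<and> X1 x * X2 x + X1 x * X3 x ^ 2 = 0 \<and> x $ e 4 = 0 \<and> x $ e 5 = 0 \<and> x $ e 6 = 0 \<and>
      pq_zero_from e n 4 x" for x
    unfolding C_iff4 pq_zero_iff range6[OF n3] by (simp add: conj_assoc)
  have p: "param ?f M"
    by (rule param_nmap[OF l]) (auto simp: C6 G(3) pq pq_simps f)
  have s: "sm ?f" using l by (simp add: ld_def)
  have t1: "exact (\<lambda>x v. theta ?f x v - (?f x $ e 1 * fder (\<lambda>x. ?f x $ e 2) x v + ?f x $ e 3 * fder (\<lambda>x. ?f x $ e 4) x v +
     ?f x $ e 5 * fder (\<lambda>x. ?f x $ e 6) x v))"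
  proof (rule theta_pdq3[OF s n3])
    fix i x assume i: "i \<in> {4..n}" and x: "x \<in> C"
    then show "?f x $ e (2 * i - 1) = 0" using high[OF i] by (auto simp: C6 pq_zero_iff)
  qed
  have t2: "exact (\<lambda>x v. X1 x * v $ e 4 + X2 x * v $ e 5 + X3 x * v $ e 6)"
    by (intro exact_add exact_transversal sm_coord) (use n3 in auto)
  have t3: "exact (\<lambda>x v. X3 x * fder ?g x v + ?g x * fder (\<lambda>x. X3 x) x v)"
    by (rule exact_by_parts[OF sm_coord G(1)])
  from exact_add[OF exact_add[OF t1 t2] t3]
  have "exact (\<lambda>x v. theta ?f x v - (?f x $ e 1 * fder (\<lambda>x. ?f x $ e 2) x v + ?f x $ e 3 * fder (\<lambda>x. ?f x $ e 4) x v +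
     ?f x $ e 5 * fder (\<lambda>x. ?f x $ e 6) x v) + (X1 x * v $ e 4 + X2 x * v $ e 5 + X3 x * v $ e 6) +
     (X3 x * fder ?g x v + ?g x * fder (\<lambda>x. X3 x) x v))"
    .
  then have "exact (\<lambda>x v. theta ?f x v - - ?g x * X3 v)"
  proof (rule exact_cong)
    show "near x. x \<in> C \<longrightarrow> (\<forall>v. theta ?f x v - - ?g x * X3 v = theta ?f x v - (?f x $ e 1 * fder (\<lambda>x. ?f x $ e 2) x v + ?f x $ e 3 * fder (\<lambda>x. ?f x $ e 4) x v +
     ?f x $ e 5 * fder (\<lambda>x. ?f x $ e 6) x v) + (X1 x * v $ e 4 + X2 x * v $ e 5 + X3 x * v $ e 6) +
     (X3 x * fder ?g x v + ?g x * fder (\<lambda>x. X3 x) x v))"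
      using sm_differentiable[OF G(1)]
    proof eventually_elim
      case (elim x)
      have "fder (\<lambda>x. x $ e 6 + ?g x) x v = v $ e 6 + fder ?g x v" for v
        by (rule fder_eqI) (intro has_derivative_add has_derivative_coord has_fder elim)
      then show ?case unfolding f by (simp add: algebra_simps)
    qed
  qed
  then show ?thesis using p by blast
qed

fun nfset :: "normal_form \<Rightarrow> real \<Rightarrow> real \<Rightarrow> real \<Rightarrow> (real ^ 'm) set" where
  "nfset F0 s a b = U8_0 e n a b"
| "nfset F1 s a b = U8_1 e n s a b"
| "nfset F2 s a b = U8_2 e n a b"
| "nfset F30_5 s a b = U8_30_5 e n a b"
| "nfset F30_inf s a b = U8_30_inf e n a b"
| "nfset F31 s a b = U8_31 e n a"
| "nfset F4 s a b = U8_4 e n s a"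
| "nfset F5 s a b = U8_5 e n a"
| "nfset F6 s a b = U8_6 e n s a"
| "nfset F7 s a b = U8_7 e n"
| "nfset F8 s a b = U8_8 e n"

lemma members_iff:
  "M \<in> members e n F \<longleftrightarrow> (\<exists>s a b. s \<in> {1, -1} \<and> (F = F2 \<longrightarrow> (a, b) \<in> U8_2_params) \<and> M = nfset F s a b)"
  by (cases F) auto

lemma U8_8_iff:
  "n \<ge> 3 \<Longrightarrow> z \<in> U8_8 e n \<longleftrightarrow> pc e 1 z ^ 2 + pc e 2 z * pc e 3 z = 0 \<and> pc e 1 z * pc e 2 z + pc e 1 z * pc e 3 z ^ 2 = 0 \<and>
       qc e 1 z = 0 \<and> qc e 2 z = 0 \<and> qc e 3 z = 0 \<and> pq_zero_from e n 4 z"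
proof -
  assume "n \<ge> 3"
  then have "{1..n} = {1, 2, 3} \<union> {4..n}" by auto
  then show ?thesis by (auto simp: U8_8_def pq_zero_from_def)
qed

lemma param_normal_form:
  assumes "F \<in> normal_forms n" "s \<in> {1, -1}"
  shows "\<exists>f. param f (nfset F s a b) \<and> crd (theta f) (cl (nfc F s a b))"
proof -
  have n3: "n \<ge> 3" if "F \<in> {F31, F4, F5, F6, F7, F8}"
    using assms(1) n2 that by (auto simp: normal_forms_def split: if_splits)
  have p2: ?thesis if "sm (\<lambda>x. G (X1 x) (X3 x))" "G 0 0 = 0"
    "\<And>z. z \<in> nfset F s a b \<longleftrightarrow> pc e 1 z ^ 2 + qc e 1 z * qc e 2 z = 0 \<and> pc e 1 z * qc e 1 z + pc e 1 z * qc e 2 z ^ 2 = 0 \<and>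
       pc e 2 z = G (pc e 1 z) (qc e 2 z) \<and> pq_zero_from e n 3 z"
    "\<And>x v. X1 x * X2 v + G (X1 x) (X3 x) * X3 v = (\<Sum>i=1..8. cl (nfc F s a b) i * B i x v)" for G :: "real \<Rightarrow> real \<Rightarrow> real"
    using param_graph_p2[OF that(1-3)] unfolding that(4) crd_def .
  have q3: ?thesis if "F \<in> {F31, F4, F5, F6, F7, F8}" "sm (\<lambda>x. G (X1 x) (X3 x))" "G 0 0 = 0"
    "\<And>z. z \<in> nfset F s a b \<longleftrightarrow> pc e 1 z ^ 2 + pc e 2 z * pc e 3 z = 0 \<and> pc e 1 z * pc e 2 z + pc e 1 z * pc e 3 z ^ 2 = 0 \<and>
       qc e 1 z = 0 \<and> qc e 2 z = 0 \<and> qc e 3 z = G (pc e 1 z) (pc e 3 z) \<and> pq_zero_from e n 4 z"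
    "\<And>x v. - G (X1 x) (X3 x) * X3 v = (\<Sum>i=1..8. cl (nfc F s a b) i * B i x v)" for G :: "real \<Rightarrow> real \<Rightarrow> real"
    using param_graph_q3[OF n3[OF that(1)] that(2-4)] unfolding that(5) crd_def .
  show ?thesis
  proof (cases F)
    case F0 then show ?thesis using param_F0 by simp
  next
    case F1 then show ?thesis using param_F1[OF assms(2)] by simp
  next
    case F2 then show ?thesis
      by (intro p2[of "\<lambda>p q. a * p * q + b / 2 * p ^ 2"])
         (auto intro!: sm_add sm_mult sm_power sm_coord sm_const simp: U8_2_def sum18 algebra_simps)
  next
    case F30_5 then show ?thesis
      by (intro p2[of "\<lambda>p q. - (1 / 3) * p * q + a / 2 * p ^ 2 + b * p * q ^ 2"])
         (auto intro!: sm_add sm_mult sm_power sm_coord sm_const simp: U8_30_5_def sum18 algebra_simps)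
  next
    case F30_inf then show ?thesis
      by (intro p2[of "\<lambda>p q. 2 * p * q + a / 2 * p ^ 2 + b / 2 * p ^ 2 * q"])
         (auto intro!: sm_add sm_mult sm_power sm_coord sm_const simp: U8_30_inf_def sum18 algebra_simps)
  next
    case F31 then show ?thesis
      by (intro q3[of "\<lambda>p q. - (p * q) - a / 2 * p ^ 2"])
         (auto intro!: sm_diff sm_minus sm_mult sm_power sm_coord sm_const simp: U8_31_def sum18 algebra_simps)
  next
    case F4 then show ?thesis
      by (intro q3[of "\<lambda>p q. - s * (1 / 2) * p ^ 2 - a * p * q ^ 2"])
         (auto intro!: sm_diff sm_minus sm_mult sm_power sm_coord sm_const simp: U8_4_def sum18 algebra_simps)
  next
    case F5 then show ?thesis
      by (intro q3[of "\<lambda>p q. - (p * q ^ 2) - a / 2 * p ^ 2 * q"])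
         (auto intro!: sm_diff sm_minus sm_mult sm_power sm_coord sm_const simp: U8_5_def sum18 algebra_simps)
  next
    case F6 then show ?thesis
      by (intro q3[of "\<lambda>p q. - s * (1 / 2) * p ^ 2 * q + a * p * q ^ 3"])
         (auto intro!: sm_add sm_minus sm_mult sm_power sm_coord sm_const simp: U8_6_def sum18 algebra_simps)
  next
    case F7 then show ?thesis
      by (intro q3[of "\<lambda>p q. - (p * q ^ 3)"])
         (auto intro!: sm_minus sm_mult sm_power sm_coord sm_const simp: U8_7_def sum18 algebra_simps)
  next
    case F8 then show ?thesis
      by (intro q3[of "\<lambda>p q. 0"]) (use n3 in \<open>auto simp: U8_8_iff sum18\<close>)
  qed
qed

subsection \<open>Uniqueness of the normal form\<close>

text \<open>The parameters a family actually has, absent ones set to \<open>0\<close>, as a vector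
  so that pairs can be compared up to a common sign.\<close>

fun upar :: "normal_form \<Rightarrow> real \<Rightarrow> real \<Rightarrow> real \<times> real" where
  "upar F0 a b = (a, b)" | "upar F1 a b = (a, b)" | "upar F2 a b = (a, b)" | "upar F30_5 a b = (a, b)"
| "upar F30_inf a b = (a, b)" | "upar F31 a b = (a, 0)" | "upar F4 a b = (a, 0)" | "upar F5 a b = (a, 0)"
| "upar F6 a b = (a, 0)" | "upar F7 a b = (0, 0)" | "upar F8 a b = (0, 0)"

fun lead :: "normal_form \<Rightarrow> nat" where
  "lead F0 = 1" | "lead F1 = 2" | "lead F2 = 3" | "lead F30_5 = 3" | "lead F30_inf = 3" | "lead F31 = 4"
| "lead F4 = 5" | "lead F5 = 6" | "lead F6 = 7" | "lead F7 = 8" | "lead F8 = 9"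

lemma lead_eq:
  assumes "s \<noteq> 0" "c = cl (nfc F s p q)"
  shows "lead F = (if c 1 \<noteq> 0 then 1 else if c 2 \<noteq> 0 then 2 else if c 3 \<noteq> 0 then 3 else if c 4 \<noteq> 0 then 4
    else if c 5 \<noteq> 0 then 5 else if c 6 \<noteq> 0 then 6 else if c 7 \<noteq> 0 then 7 else if c 8 \<noteq> 0 then 8 else 9)"
  unfolding assms(2) by (cases F) (use assms(1) in simp_all)

lemma rel8_zero:
  assumes "rel8 c' c"
  shows "c' 1 = 0 \<longleftrightarrow> c 1 = 0" "c 1 = 0 \<Longrightarrow> c' 2 = 0 \<longleftrightarrow> c 2 = 0" "c 1 = 0 \<Longrightarrow> c 2 = 0 \<Longrightarrow> c' 3 = 0 \<longleftrightarrow> c 3 = 0"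
    "c 1 = 0 \<Longrightarrow> c 2 = 0 \<Longrightarrow> c 3 = 0 \<Longrightarrow> c' 4 = 0 \<longleftrightarrow> c 4 = 0"
    "c 1 = 0 \<Longrightarrow> c 2 = 0 \<Longrightarrow> c 3 = 0 \<Longrightarrow> c 4 = 0 \<Longrightarrow> c' 5 = 0 \<longleftrightarrow> c 5 = 0"
    "c 1 = 0 \<Longrightarrow> c 2 = 0 \<Longrightarrow> c 3 = 0 \<Longrightarrow> c 4 = 0 \<Longrightarrow> c 5 = 0 \<Longrightarrow> c' 6 = 0 \<longleftrightarrow> c 6 = 0"
    "c 1 = 0 \<Longrightarrow> c 2 = 0 \<Longrightarrow> c 3 = 0 \<Longrightarrow> c 4 = 0 \<Longrightarrow> c 5 = 0 \<Longrightarrow> c 6 = 0 \<Longrightarrow> c' 7 = 0 \<longleftrightarrow> c 7 = 0"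
    "c 1 = 0 \<Longrightarrow> c 2 = 0 \<Longrightarrow> c 3 = 0 \<Longrightarrow> c 4 = 0 \<Longrightarrow> c 5 = 0 \<Longrightarrow> c 6 = 0 \<Longrightarrow> c' 8 = 0 \<longleftrightarrow> c 8 = 0"
  using assms unfolding rel8_def by auto

text \<open>The position of the first nonzero coordinate is invariant. As that coordinate is
  normalised, \<open>a\<close> is \<open>1\<close> in odd leading weight and a sign in even leading
  weight. In the latter case the parameters sit in odd weight, are multiplied by \<open>a\<close>,
  and \<open>a\<close> itself serves as \<epsilon>.\<close>

lemma rel8_nfc:
  assumes R: "rel8 (cl (nfc F s p q)) (cl (nfc F' t p' q'))" and st: "s \<in> {1, -1}" "t \<in> {1, -1}"
    and F2: "F = F2 \<Longrightarrow> (p, q) \<in> U8_2_params" "F' = F2 \<Longrightarrow> (p', q') \<in> U8_2_params"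
  shows "F = F' \<and> (\<exists>\<epsilon>\<in>{1, -1}. upar F p q = \<epsilon> *\<^sub>R upar F' p' q')"
proof -
  have st0: "s \<noteq> 0" "t \<noteq> 0" using st by auto
  obtain a b d where a: "a \<noteq> 0" and r: "cl (nfc F s p q) 1 = a ^ 5 * cl (nfc F' t p' q') 1"
     "cl (nfc F s p q) 2 = a ^ 6 * cl (nfc F' t p' q') 2"
     "cl (nfc F s p q) 3 = a ^ 7 * cl (nfc F' t p' q') 3"
     "cl (nfc F s p q) 4 = a ^ 7 * cl (nfc F' t p' q') 4 + 7 * a ^ 4 * b * cl (nfc F' t p' q') 1"
     "cl (nfc F s p q) 5 = a ^ 8 * cl (nfc F' t p' q') 5 + 4 * a ^ 4 * d * cl (nfc F' t p' q') 1 - 8 * a ^ 5 * b * cl (nfc F' t p' q') 2"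
     "cl (nfc F' t p' q') 1 = 0 \<longrightarrow> cl (nfc F s p q) 6 = a ^ 9 * cl (nfc F' t p' q') 6 - 6 * a ^ 5 * d * cl (nfc F' t p' q') 2 +
        a ^ 6 * b * (3 * cl (nfc F' t p' q') 3 + 9 * cl (nfc F' t p' q') 4)"
     "cl (nfc F' t p' q') 1 = 0 \<longrightarrow> cl (nfc F' t p' q') 2 = 0 \<longrightarrow> cl (nfc F s p q) 7 = a ^ 10 * cl (nfc F' t p' q') 7 +
        a ^ 6 * d * (5 * cl (nfc F' t p' q') 4 - 10 * cl (nfc F' t p' q') 3) + 10 * a ^ 7 * b * cl (nfc F' t p' q') 5"
     "cl (nfc F' t p' q') 1 = 0 \<longrightarrow> cl (nfc F' t p' q') 2 = 0 \<longrightarrow> cl (nfc F' t p' q') 3 = 0 \<longrightarrow> cl (nfc F' t p' q') 4 = 0 \<longrightarrow>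
        cl (nfc F s p q) 8 = a ^ 11 * cl (nfc F' t p' q') 8 + 22/3 * a ^ 7 * d * cl (nfc F' t p' q') 5 + 11 * a ^ 8 * b * cl (nfc F' t p' q') 6"
    using R unfolding rel8_def by blast
  have "lead F = lead F'"
    unfolding lead_eq[OF st0(1) refl, of F p q] lead_eq[OF st0(2) refl, of F' p' q'] using rel8_zero[OF R] by presburger
  \<comment> \<open>The position does not separate the three families with leading term
    \<open>B 3\<close>; the coordinate of \<open>B 4\<close>, invariant once \<open>a = 1\<close>,
    will.\<close>
  then consider "F = F'" | "lead F = 3" "lead F' = 3" by (cases F; cases F'; simp)
  then show ?thesis
  proof cases
    case 1
    have one: "\<exists>\<epsilon>\<in>{1, -1::real}. x = \<epsilon> *\<^sub>R x" for x :: "real \<times> real" by (intro bexI[of _ 1]) auto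
    show ?thesis
    proof (cases F)
      case F0
      then have "a = 1" using r(1) 1 odd_power_eq_1[of 5 a] by simp
      then show ?thesis using r(2,3) 1 F0 one by simp
    next
      case F1
      then have "s = t \<and> a \<in> {1, -1}" using r(2) 1 st even_power_sign[of 6 s a t] by simp
      then show ?thesis using r(3,4) 1 F1 by (intro conjI bexI[of _ a]) auto
    next
      case F2
      then have "a = 1" using r(3) 1 odd_power_eq_1[of 7 a] by simp
      then show ?thesis using r(4,5) 1 F2 one by simp
    next
      case F30_5
      then have "a = 1" using r(3) 1 odd_power_eq_1[of 7 a] by simp
      \<comment> \<open>The factor of \<open>b\<close> in weight 9 is zero at this resonance, so the
        second parameter does not move.\<close>
      then show ?thesis using r(5,6) 1 F30_5 one by simp
    next
      case F30_inf
      then have a1: "a = 1" using r(3) 1 odd_power_eq_1[of 7 a] by simp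
      \<comment> \<open>In weight 9 both coordinates are zero and \<open>b\<close> has the factor
        21. In weight 10 the factor of \<open>d\<close> is then zero by resonance, so the second
        parameter is fixed.\<close>
      then have "b = 0" using r(6) 1 F30_inf by simp
      then show ?thesis using r(5,7) 1 F30_inf a1 one by simp
    next
      case F31
      then have "a = 1" using r(4) 1 odd_power_eq_1[of 7 a] by simp
      then show ?thesis using r(5) 1 F31 one by simp
    next
      case F4
      then have "s = t \<and> a \<in> {1, -1}" using r(5) 1 st even_power_sign[of 8 s a t] by simp
      then show ?thesis using r(6) 1 F4 by (intro conjI bexI[of _ a]) auto
    next
      case F5
      then have "a = 1" using r(6) 1 odd_power_eq_1[of 9 a] by simp
      then show ?thesis using r(7) 1 F5 one by simp
    next
      case F6
      then have "s = t \<and> a \<in> {1, -1}" using r(7) 1 st even_power_sign[of 10 s a t] by simp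
      then show ?thesis using r(8) 1 F6 by (intro conjI bexI[of _ a]) auto
    qed (use 1 in \<open>auto intro: exI[of _ 1]\<close>)
  next
    case 2
    then have a1: "a = 1" using r(3) odd_power_eq_1[of 7 a] by (cases F; cases F'; simp)
    have one: "\<exists>\<epsilon>\<in>{1, -1::real}. x = \<epsilon> *\<^sub>R x" for x :: "real \<times> real" by (intro bexI[of _ 1]) auto
    have "F = F'" using 2 r(4) a1 F2 by (cases F; cases F'; auto simp: U8_2_params_def)
    moreover have "upar F p q = upar F' p' q'"
      using 2 r(4,5,6,7) a1 \<open>F = F'\<close> by (cases F; simp)
    ultimately show ?thesis using one by metis
  qed
qed

lemma normal_form_unique:
  assumes "F \<in> normal_forms n" "F' \<in> normal_forms n" "s \<in> {1, -1}" "t \<in> {1, -1}"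
    and "F = F2 \<Longrightarrow> (p, q) \<in> U8_2_params" "F' = F2 \<Longrightarrow> (p', q') \<in> U8_2_params"
    and "symp_equiv e n (nfset F s p q) (nfset F' t p' q')"
  shows "F = F' \<and> (\<exists>\<epsilon>\<in>{1, -1}. upar F p q = \<epsilon> *\<^sub>R upar F' p' q')"
proof -
  obtain f f' where "param f (nfset F s p q)" "crd (theta f) (cl (nfc F s p q))"
    "param f' (nfset F' t p' q')" "crd (theta f') (cl (nfc F' t p' q'))"
    using param_normal_form[OF assms(1,3)] param_normal_form[OF assms(2,4)] by blast
  then have "rel8 (cl (nfc F s p q)) (cl (nfc F' t p' q'))"
    using symp_equiv_rel8 assms(7) by blast
  then show ?thesis by (rule rel8_nfc[OF _ assms(3-6)])
qed

text \<open>Existence: coordinates are brought to a listed vector by reparametrisation, and equal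
  coordinates imply equivalence. Uniqueness: two candidates are equivalent to each other and are
  compared by \<open>normal_form_unique\<close>.\<close>

theorem normal_form_exists_unique:
  assumes "germ_diffeomorphic C N"
  shows "\<exists>!F. F \<in> normal_forms n \<and> (\<exists>M\<in>members e n F. symp_equiv e n N M)"
proof -
  obtain f where f: "param f N" using assms unfolding germ_diffeomorphic_iff param_def by blast
  obtain c where c: "crd (theta f) c" using theta_crd[OF param_sm(1)[OF f]] by blast
  have "ld (\<lambda>x :: real ^ 'm. x)"
    by (simp add: ld_def inj_def fder_linear[OF bounded_linear_ident])
  then have "admissible (\<lambda>x. x)" by (simp add: admissible_def)
  moreover have "pb (theta f) (\<lambda>x. x) = theta f" by (intro ext) (simp add: pb_def fder_linear[OF bounded_linear_ident])
  ultimately have "Reach (theta f) c" unfolding Reach_def using c by metis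
  then obtain F s a b where F: "s \<in> {1, -1}" "F = F2 \<longrightarrow> (a, b) \<in> U8_2_params" "Reach (theta f) (cl (nfc F s a b))"
    using Reach_normal by blast
  obtain g where g: "param g N" "crd (theta g) (cl (nfc F s a b))" using Reach_param[OF f F(3)] by blast
  \<comment> \<open>For \<open>n = 2\<close> one of the first three coordinates is nonzero, which
    leaves precisely the five families listed for that dimension.\<close>
  have nF: "F \<in> normal_forms n"
  proof (cases "n = 2")
    case True
    show ?thesis using not_isotropic[OF True g] True by (cases F) (simp_all add: normal_forms_def)
  qed (simp add: normal_forms_def)
  obtain h where h: "param h (nfset F s a b)" "crd (theta h) (cl (nfc F s a b))"
    using param_normal_form[OF nF F(1)] by blast
  have eq: "symp_equiv e n N (nfset F s a b)" by (rule symp_equivI_crd[OF g(1) h(1) g(2) h(2)])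
  show ?thesis
  proof (rule ex1I[of _ F])
    show "F \<in> normal_forms n \<and> (\<exists>M\<in>members e n F. symp_equiv e n N M)"
      using nF eq F(1,2) members_iff by blast
    fix F' assume "F' \<in> normal_forms n \<and> (\<exists>M\<in>members e n F'. symp_equiv e n N M)"
    then obtain M where M: "F' \<in> normal_forms n" "M \<in> members e n F'" "symp_equiv e n N M" by blast
    then obtain t p q where t: "t \<in> {1, -1}" "F' = F2 \<longrightarrow> (p, q) \<in> U8_2_params" "M = nfset F' t p q"
      using members_iff[of M F'] by blast
    note F' = M(1) t(1,2) M(3)[unfolded t(3)]
    have "symp_equiv e n (nfset F' t p q) (nfset F s a b)" by (rule symp_equiv_trans[OF symp_equiv_sym[OF F'(4)] eq])
    then show "F' = F" using normal_form_unique[OF F'(1) nF F'(2) F(1)] F(2) F'(3) by blast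
  qed
qed

text \<open>Uniqueness of the parameter up to sign is enough: a path all of whose values are
  \<open>\<gamma> 0\<close> or \<open>- \<gamma> 0\<close> has a finite connected image, hence is
  constant.\<close>

lemma moduli_onI:
  fixes N :: "'c::real_normed_vector \<Rightarrow> (real ^ 'm) set"
  assumes "\<And>c c'. c \<in> P \<Longrightarrow> c' \<in> P \<Longrightarrow> symp_equiv e n (N c) (N c') \<Longrightarrow> c = c' \<or> c = - c'"
  shows "moduli_on e n P N"
  unfolding moduli_on_def
proof (intro allI impI ballI, elim conjE exE)
  fix \<gamma> :: "real \<Rightarrow> 'c" and t :: real and I
  assume t: "t \<in> {0..1}" and I: "open I" "{0..1} \<subseteq> I" "smooth_on I \<gamma>" and P: "\<gamma> ` {0..1} \<subseteq> P"
    and eq: "\<forall>t\<in>{0..1}. \<forall>u\<in>{0..1}. symp_equiv e n (N (\<gamma> t)) (N (\<gamma> u))"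
  have "continuous_on {0..1} \<gamma>" using smooth_on_continuous[OF I(3)] I(2) continuous_on_subset by blast
  then have con: "connected (\<gamma> ` {0..1})" by (rule connected_continuous_image) simp
  have "\<gamma> u \<in> {\<gamma> 0, - \<gamma> 0}" if "u \<in> {0..1}" for u
  proof -
    have "\<gamma> u \<in> P" "\<gamma> 0 \<in> P" using P that by auto
    moreover have "symp_equiv e n (N (\<gamma> u)) (N (\<gamma> 0))" using eq that by simp
    ultimately show ?thesis using assms by blast
  qed
  then have sub: "\<gamma> ` {0..1} \<subseteq> {\<gamma> 0, - \<gamma> 0}" by blast
  then have "finite (\<gamma> ` {0..1})" using finite_subset by blast
  then obtain z where "\<gamma> ` {0..1} \<subseteq> {z}" using con connected_finite_iff_sing[OF con] by (metis empty_subsetI subset_refl)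
  moreover have "(0::real) \<in> {0..1}" by simp
  ultimately show "\<gamma> t = \<gamma> 0" using t by blast
qed

theorem parameters_moduli:
  assumes F: "F \<in> normal_forms n"
  shows "parameters_are_moduli e n F"
proof -
  have u: "upar F p q = upar F p' q' \<or> upar F p q = - upar F p' q'"
    if "symp_equiv e n (nfset F s p q) (nfset F s p' q')" "s \<in> {1, -1}"
      "F = F2 \<Longrightarrow> (p, q) \<in> U8_2_params" "F = F2 \<Longrightarrow> (p', q') \<in> U8_2_params" for s p q p' q'
    using normal_form_unique[OF F F that(2,2,3,4,1)] by auto
  show ?thesis
  proof (cases F)
    case F0
    have "p = p' \<and> q = q' \<or> p = - p' \<and> q = - q'" if "symp_equiv e n (U8_0 e n p q) (U8_0 e n p' q')" for p q p' q'
      using u[of 1 p q p' q'] that F0 by simp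
    note * = this
    show ?thesis using F0 by (auto intro!: moduli_onI dest!: *)
  next
    case F1
    have "p = p' \<and> q = q' \<or> p = - p' \<and> q = - q'" if "symp_equiv e n (U8_1 e n s p q) (U8_1 e n s p' q')" "s \<in> {1, -1}" for s p q p' q'
      using u[of s p q p' q'] that F1 by simp
    note * = this[OF _ insertI1] this[OF _ insertI2[OF singletonI]]
    show ?thesis using F1 by (auto intro!: moduli_onI dest!: *)
  next
    case F2
    have "p = p' \<and> q = q' \<or> p = - p' \<and> q = - q'" if "symp_equiv e n (U8_2 e n p q) (U8_2 e n p' q')" "(p, q) \<in> U8_2_params" "(p', q') \<in> U8_2_params" for p q p' q'
      using u[of 1 p q p' q'] that F2 by simp
    note * = this
    show ?thesis using F2 by (auto intro!: moduli_onI dest!: *)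
  next
    case F30_5
    have "p = p' \<and> q = q' \<or> p = - p' \<and> q = - q'" if "symp_equiv e n (U8_30_5 e n p q) (U8_30_5 e n p' q')" for p q p' q'
      using u[of 1 p q p' q'] that F30_5 by simp
    note * = this
    show ?thesis using F30_5 by (auto intro!: moduli_onI dest!: *)
  next
    case F30_inf
    have "p = p' \<and> q = q' \<or> p = - p' \<and> q = - q'" if "symp_equiv e n (U8_30_inf e n p q) (U8_30_inf e n p' q')" for p q p' q'
      using u[of 1 p q p' q'] that F30_inf by simp
    note * = this
    show ?thesis using F30_inf by (auto intro!: moduli_onI dest!: *)
  next
    case F31
    have "p = p' \<or> p = - p'" if "symp_equiv e n (U8_31 e n p) (U8_31 e n p')" for p p'
      using u[of 1 p 0 p' 0] that F31 by simp
    note * = this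
    show ?thesis using F31 by (auto intro!: moduli_onI dest!: *)
  next
    case F4
    have "p = p' \<or> p = - p'" if "symp_equiv e n (U8_4 e n s p) (U8_4 e n s p')" "s \<in> {1, -1}" for s p p'
      using u[of s p 0 p' 0] that F4 by simp
    note * = this[OF _ insertI1] this[OF _ insertI2[OF singletonI]]
    show ?thesis using F4 by (auto intro!: moduli_onI dest!: *)
  next
    case F5
    have "p = p' \<or> p = - p'" if "symp_equiv e n (U8_5 e n p) (U8_5 e n p')" for p p'
      using u[of 1 p 0 p' 0] that F5 by simp
    note * = this
    show ?thesis using F5 by (auto intro!: moduli_onI dest!: *)
  next
    case F6
    have "p = p' \<or> p = - p'" if "symp_equiv e n (U8_6 e n s p) (U8_6 e n s p')" "s \<in> {1, -1}" for s p p'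
      using u[of s p 0 p' 0] that F6 by simp
    note * = this[OF _ insertI1] this[OF _ insertI2[OF singletonI]]
    show ?thesis using F6 by (auto intro!: moduli_onI dest!: *)
  qed simp_all
qed

end

theorem theorem4p1:
  fixes n :: nat and e :: "nat \<Rightarrow> 'm::finite"
  assumes "n \<ge> 2" and "bij_betw e {1..2*n} UNIV"
  shows "(\<forall>N :: (real ^ 'm) set. germ_diffeomorphic (U8 e n) N \<longrightarrow>
            (\<exists>!F. F \<in> normal_forms n \<and> (\<exists>M\<in>members e n F. symp_equiv e n N M)))
       \<and> (\<forall>F\<in>normal_forms n. parameters_are_moduli e n F)"
proof -
  interpret symp_coords e n by unfold_locales (fact assms)+
  show ?thesis using normal_form_exists_unique parameters_moduli by blast
qed

end
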